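(* There is an algorithm with running time $n^{O(d^3)}$ which, given $n$ arbitrary samples $(X_i,y_i)_{i=1}^n$ with $X_1,\dots,X_n \in \mathbb{R}^d$ and $y_1,\dots,y_n\in\mathbb{R}$, and given $k \geq 0$, decides whether $\mathrm{Stability}(X,y) \leq k$.
   Context: For $w\in[0,1]^n$, the weight-$w$ OLS solution set is $\mathrm{OLS}(X,y,w) := \arg\min_{\beta\in\mathbb{R}^d}\frac1n\sum_{i=1}^n w_i(\langle X_i,\beta\rangle - y_i)^2$. The finite-sample stability is $\mathrm{Stability}(X,y) := \inf_{w\in[0,1]^n,\ \beta\in\mathbb{R}^d}\{\, n-\|w\|_1 : \beta_1 = 0 \text{ and } \beta\in \mathrm{OLS}(X,y,w)\}$. Running time is measured in the real number model. *)

theory Defs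
  imports Complex_Main
begin

text \<open>Data: n samples, X i j (i < n, j < d) is the j-th coordinate of X_(i+1),
  y i is y_(i+1). Coefficient vectors beta are functions nat => real supported on
  {..<d}; coordinate beta 0 is the paper's beta_1.\<close>

definition wloss :: "nat \<Rightarrow> nat \<Rightarrow> (nat \<Rightarrow> nat \<Rightarrow> real) \<Rightarrow> (nat \<Rightarrow> real)
    \<Rightarrow> (nat \<Rightarrow> real) \<Rightarrow> (nat \<Rightarrow> real) \<Rightarrow> real" where
  "wloss n d X y w \<beta> = (1 / real n) * (\<Sum>i<n. w i * ((\<Sum>j<d. X i j * \<beta> j) - y i)\<^sup>2)"

definition is_vec :: "nat \<Rightarrow> (nat \<Rightarrow> real) \<Rightarrow> bool" where
  "is_vec d \<beta> \<longleftrightarrow> (\<forall>j\<ge>d. \<beta> j = 0)"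

definition OLS :: "nat \<Rightarrow> nat \<Rightarrow> (nat \<Rightarrow> nat \<Rightarrow> real) \<Rightarrow> (nat \<Rightarrow> real)
    \<Rightarrow> (nat \<Rightarrow> real) \<Rightarrow> (nat \<Rightarrow> real) set" where
  "OLS n d X y w = {\<beta>. is_vec d \<beta> \<and>
      (\<forall>\<beta>'. is_vec d \<beta>' \<longrightarrow> wloss n d X y w \<beta> \<le> wloss n d X y w \<beta>')}"

definition Stability :: "nat \<Rightarrow> nat \<Rightarrow> (nat \<Rightarrow> nat \<Rightarrow> real) \<Rightarrow> (nat \<Rightarrow> real) \<Rightarrow> real" where
  "Stability n d X y = Inf {real n - (\<Sum>i<n. w i) | w \<beta>.
      (\<forall>i<n. 0 \<le> w i \<and> w i \<le> 1) \<and> \<beta> 0 = 0 \<and> \<beta> \<in> OLS n d X y w}"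

text \<open>Two register files: real registers R (nat => real) and integer registers
  I (nat => int), the latter used for counters and indirect addressing.
  Real registers support +, -, *, / (with x/0 = 0), constants, comparisons;
  there is no real-to-integer conversion (no floor).
  Each executed instruction costs one time unit.\<close>

datatype instr =
    RConst nat real
  | RAdd nat nat nat
  | RSub nat nat nat
  | RMul nat nat nat
  | RDiv nat nat nat
  | RLoad nat nat
  | RStore nat nat
  | IConst nat int
  | IAdd nat nat nat
  | ISub nat nat nat
  | IToR nat nat
  | IfRPos nat nat
  | IfRZero nat nat
  | IfIPos nat nat
  | Jmp nat
  | Halt

type_synonym config = "nat \<times> (nat \<Rightarrow> int) \<times> (nat \<Rightarrow> real)"

fun exec :: "instr \<Rightarrow> config \<Rightarrow> config" where
  "exec (RConst a c) (pc, I, R) = (Suc pc, I, R(a := c))"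
| "exec (RAdd a b c) (pc, I, R) = (Suc pc, I, R(a := R b + R c))"
| "exec (RSub a b c) (pc, I, R) = (Suc pc, I, R(a := R b - R c))"
| "exec (RMul a b c) (pc, I, R) = (Suc pc, I, R(a := R b * R c))"
| "exec (RDiv a b c) (pc, I, R) = (Suc pc, I, R(a := R b / R c))"
| "exec (RLoad a b) (pc, I, R) = (Suc pc, I, R(a := R (nat (I b))))"
| "exec (RStore a b) (pc, I, R) = (Suc pc, I, R(nat (I b) := R a))"
| "exec (IConst a c) (pc, I, R) = (Suc pc, I(a := c), R)"
| "exec (IAdd a b c) (pc, I, R) = (Suc pc, I(a := I b + I c), R)"
| "exec (ISub a b c) (pc, I, R) = (Suc pc, I(a := I b - I c), R)"
| "exec (IToR a b) (pc, I, R) = (Suc pc, I, R(a := of_int (I b)))"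
| "exec (IfRPos a l) (pc, I, R) = ((if R a > 0 then l else Suc pc), I, R)"
| "exec (IfRZero a l) (pc, I, R) = ((if R a = 0 then l else Suc pc), I, R)"
| "exec (IfIPos a l) (pc, I, R) = ((if I a > 0 then l else Suc pc), I, R)"
| "exec (Jmp l) (pc, I, R) = (l, I, R)"
| "exec Halt (pc, I, R) = (pc, I, R)"

definition halted :: "instr list \<Rightarrow> config \<Rightarrow> bool" where
  "halted P c \<longleftrightarrow> fst c \<ge> length P \<or> P ! fst c = Halt"

definition step :: "instr list \<Rightarrow> config \<Rightarrow> config" where
  "step P c = (if halted P c then c else exec (P ! fst c) c)"

definition run :: "instr list \<Rightarrow> nat \<Rightarrow> config \<Rightarrow> config" where
  "run P t c = (step P ^^ t) c"

definition init_config :: "nat \<Rightarrow> nat \<Rightarrow> (nat \<Rightarrow> nat \<Rightarrow> real) \<Rightarrow> (nat \<Rightarrow> real) \<Rightarrow> real \<Rightarrow> config" where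
  "init_config n d X y k =
    (0,
     (\<lambda>r. if r = 0 then int n else if r = 1 then int d else 0),
     (\<lambda>r. if r = 0 then k
          else if 1 \<le> r \<and> r < 1 + n then y (r - 1)
          else if 1 + n \<le> r \<and> r < 1 + n + n * d
            then X ((r - (1 + n)) div d) ((r - (1 + n)) mod d)
          else 0))"

definition accepts :: "config \<Rightarrow> bool" where
  "accepts c \<longleftrightarrow> fst (snd c) 0 = 1"

end

theory Submission
  imports Defs
    "Jordan_Normal_Form.Schur_Decomposition"
    "HOL-Computational_Algebra.Fundamental_Theorem_Algebra"
    "HOL-Computational_Algebra.Polynomial_FPS"
    "HOL-Library.Function_Algebras"
begin

text \<open>
  A single real constant of the machine can encode infinitely many bits, so one fixed program can
  interpret, for all \<open>n\<close> and \<open>d\<close>, a straight-line program read off such a constant. It remains to bound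
  the length of straight-line programs by \<open>(n + 1) ^ O(d\<^sup>3)\<close>.

  By the normal equations, \<open>w\<close> and \<open>\<beta>\<close> certify the bound \<open>k\<close> iff \<open>\<Sum> w\<^sub>i r\<^sub>i X\<^sub>i = 0\<close> for the residuals
  \<open>r\<^sub>i\<close> and \<open>\<Sum> w\<^sub>i \<ge> n - k\<close>. For fixed \<open>\<beta>\<close> the equations depend on \<open>w\<close> only through \<open>p = d (d + 1)\<close> linear
  functionals, so by linear programming some optimal \<open>w\<close> is 0 or 1 outside a basis \<open>Z\<close> of \<open>p\<close> samples,
  and for generic costs the 0/1 pattern is determined by \<open>Z\<close> alone, as the signs of reduced costs.
  There are at most \<open>(n + p)\<^sup>p\<close> bases. For each of them a system of quadratic equations in \<open>O(d\<^sup>2)\<close>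
  unknowns remains.

  Let \<open>Q\<close> be the sum of the squares of these equations. An infinitesimally perturbed zero exists iff
  \<open>\<kappa>\<^sup>2 Q + \<Sum> x\<^sub>i\<^sup>6 - \<kappa>\<close> takes a negative value for all large \<open>\<kappa>\<close>, and for this problem approximate
  solutions of that quality converge to exact ones. The perturbed function is negative somewhere iff it
  is negative at a real critical point; its critical points are the solutions of
  \<open>x\<^sub>i\<^sup>5 = - \<kappa>\<^sup>2 \<partial>\<^sub>i Q / 6\<close>, whose quotient algebra has the monomials with exponents below 5 as a basis
  because \<open>Q\<close> has degree 4. Hermite's trace forms then count the real critical points by sign,
  with signatures computed from characteristic polynomials by Descartes' rule, and the sign at large
  \<open>\<kappa>\<close> is that of a leading coefficient. This costs \<open>2 ^ O(N)\<close> operations in \<open>N\<close> unknowns.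
\<close>

section \<open>Linear algebra over finite index sets\<close>

text \<open>Two difficulties shape the argument: optimal coefficient vectors may escape to infinity,
  and the input may be degenerate. Against the first, only products of weights and residuals are
  followed to the limit, and the perturbation is scaled to suit this: a negative value forces Q
  below 1 / \<kappa>, so every equation holds up to \<kappa>^(-1/2), while the sixth powers keep
  every coordinate below \<kappa>^(1/6); error times coefficient still vanishes. Against the second,
  sixth powers dominate any quartic at infinity, so a minimum exists and the critical equations have
  pairwise coprime leading monomials for every input. Normal forms use ring operations only, so
  \<kappa> can stay an indeterminate and all signs at large \<kappa> are read from leading
  coefficients. Multiple solutions do no harm, since the Hermite forms only use that multiplicities
  are positive. Writing out determinants with p! terms, of order (d^2)^(d^2), is affordable under
  the cubic exponent, and so are the 5^N basis monomials with N of order d^2.\<close>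

lemma homogeneous_system_nontrivial:
  fixes a :: "'r \<Rightarrow> 's \<Rightarrow> 'a::field"
  assumes "finite R" "finite S" "card R < card S"
  shows "\<exists>x. (\<exists>s\<in>S. x s \<noteq> 0) \<and> (\<forall>r\<in>R. (\<Sum>s\<in>S. a r s * x s) = 0)"
  using assms
proof (induction R arbitrary: S a rule: finite_induct)
  case empty
  then obtain s where "s \<in> S" by fastforce
  then show ?case by (intro exI[of _ "\<lambda>_. 1"]) auto
next
  case (insert r R)
  show ?case
  proof (cases "\<forall>s\<in>S. a r s = 0")
    case True
    from insert.IH[of S a] insert.prems insert.hyps obtain x where
      "\<exists>s\<in>S. x s \<noteq> 0" "\<forall>r\<in>R. (\<Sum>s\<in>S. a r s * x s) = 0" by auto
    with True show ?thesis by (intro exI[of _ x]) auto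
  next
    case False
    then obtain s0 where s0: "s0 \<in> S" "a r s0 \<noteq> 0" by auto
    define S' where "S' = S - {s0}"
    have S': "finite S'" "S = insert s0 S'" "s0 \<notin> S'" "card R < card S'"
      using insert s0 by (auto simp: S'_def)
    from insert.IH[of S' "\<lambda>r' s. a r' s - a r' s0 * a r s / a r s0"] S' obtain x where
      x: "\<exists>s\<in>S'. x s \<noteq> 0"
      "\<And>r'. r' \<in> R \<Longrightarrow> (\<Sum>s\<in>S'. (a r' s - a r' s0 * a r s / a r s0) * x s) = 0" by auto
    \<comment> \<open>The smaller system has \<open>s0\<close> eliminated; its value is recovered
      from equation \<open>r\<close>, where it has a nonzero coefficient.\<close>
    define y where "y = x(s0 := - (\<Sum>s\<in>S'. a r s * x s) / a r s0)"
    have yx: "(\<Sum>s\<in>S'. f s * y s) = (\<Sum>s\<in>S'. f s * x s)" for f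
      by (rule sum.cong) (use S' in \<open>auto simp: y_def\<close>)
    have "(\<Sum>s\<in>S. a r' s * y s) = 0" if "r' \<in> insert r R" for r'
    proof (cases "r' = r")
      case True
      have "(\<Sum>s\<in>S. a r s * y s) = a r s0 * y s0 + (\<Sum>s\<in>S'. a r s * x s)"
        using S' yx by simp
      also have "\<dots> = 0" using s0 by (simp add: y_def)
      finally show ?thesis using True by simp
    next
      case False
      with that have "r' \<in> R" by simp
      have "(\<Sum>s\<in>S. a r' s * y s) = a r' s0 * y s0 + (\<Sum>s\<in>S'. a r' s * x s)"
        using S' yx by simp
      also have "a r' s0 * y s0 = - (\<Sum>s\<in>S'. a r' s0 * a r s / a r s0 * x s)"
        by (simp add: y_def sum_distrib_left sum_divide_distrib mult_ac)
      also have "\<dots> + (\<Sum>s\<in>S'. a r' s * x s) = (\<Sum>s\<in>S'. (a r' s - a r' s0 * a r s / a r s0) * x s)"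
        by (simp add: sum_subtractf[symmetric] algebra_simps)
      also have "\<dots> = 0" using x \<open>r' \<in> R\<close> by blast
      finally show ?thesis .
    qed
    moreover have "\<exists>s\<in>S. y s \<noteq> 0" using x(1) S' by (auto simp: y_def)
    ultimately show ?thesis by blast
  qed
qed

text \<open>The orbit of \<open>v\<close> is annihilated by a nonzero polynomial. One of least
  degree has a root \<open>z\<close>, and the cofactor of its linear factor sends \<open>v\<close>
  to a nonzero vector on which the matrix acts as \<open>z\<close>. The subspace is a predicate
  \<open>W\<close> closed under the operations used, so the lemma serves both for orthogonal
  complements and for joint eigenspaces.\<close>

lemma invariant_eigenvector:
  fixes M :: "'s \<Rightarrow> 's \<Rightarrow> complex"
  assumes S: "finite S" and v: "W v" "\<exists>s\<in>S. v s \<noteq> 0"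
    and add: "\<And>x y. W x \<Longrightarrow> W y \<Longrightarrow> W (\<lambda>s. x s + y s)"
    and scale: "\<And>c x. W x \<Longrightarrow> W (\<lambda>s. c * x s)"
    and app: "\<And>x. W x \<Longrightarrow> W (\<lambda>s. \<Sum>t\<in>S. M s t * x t)"
  shows "\<exists>u z. W u \<and> (\<exists>s\<in>S. u s \<noteq> 0) \<and> (\<forall>s\<in>S. (\<Sum>t\<in>S. M s t * u t) = z * u s)"
proof -
  define it where "it k = ((\<lambda>x s. \<Sum>t\<in>S. M s t * x t) ^^ k) v" for k
  have it0: "it 0 = v" and itS: "it (Suc k) = (\<lambda>s. \<Sum>t\<in>S. M s t * it k t)" for k
    by (simp_all add: it_def)
  have Wit: "W (it k)" for k
    by (induction k) (use v app in \<open>auto simp: it0 itS\<close>)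
  define op where "op q s = (\<Sum>k\<le>degree q. coeff q k * it k s)" for q :: "complex poly" and s
  have op_ext: "op q s = (\<Sum>k\<le>D. coeff q k * it k s)" if "degree q \<le> D" for q s D
    unfolding op_def by (rule sum.mono_neutral_left) (use that in \<open>auto simp: coeff_eq_0\<close>)
  have Wsum: "W (\<lambda>s. \<Sum>k\<le>D. c k * it k s)" for D :: nat and c
    by (induction D) (use scale Wit add in auto)
  have Wop: "W (op q)" for q
  proof -
    have "op q = (\<lambda>s. \<Sum>k\<le>degree q. coeff q k * it k s)" by (rule ext) (simp add: op_def)
    then show ?thesis using Wsum by simp
  qed
  have "\<exists>q. q \<noteq> 0 \<and> (\<forall>s\<in>S. op q s = 0)"
  proof -
    \<comment> \<open>There are \<open>card S + 1\<close> iterates in a space of dimension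
      \<open>card S\<close>, hence a linear relation.\<close>
    from homogeneous_system_nontrivial[of S "{..card S}" "\<lambda>s k. it k s"] S obtain c where
      c: "\<exists>k\<in>{..card S}. c k \<noteq> 0" "\<forall>s\<in>S. (\<Sum>k\<le>card S. it k s * c k) = 0" by auto
    define q where "q = (\<Sum>k\<le>card S. monom (c k) k)"
    have cq: "coeff q k = (if k \<le> card S then c k else 0)" for k
      by (simp add: q_def coeff_sum if_distrib)
    have "q \<noteq> 0" using c(1) cq by (metis coeff_0 atMost_iff)
    moreover have "degree q \<le> card S" by (rule degree_le) (simp add: cq)
    then have "op q s = (\<Sum>k\<le>card S. it k s * c k)" for s
      by (subst op_ext[of q "card S"]) (auto simp: cq mult.commute intro!: sum.cong)
    ultimately show ?thesis using c(2) by auto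
  qed
  then obtain q0 where q0: "q0 \<noteq> 0 \<and> (\<forall>s\<in>S. op q0 s = 0)" by blast
  define PP where "PP q \<longleftrightarrow> q \<noteq> 0 \<and> (\<forall>s\<in>S. op q s = 0)" for q
  from q0 have "PP q0" by (simp add: PP_def)
  from ex_has_least_nat[of PP, OF this, of degree]
  obtain q where PPq: "PP q" and PPmin: "\<forall>q'. PP q' \<longrightarrow> degree q \<le> degree q'" by (elim exE conjE)
  from PPq have q: "q \<noteq> 0" "\<forall>s\<in>S. op q s = 0" unfolding PP_def by simp_all
  have qmin: "degree q \<le> degree q'" if "q' \<noteq> 0" "\<forall>s\<in>S. op q' s = 0" for q'
    using PPmin that by (simp add: PP_def)
  have "degree q \<noteq> 0"
  proof
    assume "degree q = 0"
    then obtain c where "q = [:c:]" by (metis degree_eq_zeroE)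
    then show False using q v by (auto simp: op_def it0)
  qed
  then have "\<not> constant (poly q)" by (simp add: constant_degree)
  from fundamental_theorem_of_algebra[OF this] obtain z where "poly q z = 0" ..
  then obtain q1 where q1: "q = [:-z, 1:] * q1" by (metis poly_eq_0_iff_dvd dvdE)
  have q10: "q1 \<noteq> 0" using q q1 by auto
  then have dq: "degree q = Suc (degree q1)"
    unfolding q1 by (subst degree_mult_eq) auto
  have cq: "coeff q k = (if k = 0 then 0 else coeff q1 (k - 1)) - z * coeff q1 k" for k
    unfolding q1 by (cases k) (simp_all add: coeff_pCons)
  have "\<not> (\<forall>s\<in>S. op q1 s = 0)" using qmin[OF q10] dq by fastforce
  moreover have "(\<Sum>t\<in>S. M s t * op q1 t) = z * op q1 s" if "s \<in> S" for s
  proof -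
    have "0 = op q s" using q that by simp
    also have "\<dots> = (\<Sum>k\<le>Suc (degree q1). (if k = 0 then 0 else coeff q1 (k - 1)) * it k s)
        - z * (\<Sum>k\<le>Suc (degree q1). coeff q1 k * it k s)"
      unfolding op_def dq cq by (simp add: algebra_simps sum_subtractf sum_distrib_left del: sum.atMost_Suc)
    also have "(\<Sum>k\<le>Suc (degree q1). coeff q1 k * it k s) = op q1 s"
      by (rule op_ext[symmetric]) simp
    also have "(\<Sum>k\<le>Suc (degree q1). (if k = 0 then 0 else coeff q1 (k - 1)) * it k s)
       = (\<Sum>k\<le>degree q1. coeff q1 k * it (Suc k) s)"
      by (subst sum.atMost_Suc_shift) simp
    also have "\<dots> = (\<Sum>t\<in>S. M s t * op q1 t)"
      unfolding op_def itS sum_distrib_left by (subst sum.swap) (simp add: mult_ac)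
    finally show ?thesis by simp
  qed
  ultimately show ?thesis using Wop by blast
qed

text \<open>Induction on the number of eigenvectors found: their orthogonal complement is nonzero
  for dimension reasons and is mapped to itself because the matrix is self-adjoint, so it contains a
  further eigenvector.\<close>

lemma hermitian_eigenbasis:
  fixes H :: "'s \<Rightarrow> 's \<Rightarrow> complex"
  assumes S: "finite S" and H: "\<And>s t. s \<in> S \<Longrightarrow> t \<in> S \<Longrightarrow> H s t = cnj (H t s)"
  shows "\<exists>(U :: nat \<Rightarrow> 's \<Rightarrow> complex) (lam :: nat \<Rightarrow> real).
    (\<forall>i<card S. \<forall>j<card S. (\<Sum>s\<in>S. cnj (U i s) * U j s) = (if i = j then 1 else 0)) \<and>
    (\<forall>i<card S. \<forall>s\<in>S. (\<Sum>t\<in>S. H s t * U i t) = of_real (lam i) * U i s)"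
proof -
  have adj: "(\<Sum>s\<in>S. cnj (x s) * (\<Sum>t\<in>S. H s t * y t)) = (\<Sum>t\<in>S. cnj (\<Sum>s\<in>S. H t s * x s) * y t)" for x y
  proof -
    have "(\<Sum>s\<in>S. cnj (x s) * (\<Sum>t\<in>S. H s t * y t)) = (\<Sum>t\<in>S. \<Sum>s\<in>S. cnj (x s) * (H s t * y t))"
      unfolding sum_distrib_left by (rule sum.swap)
    also have "\<dots> = (\<Sum>t\<in>S. \<Sum>s\<in>S. cnj (H t s) * cnj (x s) * y t)"
      by (intro sum.cong refl) (subst H, auto)
    finally show ?thesis by (simp add: sum_distrib_right)
  qed
  have pos: "\<exists>r>0. (\<Sum>s\<in>S. cnj (x s) * x s) = of_real r" if "\<exists>s\<in>S. x s \<noteq> 0" for x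
  proof (intro exI conjI)
    show "(\<Sum>s\<in>S. (cmod (x s))\<^sup>2) > 0" using that S by (auto intro!: sum_pos2)
    show "(\<Sum>s\<in>S. cnj (x s) * x s) = of_real (\<Sum>s\<in>S. (cmod (x s))\<^sup>2)"
      unfolding of_real_sum by (intro sum.cong refl) (simp add: complex_norm_square mult.commute del: of_real_power)
  qed
  have "k \<le> card S \<Longrightarrow> \<exists>(U :: nat \<Rightarrow> 's \<Rightarrow> complex) (lam :: nat \<Rightarrow> real).
    (\<forall>i<k. \<forall>j<k. (\<Sum>s\<in>S. cnj (U i s) * U j s) = (if i = j then 1 else 0)) \<and>
    (\<forall>i<k. \<forall>s\<in>S. (\<Sum>t\<in>S. H s t * U i t) = of_real (lam i) * U i s)" for k
  proof (induction k)
    case 0 show ?case by simp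
  next
    case (Suc k)
    from Suc.IH[OF Suc_leD[OF Suc.prems]] obtain U lam where
      U: "\<And>i j. i < k \<Longrightarrow> j < k \<Longrightarrow> (\<Sum>s\<in>S. cnj (U i s) * U j s) = (if i = j then 1 else 0)"
      and lam: "\<And>i s. i < k \<Longrightarrow> s \<in> S \<Longrightarrow> (\<Sum>t\<in>S. H s t * U i t) = of_real (lam i) * U i s" by blast
    define W where "W x \<longleftrightarrow> (\<forall>i<k. (\<Sum>s\<in>S. cnj (U i s) * x s) = 0)" for x
    from homogeneous_system_nontrivial[of "{..<k}" S "\<lambda>i s. cnj (U i s)"] Suc.prems S obtain v where
      v: "\<exists>s\<in>S. v s \<noteq> 0" "W v" unfolding W_def by auto
    have "\<exists>u z. W u \<and> (\<exists>s\<in>S. u s \<noteq> 0) \<and> (\<forall>s\<in>S. (\<Sum>t\<in>S. H s t * u t) = z * u s)"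
    proof (rule invariant_eigenvector[where W = W, OF S v(2,1)])
      fix x y :: "'s \<Rightarrow> complex" assume "W x" "W y"
      then show "W (\<lambda>s. x s + y s)" by (simp add: W_def distrib_left sum.distrib)
    next
      fix c and x :: "'s \<Rightarrow> complex" assume "W x"
      then show "W (\<lambda>s. c * x s)"
        by (simp add: W_def sum_distrib_left[symmetric] mult.left_commute[of _ c])
    next
      fix x :: "'s \<Rightarrow> complex" assume W: "W x"
      show "W (\<lambda>s. \<Sum>t\<in>S. H s t * x t)" unfolding W_def
      proof (intro allI impI)
        fix i assume i: "i < k"
        have "(\<Sum>s\<in>S. cnj (U i s) * (\<Sum>t\<in>S. H s t * x t)) = (\<Sum>t\<in>S. cnj (of_real (lam i) * U i t) * x t)"
          unfolding adj by (intro sum.cong refl) (simp add: lam i)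
        also have "\<dots> = of_real (lam i) * (\<Sum>t\<in>S. cnj (U i t) * x t)"
          by (simp add: sum_distrib_left mult_ac)
        finally show "(\<Sum>s\<in>S. cnj (U i s) * (\<Sum>t\<in>S. H s t * x t)) = 0" using W i by (simp add: W_def)
      qed
    qed
    then obtain u z where u: "W u" "\<exists>s\<in>S. u s \<noteq> 0" "\<And>s. s \<in> S \<Longrightarrow> (\<Sum>t\<in>S. H s t * u t) = z * u s" by blast
    from pos[OF u(2)] obtain r where r: "r > 0" "(\<Sum>s\<in>S. cnj (u s) * u s) = of_real r" by blast
    \<comment> \<open>The form at \<open>u\<close> is evaluated with the matrix acting on either
      factor; comparing the results shows that the eigenvalue is real.\<close>
    have "z * of_real r = (\<Sum>s\<in>S. cnj (u s) * (\<Sum>t\<in>S. H s t * u t))"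
      unfolding r(2)[symmetric] sum_distrib_left[of z] by (intro sum.cong refl) (simp add: u(3))
    also have "\<dots> = cnj z * of_real r"
      unfolding adj r(2)[symmetric] sum_distrib_left[of "cnj z"] by (intro sum.cong refl) (simp add: u(3))
    finally have "z = cnj z" using r by simp
    then have z: "z = of_real (Re z)" by (metis Reals_cnj_iff of_real_Re)
    define w where "w s = u s / of_real (sqrt r)" for s
    have sq: "complex_of_real (sqrt r) * complex_of_real (sqrt r) = of_real r"
      using r by (simp flip: of_real_mult)
    have ww: "(\<Sum>s\<in>S. cnj (w s) * w s) = 1"
    proof -
      have "(\<Sum>s\<in>S. cnj (w s) * w s) = (\<Sum>s\<in>S. cnj (u s) * u s) / of_real r"
        unfolding w_def sum_divide_distrib by (intro sum.cong refl) (simp add: sq)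
      then show ?thesis using r by simp
    qed
    have Uw: "(\<Sum>s\<in>S. cnj (U i s) * w s) = 0" if "i < k" for i
    proof -
      have "(\<Sum>s\<in>S. cnj (U i s) * w s) = (\<Sum>s\<in>S. cnj (U i s) * u s) / of_real (sqrt r)"
        unfolding w_def sum_divide_distrib by simp
      then show ?thesis using u(1) that by (simp add: W_def)
    qed
    have wU: "(\<Sum>s\<in>S. cnj (w s) * U i s) = 0" if "i < k" for i
    proof -
      have "(\<Sum>s\<in>S. cnj (w s) * U i s) = cnj (\<Sum>s\<in>S. cnj (U i s) * w s)" by (simp add: mult.commute)
      then show ?thesis using Uw[OF that] by simp
    qed
    have Hw: "(\<Sum>t\<in>S. H s t * w t) = of_real (Re z) * w s" if "s \<in> S" for s
    proof -
      have "(\<Sum>t\<in>S. H s t * w t) = (\<Sum>t\<in>S. H s t * u t) / of_real (sqrt r)"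
        unfolding w_def sum_divide_distrib by simp
      then show ?thesis using u(3)[OF that] z by (simp add: w_def)
    qed
    show ?case
    proof (intro exI[of _ "U(k := w)"] exI[of _ "lam(k := Re z)"] conjI allI impI ballI)
      fix i j assume "i < Suc k" "j < Suc k"
      then show "(\<Sum>s\<in>S. cnj ((U(k := w)) i s) * (U(k := w)) j s) = (if i = j then 1 else 0)"
        using U[of i j] ww Uw[of i] wU[of j] by (cases "i = k"; cases "j = k") auto
    next
      fix i s assume "i < Suc k" "s \<in> S"
      then show "(\<Sum>t\<in>S. H s t * (U(k := w)) i t) = of_real ((lam(k := Re z)) i) * (U(k := w)) i s"
        using lam[of i s] Hw[of s] by (cases "i = k") auto
    qed
  qed
  from this[of "card S"] show ?thesis by simp
qed

text \<open>If this failed, the component of the unit vector at \<open>t\<close> orthogonal to all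
  \<open>U i\<close> would be nonzero, and \<open>card S + 1\<close> nonzero pairwise orthogonal
  vectors would be linearly dependent. It passes from orthonormal columns to orthonormal
  rows.\<close>

lemma orthonormal_complete:
  fixes U :: "nat \<Rightarrow> 's \<Rightarrow> complex"
  assumes S: "finite S"
    and U: "\<And>i j. i < card S \<Longrightarrow> j < card S \<Longrightarrow> (\<Sum>s\<in>S. cnj (U i s) * U j s) = (if i = j then 1 else 0)"
    and st: "s \<in> S" "t \<in> S"
  shows "(\<Sum>i<card S. U i s * cnj (U i t)) = (if s = t then 1 else 0)"
proof (rule ccontr)
  assume neq: "\<not> ?thesis"
  define w where "w r = (if r = t then 1 else 0) - (\<Sum>i<card S. U i r * cnj (U i t))" for r
  have w: "w s \<noteq> 0" using neq by (auto simp: w_def split: if_splits)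
  have orth: "(\<Sum>r\<in>S. cnj (U j r) * w r) = 0" if j: "j < card S" for j
  proof -
    have "(\<Sum>r\<in>S. cnj (U j r) * w r) = (\<Sum>r\<in>S. (if r = t then cnj (U j r) else 0)
       - (\<Sum>i<card S. cnj (U j r) * U i r * cnj (U i t)))"
      unfolding w_def by (intro sum.cong refl) (auto simp: right_diff_distrib sum_distrib_left mult_ac)
    also have "\<dots> = (\<Sum>r\<in>S. (if r = t then cnj (U j r) else 0))
       - (\<Sum>r\<in>S. \<Sum>i<card S. cnj (U j r) * U i r * cnj (U i t))" by (rule sum_subtractf)
    also have "(\<Sum>r\<in>S. \<Sum>i<card S. cnj (U j r) * U i r * cnj (U i t)) = (\<Sum>i<card S. (\<Sum>r\<in>S. cnj (U j r) * U i r) * cnj (U i t))"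
      by (subst sum.swap) (simp add: sum_distrib_right)
    also have "\<dots> = (\<Sum>i<card S. if i = j then cnj (U i t) else 0)"
      by (rule sum.cong) (use j U in auto)
    finally show ?thesis using S st j by simp
  qed
  define V where "V i = (if i < card S then U i else w)" for i
  from homogeneous_system_nontrivial[of S "{..card S}" "\<lambda>r i. V i r"] S obtain c where
    c: "\<exists>i\<le>card S. c i \<noteq> 0" "\<And>r. r \<in> S \<Longrightarrow> (\<Sum>i\<le>card S. V i r * c i) = 0" by auto
  have expand: "(\<Sum>r\<in>S. cnj (V j r) * (\<Sum>i\<le>card S. V i r * c i))
      = (\<Sum>i\<le>card S. (\<Sum>r\<in>S. cnj (V j r) * V i r) * c i)" for j
    unfolding sum_distrib_left by (subst sum.swap) (simp add: sum_distrib_right mult.assoc)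
  have orth': "(\<Sum>r\<in>S. cnj (w r) * U j r) = 0" if "j < card S" for j
  proof -
    have "(\<Sum>r\<in>S. cnj (w r) * U j r) = cnj (\<Sum>r\<in>S. cnj (U j r) * w r)" by (simp add: mult.commute)
    then show ?thesis using orth[OF that] by simp
  qed
  have "c j = 0" if j: "j \<le> card S" for j
  proof -
    have V0: "(\<Sum>r\<in>S. cnj (V j r) * V i r) = 0" if "i \<le> card S" "i \<noteq> j" for i
      using that j U[of j i] orth[of j] orth'[of i] by (auto simp: V_def)
    have Vj: "(\<Sum>r\<in>S. cnj (V j r) * V j r) \<noteq> 0"
    proof (cases "j < card S")
      case True then show ?thesis using U[of j j] by (simp add: V_def)
    next
      case False
      have "(\<Sum>r\<in>S. cnj (w r) * w r) = of_real (\<Sum>r\<in>S. (cmod (w r))\<^sup>2)"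
        unfolding of_real_sum by (intro sum.cong refl) (simp add: complex_norm_square mult.commute del: of_real_power)
      moreover have "(\<Sum>r\<in>S. (cmod (w r))\<^sup>2) > 0" using w st S by (auto intro!: sum_pos2)
      ultimately have "(\<Sum>r\<in>S. cnj (w r) * w r) \<noteq> 0"
        by (metis (no_types, lifting) less_irrefl of_real_eq_0_iff)
      then show ?thesis using False by (simp add: V_def)
    qed
    have "0 = (\<Sum>r\<in>S. cnj (V j r) * (\<Sum>i\<le>card S. V i r * c i))" using c(2) by simp
    also have "\<dots> = (\<Sum>i\<le>card S. if i = j then (\<Sum>r\<in>S. cnj (V j r) * V j r) * c j else 0)"
      unfolding expand by (rule sum.cong) (use V0 in auto)
    finally show ?thesis using Vj j by simp
  qed
  with c(1) show False by blast
qed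

section \<open>Spectral expansions and the inertia of a Hermitian form\<close>

locale hermitian_spectrum =
  fixes S :: "'s set" and H :: "'s \<Rightarrow> 's \<Rightarrow> complex" and U :: "nat \<Rightarrow> 's \<Rightarrow> complex" and lam :: "nat \<Rightarrow> real"
  assumes S: "finite S"
    and U: "\<And>i j. i < card S \<Longrightarrow> j < card S \<Longrightarrow> (\<Sum>s\<in>S. cnj (U i s) * U j s) = (if i = j then 1 else 0)"
    and lam: "\<And>i s. i < card S \<Longrightarrow> s \<in> S \<Longrightarrow> (\<Sum>t\<in>S. H s t * U i t) = of_real (lam i) * U i s"
begin

lemma mult_expansion:
  assumes "s \<in> S" "t \<in> S"
  shows "(\<Sum>i<card S. of_real (lam i) ^ k * (of_real (lam i) * U i s * cnj (U i t)))
    = (\<Sum>r\<in>S. H s r * (\<Sum>i<card S. of_real (lam i) ^ k * (U i r * cnj (U i t))))"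
proof -
  have "(\<Sum>r\<in>S. H s r * (\<Sum>i<card S. of_real (lam i) ^ k * (U i r * cnj (U i t))))
     = (\<Sum>i<card S. \<Sum>r\<in>S. H s r * (of_real (lam i) ^ k * (U i r * cnj (U i t))))"
    unfolding sum_distrib_left by (rule sum.swap)
  also have "\<dots> = (\<Sum>i<card S. of_real (lam i) ^ k * ((\<Sum>r\<in>S. H s r * U i r) * cnj (U i t)))"
    by (simp add: sum_distrib_left sum_distrib_right mult_ac)
  also have "\<dots> = (\<Sum>i<card S. of_real (lam i) ^ k * (of_real (lam i) * U i s * cnj (U i t)))"
    by (rule sum.cong) (use lam assms in auto)
  finally show ?thesis by simp
qed

lemma power_expansion:
  assumes P0: "\<And>s t. s \<in> S \<Longrightarrow> t \<in> S \<Longrightarrow> P 0 s t = (if s = t then 1 else 0)"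
    and PS: "\<And>k s t. s \<in> S \<Longrightarrow> t \<in> S \<Longrightarrow> P (Suc k) s t = (\<Sum>r\<in>S. H s r * P k r t)"
    and st: "s \<in> S" "t \<in> S"
  shows "P k s t = (\<Sum>i<card S. of_real (lam i) ^ k * (U i s * cnj (U i t)))"
  using st
proof (induction k arbitrary: s)
  case 0
  then show ?case using P0 orthonormal_complete[OF S U] by simp
next
  case (Suc k)
  have "P (Suc k) s t = (\<Sum>r\<in>S. H s r * (\<Sum>i<card S. of_real (lam i) ^ k * (U i r * cnj (U i t))))"
    using Suc PS by simp
  also have "\<dots> = (\<Sum>i<card S. of_real (lam i) ^ Suc k * (U i s * cnj (U i t)))"
    using mult_expansion[OF Suc.prems, of k] by (simp add: mult_ac)
  finally show ?case .
qed

lemma trace_power: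
  assumes P0: "\<And>s t. s \<in> S \<Longrightarrow> t \<in> S \<Longrightarrow> P 0 s t = (if s = t then 1 else 0)"
    and PS: "\<And>k s t. s \<in> S \<Longrightarrow> t \<in> S \<Longrightarrow> P (Suc k) s t = (\<Sum>r\<in>S. H s r * P k r t)"
  shows "(\<Sum>s\<in>S. P k s s) = of_real (\<Sum>i<card S. lam i ^ k)"
proof -
  have "(\<Sum>s\<in>S. P k s s) = (\<Sum>s\<in>S. \<Sum>i<card S. of_real (lam i) ^ k * (cnj (U i s) * U i s))"
    by (rule sum.cong) (simp_all add: power_expansion[OF P0 PS] mult_ac)
  also have "\<dots> = (\<Sum>i<card S. of_real (lam i) ^ k * (\<Sum>s\<in>S. cnj (U i s) * U i s))"
    unfolding sum_distrib_left by (rule sum.swap)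
  finally show ?thesis by (simp add: U)
qed

lemma quadratic_form:
  "(\<Sum>s\<in>S. \<Sum>t\<in>S. cnj (x s) * H s t * x t)
    = of_real (\<Sum>i<card S. lam i * (cmod (\<Sum>s\<in>S. cnj (U i s) * x s))\<^sup>2)"
proof -
  have He: "H s t = (\<Sum>i<card S. of_real (lam i) * (U i s * cnj (U i t)))" if st: "s \<in> S" "t \<in> S" for s t
  proof -
    have "H s t = (\<Sum>r\<in>S. H s r * (\<Sum>i<card S. U i r * cnj (U i t)))"
      (is "_ = ?rhs")
    proof -
      have "?rhs = (\<Sum>r\<in>S. if r = t then H s r else 0)"
        by (rule sum.cong) (use orthonormal_complete[OF S U _ st(2)] in auto)
      then show ?thesis using st S by simp
    qed
    also have "\<dots> = (\<Sum>i<card S. of_real (lam i) * (U i s * cnj (U i t)))"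
      using mult_expansion[OF st, of 0] by (simp add: mult_ac)
    finally show ?thesis .
  qed
  have "(\<Sum>s\<in>S. \<Sum>t\<in>S. cnj (x s) * H s t * x t)
    = (\<Sum>s\<in>S. \<Sum>t\<in>S. \<Sum>i<card S. of_real (lam i) * ((cnj (x s) * U i s) * (cnj (U i t) * x t)))"
    by (intro sum.cong refl) (simp add: He sum_distrib_left sum_distrib_right mult_ac)
  also have "\<dots> = (\<Sum>s\<in>S. \<Sum>i<card S. \<Sum>t\<in>S. of_real (lam i) * ((cnj (x s) * U i s) * (cnj (U i t) * x t)))"
    by (intro sum.cong refl sum.swap)
  also have "\<dots> = (\<Sum>i<card S. \<Sum>s\<in>S. \<Sum>t\<in>S. of_real (lam i) * ((cnj (x s) * U i s) * (cnj (U i t) * x t)))"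
    by (rule sum.swap)
  also have "\<dots> = (\<Sum>i<card S. of_real (lam i) * (cnj (\<Sum>s\<in>S. cnj (U i s) * x s) * (\<Sum>t\<in>S. cnj (U i t) * x t)))"
  proof -
    have "cnj (\<Sum>s\<in>S. cnj (U i s) * x s) * (\<Sum>t\<in>S. cnj (U i t) * x t)
      = (\<Sum>s\<in>S. \<Sum>t\<in>S. (cnj (x s) * U i s) * (cnj (U i t) * x t))" for i
      unfolding cnj_sum sum_product by (intro sum.cong refl) simp
    then show ?thesis by (simp only: sum_distrib_left)
  qed
  also have "\<dots> = of_real (\<Sum>i<card S. lam i * (cmod (\<Sum>s\<in>S. cnj (U i s) * x s))\<^sup>2)"
    by (simp only: of_real_sum of_real_mult complex_norm_square mult.commute)
  finally show ?thesis .
qed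

text \<open>Sylvester's law of inertia, for a form given as a signed sum of squares of
  linear functionals \<open>L j\<close> that are jointly onto.\<close>

lemma inertia:
  fixes L :: "'j \<Rightarrow> 's \<Rightarrow> complex"
  assumes fin: "finite P" "finite R" "P \<inter> R = {}"
    and form: "\<And>x. (\<Sum>s\<in>S. \<Sum>t\<in>S. cnj (x s) * H s t * x t)
      = of_real ((\<Sum>j\<in>P. (cmod (\<Sum>s\<in>S. L j s * x s))\<^sup>2) - (\<Sum>j\<in>R. (cmod (\<Sum>s\<in>S. L j s * x s))\<^sup>2))"
    and onto: "\<And>j. j \<in> P \<union> R \<Longrightarrow> \<exists>x. \<forall>i\<in>P \<union> R. (\<Sum>s\<in>S. L i s * x s) = (if i = j then 1 else 0)"
  shows "card {i. i < card S \<and> lam i < 0} = card R"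
proof -
  define I where "I = {i. i < card S \<and> lam i < 0}"
  have I: "finite I" by (simp add: I_def)
  have forms: "(\<Sum>i<card S. lam i * (cmod (\<Sum>s\<in>S. cnj (U i s) * x s))\<^sup>2)
     = (\<Sum>j\<in>P. (cmod (\<Sum>s\<in>S. L j s * x s))\<^sup>2) - (\<Sum>j\<in>R. (cmod (\<Sum>s\<in>S. L j s * x s))\<^sup>2)" for x
    using form[of x] unfolding quadratic_form of_real_eq_iff .
  \<comment> \<open>With too many negative eigenvalues, some nonzero combination of their
    eigenvectors is killed by all functionals in \<open>R\<close>. There the signed squares are
    nonnegative while the eigenvalues make the form negative.\<close>
  have "\<not> card R < card I"
  proof
    assume "card R < card I"
    from homogeneous_system_nontrivial[OF fin(2) I this, of "\<lambda>j i. \<Sum>s\<in>S. L j s * U i s"] obtain c where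
      c: "\<exists>i\<in>I. c i \<noteq> 0" "\<And>j. j \<in> R \<Longrightarrow> (\<Sum>i\<in>I. (\<Sum>s\<in>S. L j s * U i s) * c i) = 0" by blast
    define x where "x s = (\<Sum>i\<in>I. U i s * c i)" for s
    have "(\<Sum>s\<in>S. L j s * x s) = (\<Sum>i\<in>I. (\<Sum>s\<in>S. L j s * U i s) * c i)" for j
      unfolding x_def sum_distrib_left sum_distrib_right by (subst sum.swap) (simp add: mult.assoc)
    then have Rz: "(\<Sum>j\<in>R. (cmod (\<Sum>s\<in>S. L j s * x s))\<^sup>2) = 0" using c(2) by simp
    have Ux: "(\<Sum>s\<in>S. cnj (U k s) * x s) = (if k \<in> I then c k else 0)" if k: "k < card S" for k
    proof -
      have "(\<Sum>s\<in>S. cnj (U k s) * x s) = (\<Sum>i\<in>I. (\<Sum>s\<in>S. cnj (U k s) * U i s) * c i)"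
        unfolding x_def sum_distrib_left sum_distrib_right by (subst sum.swap) (simp add: mult.assoc)
      also have "\<dots> = (\<Sum>i\<in>I. if i = k then c k else 0)"
        by (rule sum.cong) (use U k in \<open>auto simp: I_def\<close>)
      finally show ?thesis using I by simp
    qed
    have "(\<Sum>i<card S. lam i * (cmod (\<Sum>s\<in>S. cnj (U i s) * x s))\<^sup>2) = (\<Sum>i<card S. if i \<in> I then lam i * (cmod (c i))\<^sup>2 else 0)"
      by (rule sum.cong) (auto simp: Ux)
    also have "\<dots> = (\<Sum>i\<in>I. lam i * (cmod (c i))\<^sup>2)"
      by (subst sum.inter_restrict[symmetric]) (auto simp: I_def intro!: sum.cong)
    also have "\<dots> = - (\<Sum>i\<in>I. - lam i * (cmod (c i))\<^sup>2)" by (simp add: sum_negf)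
    finally have "(\<Sum>i<card S. lam i * (cmod (\<Sum>s\<in>S. cnj (U i s) * x s))\<^sup>2) = - (\<Sum>i\<in>I. - lam i * (cmod (c i))\<^sup>2)" .
    moreover have "(\<Sum>i\<in>I. - lam i * (cmod (c i))\<^sup>2) > 0"
    proof -
      from c(1) obtain i where "i \<in> I" "c i \<noteq> 0" by blast
      then show ?thesis using I by (intro sum_pos2[of I i]) (auto simp: I_def mult_less_0_iff mult_nonpos_nonneg)
    qed
    ultimately have "(\<Sum>i<card S. lam i * (cmod (\<Sum>s\<in>S. cnj (U i s) * x s))\<^sup>2) < 0" by linarith
    moreover have "(\<Sum>j\<in>P. (cmod (\<Sum>s\<in>S. L j s * x s))\<^sup>2) \<ge> 0" by (simp add: sum_nonneg)
    ultimately show False using forms[of x] Rz by linarith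
  qed
  \<comment> \<open>The mirror argument: a combination of the dual vectors of \<open>R\<close> is
    orthogonal to all negative eigenvectors, and there the form is negative by the squares but
    nonnegative by the eigenvalues.\<close>
  moreover have "\<not> card I < card R"
  proof
    assume "card I < card R"
    from onto obtain X where X: "\<And>i j. j \<in> P \<union> R \<Longrightarrow> i \<in> P \<union> R \<Longrightarrow> (\<Sum>s\<in>S. L i s * X j s) = (if i = j then 1 else 0)"
      by metis
    from homogeneous_system_nontrivial[OF I fin(2) \<open>card I < card R\<close>, of "\<lambda>i j. \<Sum>s\<in>S. cnj (U i s) * X j s"] obtain c where
      c: "\<exists>j\<in>R. c j \<noteq> 0" "\<And>i. i \<in> I \<Longrightarrow> (\<Sum>j\<in>R. (\<Sum>s\<in>S. cnj (U i s) * X j s) * c j) = 0" by blast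
    define x where "x s = (\<Sum>j\<in>R. X j s * c j)" for s
    have "(\<Sum>s\<in>S. cnj (U i s) * x s) = (\<Sum>j\<in>R. (\<Sum>s\<in>S. cnj (U i s) * X j s) * c j)" for i
      unfolding x_def sum_distrib_left sum_distrib_right by (subst sum.swap) (simp add: mult.assoc)
    then have "(\<Sum>i<card S. lam i * (cmod (\<Sum>s\<in>S. cnj (U i s) * x s))\<^sup>2) \<ge> 0"
    proof (intro sum_nonneg)
      fix i assume Ux: "\<And>i. (\<Sum>s\<in>S. cnj (U i s) * x s) = (\<Sum>j\<in>R. (\<Sum>s\<in>S. cnj (U i s) * X j s) * c j)" and i: "i \<in> {..<card S}"
      show "0 \<le> lam i * (cmod (\<Sum>s\<in>S. cnj (U i s) * x s))\<^sup>2"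
        using c(2)[of i] i by (cases "i \<in> I") (auto simp: Ux I_def)
    qed
    moreover have Lx: "(\<Sum>s\<in>S. L k s * x s) = (if k \<in> R then c k else 0)" if k: "k \<in> P \<union> R" for k
    proof -
      have "(\<Sum>s\<in>S. L k s * x s) = (\<Sum>j\<in>R. (\<Sum>s\<in>S. L k s * X j s) * c j)"
        unfolding x_def sum_distrib_left sum_distrib_right by (subst sum.swap) (simp add: mult.assoc)
      also have "\<dots> = (\<Sum>j\<in>R. if j = k then c k else 0)"
        by (rule sum.cong) (use X k in auto)
      finally show ?thesis using fin by simp
    qed
    have "(\<Sum>j\<in>P. (cmod (\<Sum>s\<in>S. L j s * x s))\<^sup>2) = 0"
      using Lx fin(3) by (intro sum.neutral) auto
    moreover have "(\<Sum>j\<in>R. (cmod (\<Sum>s\<in>S. L j s * x s))\<^sup>2) > 0"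
    proof -
      from c(1) obtain j where "j \<in> R" "c j \<noteq> 0" by blast
      then show ?thesis using fin Lx[of j] by (intro sum_pos2[of R j]) auto
    qed
    ultimately show False using forms[of x] by linarith
  qed
  ultimately show ?thesis unfolding I_def by linarith
qed

end

section \<open>Trace and eigenvalues of an arbitrary complex matrix\<close>

text \<open>The diagonal of a Schur form lists the eigenvalues and has the same trace. The other two
  clauses work in opposite directions: right eigenvectors restrict which values can be listed, left
  eigenvectors prove that a given value is listed. The latter uses that the transpose has the same
  characteristic polynomial.\<close>

lemma trace_eigenvalues:
  fixes A :: "'s \<Rightarrow> 's \<Rightarrow> complex"
  assumes S: "finite S"
  shows "\<exists>es. (\<Sum>s\<in>S. A s s) = sum_list es
    \<and> (\<forall>e\<in>set es. \<exists>v. (\<exists>s\<in>S. v s \<noteq> 0) \<and> (\<forall>s\<in>S. (\<Sum>t\<in>S. A s t * v t) = e * v s))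
    \<and> (\<forall>e v. (\<exists>s\<in>S. v s \<noteq> 0) \<longrightarrow> (\<forall>t\<in>S. (\<Sum>s\<in>S. v s * A s t) = e * v t) \<longrightarrow> e \<in> set es)"
proof -
  define n where "n = card S"
  obtain h where h: "bij_betw h {..<n} S"
    using S by (metis n_def ex_bij_betw_nat_finite atLeast0LessThan)
  define g where "g = inv_into {..<n} h"
  have gh: "g (h i) = i" if "i < n" for i
    unfolding g_def using that h by (simp add: bij_betw_def)
  have hg: "h (g s) = s" "g s < n" if "s \<in> S" for s
    using that h unfolding g_def by (auto simp: bij_betw_def f_inv_into_f inv_into_into intro!: inv_into_into[of _ h "{..<n}", simplified])
  have hS: "h i \<in> S" if "i < n" for i using h that by (auto simp: bij_betw_def)
  have re: "(\<Sum>s\<in>S. f s) = (\<Sum>i = 0..<n. f (h i))" for f :: "'s \<Rightarrow> complex"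
    using sum.reindex_bij_betw[OF h, of f] by (simp add: atLeast0LessThan)
  define M where "M = mat n n (\<lambda>(i,j). A (h i) (h j))"
  have M: "M \<in> carrier_mat n n" by (simp add: M_def)
  obtain es where es: "char_poly M = (\<Prod>a\<leftarrow>es. [:-a, 1:])" "length es = n"
    using char_poly_factorized[OF M] by blast
  obtain B where B: "B \<in> carrier_mat n n" "upper_triangular B" "similar_mat M B"
    using schur_decomposition_exists[OF M es(1)] by blast
  have roots: "poly (\<Prod>a\<leftarrow>xs. [:-a, 1:]) x = 0 \<longleftrightarrow> x \<in> set xs" for x :: complex and xs
    by (induction xs) auto
  have "char_poly B = (\<Prod>a\<leftarrow>diag_mat B. [:-a, 1:])" by (rule char_poly_upper_triangular[OF B(1,2)])
  then have ev: "eigenvalue M e \<longleftrightarrow> e \<in> set (diag_mat B)" for e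
    using eigenvalue_root_char_poly[OF M] char_poly_similar[OF B(3)] roots by metis
  from B(3) obtain P Q where PQ: "similar_mat_wit M B P Q" unfolding similar_mat_def by blast
  then have c: "P \<in> carrier_mat n n" "Q \<in> carrier_mat n n" "Q * P = 1\<^sub>m n" "M = P * B * Q"
    using M unfolding similar_mat_wit_def Let_def by auto
  have entry: "M $$ (i,i) = (\<Sum>j = 0..<n. \<Sum>k = 0..<n. (Q $$ (j,i) * P $$ (i,k)) * B $$ (k,j))" if "i < n" for i
  proof -
    have "M $$ (i,i) = (\<Sum>j = 0..<n. (\<Sum>k = 0..<n. P $$ (i,k) * B $$ (k,j)) * Q $$ (j,i))"
      using c B that by (simp add: scalar_prod_def del: assoc_mult_mat)
    then show ?thesis by (simp add: sum_distrib_left sum_distrib_right mult_ac)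
  qed
  \<comment> \<open>Cyclicity of the trace: summing over the outer index first leaves the product
    \<open>Q * P\<close>, which is the identity.\<close>
  have "(\<Sum>s\<in>S. A s s) = (\<Sum>i = 0..<n. M $$ (i,i))"
    unfolding re by (rule sum.cong) (simp_all add: M_def)
  also have "\<dots> = (\<Sum>i = 0..<n. \<Sum>j = 0..<n. \<Sum>k = 0..<n. (Q $$ (j,i) * P $$ (i,k)) * B $$ (k,j))"
    by (rule sum.cong) (simp_all add: entry)
  also have "\<dots> = (\<Sum>j = 0..<n. \<Sum>i = 0..<n. \<Sum>k = 0..<n. (Q $$ (j,i) * P $$ (i,k)) * B $$ (k,j))"
    by (rule sum.swap)
  also have "\<dots> = (\<Sum>j = 0..<n. \<Sum>k = 0..<n. \<Sum>i = 0..<n. (Q $$ (j,i) * P $$ (i,k)) * B $$ (k,j))"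
    by (intro sum.cong refl sum.swap)
  also have "\<dots> = (\<Sum>j = 0..<n. \<Sum>k = 0..<n. (Q * P) $$ (j,k) * B $$ (k,j))"
  proof (intro sum.cong refl)
    fix j k assume "j \<in> {0..<n}" "k \<in> {0..<n}"
    then have "(Q * P) $$ (j,k) = (\<Sum>i = 0..<n. Q $$ (j,i) * P $$ (i,k))"
      using c(1,2) by (simp add: scalar_prod_def)
    then show "(\<Sum>i = 0..<n. Q $$ (j,i) * P $$ (i,k) * B $$ (k,j)) = (Q * P) $$ (j,k) * B $$ (k,j)"
      by (simp add: sum_distrib_right)
  qed
  also have "\<dots> = (\<Sum>j = 0..<n. \<Sum>k = 0..<n. if k = j then B $$ (j,j) else 0)"
    by (intro sum.cong refl) (auto simp: c(3))
  also have "\<dots> = sum_list (diag_mat B)"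
    using B(1) by (simp add: diag_mat_def interv_sum_list_conv_sum_set_nat)
  finally have tr: "(\<Sum>s\<in>S. A s s) = sum_list (diag_mat B)" .
  have right: "\<exists>v. (\<exists>s\<in>S. v s \<noteq> 0) \<and> (\<forall>s\<in>S. (\<Sum>t\<in>S. A s t * v t) = e * v s)" if e: "e \<in> set (diag_mat B)" for e
  proof -
    from e ev obtain w where w: "w \<in> carrier_vec n" "w \<noteq> 0\<^sub>v n" "M *\<^sub>v w = e \<cdot>\<^sub>v w"
      using M unfolding eigenvalue_def eigenvector_def by auto
    have "\<exists>s\<in>S. w $ g s \<noteq> 0"
    proof (rule ccontr)
      assume "\<not> ?thesis"
      then have w0: "w $ i = 0" if "i < n" for i using gh[OF that] hS[OF that] by fastforce
      have "w = 0\<^sub>v n" by (rule eq_vecI) (use w(1) w0 in auto)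
      then show False using w(2) by simp
    qed
    moreover have "(\<Sum>t\<in>S. A s t * w $ g t) = e * w $ g s" if s: "s \<in> S" for s
    proof -
      have "(M *\<^sub>v w) $ g s = (\<Sum>j = 0..<n. A s (h j) * w $ j)"
        using w(1) hg[OF s] by (simp add: M_def scalar_prod_def)
      moreover have "(M *\<^sub>v w) $ g s = e * w $ g s" unfolding w(3) using w(1) hg[OF s] by simp
      ultimately show ?thesis unfolding re by (simp add: gh)
    qed
    ultimately show ?thesis by (intro exI[of _ "\<lambda>s. w $ g s"]) auto
  qed
  have left: "e \<in> set (diag_mat B)" if v: "\<exists>s\<in>S. v s \<noteq> 0" "\<forall>t\<in>S. (\<Sum>s\<in>S. v s * A s t) = e * v t" for e v
  proof -
    define w where "w = vec n (\<lambda>i. v (h i))"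
    have "w \<noteq> 0\<^sub>v n" using v(1) hg by (metis index_vec index_zero_vec(1) w_def)
    moreover have "M\<^sup>T *\<^sub>v w = e \<cdot>\<^sub>v w"
    proof (rule eq_vecI)
      fix i assume "i < dim_vec (e \<cdot>\<^sub>v w)"
      then have i: "i < n" by (simp add: w_def)
      then show "(M\<^sup>T *\<^sub>v w) $ i = (e \<cdot>\<^sub>v w) $ i"
        using v(2) hS[OF i] by (simp add: w_def M_def scalar_prod_def re mult.commute)
    qed (simp add: M_def w_def)
    ultimately have "eigenvalue M\<^sup>T e"
      using M unfolding eigenvalue_def eigenvector_def by (intro exI[of _ w]) (auto simp: w_def)
    then have "poly (char_poly M\<^sup>T) e = 0" using eigenvalue_root_char_poly[of "M\<^sup>T" n] M by simp
    then show ?thesis using ev eigenvalue_root_char_poly[OF M] char_poly_transpose_mat[OF M] by metis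
  qed
  from tr right left show ?thesis by blast
qed

section \<open>Newton's identities and Descartes' rule for real-rooted polynomials\<close>

text \<open>Logarithmic differentiation: for \<open>F\<close> the product of the 1 + lam_j X and
  \<open>P\<close> the series of alternating power sums, X times the derivative of \<open>F\<close>
  equals \<open>F\<close> times \<open>P\<close>. Comparing coefficients gives the recursion imposed
  on \<open>E\<close>, and that recursion determines its solution.\<close>

lemma newton_identities:
  fixes lam :: "nat \<Rightarrow> real"
  assumes E0: "E 0 = 1"
    and ES: "\<And>k. E (Suc k) = (\<Sum>i\<le>k. (-1) ^ i * E (k - i) * (\<Sum>j<n. lam j ^ Suc i)) / real (Suc k)"
  shows "E k = coeff (\<Prod>j<n. [:1, lam j:]) k"
proof -
  define F where "F m = fps_of_poly (\<Prod>j<m. [:1, lam j:])" for m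
  define P where "P m = Abs_fps (\<lambda>k. if k = 0 then 0 else (-1) ^ (k - 1) * (\<Sum>j<m. lam j ^ k))" for m
  have FS: "F (Suc m) = F m * (1 + fps_const (lam m) * fps_X)" for m
    by (simp add: F_def fps_of_poly_mult fps_of_poly_pCons mult_ac)
  \<comment> \<open>The geometric series with its denominator cleared.\<close>
  have geo: "(1 + fps_const a * fps_X) * Abs_fps (\<lambda>k. if k = 0 then 0 else (-1) ^ (k - 1) * a ^ k) = fps_const a * fps_X" for a :: real
  proof (rule fps_ext)
    fix k show "fps_nth ((1 + fps_const a * fps_X) * Abs_fps (\<lambda>k. if k = 0 then 0 else (-1) ^ (k - 1) * a ^ k)) k = fps_nth (fps_const a * fps_X) k"
      by (cases k; cases "k - 1") (auto simp: distrib_right mult.assoc)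
  qed
  have PS: "P (Suc m) = P m + Abs_fps (\<lambda>k. if k = 0 then 0 else (-1) ^ (k - 1) * lam m ^ k)" for m
    by (rule fps_ext) (simp add: P_def algebra_simps)
  have main: "fps_X * fps_deriv (F m) = F m * P m" for m
  proof (induction m)
    case 0
    have "P 0 = 0" by (rule fps_ext) (simp add: P_def)
    then show ?case by (simp add: F_def)
  next
    case (Suc m)
    define G where "G = Abs_fps (\<lambda>k. if k = 0 then 0 else (-1) ^ (k - 1) * lam m ^ k)"
    define Y where "Y = 1 + fps_const (lam m) * fps_X"
    have YG: "fps_const (lam m) * fps_X = Y * G" using geo[of "lam m"] by (simp add: G_def Y_def)
    have dY: "fps_deriv Y = fps_const (lam m)" by (simp add: Y_def)
    have "fps_X * fps_deriv (F (Suc m)) = (fps_X * fps_deriv (F m)) * Y + F m * (fps_const (lam m) * fps_X)"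
      unfolding FS Y_def[symmetric] fps_deriv_mult dY by (simp add: ring_distribs mult_ac)
    also have "\<dots> = F (Suc m) * P (Suc m)"
      unfolding Suc.IH PS FS Y_def[symmetric] G_def[symmetric] unfolding YG by (simp add: ring_distribs mult_ac)
    finally show ?case .
  qed
  have rec: "of_nat (Suc k) * coeff (\<Prod>j<n. [:1, lam j:]) (Suc k)
     = (\<Sum>i\<le>k. (-1) ^ i * coeff (\<Prod>j<n. [:1, lam j:]) (k - i) * (\<Sum>j<n. lam j ^ Suc i))" for k
  proof -
    have "of_nat (Suc k) * coeff (\<Prod>j<n. [:1, lam j:]) (Suc k) = fps_nth (P n * F n) (Suc k)"
      using arg_cong[OF main[of n], of "\<lambda>f. fps_nth f (Suc k)"] by (simp add: F_def mult.commute[of "P n"] del: of_nat_Suc)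
    also have "\<dots> = (\<Sum>i = 0..Suc k. fps_nth (P n) i * fps_nth (F n) (Suc k - i))" by (rule fps_mult_nth)
    also have "\<dots> = (\<Sum>i = 0..k. fps_nth (P n) (Suc i) * fps_nth (F n) (k - i))"
      by (subst sum.atLeast0_atMost_Suc_shift) (simp add: P_def)
    finally show ?thesis by (simp add: P_def F_def atLeast0AtMost mult_ac)
  qed
  have c0: "coeff (\<Prod>j<n. [:1, lam j:]) 0 = 1"
    by (simp add: poly_0_coeff_0[symmetric] poly_prod)
  show ?thesis
  proof (induction k rule: less_induct)
    case (less k)
    show ?case
    proof (cases k)
      case 0 then show ?thesis using E0 c0 by simp
    next
      case (Suc m)
      have "E (Suc m) * real (Suc m) = (\<Sum>i\<le>m. (-1) ^ i * E (m - i) * (\<Sum>j<n. lam j ^ Suc i))"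
        unfolding ES by simp
      also have "\<dots> = real (Suc m) * coeff (\<Prod>j<n. [:1, lam j:]) (Suc m)"
        unfolding rec using less.IH Suc by (intro sum.cong refl) auto
      finally show ?thesis unfolding Suc by (simp del: of_nat_Suc)
    qed
  qed
qed

section \<open>Sign variations of a sequence\<close>

fun last_sign :: "(nat \<Rightarrow> real) \<Rightarrow> nat \<Rightarrow> real" where
  "last_sign e 0 = 0"
| "last_sign e (Suc k) = (if e k \<noteq> 0 then sgn (e k) else last_sign e k)"

text \<open>An entry is compared with the latest nonzero sign, so zeros are skipped; the first
  nonzero entry meets the value 0 and adds no variation.\<close>

fun sign_changes :: "(nat \<Rightarrow> real) \<Rightarrow> nat \<Rightarrow> nat" where
  "sign_changes e 0 = 0"
| "sign_changes e (Suc k) = sign_changes e k + (if e k * last_sign e k < 0 then 1 else 0)"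

lemma sign_changes_cong:
  assumes "\<And>i. i < k \<Longrightarrow> sgn (e i) = sgn (f i)"
  shows "last_sign e k = last_sign f k \<and> sign_changes e k = sign_changes f k"
  using assms
proof (induction k)
  case (Suc k)
  have s: "sgn (e k) = sgn (f k)" using Suc.prems by simp
  then have z: "e k = 0 \<longleftrightarrow> f k = 0" by (metis sgn_0_0)
  have "e k * t < 0 \<longleftrightarrow> f k * t < 0" for t
    using s by (metis sgn_less sgn_mult)
  then show ?case using Suc s z by auto
qed simp

lemma last_sign_cases: "last_sign e k \<in> {-1, 0, 1}"
  by (induction k) (auto simp: sgn_if)

lemma last_sign_nz: "e 0 \<noteq> 0 \<Longrightarrow> k > 0 \<Longrightarrow> last_sign e k \<noteq> 0"
proof (induction k)
  case (Suc k)
  then show ?case by (cases "k = 0") (auto simp: sgn_if)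
qed simp

lemma sign_changes_mono: "j \<le> k \<Longrightarrow> sign_changes e j \<le> sign_changes e k"
  by (induction k rule: dec_induct) auto

lemma sign_changes_stable:
  assumes "\<And>i. i \<ge> j \<Longrightarrow> e i = 0" "j \<le> k"
  shows "sign_changes e k = sign_changes e j"
  using assms(2) by (induction k rule: dec_induct) (auto simp: assms(1))

text \<open>Multiplication by 1 - a X gains a variation. Where \<open>p\<close> varies, its
  preceding coefficient is zero or of opposite sign, so the new coefficient keeps the sign of the
  old one. This maintains that \<open>q\<close> never lags behind and is ahead by one whenever the
  latest signs differ; just past the degree of \<open>p\<close> they do differ.\<close>

lemma sign_changes_linear_factor:
  assumes p0: "p 0 \<noteq> 0" and pK: "\<And>i. i \<ge> K \<Longrightarrow> p i = 0" and a: "a > 0"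
    and q: "\<And>k. q k = p k - a * (if k = 0 then 0 else p (k - 1))"
  shows "sign_changes q (Suc K) \<ge> Suc (sign_changes p K)"
proof -
  have q0: "q 0 = p 0" using q by simp
  have inv: "sign_changes q k \<ge> sign_changes p k + (if last_sign q k \<noteq> last_sign p k then 1 else 0)" if "k > 0" for k
    using that
  proof (induction k)
    case (Suc k)
    show ?case
    proof (cases "k = 0")
      case True then show ?thesis by (simp add: q0)
    next
      case False
      then have IH: "sign_changes q k \<ge> sign_changes p k + (if last_sign q k \<noteq> last_sign p k then 1 else 0)"
        using Suc.IH by simp
      have nz: "last_sign q k \<noteq> 0" "last_sign p k \<noteq> 0" using last_sign_nz False p0 q0 by auto
      have lc: "last_sign q k \<in> {-1, 0, 1}" "last_sign p k \<in> {-1, 0, 1}" by (rule last_sign_cases)+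
      have prev: "p (k - 1) \<noteq> 0 \<Longrightarrow> last_sign p k = sgn (p (k - 1))" using False by (cases k) auto
      have qk: "q k = p k - a * p (k - 1)" using False q by simp
      have flip: "p k * last_sign p k < 0 \<Longrightarrow> q k \<noteq> 0 \<and> sgn (q k) = sgn (p k)"
      proof -
        assume f: "p k * last_sign p k < 0"
        have "p (k - 1) * last_sign p k \<ge> 0" using prev by (cases "p (k - 1) = 0") (auto simp: sgn_if)
        then have "a * p (k - 1) * last_sign p k \<ge> 0" using a by (simp add: mult.assoc)
        with f lc nz show ?thesis unfolding qk by (auto simp: sgn_if)
      qed
      show ?thesis
      proof (cases "p k * last_sign p k < 0")
        case True
        with flip have "q k \<noteq> 0" "sgn (q k) = sgn (p k)" by auto
        moreover have "last_sign q k = 1 \<or> last_sign q k = -1" "last_sign p k = 1 \<or> last_sign p k = -1"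
          using lc nz by auto
        ultimately show ?thesis using True IH
          by (cases "p k" "0 :: real" rule: linorder_cases) (auto simp: sgn_if split: if_splits)
      next
        case False
        then have "p k \<noteq> 0 \<Longrightarrow> sgn (p k) = last_sign p k" using lc nz
          by (auto simp: sgn_if mult_less_0_iff split: if_splits)
        then have "last_sign p (Suc k) = last_sign p k" by simp
        moreover have "sign_changes p (Suc k) = sign_changes p k" using False by simp
        moreover have "last_sign q k = 1 \<or> last_sign q k = -1" "last_sign p k = 1 \<or> last_sign p k = -1"
          using lc nz by auto
        ultimately show ?thesis using IH
          by (cases "q k" "0 :: real" rule: linorder_cases) auto
      qed
    qed
  qed simp
  have "K > 0" using pK[of 0] p0 by (metis gr0I le_refl)
  \<comment> \<open>\<open>m\<close> is the degree of \<open>p\<close>; the coefficient of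
    \<open>q\<close> right after it is \<open>- a * p m\<close>, opposite in sign to the leading
    coefficient of \<open>p\<close>.\<close>
  define m where "m = (GREATEST m. p m \<noteq> 0)"
  have bnd: "\<And>y. p y \<noteq> 0 \<Longrightarrow> y \<le> K" using pK by (metis nat_le_linear)
  have m: "p m \<noteq> 0" "\<And>i. i > m \<Longrightarrow> p i = 0"
    using GreatestI_nat[of "\<lambda>m. p m \<noteq> 0", OF p0 bnd] Greatest_le_nat[of "\<lambda>m. p m \<noteq> 0", OF _ bnd]
    unfolding m_def by (auto, meson leD)
  have "m < K" using pK m(1) by (metis not_less)
  have qm: "q (Suc m) = - a * p m" using q m(2)[of "Suc m"] by simp
  have "last_sign q (Suc (Suc m)) \<noteq> last_sign p (Suc (Suc m))"
    using m a by (simp add: qm sgn_if mult_less_0_iff zero_less_mult_iff)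
  then have "sign_changes q (Suc (Suc m)) \<ge> Suc (sign_changes p (Suc (Suc m)))" using inv[of "Suc (Suc m)"] by simp
  moreover have "sign_changes p K \<le> sign_changes p (Suc (Suc m))"
    using sign_changes_stable[of "Suc m" p K] sign_changes_mono[of "Suc m" "Suc (Suc m)" p] m(2) \<open>m < K\<close> by simp
  moreover have "sign_changes q (Suc (Suc m)) \<le> sign_changes q (Suc K)"
    using \<open>m < K\<close> by (intro sign_changes_mono) simp
  ultimately show ?thesis by linarith
qed

text \<open>Between consecutive nonzero entries exactly one of the two sequences varies if the
  entries are adjacent, and at most both vary if the gap is 2 or more. So every gap pays for its
  variations.\<close>

lemma sign_changes_reflect:
  assumes e0: "e 0 \<noteq> 0" and eD: "\<And>i. i > D \<Longrightarrow> e i = 0"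
  shows "sign_changes e k + sign_changes (\<lambda>i. (-1) ^ i * e i) k \<le> D"
proof -
  let ?f = "\<lambda>i. (-1) ^ i * e i"
  have "k > 0 \<Longrightarrow> \<exists>m<k. e m \<noteq> 0 \<and> last_sign e k = sgn (e m) \<and> last_sign ?f k = (-1) ^ m * sgn (e m)
     \<and> sign_changes e k + sign_changes ?f k \<le> m" for k
  proof (induction k)
    case (Suc k)
    show ?case
    proof (cases "k = 0")
      case True then show ?thesis using e0 by simp
    next
      case False
      with Suc obtain m where m: "m < k" "e m \<noteq> 0" "last_sign e k = sgn (e m)"
        "last_sign ?f k = (-1) ^ m * sgn (e m)" "sign_changes e k + sign_changes ?f k \<le> m" by auto
      show ?thesis
      proof (cases "e k = 0")
        case True then show ?thesis using m by (intro exI[of _ m]) auto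
      next
        case nz: False
        have inc: "(if e k * last_sign e k < 0 then 1 else 0) + (if ?f k * last_sign ?f k < 0 then 1 else 0) \<le> k - m"
        proof (cases "Suc m = k")
          case True
          have "(-1) ^ k * (-1) ^ m = (-1 :: real)" unfolding True[symmetric] by (simp flip: power_add)
          then have "?f k * last_sign ?f k = - (e k * last_sign e k)"
            unfolding m(3,4) by (metis mult.assoc mult.left_commute mult_minus1)
          then show ?thesis using True by auto
        next
          case False
          then have "k - m \<ge> 2" using m by simp
          then show ?thesis by (auto split: if_splits)
        qed
        have "last_sign ?f (Suc k) = (-1) ^ k * sgn (e k)" using nz by (simp add: sgn_mult)
        then show ?thesis using nz inc m by (intro exI[of _ k]) auto
      qed
    qed
  qed simp
  from this[of k] eD show ?thesis
    by (cases "k = 0") (auto, metis le_trans not_le)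
qed

text \<open>Every negative \<open>lam j\<close> gives a factor that gains a variation, which bounds
  the count from below, for \<open>lam\<close> and equally for its negation. Together the two counts
  are at most the number of nonzero \<open>lam j\<close>, so both bounds are equalities.\<close>

lemma descartes_real_rooted:
  fixes lam :: "nat \<Rightarrow> real"
  shows "sign_changes (coeff (\<Prod>j<n. [:1, lam j:])) (Suc n) = card {j. j < n \<and> lam j < 0}"
proof -
  have c0: "coeff (\<Prod>j\<in>J. [:1, f j:]) 0 = 1" for J :: "nat set" and f :: "nat \<Rightarrow> real"
    by (simp add: poly_0_coeff_0[symmetric] poly_prod)
  have lower: "sign_changes (coeff (p * (\<Prod>j\<in>J. [:1, f j:]))) (Suc (degree p + card J)) \<ge> card J"
    if "finite J" "\<And>j. j \<in> J \<Longrightarrow> f j < 0" "coeff p 0 = 1" for J :: "nat set" and f :: "nat \<Rightarrow> real" and p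
    using that
  proof (induction J rule: finite_induct)
    case (insert i J)
    define r where "r = p * (\<Prod>j\<in>J. [:1, f j:])"
    have r0: "coeff r 0 \<noteq> 0" using insert.prems c0 by (simp add: r_def coeff_mult)
    have "degree (\<Prod>j\<in>J. [:1, f j:]) \<le> card J"
      using degree_prod_sum_le[OF insert.hyps(1), of "\<lambda>j. [:1, f j:]"]
      by (rule order_trans) (rule order_trans[OF sum_bounded_above[of J _ 1]], auto)
    then have dr: "degree r \<le> degree p + card J"
      unfolding r_def using degree_mult_le[of p "\<Prod>j\<in>J. [:1, f j:]"] by linarith
    have "Suc (sign_changes (coeff r) (Suc (degree p + card J)))
       \<le> sign_changes (coeff (r * [:1, f i:])) (Suc (Suc (degree p + card J)))"
    proof (rule sign_changes_linear_factor[where a = "- f i"])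
      fix k show "coeff (r * [:1, f i:]) k = coeff r k - - f i * (if k = 0 then 0 else coeff r (k - 1))"
        by (cases k) (simp_all add: mult.commute[of r] coeff_pCons)
    qed (use r0 dr insert.prems in \<open>auto intro!: coeff_eq_0\<close>)
    moreover have "card J \<le> sign_changes (coeff r) (Suc (degree p + card J))"
      unfolding r_def using insert by auto
    moreover have "p * (\<Prod>j\<in>insert i J. [:1, f j:]) = r * [:1, f i:]"
      using insert.hyps unfolding r_def by (simp add: mult_ac)
    ultimately show ?case using insert.hyps by (simp del: sign_changes.simps mult_pCons_right)
  qed simp
  have lower': "sign_changes (coeff (\<Prod>j<n. [:1, f j:])) (Suc n) \<ge> card {j. j < n \<and> f j < 0}" for f :: "nat \<Rightarrow> real"
  proof -
    define J1 where "J1 = {j. j < n \<and> f j < 0}"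
    define J0 where "J0 = {j. j < n \<and> \<not> f j < 0}"
    have J: "{..<n} = J0 \<union> J1" "J0 \<inter> J1 = {}" "finite J0" "finite J1" by (auto simp: J0_def J1_def)
    define p where "p = (\<Prod>j\<in>J0. [:1, f j:])"
    have "degree p \<le> card J0"
      unfolding p_def using degree_prod_sum_le[OF J(3), of "\<lambda>j. [:1, f j:]"]
      by (rule order_trans) (rule order_trans[OF sum_bounded_above[of J0 _ 1]], auto)
    moreover have "card J0 + card J1 = n" using J by (metis card_Un_disjoint card_lessThan)
    moreover have "(\<Prod>j<n. [:1, f j:]) = p * (\<Prod>j\<in>J1. [:1, f j:])"
      unfolding p_def J(1) by (rule prod.union_disjoint) (use J in auto)
    moreover have "card J1 \<le> sign_changes (coeff (p * (\<Prod>j\<in>J1. [:1, f j:]))) (Suc (degree p + card J1))"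
      by (rule lower) (use J c0 in \<open>auto simp: J1_def p_def\<close>)
    ultimately show ?thesis
      using sign_changes_mono[of "Suc (degree p + card J1)" "Suc n" "coeff (p * (\<Prod>j\<in>J1. [:1, f j:]))"]
      by (simp add: J1_def)
  qed
  have refl: "coeff (\<Prod>j<m. [:1, - lam j:]) k = (-1) ^ k * coeff (\<Prod>j<m. [:1, lam j:]) k" for m k
  proof (induction m arbitrary: k)
    case 0 show ?case by (cases k) (auto simp: coeff_1)
  next
    case (Suc m)
    then show ?case by (cases k) (simp_all add: mult.commute[of "prod _ _"] coeff_pCons algebra_simps)
  qed
  \<comment> \<open>A zero \<open>lam j\<close> contributes the factor 1, so the degree is at most
    \<open>card Z\<close>.\<close>
  define Z where "Z = {j. j < n \<and> lam j \<noteq> 0}"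
  have Z: "finite Z" "Z \<subseteq> {..<n}" by (auto simp: Z_def)
  have "(\<Prod>j<n. [:1, lam j:]) = (\<Prod>j\<in>Z. [:1, lam j:])"
    by (rule prod.mono_neutral_right) (use Z in \<open>auto simp: Z_def one_pCons\<close>)
  moreover have "degree (\<Prod>j\<in>Z. [:1, lam j:]) \<le> card Z"
    using degree_prod_sum_le[OF Z(1), of "\<lambda>j. [:1, lam j:]"]
    by (rule order_trans) (rule order_trans[OF sum_bounded_above[of Z _ 1]], auto)
  ultimately have deg: "coeff (\<Prod>j<n. [:1, lam j:]) i = 0" if "i > card Z" for i
    using that by (intro coeff_eq_0) simp
  have "sign_changes (coeff (\<Prod>j<n. [:1, lam j:])) (Suc n) + sign_changes (\<lambda>i. (-1) ^ i * coeff (\<Prod>j<n. [:1, lam j:]) i) (Suc n) \<le> card Z"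
    by (rule sign_changes_reflect) (use deg c0[of lam "{..<n}"] in auto)
  moreover have "(\<lambda>i. (-1) ^ i * coeff (\<Prod>j<n. [:1, lam j:]) i) = coeff (\<Prod>j<n. [:1, - lam j:])"
    using refl by auto
  moreover have "card Z = card {j. j < n \<and> lam j < 0} + card {j. j < n \<and> - lam j < 0}"
    by (subst card_Un_disjoint[symmetric]) (auto simp: Z_def intro!: arg_cong[where f = card])
  ultimately show ?thesis using lower'[of lam] lower'[of "\<lambda>j. - lam j"] by simp
qed

section \<open>A quotient algebra with monomial basis\<close>

text \<open>Pinning the exponents to 0 from \<open>N\<close> on makes equal monomials equal
  functions, so addition and truncated subtraction can be taken pointwise.\<close>

definition mon :: "nat \<Rightarrow> (nat \<Rightarrow> nat) set" where
  "mon N = {g. \<forall>i\<ge>N. g i = 0}"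

definition mdeg :: "nat \<Rightarrow> (nat \<Rightarrow> nat) \<Rightarrow> nat" where
  "mdeg N g = (\<Sum>i<N. g i)"

definition ex :: "nat \<Rightarrow> nat \<Rightarrow> nat \<Rightarrow> nat" where
  "ex i c = (\<lambda>j. if j = i then c else 0)"

definition Bs :: "nat \<Rightarrow> (nat \<Rightarrow> nat) set" where
  "Bs N = {g \<in> mon N. \<forall>i<N. g i < 5}"

definition mev :: "nat \<Rightarrow> (nat \<Rightarrow> 'a::comm_monoid_mult) \<Rightarrow> (nat \<Rightarrow> nat) \<Rightarrow> 'a" where
  "mev N z g = (\<Prod>i<N. z i ^ g i)"

lemma mon_add [simp]: "g \<in> mon N \<Longrightarrow> h \<in> mon N \<Longrightarrow> g + h \<in> mon N"
  by (simp add: mon_def)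

lemma mon_diff [simp]: "g \<in> mon N \<Longrightarrow> g - h \<in> mon N"
  by (simp add: mon_def)

lemma mon_ex [simp]: "i < N \<Longrightarrow> ex i c \<in> mon N"
  by (simp add: mon_def ex_def)

lemma mon_0 [simp]: "0 \<in> mon N"
  by (simp add: mon_def)

lemma mdeg_add: "mdeg N (g + h) = mdeg N g + mdeg N h"
  by (simp add: mdeg_def sum.distrib)

lemma mdeg_ex [simp]: "i < N \<Longrightarrow> mdeg N (ex i c) = c"
  by (simp add: mdeg_def ex_def)

lemma diff_ex_add: "c \<le> g i \<Longrightarrow> g - ex i c + ex i c = g"
  by (auto simp: ex_def fun_eq_iff)

lemma mdeg_diff_ex: "i < N \<Longrightarrow> c \<le> g i \<Longrightarrow> mdeg N (g - ex i c) + c = mdeg N g"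
  by (metis diff_ex_add mdeg_add mdeg_ex)

lemma mev_add: "mev N z (g + h) = mev N z g * mev N z h"
  by (simp add: mev_def power_add prod.distrib)

lemma mev_ex [simp]: "i < N \<Longrightarrow> mev N z (ex i c) = z i ^ c"
  by (simp add: mev_def ex_def if_distrib cong: if_cong)

lemma mev_0 [simp]: "mev N z 0 = 1"
  by (simp add: mev_def)

lemma Bs_mon: "b \<in> Bs N \<Longrightarrow> b \<in> mon N"
  by (simp add: Bs_def)

lemma zero_Bs [simp]: "0 \<in> Bs N"
  by (simp add: Bs_def)

lemma finite_Bs [simp]: "finite (Bs N)"
proof (rule finite_subset)
  show "Bs N \<subseteq> {f. \<forall>x. (x \<in> {..<N} \<longrightarrow> f x \<in> {..<5}) \<and> (x \<notin> {..<N} \<longrightarrow> f x = 0)}"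
    by (auto simp: Bs_def mon_def)
  show "finite {f. \<forall>x. (x \<in> {..<N} \<longrightarrow> f x \<in> {..<5}) \<and> (x \<notin> {..<N} \<longrightarrow> f x = (0::nat))}"
    by (rule finite_set_of_finite_funs) auto
qed

text \<open>The ring of polynomials in \<open>N\<close> variables modulo \<open>x\<^sub>i\<^sup>5 = r\<^sub>i\<close>, where the
  \<open>r\<^sub>i\<close> have degree below 5. The polynomial \<open>r\<^sub>i\<close> is given by its terms
  \<open>rc i t\<close>, \<open>rd i t\<close> (coefficient, exponent vector) for \<open>t \<in> T\<close>, and \<open>nf g\<close> is the
  coordinate vector of the monomial with exponents \<open>g\<close>.\<close>

locale quot =
  fixes N :: nat and T :: "'t set" and rd :: "nat \<Rightarrow> 't \<Rightarrow> nat \<Rightarrow> nat" and rc :: "nat \<Rightarrow> 't \<Rightarrow> 'a::comm_ring_1"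
  assumes finT: "finite T"
    and rd_mon: "\<And>i t. i < N \<Longrightarrow> t \<in> T \<Longrightarrow> rd i t \<in> mon N"
    and rd_deg: "\<And>i t. i < N \<Longrightarrow> t \<in> T \<Longrightarrow> mdeg N (rd i t) < 5"
begin

definition lv :: "(nat \<Rightarrow> nat) \<Rightarrow> nat" where "lv g = (LEAST i. i < N \<and> 5 \<le> g i)"

lemma lv: "\<exists>i<N. 5 \<le> g i \<Longrightarrow> lv g < N \<and> 5 \<le> g (lv g)"
  unfolding lv_def by (rule LeastI_ex)

lemma reduce_deg: "i < N \<Longrightarrow> 5 \<le> g i \<Longrightarrow> t \<in> T \<Longrightarrow> mdeg N (g - ex i 5 + rd i t) < mdeg N g"
  using mdeg_diff_ex[of i N 5 g] rd_deg[of i t] by (simp add: mdeg_add)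

function nf :: "(nat \<Rightarrow> nat) \<Rightarrow> (nat \<Rightarrow> nat) \<Rightarrow> 'a" where
  "nf g b = (if \<exists>i<N. 5 \<le> g i
     then \<Sum>t\<in>T. rc (lv g) t * nf (g - ex (lv g) 5 + rd (lv g) t) b
     else if b = g then 1 else 0)"
  by auto
termination
  by (relation "measure (\<lambda>(g, b). mdeg N g)") (use lv reduce_deg in auto)

declare nf.simps [simp del]

lemma nf_basis: "b \<in> Bs N \<Longrightarrow> nf b b' = (if b' = b then 1 else 0)"
  by (subst nf.simps) (auto simp: Bs_def)

text \<open>The result of the reduction does not depend on the variable chosen, because the leading
  monomials \<open>x\<^sub>i\<^sup>5\<close> are pairwise coprime.\<close>

lemma nf_reduce:
  "i < N \<Longrightarrow> 5 \<le> g i \<Longrightarrow> nf g b = (\<Sum>t\<in>T. rc i t * nf (g - ex i 5 + rd i t) b)"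
proof (induction "mdeg N g" arbitrary: g i rule: less_induct)
  case less
  let ?j = "lv g"
  have j: "?j < N" "5 \<le> g ?j" using lv[of g] less.prems by auto
  have nfg: "nf g b = (\<Sum>t\<in>T. rc ?j t * nf (g - ex ?j 5 + rd ?j t) b)"
    using less.prems by (subst nf.simps) auto
  show ?case
  proof (cases "i = ?j")
    case True then show ?thesis using nfg by simp
  next
    case False
    \<comment> \<open>The chosen variable and \<open>i\<close> are both reduced, one after the
      other. The induction hypothesis applies in either order, as all terms have smaller degree, and
      the two double sums agree term by term.\<close>
    have "nf g b = (\<Sum>t\<in>T. \<Sum>u\<in>T. rc ?j t * (rc i u * nf (g - ex ?j 5 + rd ?j t - ex i 5 + rd i u) b))"
      unfolding nfg
    proof (rule sum.cong[OF refl])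
      fix t assume t: "t \<in> T"
      have "nf (g - ex ?j 5 + rd ?j t) b = (\<Sum>u\<in>T. rc i u * nf (g - ex ?j 5 + rd ?j t - ex i 5 + rd i u) b)"
        by (rule less.hyps) (use reduce_deg[where g = g, OF j t] less.prems False in \<open>auto simp: ex_def\<close>)
      then show "rc ?j t * nf (g - ex ?j 5 + rd ?j t) b
        = (\<Sum>u\<in>T. rc ?j t * (rc i u * nf (g - ex ?j 5 + rd ?j t - ex i 5 + rd i u) b))"
        by (simp add: sum_distrib_left)
    qed
    also have "\<dots> = (\<Sum>u\<in>T. \<Sum>t\<in>T. rc i u * (rc ?j t * nf (g - ex i 5 + rd i u - ex ?j 5 + rd ?j t) b))"
    proof (subst sum.swap, intro sum.cong refl)
      fix t u
      have "g - ex ?j 5 + rd ?j t - ex i 5 + rd i u = g - ex i 5 + rd i u - ex ?j 5 + rd ?j t"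
        using False less.prems j by (auto simp: ex_def fun_eq_iff)
      then show "rc ?j t * (rc i u * nf (g - ex ?j 5 + rd ?j t - ex i 5 + rd i u) b)
        = rc i u * (rc ?j t * nf (g - ex i 5 + rd i u - ex ?j 5 + rd ?j t) b)"
        by (simp add: mult.left_commute)
    qed
    also have "\<dots> = (\<Sum>u\<in>T. rc i u * nf (g - ex i 5 + rd i u) b)"
    proof (rule sum.cong[OF refl])
      fix u assume u: "u \<in> T"
      have "nf (g - ex i 5 + rd i u) b = (\<Sum>t\<in>T. rc ?j t * nf (g - ex i 5 + rd i u - ex ?j 5 + rd ?j t) b)"
        by (rule less.hyps) (use reduce_deg[where g = g, OF less.prems u] j False in \<open>auto simp: ex_def\<close>)
      then show "(\<Sum>t\<in>T. rc i u * (rc ?j t * nf (g - ex i 5 + rd i u - ex ?j 5 + rd ?j t) b))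
        = rc i u * nf (g - ex i 5 + rd i u) b"
        by (simp add: sum_distrib_left)
    qed
    finally show ?thesis .
  qed
qed

lemma mon_cases:
  assumes "g \<in> mon N"
  obtains "g \<in> Bs N" | i where "i < N" "5 \<le> g i"
  using assms by (auto simp: Bs_def not_le[symmetric])

text \<open>Since the variable to be reduced is free to choose, all reductions of
  \<open>g + h\<close> can be carried out inside \<open>g\<close> until \<open>g\<close> is a basis
  monomial. This is multiplication in the quotient algebra, in coordinates.\<close>

lemma nf_add:
  "g \<in> mon N \<Longrightarrow> h \<in> mon N \<Longrightarrow> nf (g + h) b = (\<Sum>a\<in>Bs N. nf g a * nf (a + h) b)"
proof (induction "mdeg N g" arbitrary: g rule: less_induct)
  case less
  from less.prems(1) show ?case
  proof (cases rule: mon_cases)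
    case 1
    have "(\<Sum>a\<in>Bs N. nf g a * nf (a + h) b) = (\<Sum>a\<in>Bs N. if a = g then nf (g + h) b else 0)"
      by (rule sum.cong) (auto simp: nf_basis 1)
    then show ?thesis using 1 by simp
  next
    case (2 i)
    have "nf (g + h) b = (\<Sum>t\<in>T. rc i t * nf (g + h - ex i 5 + rd i t) b)"
      using 2 by (intro nf_reduce) auto
    also have "\<dots> = (\<Sum>t\<in>T. rc i t * nf ((g - ex i 5 + rd i t) + h) b)"
    proof (intro sum.cong refl)
      fix t
      have "g + h - ex i 5 + rd i t = (g - ex i 5 + rd i t) + h"
        using 2 by (auto simp: ex_def fun_eq_iff)
      then show "rc i t * nf (g + h - ex i 5 + rd i t) b = rc i t * nf ((g - ex i 5 + rd i t) + h) b" by simp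
    qed
    also have "\<dots> = (\<Sum>t\<in>T. rc i t * (\<Sum>a\<in>Bs N. nf (g - ex i 5 + rd i t) a * nf (a + h) b))"
      by (intro sum.cong refl arg_cong2[where f = "(*)"] less.hyps)
        (use 2 reduce_deg less.prems rd_mon in auto)
    also have "\<dots> = (\<Sum>a\<in>Bs N. \<Sum>t\<in>T. rc i t * (nf (g - ex i 5 + rd i t) a * nf (a + h) b))"
      unfolding sum_distrib_left by (rule sum.swap)
    also have "\<dots> = (\<Sum>a\<in>Bs N. nf g a * nf (a + h) b)"
      by (simp add: nf_reduce[where g = g and i = i, OF 2] sum_distrib_right mult.assoc)
    finally show ?thesis .
  qed
qed

definition M :: "(nat \<Rightarrow> nat) \<Rightarrow> (nat \<Rightarrow> nat) \<Rightarrow> (nat \<Rightarrow> nat) \<Rightarrow> 'a" where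
  "M g b' b = nf (b + g) b'"

text \<open>The trace of \<open>M g\<close>, the matrix of multiplication by the monomial
  \<open>g\<close>.\<close>

definition tau :: "(nat \<Rightarrow> nat) \<Rightarrow> 'a" where
  "tau g = (\<Sum>b\<in>Bs N. nf (b + g) b)"

lemma M_mult:
  assumes "g \<in> mon N" "h \<in> mon N" "b \<in> Bs N"
  shows "(\<Sum>a\<in>Bs N. M g b' a * M h a b) = M (g + h) b' b"
proof -
  have "M (g + h) b' b = nf ((b + h) + g) b'" by (simp add: M_def ac_simps)
  also have "\<dots> = (\<Sum>a\<in>Bs N. nf (b + h) a * nf (a + g) b')"
    by (rule nf_add) (use assms Bs_mon in auto)
  finally show ?thesis by (simp add: M_def mult.commute)
qed

end

text \<open>Reduction uses only additions and multiplications of coefficients. The lemma is applied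
  to evaluation of coefficients that are polynomials in \<kappa>, and to complex
  conjugation.\<close>

lemma nf_hom:
  assumes "quot N T rd"
    and f: "\<And>x y. f (x + y) = f x + f y" "\<And>x y. f (x * y) = f x * f y" "f 1 = 1" "f 0 = 0"
  shows "f (quot.nf N T rd rc g b) = quot.nf N T rd (\<lambda>i t. f (rc i t)) g b"
proof -
  interpret A: quot N T rd rc by (rule assms)
  interpret B: quot N T rd "\<lambda>i t. f (rc i t)" by (rule assms)
  have fs: "f (sum h X) = (\<Sum>x\<in>X. f (h x))" for h X
    by (induction X rule: infinite_finite_induct) (auto simp: f)
  show ?thesis
  proof (induction "mdeg N g" arbitrary: g rule: less_induct)
    case less
    show ?case
    proof (cases "\<exists>i<N. 5 \<le> g i")
      case True
      then have l: "A.lv g < N" "5 \<le> g (A.lv g)" using A.lv by auto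
      have "f (A.nf g b) = (\<Sum>t\<in>T. f (rc (A.lv g) t) * f (A.nf (g - ex (A.lv g) 5 + rd (A.lv g) t) b))"
        using True by (subst A.nf.simps) (simp add: fs f)
      also have "\<dots> = (\<Sum>t\<in>T. f (rc (A.lv g) t) * B.nf (g - ex (A.lv g) 5 + rd (A.lv g) t) b)"
        by (intro sum.cong refl arg_cong2[where f = "(*)"] less) (rule A.reduce_deg[where g = g, OF l])
      also have "\<dots> = B.nf g b" by (rule B.nf_reduce[where g = g, OF l, symmetric])
      finally show ?thesis .
    next
      case False
      then show ?thesis by (subst A.nf.simps, subst B.nf.simps) (auto simp: f)
    qed
  qed
qed

section \<open>Solutions as joint eigenvalues of the multiplication matrices; the trace
  formula\<close>

locale cquot = quot N T rd rc for N :: nat and T :: "'t set" and rd and rc :: "nat \<Rightarrow> 't \<Rightarrow> complex"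
begin

text \<open>Coordinates from \<open>N\<close> on are fixed to 0, without which the set could not be
  finite.\<close>

definition Sol :: "(nat \<Rightarrow> complex) set" where
  "Sol = {z. (\<forall>i\<ge>N. z i = 0) \<and> (\<forall>i<N. z i ^ 5 = (\<Sum>t\<in>T. rc i t * mev N z (rd i t)))}"

text \<open>Each reduction preserves values at solutions. Consequently the values of the basis
  monomials at a solution form a left eigenvector of every \<open>M g\<close>.\<close>

lemma mev_nf:
  assumes z: "z \<in> Sol"
  shows "g \<in> mon N \<Longrightarrow> (\<Sum>b\<in>Bs N. mev N z b * nf g b) = mev N z g"
proof (induction "mdeg N g" arbitrary: g rule: less_induct)
  case less
  from less.prems show ?case
  proof (cases rule: mon_cases)
    case 1
    have "(\<Sum>b\<in>Bs N. mev N z b * nf g b) = (\<Sum>b\<in>Bs N. if b = g then mev N z g else 0)"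
      by (rule sum.cong) (auto simp: nf_basis 1)
    then show ?thesis using 1 by simp
  next
    case (2 i)
    have "(\<Sum>b\<in>Bs N. mev N z b * nf g b)
      = (\<Sum>b\<in>Bs N. \<Sum>t\<in>T. rc i t * (mev N z b * nf (g - ex i 5 + rd i t) b))"
      by (simp add: nf_reduce[where g = g and i = i, OF 2] sum_distrib_left mult.left_commute)
    also have "\<dots> = (\<Sum>t\<in>T. rc i t * (\<Sum>b\<in>Bs N. mev N z b * nf (g - ex i 5 + rd i t) b))"
      unfolding sum_distrib_left by (rule sum.swap)
    also have "\<dots> = (\<Sum>t\<in>T. rc i t * mev N z (g - ex i 5 + rd i t))"
      by (intro sum.cong refl arg_cong2[where f = "(*)"] less.hyps)
        (use 2 reduce_deg less.prems rd_mon in auto)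
    also have "\<dots> = mev N z (g - ex i 5) * (\<Sum>t\<in>T. rc i t * mev N z (rd i t))"
      by (simp add: mev_add sum_distrib_left mult_ac)
    also have "(\<Sum>t\<in>T. rc i t * mev N z (rd i t)) = mev N z (ex i 5)"
      using z 2 by (simp add: Sol_def)
    also have "mev N z (g - ex i 5) * mev N z (ex i 5) = mev N z g"
      by (simp only: mev_add[symmetric] diff_ex_add[where g = g, OF 2(2)])
    finally show ?thesis .
  qed
qed

text \<open>A matrix paired with the polynomial function by which it multiplies. Working with pairs
  lets facts about operators and facts about evaluation be proved by one induction over how the
  polynomial is built.\<close>

inductive pr :: "((nat \<Rightarrow> nat) \<Rightarrow> (nat \<Rightarrow> nat) \<Rightarrow> complex) \<Rightarrow> ((nat \<Rightarrow> complex) \<Rightarrow> complex) \<Rightarrow> bool" where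
  pr_mon: "g \<in> mon N \<Longrightarrow> pr (M g) (\<lambda>z. mev N z g)"
| pr_scale: "pr A f \<Longrightarrow> pr (\<lambda>b' b. c * A b' b) (\<lambda>z. c * f z)"
| pr_add: "pr A f \<Longrightarrow> pr A' f' \<Longrightarrow> pr (\<lambda>b' b. A b' b + A' b' b) (\<lambda>z. f z + f' z)"
| pr_mult: "pr A f \<Longrightarrow> pr A' f' \<Longrightarrow> pr (\<lambda>b' b. \<Sum>a\<in>Bs N. A b' a * A' a b) (\<lambda>z. f z * f' z)"

lemma pr_zero: "pr (\<lambda>_ _. 0) (\<lambda>_. 0)"
  using pr_scale[OF pr_mon[OF mon_0], of 0] by simp

lemma pr_sum: "(\<And>x. x \<in> X \<Longrightarrow> pr (A x) (f x)) \<Longrightarrow> pr (\<lambda>b' b. \<Sum>x\<in>X. A x b' b) (\<lambda>z. \<Sum>x\<in>X. f x z)"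
  by (induction X rule: infinite_finite_induct) (auto intro: pr_zero pr_add)

lemma pr_left:
  assumes "pr A f" "z \<in> Sol" "b \<in> Bs N"
  shows "(\<Sum>b'\<in>Bs N. mev N z b' * A b' b) = f z * mev N z b"
  using assms
proof (induction arbitrary: b rule: pr.induct)
  case (pr_mon g)
  then show ?case using mev_nf[OF pr_mon(2), of "b + g"] Bs_mon[of b N]
    by (simp add: M_def mev_add mult.commute)
next
  case (pr_scale A f c)
  then show ?case by (simp add: mult.left_commute[of _ c] sum_distrib_left[symmetric] mult.assoc)
next
  case (pr_add A f A' f')
  then show ?case by (simp add: distrib_left distrib_right sum.distrib)
next
  case (pr_mult A f A' f')
  have "(\<Sum>b'\<in>Bs N. mev N z b' * (\<Sum>a\<in>Bs N. A b' a * A' a b))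
    = (\<Sum>a\<in>Bs N. (\<Sum>b'\<in>Bs N. mev N z b' * A b' a) * A' a b)"
    unfolding sum_distrib_left sum_distrib_right by (subst sum.swap) (simp add: mult.assoc)
  also have "\<dots> = (\<Sum>a\<in>Bs N. f z * (mev N z a * A' a b))"
    by (intro sum.cong refl) (simp add: pr_mult)
  also have "\<dots> = f z * (f' z * mev N z b)"
    unfolding sum_distrib_left[symmetric] using pr_mult by simp
  finally show ?case by (simp add: mult.assoc)
qed

lemma pr_commute:
  assumes "pr A f" "g \<in> mon N" "b' \<in> Bs N" "b \<in> Bs N"
  shows "(\<Sum>a\<in>Bs N. A b' a * M g a b) = (\<Sum>a\<in>Bs N. M g b' a * A a b)"
  using assms
proof (induction arbitrary: b' b rule: pr.induct)
  case (pr_mon h)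
  then show ?case by (simp add: M_mult add.commute)
next
  case (pr_scale A f c)
  then show ?case by (simp add: mult.left_commute[of _ c] sum_distrib_left[symmetric] mult.assoc)
next
  case (pr_add A f A' f')
  then show ?case by (simp add: distrib_left distrib_right sum.distrib)
next
  case (pr_mult A f A' f')
  have "(\<Sum>a\<in>Bs N. (\<Sum>c\<in>Bs N. A b' c * A' c a) * M g a b)
     = (\<Sum>c\<in>Bs N. A b' c * (\<Sum>a\<in>Bs N. A' c a * M g a b))"
    unfolding sum_distrib_left sum_distrib_right by (subst sum.swap) (simp add: mult.assoc)
  also have "\<dots> = (\<Sum>c\<in>Bs N. A b' c * (\<Sum>a\<in>Bs N. M g c a * A' a b))"
    by (intro sum.cong refl) (simp add: pr_mult)
  also have "\<dots> = (\<Sum>a\<in>Bs N. (\<Sum>c\<in>Bs N. A b' c * M g c a) * A' a b)"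
    unfolding sum_distrib_left sum_distrib_right by (subst sum.swap) (simp add: mult.assoc)
  also have "\<dots> = (\<Sum>a\<in>Bs N. (\<Sum>c\<in>Bs N. M g b' c * A c a) * A' a b)"
    by (intro sum.cong refl) (simp add: pr_mult)
  also have "\<dots> = (\<Sum>c\<in>Bs N. M g b' c * (\<Sum>a\<in>Bs N. A c a * A' a b))"
    unfolding sum_distrib_left sum_distrib_right by (subst sum.swap) (simp add: mult.assoc)
  finally show ?case .
qed

lemma M_eigenvector:
  assumes v: "\<And>i b. i < N \<Longrightarrow> b \<in> Bs N \<Longrightarrow> (\<Sum>a\<in>Bs N. M (ex i 1) b a * v a) = z i * v b"
  shows "g \<in> mon N \<Longrightarrow> b \<in> Bs N \<Longrightarrow> (\<Sum>a\<in>Bs N. M g b a * v a) = mev N z g * v b"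
proof (induction "mdeg N g" arbitrary: g b)
  case 0
  then have "g x = 0" for x by (cases "x < N") (auto simp: mdeg_def mon_def)
  then have "g = 0" by auto
  have "(\<Sum>a\<in>Bs N. M g b a * v a) = (\<Sum>a\<in>Bs N. if a = b then v b else 0)"
    by (rule sum.cong) (auto simp: \<open>g = 0\<close> M_def nf_basis)
  also have "\<dots> = v b" using 0 by simp
  finally show ?case by (simp only: \<open>g = 0\<close> mev_0 mult_1)
next
  case (Suc n)
  have "\<not> (\<forall>i<N. g i = 0)"
  proof
    assume "\<forall>i<N. g i = 0"
    then have "mdeg N g = 0" by (simp add: mdeg_def)
    with Suc.hyps(2) show False by simp
  qed
  then obtain i where i: "i < N" "1 \<le> g i" by auto
  define h where "h = g - ex i 1"
  have h: "g = h + ex i 1" "h \<in> mon N" using i Suc.prems by (auto simp: h_def diff_ex_add)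
  have "mdeg N h = n" using Suc.hyps(2) mdeg_diff_ex[where g = g, OF i] by (simp add: h_def)
  note IH = Suc.hyps(1)[OF this[symmetric] h(2)]
  have "(\<Sum>a\<in>Bs N. M g b a * v a) = (\<Sum>a\<in>Bs N. (\<Sum>c\<in>Bs N. M h b c * M (ex i 1) c a) * v a)"
    unfolding h(1) by (intro sum.cong refl) (simp add: M_mult h i)
  also have "\<dots> = (\<Sum>c\<in>Bs N. M h b c * (\<Sum>a\<in>Bs N. M (ex i 1) c a * v a))"
    unfolding sum_distrib_left sum_distrib_right by (subst sum.swap) (simp add: mult.assoc)
  also have "\<dots> = (\<Sum>c\<in>Bs N. z i * (M h b c * v c))"
    by (intro sum.cong refl) (use v i in auto)
  also have "\<dots> = z i * (mev N z h * v b)"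
    unfolding sum_distrib_left[symmetric] using IH Suc.prems by simp
  finally show ?case unfolding h(1) using i by (simp add: mev_add mult_ac)
qed

lemma pr_right:
  assumes "pr A f"
    and v: "\<And>i b. i < N \<Longrightarrow> b \<in> Bs N \<Longrightarrow> (\<Sum>a\<in>Bs N. M (ex i 1) b a * v a) = z i * v b"
    and "b \<in> Bs N"
  shows "(\<Sum>a\<in>Bs N. A b a * v a) = f z * v b"
  using assms(1,3)
proof (induction arbitrary: b rule: pr.induct)
  case (pr_mon g)
  then show ?case using M_eigenvector[OF v] by blast
next
  case (pr_scale A f c)
  then show ?case by (simp add: mult.left_commute[of _ c] sum_distrib_left[symmetric] mult.assoc)
next
  case (pr_add A f A' f')
  then show ?case by (simp add: distrib_left distrib_right sum.distrib)
next
  case (pr_mult A f A' f')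
  have "(\<Sum>a\<in>Bs N. (\<Sum>c\<in>Bs N. A b c * A' c a) * v a)
     = (\<Sum>c\<in>Bs N. A b c * (\<Sum>a\<in>Bs N. A' c a * v a))"
    unfolding sum_distrib_left sum_distrib_right by (subst sum.swap) (simp add: mult.assoc)
  also have "\<dots> = (\<Sum>c\<in>Bs N. f' z * (A b c * v c))"
    by (intro sum.cong refl) (simp add: pr_mult)
  also have "\<dots> = f' z * (f z * v b)"
    unfolding sum_distrib_left[symmetric] using pr_mult by simp
  finally show ?case by (simp add: mult_ac)
qed

text \<open>The matrix of x_i^5 equals that of the right-hand side of equation i; applied to a joint
  eigenvector, this matrix identity becomes the equation for the tuple of eigenvalues.\<close>

lemma joint_eigenvector_Sol:
  assumes v: "\<And>i b. i < N \<Longrightarrow> b \<in> Bs N \<Longrightarrow> (\<Sum>a\<in>Bs N. M (ex i 1) b a * v a) = z i * v b"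
    and v0: "\<exists>b\<in>Bs N. v b \<noteq> 0" and z: "\<And>i. i \<ge> N \<Longrightarrow> z i = 0"
  shows "z \<in> Sol"
proof -
  have "z i ^ 5 = (\<Sum>t\<in>T. rc i t * mev N z (rd i t))" if i: "i < N" for i
  proof -
    from v0 obtain b where b: "b \<in> Bs N" "v b \<noteq> 0" by blast
    have "z i ^ 5 * v b = (\<Sum>a\<in>Bs N. M (ex i 5) b a * v a)"
      using M_eigenvector[OF v mon_ex[OF i] b(1), of 5] i by simp
    also have "\<dots> = (\<Sum>a\<in>Bs N. (\<Sum>t\<in>T. rc i t * M (rd i t) b a) * v a)"
    proof (intro sum.cong refl arg_cong2[where f = "(*)"])
      fix a
      have "M (ex i 5) b a = (\<Sum>t\<in>T. rc i t * nf (a + ex i 5 - ex i 5 + rd i t) b)"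
        unfolding M_def by (rule nf_reduce[OF i]) (simp add: ex_def)
      moreover have "a + ex i 5 - ex i 5 = a" by (auto simp: fun_eq_iff)
      ultimately show "M (ex i 5) b a = (\<Sum>t\<in>T. rc i t * M (rd i t) b a)" by (simp only: M_def)
    qed
    also have "\<dots> = (\<Sum>t\<in>T. rc i t * (\<Sum>a\<in>Bs N. M (rd i t) b a * v a))"
      unfolding sum_distrib_left sum_distrib_right by (subst sum.swap) (simp add: mult.assoc)
    also have "\<dots> = (\<Sum>t\<in>T. rc i t * mev N z (rd i t)) * v b"
      unfolding sum_distrib_right
      by (intro sum.cong refl) (simp add: M_eigenvector[OF v rd_mon[OF i] b(1)] mult.assoc)
    finally show ?thesis using b(2) by simp
  qed
  with z show ?thesis by (simp add: Sol_def)
qed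

text \<open>A converse to \<open>pr_left\<close>. Starting in the eigenspace of \<open>A\<close>,
  the multiplications by the variables are taken in turn; each commutes with everything before it,
  so the joint eigenspace reached so far is invariant and contains an eigenvector of the next one.
  The final tuple of eigenvalues is a solution.\<close>

lemma pr_eigenvalue:
  assumes A: "pr A f" and v0: "\<exists>b\<in>Bs N. v0 b \<noteq> 0"
    and e: "\<And>b. b \<in> Bs N \<Longrightarrow> (\<Sum>a\<in>Bs N. A b a * v0 a) = e * v0 b"
  shows "\<exists>z\<in>Sol. e = f z"
proof -
  have "k \<le> N \<Longrightarrow> \<exists>v z. (\<exists>b\<in>Bs N. v b \<noteq> 0) \<and> (\<forall>b\<in>Bs N. (\<Sum>a\<in>Bs N. A b a * v a) = e * v b)
     \<and> (\<forall>i<k. \<forall>b\<in>Bs N. (\<Sum>a\<in>Bs N. M (ex i 1) b a * v a) = z i * v b)" for k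
  proof (induction k)
    case 0 then show ?case using v0 e by auto
  next
    case (Suc k)
    then obtain v z where v: "\<exists>b\<in>Bs N. v b \<noteq> 0" "\<forall>b\<in>Bs N. (\<Sum>a\<in>Bs N. A b a * v a) = e * v b"
      "\<forall>i<k. \<forall>b\<in>Bs N. (\<Sum>a\<in>Bs N. M (ex i 1) b a * v a) = z i * v b" by auto
    define W where "W v \<longleftrightarrow> (\<forall>b\<in>Bs N. (\<Sum>a\<in>Bs N. A b a * v a) = e * v b)
       \<and> (\<forall>i<k. \<forall>b\<in>Bs N. (\<Sum>a\<in>Bs N. M (ex i 1) b a * v a) = z i * v b)" for v
    have app: "(\<Sum>a\<in>Bs N. C b a * (\<Sum>c\<in>Bs N. M (ex k 1) a c * x c)) = s * (\<Sum>c\<in>Bs N. M (ex k 1) b c * x c)"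
      if C: "pr C h" and x: "\<forall>b\<in>Bs N. (\<Sum>a\<in>Bs N. C b a * x a) = s * x b" and b: "b \<in> Bs N" for C h x s b
    proof -
      have "(\<Sum>a\<in>Bs N. C b a * (\<Sum>c\<in>Bs N. M (ex k 1) a c * x c)) = (\<Sum>c\<in>Bs N. (\<Sum>a\<in>Bs N. C b a * M (ex k 1) a c) * x c)"
        unfolding sum_distrib_left sum_distrib_right by (subst sum.swap) (simp add: mult.assoc)
      also have "\<dots> = (\<Sum>c\<in>Bs N. (\<Sum>a\<in>Bs N. M (ex k 1) b a * C a c) * x c)"
        by (intro sum.cong refl arg_cong2[where f = "(*)"] pr_commute[OF C]) (use b Suc.prems in auto)
      also have "\<dots> = (\<Sum>a\<in>Bs N. M (ex k 1) b a * (\<Sum>c\<in>Bs N. C a c * x c))"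
        unfolding sum_distrib_left sum_distrib_right by (subst sum.swap) (simp add: mult.assoc)
      also have "\<dots> = (\<Sum>a\<in>Bs N. s * (M (ex k 1) b a * x a))"
        by (intro sum.cong refl) (simp add: x)
      finally show ?thesis by (simp add: sum_distrib_left)
    qed
    have "\<exists>u s. W u \<and> (\<exists>b\<in>Bs N. u b \<noteq> 0) \<and> (\<forall>b\<in>Bs N. (\<Sum>a\<in>Bs N. M (ex k 1) b a * u a) = s * u b)"
    proof (rule invariant_eigenvector[where W = W and v = v])
      show "W v" "\<exists>b\<in>Bs N. v b \<noteq> 0" using v by (auto simp: W_def)
    next
      fix x y assume "W x" "W y"
      then show "W (\<lambda>s. x s + y s)" by (simp add: W_def distrib_left sum.distrib)
    next
      fix c x assume "W x"
      then show "W (\<lambda>s. c * x s)"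
        by (simp add: W_def sum_distrib_left[symmetric] mult.left_commute[of _ c])
    next
      fix x assume x: "W x"
      show "W (\<lambda>s. \<Sum>t\<in>Bs N. M (ex k 1) s t * x t)"
        unfolding W_def
      proof (intro conjI ballI allI impI)
        fix b assume "b \<in> Bs N"
        then show "(\<Sum>a\<in>Bs N. A b a * (\<Sum>t\<in>Bs N. M (ex k 1) a t * x t)) = e * (\<Sum>t\<in>Bs N. M (ex k 1) b t * x t)"
          using app[OF A, of x e] x by (simp add: W_def)
      next
        fix i b assume i: "i < k" and "b \<in> Bs N"
        moreover have "pr (M (ex i 1)) (\<lambda>z. mev N z (ex i 1))" using i Suc.prems by (intro pr_mon) auto
        ultimately show "(\<Sum>a\<in>Bs N. M (ex i 1) b a * (\<Sum>t\<in>Bs N. M (ex k 1) a t * x t)) = z i * (\<Sum>t\<in>Bs N. M (ex k 1) b t * x t)"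
          using app[of "M (ex i 1)" _ x "z i" b] x by (simp add: W_def)
      qed
    qed simp
    then obtain u s where u: "W u" "\<exists>b\<in>Bs N. u b \<noteq> 0" "\<forall>b\<in>Bs N. (\<Sum>a\<in>Bs N. M (ex k 1) b a * u a) = s * u b"
      by blast
    show ?case
      by (intro exI[of _ u] exI[of _ "z(k := s)"]) (use u in \<open>auto simp: W_def less_Suc_eq\<close>)
  qed
  from this[of N] obtain v z where v: "\<exists>b\<in>Bs N. v b \<noteq> 0" "\<forall>b\<in>Bs N. (\<Sum>a\<in>Bs N. A b a * v a) = e * v b"
     "\<forall>i<N. \<forall>b\<in>Bs N. (\<Sum>a\<in>Bs N. M (ex i 1) b a * v a) = z i * v b" by auto
  define z' where "z' i = (if i < N then z i else 0)" for i
  have v': "\<And>i b. i < N \<Longrightarrow> b \<in> Bs N \<Longrightarrow> (\<Sum>a\<in>Bs N. M (ex i 1) b a * v a) = z' i * v b"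
    using v(3) by (simp add: z'_def)
  have "z' \<in> Sol" by (rule joint_eigenvector_Sol[OF v' v(1)]) (auto simp: z'_def)
  moreover from v(1) obtain b where b: "b \<in> Bs N" "v b \<noteq> 0" by blast
  have "e * v b = f z' * v b" using pr_right[OF A v' b(1)] v(2) b by simp
  then have "e = f z'" using b by simp
  ultimately show ?thesis by blast
qed

text \<open>Each coordinate of a solution is a left eigenvalue of multiplication by that variable,
  and a matrix has finitely many eigenvalues.\<close>

lemma finite_Sol: "finite Sol"
proof -
  have "\<exists>F. finite F \<and> (\<forall>z\<in>Sol. z i \<in> F)" if i: "i < N" for i
  proof -
    obtain es where es: "\<forall>e v. (\<exists>s\<in>Bs N. v s \<noteq> 0) \<longrightarrow> (\<forall>t\<in>Bs N. (\<Sum>s\<in>Bs N. v s * M (ex i 1) s t) = e * v t) \<longrightarrow> e \<in> set es"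
      using trace_eigenvalues[OF finite_Bs[of N], of "M (ex i 1)"] by blast
    have "z i \<in> set es" if z: "z \<in> Sol" for z
    proof (rule es[rule_format, of "mev N z"])
      show "\<exists>s\<in>Bs N. mev N z s \<noteq> 0" by (rule bexI[of _ 0]) auto
      show "\<And>t. t \<in> Bs N \<Longrightarrow> (\<Sum>s\<in>Bs N. mev N z s * M (ex i 1) s t) = z i * mev N z t"
        using pr_left[OF pr_mon[OF mon_ex[OF i, of 1]] z] i by simp
    qed
    then show ?thesis by (intro exI[of _ "set es"]) auto
  qed
  then obtain F where F: "\<And>i. i < N \<Longrightarrow> finite (F i)" "\<And>i z. i < N \<Longrightarrow> z \<in> Sol \<Longrightarrow> z i \<in> F i" by metis
  show ?thesis
  proof (rule finite_subset)
    show "Sol \<subseteq> {f. \<forall>x. (x \<in> {..<N} \<longrightarrow> f x \<in> (\<Union>i<N. F i)) \<and> (x \<notin> {..<N} \<longrightarrow> f x = 0)}"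
      using F by (auto simp: Sol_def) 
    show "finite {f. \<forall>x. (x \<in> {..<N} \<longrightarrow> f x \<in> (\<Union>i<N. F i)) \<and> (x \<notin> {..<N} \<longrightarrow> f x = (0::complex))}"
      by (rule finite_set_of_finite_funs) (use F in auto)
  qed
qed

text \<open>A product of normalized linear factors, one for each other solution, taken in a
  coordinate where that solution differs from \<open>w\<close>.\<close>

lemma interpolation:
  assumes w: "w \<in> Sol"
  shows "\<exists>A f. pr A f \<and> f w = 1 \<and> (\<forall>z\<in>Sol - {w}. f z = 0)"
proof -
  have "finite F \<Longrightarrow> F \<subseteq> Sol - {w} \<Longrightarrow> \<exists>A f. pr A f \<and> f w = 1 \<and> (\<forall>z\<in>F. f z = 0)" for F
  proof (induction F rule: finite_induct)
    case empty
    show ?case using pr_mon[OF mon_0] by (intro exI[of _ "M 0"] exI[of _ "\<lambda>z. mev N z 0"]) auto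
  next
    case (insert z F)
    then obtain A f where A: "pr A f" "f w = 1" "\<forall>z\<in>F. f z = 0" by auto
    from insert.prems have "z \<noteq> w" "z \<in> Sol" by auto
    then obtain i where i: "i < N" "z i \<noteq> w i" using w by (auto simp: Sol_def fun_eq_iff) (metis not_less)
    define c where "c = 1 / (w i - z i)"
    have g: "pr (\<lambda>b' b. c * (M (ex i 1) b' b + (- z i) * M 0 b' b)) (\<lambda>x. c * (mev N x (ex i 1) + (- z i) * mev N x 0))"
      by (intro pr.intros) (use i in auto)
    have "c * (w i - z i) = 1" using i by (simp add: c_def)
    moreover obtain B where "pr B (\<lambda>x. f x * (c * (mev N x (ex i 1) + (- z i) * mev N x 0)))"
      using pr_mult[OF A(1) g] by blast
    ultimately show ?case using A i
      by (intro exI[of _ B] exI[of _ "\<lambda>x. f x * (c * (mev N x (ex i 1) + (- z i) * mev N x 0))"]) auto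
  qed
  from this[of "Sol - {w}"] finite_Sol show ?thesis by auto
qed

text \<open>All eigenvalues of the matrix of \<open>f\<close> are values of \<open>f\<close> at
  solutions. So a function vanishing on \<open>Sol\<close> has trace 0, and the trace depends on
  values only. The interpolant at \<open>w\<close> has only the eigenvalues 0 and 1, and 1 occurs
  because of its left eigenvector; its trace is therefore a positive integer, taken as the
  multiplicity of \<open>w\<close>.\<close>

theorem trace_formula:
  "\<exists>m :: (nat \<Rightarrow> complex) \<Rightarrow> nat. (\<forall>z\<in>Sol. m z \<ge> 1) \<and>
    (\<forall>A f. pr A f \<longrightarrow> (\<Sum>b\<in>Bs N. A b b) = (\<Sum>z\<in>Sol. of_nat (m z) * f z))"
proof -
  have vanish: "(\<Sum>b\<in>Bs N. A b b) = 0" if "pr A f" "\<And>z. z \<in> Sol \<Longrightarrow> f z = 0" for A f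
  proof -
    obtain es where es: "(\<Sum>b\<in>Bs N. A b b) = sum_list es"
      "\<And>e. e \<in> set es \<Longrightarrow> \<exists>v. (\<exists>s\<in>Bs N. v s \<noteq> 0) \<and> (\<forall>s\<in>Bs N. (\<Sum>t\<in>Bs N. A s t * v t) = e * v s)"
      using trace_eigenvalues[OF finite_Bs[of N], of A] by blast
    have "e = 0" if "e \<in> set es" for e
    proof -
      from es(2)[OF that] obtain v where "\<exists>s\<in>Bs N. v s \<noteq> 0" "\<forall>s\<in>Bs N. (\<Sum>t\<in>Bs N. A s t * v t) = e * v s" by blast
      with pr_eigenvalue[OF \<open>pr A f\<close>] obtain z where "z \<in> Sol" "e = f z" by blast
      then show ?thesis using \<open>\<And>z. z \<in> Sol \<Longrightarrow> f z = 0\<close> by simp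
    qed
    then show ?thesis unfolding es(1) by (simp add: sum_list_neutral)
  qed
  obtain E h where E: "\<And>w. w \<in> Sol \<Longrightarrow> pr (E w) (h w)" "\<And>w. w \<in> Sol \<Longrightarrow> h w w = 1"
    "\<And>w z. w \<in> Sol \<Longrightarrow> z \<in> Sol \<Longrightarrow> z \<noteq> w \<Longrightarrow> h w z = 0"
    using interpolation by (metis DiffI singletonD)
  have "\<exists>k::nat. k \<ge> 1 \<and> (\<Sum>b\<in>Bs N. E w b b) = of_nat k" if w: "w \<in> Sol" for w
  proof -
    obtain es where es: "(\<Sum>b\<in>Bs N. E w b b) = sum_list es"
      "\<And>e. e \<in> set es \<Longrightarrow> \<exists>v. (\<exists>s\<in>Bs N. v s \<noteq> 0) \<and> (\<forall>s\<in>Bs N. (\<Sum>t\<in>Bs N. E w s t * v t) = e * v s)"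
      "\<And>e v. (\<exists>s\<in>Bs N. v s \<noteq> 0) \<Longrightarrow> (\<forall>t\<in>Bs N. (\<Sum>s\<in>Bs N. v s * E w s t) = e * v t) \<Longrightarrow> e \<in> set es"
      using trace_eigenvalues[OF finite_Bs[of N], of "E w"] by blast
    have "e = 0 \<or> e = 1" if "e \<in> set es" for e
    proof -
      from es(2)[OF that] obtain v where "\<exists>s\<in>Bs N. v s \<noteq> 0" "\<forall>s\<in>Bs N. (\<Sum>t\<in>Bs N. E w s t * v t) = e * v s" by blast
      with pr_eigenvalue[OF E(1)[OF w]] obtain z where "z \<in> Sol" "e = h w z" by blast
      then show ?thesis using E w by (cases "z = w") auto
    qed
    then have "sum_list es = of_nat (length (filter (\<lambda>e. e = 1) es))"
      by (induction es) auto
    moreover have "1 \<in> set es"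
      by (rule es(3)[of "mev N w"]) (use pr_left[OF E(1)[OF w] w] E(2)[OF w] in \<open>auto intro: bexI[of _ 0]\<close>)
    then have "filter (\<lambda>e. e = 1) es \<noteq> []" by (auto simp: filter_empty_conv)
    ultimately show ?thesis using es(1) by (intro exI[of _ "length (filter (\<lambda>e. e = 1) es)"]) (simp add: Suc_le_eq)
  qed
  then obtain m :: "(nat \<Rightarrow> complex) \<Rightarrow> nat" where m: "\<And>w. w \<in> Sol \<Longrightarrow> m w \<ge> 1"
    "\<And>w. w \<in> Sol \<Longrightarrow> (\<Sum>b\<in>Bs N. E w b b) = of_nat (m w)" by metis
  have "(\<Sum>b\<in>Bs N. A b b) = (\<Sum>z\<in>Sol. of_nat (m z) * f z)" if A: "pr A f" for A f
  proof -
    \<comment> \<open>Subtracting the combination of interpolants with the same values leaves a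
      function that vanishes on \<open>Sol\<close>.\<close>
    have "pr (\<lambda>b' b. A b' b + (\<Sum>w\<in>Sol. (- f w) * E w b' b)) (\<lambda>z. f z + (\<Sum>w\<in>Sol. (- f w) * h w z))"
      by (intro pr_add A pr_sum pr_scale E)
    moreover have "f z + (\<Sum>w\<in>Sol. (- f w) * h w z) = 0" if z: "z \<in> Sol" for z
    proof -
      have "(\<Sum>w\<in>Sol. (- f w) * h w z) = (\<Sum>w\<in>Sol. if w = z then - f z else 0)"
        by (rule sum.cong) (use E z in auto)
      then show ?thesis using finite_Sol z by simp
    qed
    ultimately have "(\<Sum>b\<in>Bs N. A b b + (\<Sum>w\<in>Sol. (- f w) * E w b b)) = 0" by (rule vanish)
    then have "(\<Sum>b\<in>Bs N. A b b) = (\<Sum>b\<in>Bs N. \<Sum>w\<in>Sol. f w * E w b b)"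
      by (simp add: sum.distrib sum_negf sum_subtractf)
    also have "\<dots> = (\<Sum>w\<in>Sol. f w * (\<Sum>b\<in>Bs N. E w b b))"
      unfolding sum_distrib_left by (rule sum.swap)
    finally show ?thesis by (simp add: m(2) mult.commute)
  qed
  with m(1) show ?thesis by blast
qed

text \<open>The column of a multiplication matrix at the basis monomial 1 holds the coordinates of
  the polynomial itself, so interpolants provide coordinate vectors with prescribed values.\<close>

lemma evaluation_onto: "\<exists>x. \<forall>z\<in>Sol. (\<Sum>b\<in>Bs N. mev N z b * x b) = y z"
proof -
  obtain E h where E: "\<And>w. w \<in> Sol \<Longrightarrow> pr (E w) (h w)" "\<And>w. w \<in> Sol \<Longrightarrow> h w w = 1"
    "\<And>w z. w \<in> Sol \<Longrightarrow> z \<in> Sol \<Longrightarrow> z \<noteq> w \<Longrightarrow> h w z = 0"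
    using interpolation by (metis DiffI singletonD)
  have "(\<Sum>b\<in>Bs N. mev N z b * (\<Sum>w\<in>Sol. y w * E w b 0)) = y z" if z: "z \<in> Sol" for z
  proof -
    have "(\<Sum>b\<in>Bs N. mev N z b * (\<Sum>w\<in>Sol. y w * E w b 0)) = (\<Sum>w\<in>Sol. y w * (\<Sum>b\<in>Bs N. mev N z b * E w b 0))"
      unfolding sum_distrib_left by (subst sum.swap) (simp add: mult.left_commute)
    also have "\<dots> = (\<Sum>w\<in>Sol. if w = z then y z else 0)"
      by (rule sum.cong) (use E z pr_left[OF E(1) z zero_Bs] in auto)
    finally show ?thesis using finite_Sol z by simp
  qed
  then show ?thesis by (intro exI[of _ "\<lambda>b. \<Sum>w\<in>Sol. y w * E w b 0"]) blast
qed

end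

section \<open>Counting real solutions by Hermite forms\<close>

definition conjS :: "(nat \<Rightarrow> complex) \<Rightarrow> nat \<Rightarrow> complex" where
  "conjS z = (\<lambda>i. cnj (z i))"

text \<open>Selects one point of each nonreal conjugate pair: the first coordinate off the real line
  lies in the upper half plane.\<close>

definition upper :: "(nat \<Rightarrow> complex) \<Rightarrow> bool" where
  "upper z \<longleftrightarrow> (\<exists>i. Im (z i) > 0 \<and> (\<forall>j<i. Im (z j) = 0))"

lemma conjS_conjS [simp]: "conjS (conjS z) = z"
  by (simp add: conjS_def)

lemma mev_conjS: "mev N (conjS z) g = cnj (mev N z g)"
  by (simp add: mev_def conjS_def)

lemma upper_cases: "conjS z = z \<or> upper z \<or> upper (conjS z)"
proof (cases "\<exists>i. Im (z i) \<noteq> 0")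
  case True
  define i where "i = (LEAST i. Im (z i) \<noteq> 0)"
  have "Im (z i) \<noteq> 0" unfolding i_def using True by (rule LeastI_ex)
  moreover have "\<forall>j<i. Im (z j) = 0" unfolding i_def using not_less_Least by blast
  ultimately have "upper z \<or> upper (conjS z)"
    unfolding upper_def by (cases "Im (z i) > 0") (auto simp: conjS_def intro!: exI[of _ i])
  then show ?thesis by blast
next
  case False
  then show ?thesis by (auto simp: conjS_def fun_eq_iff complex_eq_iff)
qed

lemma upper_not_both: "\<not> (upper z \<and> upper (conjS z))"
proof
  assume "upper z \<and> upper (conjS z)"
  then obtain i j where "Im (z i) > 0" "\<forall>k<i. Im (z k) = 0" "Im (z j) < 0" "\<forall>k<j. Im (z k) = 0"
    by (auto simp: upper_def conjS_def)
  then show False by (cases i j rule: linorder_cases) auto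
qed

lemma upper_not_real: "upper z \<Longrightarrow> conjS z \<noteq> z"
  using upper_not_both by metis

lemma sum_times_singleton: "(\<Sum>p\<in>A \<times> {k}. g p) = (\<Sum>z\<in>A. g (z, k))"
  by (rule sum.reindex_bij_witness[of _ "\<lambda>z. (z, k)" fst]) auto

text \<open>Used to write the two terms of a conjugate pair as one positive and one negative
  square.\<close>

lemma polarization:
  "a * cnj b + cnj a * b = of_real (((cmod (a + b))\<^sup>2 - (cmod (a - b))\<^sup>2) / 2)"
proof -
  have "complex_of_real ((cmod (a + b))\<^sup>2 - (cmod (a - b))\<^sup>2) = 2 * (a * cnj b + cnj a * b)"
    unfolding of_real_diff complex_norm_square by (simp add: algebra_simps)
  then show ?thesis by (simp only: of_real_divide) simp
qed

locale rquot = cquot +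
  assumes rc_real: "\<And>i t. cnj (rc i t) = rc i t"
begin

lemma conjS_Sol: "z \<in> Sol \<Longrightarrow> conjS z \<in> Sol"
proof -
  assume z: "z \<in> Sol"
  have "conjS z i ^ 5 = (\<Sum>t\<in>T. rc i t * mev N (conjS z) (rd i t))" if "i < N" for i
  proof -
    have "conjS z i ^ 5 = cnj (z i ^ 5)" by (simp add: conjS_def)
    also have "\<dots> = cnj (\<Sum>t\<in>T. rc i t * mev N z (rd i t))" using z that by (simp add: Sol_def)
    finally show ?thesis by (simp add: rc_real mev_conjS)
  qed
  then show ?thesis using z by (auto simp: Sol_def conjS_def)
qed

lemma M_real: "cnj (M g b' b) = M g b' b"
proof -
  have "quot N T rd" by unfold_locales
  from nf_hom[OF this, of cnj rc "b + g" b'] show ?thesis by (simp add: M_def rc_real)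
qed

lemma sum_conjS: "(\<Sum>z\<in>Sol. g (conjS z)) = (\<Sum>z\<in>Sol. g z)"
  by (rule sum.reindex_bij_witness[of _ conjS conjS]) (auto intro: conjS_Sol)

lemma sum_Sol_split:
  "(\<Sum>z\<in>Sol. g z) = (\<Sum>z\<in>{z\<in>Sol. conjS z = z}. g z) + (\<Sum>z\<in>{z\<in>Sol. upper z}. g z + g (conjS z))"
proof -
  let ?R = "{z\<in>Sol. conjS z = z}" and ?U = "{z\<in>Sol. upper z}"
  have S: "Sol = ?R \<union> (?U \<union> conjS ` ?U)"
  proof (intro equalityI subsetI)
    fix z assume z: "z \<in> Sol"
    have "z \<in> conjS ` ?U" if "upper (conjS z)"
      using that z conjS_Sol by (intro image_eqI[of _ _ "conjS z"]) auto
    then show "z \<in> ?R \<union> (?U \<union> conjS ` ?U)" using upper_cases[of z] z by blast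
  qed (auto intro: conjS_Sol)
  have 1: "?R \<inter> (?U \<union> conjS ` ?U) = {}" using upper_not_real by force
  have 2: "?U \<inter> conjS ` ?U = {}" using upper_not_both by force
  have fin: "finite ?R" "finite ?U" "finite (conjS ` ?U)" using finite_Sol by auto
  have "inj_on conjS ?U" by (rule inj_on_inverseI[of _ conjS]) simp
  then have "(\<Sum>z\<in>conjS ` ?U. g z) = (\<Sum>z\<in>?U. g (conjS z))" by (simp add: sum.reindex)
  moreover have "(\<Sum>z\<in>?U \<union> conjS ` ?U. g z) = (\<Sum>z\<in>?U. g z) + (\<Sum>z\<in>conjS ` ?U. g z)"
    by (rule sum.union_disjoint) (use fin 2 in auto)
  moreover have "(\<Sum>z\<in>Sol. g z) = (\<Sum>z\<in>?R. g z) + (\<Sum>z\<in>?U \<union> conjS ` ?U. g z)"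
    by (subst S, rule sum.union_disjoint) (use fin 1 in auto)
  ultimately show ?thesis by (simp add: sum.distrib)
qed

text \<open>By the trace formula the entries are weighted sums over the solutions. The formula alone
  does not say that conjugate solutions have equal multiplicity, but the matrix is real, so each
  multiplicity may be replaced by the average over its pair.\<close>

lemma hermite_form:
  assumes A: "pr A f" and Areal: "\<And>b' b. b' \<in> Bs N \<Longrightarrow> b \<in> Bs N \<Longrightarrow> cnj (A b' b) = A b' b"
    and fconj: "\<And>z. f (conjS z) = cnj (f z)"
    and H: "\<And>s t. s \<in> Bs N \<Longrightarrow> t \<in> Bs N \<Longrightarrow> H s t = (\<Sum>b\<in>Bs N. \<Sum>a\<in>Bs N. A b a * M (s + t) a b)"
  shows "\<exists>m :: (nat \<Rightarrow> complex) \<Rightarrow> real. (\<forall>z\<in>Sol. m z > 0) \<and> (\<forall>z. m (conjS z) = m z) \<and>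
    (\<forall>x. (\<Sum>s\<in>Bs N. \<Sum>t\<in>Bs N. cnj (x s) * H s t * x t)
      = (\<Sum>z\<in>Sol. of_real (m z) * (f z * cnj (\<Sum>s\<in>Bs N. mev N (conjS z) s * x s) * (\<Sum>s\<in>Bs N. mev N z s * x s))))"
proof -
  obtain m :: "(nat \<Rightarrow> complex) \<Rightarrow> nat" where m: "\<And>z. z \<in> Sol \<Longrightarrow> m z \<ge> 1"
    "\<And>A f. pr A f \<Longrightarrow> (\<Sum>b\<in>Bs N. A b b) = (\<Sum>z\<in>Sol. of_nat (m z) * f z)"
    using trace_formula by blast
  define mm where "mm z = (real (m z) + real (m (conjS z))) / 2" for z
  have mm: "mm z > 0" if "z \<in> Sol" for z
    using m(1)[OF that] m(1)[OF conjS_Sol[OF that]] by (simp add: mm_def)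
  have mmc: "mm (conjS z) = mm z" for z by (simp add: mm_def add.commute)
  have He: "H s t = (\<Sum>z\<in>Sol. of_real (mm z) * (f z * (mev N z s * mev N z t)))"
    if st: "s \<in> Bs N" "t \<in> Bs N" for s t
  proof -
    have "s + t \<in> mon N" using st Bs_mon by auto
    from m(2)[OF pr_mult[OF A pr_mon[OF this]]]
    have H1: "H s t = (\<Sum>z\<in>Sol. of_nat (m z) * (f z * mev N z (s + t)))" using H st by simp
    have "H s t = cnj (H s t)" using H[OF st] Areal by (simp add: M_real)
    also have "\<dots> = (\<Sum>z\<in>Sol. of_nat (m (conjS (conjS z))) * (f (conjS z) * mev N (conjS z) (s + t)))"
      unfolding H1 by (simp add: fconj mev_conjS)
    also have "\<dots> = (\<Sum>z\<in>Sol. of_nat (m (conjS z)) * (f z * mev N z (s + t)))"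
      by (rule sum_conjS[of "\<lambda>z. of_nat (m (conjS z)) * (f z * mev N z (s + t))"])
    finally have H2: "H s t = (\<Sum>z\<in>Sol. of_nat (m (conjS z)) * (f z * mev N z (s + t)))" .
    have "H s t = (H s t + H s t) / 2" by simp
    also have "\<dots> = (\<Sum>z\<in>Sol. of_nat (m z) * (f z * mev N z (s + t)) + of_nat (m (conjS z)) * (f z * mev N z (s + t))) / 2"
      by (subst H1, subst H2) (simp add: sum.distrib)
    also have "\<dots> = (\<Sum>z\<in>Sol. of_real (mm z) * (f z * (mev N z s * mev N z t)))"
      unfolding sum_divide_distrib by (intro sum.cong refl) (simp add: mm_def mev_add field_simps)
    finally show ?thesis .
  qed
  have "(\<Sum>s\<in>Bs N. \<Sum>t\<in>Bs N. cnj (x s) * H s t * x t)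
      = (\<Sum>z\<in>Sol. of_real (mm z) * (f z * cnj (\<Sum>s\<in>Bs N. mev N (conjS z) s * x s) * (\<Sum>s\<in>Bs N. mev N z s * x s)))" for x
  proof -
    have "(\<Sum>s\<in>Bs N. \<Sum>t\<in>Bs N. cnj (x s) * H s t * x t)
      = (\<Sum>s\<in>Bs N. \<Sum>t\<in>Bs N. \<Sum>z\<in>Sol. of_real (mm z) * f z * ((mev N z s * cnj (x s)) * (mev N z t * x t)))"
      by (intro sum.cong refl) (simp add: He sum_distrib_left sum_distrib_right mult_ac)
    also have "\<dots> = (\<Sum>s\<in>Bs N. \<Sum>z\<in>Sol. \<Sum>t\<in>Bs N. of_real (mm z) * f z * ((mev N z s * cnj (x s)) * (mev N z t * x t)))"
      by (intro sum.cong refl sum.swap)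
    also have "\<dots> = (\<Sum>z\<in>Sol. \<Sum>s\<in>Bs N. \<Sum>t\<in>Bs N. of_real (mm z) * f z * ((mev N z s * cnj (x s)) * (mev N z t * x t)))"
      by (rule sum.swap)
    also have "\<dots> = (\<Sum>z\<in>Sol. of_real (mm z) * f z * ((\<Sum>s\<in>Bs N. mev N z s * cnj (x s)) * (\<Sum>t\<in>Bs N. mev N z t * x t)))"
      unfolding sum_product by (simp only: sum_distrib_left)
    also have "\<dots> = (\<Sum>z\<in>Sol. of_real (mm z) * (f z * cnj (\<Sum>s\<in>Bs N. mev N (conjS z) s * x s) * (\<Sum>s\<in>Bs N. mev N z s * x s)))"
      by (simp add: mev_conjS mult.assoc)
    finally show ?thesis .
  qed
  with mm mmc show ?thesis by (intro exI[of _ mm]) blast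
qed

text \<open>A real solution contributes one square with the sign of \<open>f\<close>; a conjugate
  pair with nonzero \<open>f\<close> contributes one positive and one negative square, whatever
  \<open>f\<close> is. Evaluations at distinct solutions are jointly onto, so Sylvester's law counts
  the negative squares.\<close>

theorem hermite_negative_index:
  assumes A: "pr A f" and Areal: "\<And>b' b. b' \<in> Bs N \<Longrightarrow> b \<in> Bs N \<Longrightarrow> cnj (A b' b) = A b' b"
    and fconj: "\<And>z. f (conjS z) = cnj (f z)"
    and H: "\<And>s t. s \<in> Bs N \<Longrightarrow> t \<in> Bs N \<Longrightarrow> H s t = (\<Sum>b\<in>Bs N. \<Sum>a\<in>Bs N. A b a * M (s + t) a b)"
    and spec: "hermitian_spectrum (Bs N) H U lam"
  shows "card {i. i < card (Bs N) \<and> lam i < 0}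
    = card {z\<in>Sol. conjS z = z \<and> Re (f z) < 0} + card {z\<in>Sol. upper z \<and> f z \<noteq> 0}"
proof -
  interpret hs: hermitian_spectrum "Bs N" H U lam by (rule spec)
  define l where "l x z = (\<Sum>s\<in>Bs N. mev N z s * x s)" for x :: "(nat \<Rightarrow> nat) \<Rightarrow> complex" and z
  from hermite_form[OF A Areal fconj H] obtain m :: "(nat \<Rightarrow> complex) \<Rightarrow> real" where
    m: "\<And>z. z \<in> Sol \<Longrightarrow> m z > 0" "\<And>z. m (conjS z) = m z"
    and form: "\<And>x. (\<Sum>s\<in>Bs N. \<Sum>t\<in>Bs N. cnj (x s) * H s t * x t)
      = (\<Sum>z\<in>Sol. of_real (m z) * (f z * cnj (l x (conjS z)) * l x z))"
    unfolding l_def by blast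
  define Rp where "Rp = {z\<in>Sol. conjS z = z \<and> Re (f z) > 0}"
  define Rm where "Rm = {z\<in>Sol. conjS z = z \<and> Re (f z) < 0}"
  define U0 where "U0 = {z\<in>Sol. upper z \<and> f z \<noteq> 0}"
  have fin: "finite Rp" "finite Rm" "finite U0" using finite_Sol by (auto simp: Rp_def Rm_def U0_def)
  define c0 where "c0 z = sqrt (m z * \<bar>Re (f z)\<bar>)" for z
  define c1 where "c1 z = sqrt (m z / 2)" for z
  \<comment> \<open>Index 0 belongs to a real point; 1 and 2 are the sum and the difference that
    belong to a conjugate pair.\<close>
  define L where "L = (\<lambda>(z, k::nat) s. if k = 0 then of_real (c0 z) * mev N z s
     else if k = 1 then of_real (c1 z) * (f z * mev N z s + mev N (conjS z) s)
     else of_real (c1 z) * (f z * mev N z s - mev N (conjS z) s))"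
  have L0: "(\<Sum>s\<in>Bs N. L (z, 0) s * x s) = of_real (c0 z) * l x z" for z x
    by (simp add: L_def l_def sum_distrib_left mult.assoc)
  have L1: "(\<Sum>s\<in>Bs N. L (z, 1) s * x s) = of_real (c1 z) * (f z * l x z + l x (conjS z))" for z x
    by (simp add: L_def l_def sum_distrib_left mult.assoc distrib_left distrib_right sum.distrib)
  have L2: "(\<Sum>s\<in>Bs N. L (z, 2) s * x s) = of_real (c1 z) * (f z * l x z - l x (conjS z))" for z x
    by (simp add: L_def l_def sum_distrib_left mult.assoc right_diff_distrib left_diff_distrib sum_subtractf)
  define P where "P = Rp \<times> {0} \<union> U0 \<times> {1::nat}"
  define Q where "Q = Rm \<times> {0} \<union> U0 \<times> {2::nat}"
  have sumP: "(\<Sum>j\<in>P. g j) = (\<Sum>z\<in>Rp. g (z, 0)) + (\<Sum>z\<in>U0. g (z, 1))" for g :: "_ \<Rightarrow> real"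
    unfolding P_def by (subst sum.union_disjoint) (use fin in \<open>auto simp: sum_times_singleton\<close>)
  have sumQ: "(\<Sum>j\<in>Q. g j) = (\<Sum>z\<in>Rm. g (z, 0)) + (\<Sum>z\<in>U0. g (z, 2))" for g :: "_ \<Rightarrow> real"
    unfolding Q_def by (subst sum.union_disjoint) (use fin in \<open>auto simp: sum_times_singleton\<close>)
  have freal: "f z = of_real (Re (f z))" if "conjS z = z" for z
    using fconj[of z] that by (metis Reals_cnj_iff of_real_Re)
  have "card {i. i < card (Bs N) \<and> lam i < 0} = card Q"
  proof (rule hs.inertia[where P = P and L = L])
    show "finite P" "finite Q" "P \<inter> Q = {}"
      using fin by (auto simp: P_def Q_def Rp_def Rm_def)
  next
    fix x
    have real_part: "(\<Sum>z\<in>{z\<in>Sol. conjS z = z}. of_real (m z) * (f z * cnj (l x (conjS z)) * l x z))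
      = of_real ((\<Sum>z\<in>Rp. (cmod (of_real (c0 z) * l x z))\<^sup>2) - (\<Sum>z\<in>Rm. (cmod (of_real (c0 z) * l x z))\<^sup>2))"
    proof -
      have "(\<Sum>z\<in>{z\<in>Sol. conjS z = z}. of_real (m z) * (f z * cnj (l x (conjS z)) * l x z))
        = (\<Sum>z\<in>{z\<in>Sol. conjS z = z}. complex_of_real (m z * Re (f z) * (cmod (l x z))\<^sup>2))"
      proof (intro sum.cong refl)
        fix z assume "z \<in> {z\<in>Sol. conjS z = z}"
        then have z: "conjS z = z" by simp
        have "of_real (m z) * (f z * cnj (l x (conjS z)) * l x z) = of_real (m z) * of_real (Re (f z)) * (l x z * cnj (l x z))"
          using freal[OF z] by (simp add: z mult_ac)
        then show "of_real (m z) * (f z * cnj (l x (conjS z)) * l x z) = complex_of_real (m z * Re (f z) * (cmod (l x z))\<^sup>2)"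
          by (simp only: of_real_mult complex_norm_square)
      qed
      also have "\<dots> = of_real (\<Sum>z\<in>{z\<in>Sol. conjS z = z}. m z * Re (f z) * (cmod (l x z))\<^sup>2)" by (rule of_real_sum[symmetric])
      also have "(\<Sum>z\<in>{z\<in>Sol. conjS z = z}. m z * Re (f z) * (cmod (l x z))\<^sup>2)
        = (\<Sum>z\<in>Rp \<union> Rm. m z * Re (f z) * (cmod (l x z))\<^sup>2)"
        by (rule sum.mono_neutral_right) (use finite_Sol in \<open>auto simp: Rp_def Rm_def\<close>)
      also have "\<dots> = (\<Sum>z\<in>Rp. m z * Re (f z) * (cmod (l x z))\<^sup>2) + (\<Sum>z\<in>Rm. m z * Re (f z) * (cmod (l x z))\<^sup>2)"
        by (rule sum.union_disjoint) (use fin in \<open>auto simp: Rp_def Rm_def\<close>)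
      also have "(\<Sum>z\<in>Rp. m z * Re (f z) * (cmod (l x z))\<^sup>2) = (\<Sum>z\<in>Rp. (cmod (of_real (c0 z) * l x z))\<^sup>2)"
        by (rule sum.cong) (auto simp: Rp_def c0_def norm_mult power_mult_distrib less_imp_le m)
      also have "(\<Sum>z\<in>Rm. m z * Re (f z) * (cmod (l x z))\<^sup>2) = - (\<Sum>z\<in>Rm. (cmod (of_real (c0 z) * l x z))\<^sup>2)"
        unfolding sum_negf[symmetric]
        by (rule sum.cong) (auto simp: Rm_def c0_def norm_mult power_mult_distrib less_imp_le m mult_le_0_iff)
      finally show ?thesis by simp
    qed
    have pair_part: "(\<Sum>z\<in>{z\<in>Sol. upper z}. of_real (m z) * (f z * cnj (l x (conjS z)) * l x z)
        + of_real (m (conjS z)) * (f (conjS z) * cnj (l x (conjS (conjS z))) * l x (conjS z)))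
      = of_real ((\<Sum>z\<in>U0. (cmod (of_real (c1 z) * (f z * l x z + l x (conjS z))))\<^sup>2)
         - (\<Sum>z\<in>U0. (cmod (of_real (c1 z) * (f z * l x z - l x (conjS z))))\<^sup>2))"
    proof -
      have "(\<Sum>z\<in>{z\<in>Sol. upper z}. of_real (m z) * (f z * cnj (l x (conjS z)) * l x z)
        + of_real (m (conjS z)) * (f (conjS z) * cnj (l x (conjS (conjS z))) * l x (conjS z)))
        = (\<Sum>z\<in>{z\<in>Sol. upper z}. complex_of_real (m z * (((cmod (f z * l x z + l x (conjS z)))\<^sup>2 - (cmod (f z * l x z - l x (conjS z)))\<^sup>2) / 2)))"
        by (intro sum.cong refl, subst of_real_mult, subst polarization[symmetric])
          (simp add: m fconj distrib_left mult_ac)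
      also have "\<dots> = of_real (\<Sum>z\<in>{z\<in>Sol. upper z}. m z * (((cmod (f z * l x z + l x (conjS z)))\<^sup>2 - (cmod (f z * l x z - l x (conjS z)))\<^sup>2) / 2))"
        by (rule of_real_sum[symmetric])
      also have "(\<Sum>z\<in>{z\<in>Sol. upper z}. m z * (((cmod (f z * l x z + l x (conjS z)))\<^sup>2 - (cmod (f z * l x z - l x (conjS z)))\<^sup>2) / 2))
        = (\<Sum>z\<in>U0. m z * (((cmod (f z * l x z + l x (conjS z)))\<^sup>2 - (cmod (f z * l x z - l x (conjS z)))\<^sup>2) / 2))"
        by (rule sum.mono_neutral_right) (use finite_Sol in \<open>auto simp: U0_def\<close>)
      also have "\<dots> = (\<Sum>z\<in>U0. (cmod (of_real (c1 z) * (f z * l x z + l x (conjS z))))\<^sup>2 - (cmod (of_real (c1 z) * (f z * l x z - l x (conjS z))))\<^sup>2)"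
      proof (rule sum.cong[OF refl])
        fix z assume "z \<in> U0"
        then have "\<bar>c1 z\<bar>\<^sup>2 = m z / 2" using m(1)[of z] by (simp add: U0_def c1_def)
        then show "m z * (((cmod (f z * l x z + l x (conjS z)))\<^sup>2 - (cmod (f z * l x z - l x (conjS z)))\<^sup>2) / 2)
          = (cmod (of_real (c1 z) * (f z * l x z + l x (conjS z))))\<^sup>2 - (cmod (of_real (c1 z) * (f z * l x z - l x (conjS z))))\<^sup>2"
          unfolding norm_mult power_mult_distrib norm_of_real by (simp only:) (simp add: field_simps)
      qed
      finally show ?thesis by (simp only: sum_subtractf)
    qed
    show "(\<Sum>s\<in>Bs N. \<Sum>t\<in>Bs N. cnj (x s) * H s t * x t)
      = of_real ((\<Sum>j\<in>P. (cmod (\<Sum>s\<in>Bs N. L j s * x s))\<^sup>2) - (\<Sum>j\<in>Q. (cmod (\<Sum>s\<in>Bs N. L j s * x s))\<^sup>2))"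
      unfolding form sum_Sol_split real_part pair_part sumP sumQ L0 L1 L2 of_real_add[symmetric]
      by (simp only: algebra_simps)
  next
    fix j assume j: "j \<in> P \<union> Q"
    have lx: "\<exists>x. \<forall>z\<in>Sol. l x z = y z" for y
      using evaluation_onto[of y] unfolding l_def .
    obtain z0 k where jz: "j = (z0, k)" by (cases j)
    have z0: "z0 \<in> Sol" "k = 0 \<Longrightarrow> conjS z0 = z0 \<and> Re (f z0) \<noteq> 0" "k \<noteq> 0 \<Longrightarrow> upper z0 \<and> f z0 \<noteq> 0" "k \<in> {0,1,2}"
      using j jz by (auto simp: P_def Q_def Rp_def Rm_def U0_def)
    have c1: "c1 z0 \<noteq> 0" using m(1)[OF z0(1)] by (simp add: c1_def)
    have others: "conjS z \<noteq> z0 \<or> z = z0" "z = z0 \<Longrightarrow> conjS z = z0" if "k = 0" "conjS z = z \<or> upper z" for z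
      using that z0(2) upper_not_real upper_not_both by (metis conjS_conjS)+
    \<comment> \<open>Values for which functional \<open>j\<close> is 1 and all others are 0. At a
      pair, \<open>f z0 * l x z0\<close> and \<open>l x (conjS z0)\<close> are made equal or
      opposite, so that the difference or the sum cancels.\<close>
    define y where "y z = (if k = 0 then (if z = z0 then 1 / of_real (c0 z0) else 0)
      else if z = z0 then 1 / (2 * f z0 * of_real (c1 z0))
      else if z = conjS z0 then (if k = 1 then 1 else - 1) / (2 * of_real (c1 z0)) else 0)" for z
    obtain x where x: "\<And>z. z \<in> Sol \<Longrightarrow> l x z = y z" using lx by blast
    have "(\<Sum>s\<in>Bs N. L i s * x s) = (if i = j then 1 else 0)" if i: "i \<in> P \<union> Q" for i
    proof -
      obtain z n where iz: "i = (z, n)" by (cases i)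
      have z: "z \<in> Sol" "n = 0 \<Longrightarrow> conjS z = z \<and> Re (f z) \<noteq> 0" "n \<noteq> 0 \<Longrightarrow> upper z \<and> f z \<noteq> 0" "n \<in> {0,1,2}"
        using i iz by (auto simp: P_def Q_def Rp_def Rm_def U0_def)
      have lz: "l x z = y z" "l x (conjS z) = y (conjS z)" using x z(1) conjS_Sol by auto
      have kn: "k = 0 \<or> k = 1 \<or> k = 2" "n = 0 \<or> n = 1 \<or> n = 2" using z(4) z0(4) by auto
      consider "n = 0" "k = 0" | "n = 0" "k \<noteq> 0" | "n \<noteq> 0" "k = 0" | "n \<noteq> 0" "k \<noteq> 0" by blast
      then show ?thesis
      proof cases
        case 1
        have "c0 z0 \<noteq> 0" using z0(2)[OF 1(2)] m(1)[OF z0(1)] by (simp add: c0_def)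
        then show ?thesis using 1 by (auto simp: iz jz L0 lz y_def)
      next
        case 2
        have "z \<noteq> z0" "z \<noteq> conjS z0"
          using z(2)[OF 2(1)] z0(3)[OF 2(2)] upper_not_real by (metis conjS_conjS)+
        then show ?thesis using 2 by (auto simp: iz jz L0 lz y_def)
      next
        case 3
        have "z \<noteq> z0" "conjS z \<noteq> z0"
          using z(3)[OF 3(1)] z0(2)[OF 3(2)] upper_not_real by (metis conjS_conjS)+
        then have "y z = 0" "y (conjS z) = 0" using 3 by (auto simp: y_def)
        then show ?thesis using 3 kn L1 L2 lz by (auto simp: iz jz)
      next
        case 4
        have u: "upper z" "upper z0" using z(3) z0(3) 4 by auto
        have neq: "conjS z \<noteq> z0" "z \<noteq> conjS z0" "conjS z0 \<noteq> z0"
          using u upper_not_both by (metis conjS_conjS)+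
        show ?thesis
        proof (cases "z = z0")
          case True
          have "y z = 1 / (2 * f z0 * of_real (c1 z0))" "y (conjS z) = (if k = 1 then 1 else - 1) / (2 * of_real (c1 z0))"
            using True 4 neq by (auto simp: y_def)
          then have "of_real (c1 z0) * (f z0 * l x z0) = 1 / 2"
            "of_real (c1 z0) * l x (conjS z0) = (if k = 1 then 1 else - 1) / 2"
            using True lz z0(3) 4 c1 by auto
          then have "(\<Sum>s\<in>Bs N. L (z0, 1) s * x s) = 1 / 2 + (if k = 1 then 1 else - 1) / 2"
            "(\<Sum>s\<in>Bs N. L (z0, 2) s * x s) = 1 / 2 - (if k = 1 then 1 else - 1) / 2"
            unfolding L1 L2 by (simp_all only: distrib_left right_diff_distrib)
          then show ?thesis using True 4 kn by (auto simp: iz jz)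
        next
          case False
          then have "conjS z \<noteq> conjS z0" by (metis conjS_conjS)
          then have "y z = 0" "y (conjS z) = 0" using False neq 4 by (auto simp: y_def)
          then show ?thesis using False kn 4 L1 L2 lz by (auto simp: iz jz)
        qed
      qed
    qed
    then show "\<exists>x. \<forall>i\<in>P \<union> Q. (\<Sum>s\<in>Bs N. L i s * x s) = (if i = j then 1 else 0)" by blast
  qed
  also have "card Q = card Rm + card U0"
    unfolding Q_def by (subst card_Un_disjoint) (use fin in \<open>auto simp: card_cartesian_product\<close>)
  finally show ?thesis by (simp add: Rm_def U0_def)
qed

end

section \<open>Coordinatewise compactness\<close>

text \<open>A monotone subsequence is extracted for one coordinate after another; bounded and
  monotone gives convergent.\<close>

lemma convergent_subseq_coordinates:
  fixes f :: "nat \<Rightarrow> nat \<Rightarrow> real"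
  assumes "\<And>i. i < n \<Longrightarrow> \<exists>B. \<forall>m. \<bar>f m i\<bar> \<le> B"
  shows "\<exists>r. strict_mono (r :: nat \<Rightarrow> nat) \<and> (\<forall>i<n. convergent (\<lambda>m. f (r m) i))"
  using assms
proof (induction n)
  case 0 show ?case by (intro exI[of _ id]) (auto simp: strict_mono_def)
next
  case (Suc n)
  then obtain r where r: "strict_mono (r :: nat \<Rightarrow> nat)" "\<And>i. i < n \<Longrightarrow> convergent (\<lambda>m. f (r m) i)"
    by (metis less_Suc_eq)
  obtain B where B: "\<And>m. \<bar>f m n\<bar> \<le> B" using Suc.prems[of n] by auto
  obtain g :: "nat \<Rightarrow> nat" where g: "strict_mono g" "monoseq (\<lambda>m. f (r (g m)) n)"
    using seq_monosub[of "\<lambda>m. f (r m) n"] by blast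
  have "convergent (\<lambda>m. f (r (g m)) n)"
    by (rule Bseq_monoseq_convergent[OF _ g(2)]) (rule BseqI'[of _ B], simp add: B)
  moreover have "convergent (\<lambda>m. f (r (g m)) i)" if "i < n" for i
    using convergent_subseq_convergent[OF r(2)[OF that] g(1)] by (simp add: o_def)
  ultimately show ?case using strict_mono_compose[OF r(1) g(1)]
    by (intro exI[of _ "\<lambda>m. r (g m)"]) (auto simp: less_Suc_eq o_def)
qed

section \<open>The sign of a polynomial at infinity\<close>

text \<open>A positive leading coefficient is eventually a lower bound for the values. The zero
  polynomial fits in because its leading coefficient is 0.\<close>

lemma eventually_sgn_poly: "eventually (\<lambda>x. sgn (poly p x) = sgn (lead_coeff p)) at_top" for p :: "real poly"
proof -
  have pos: "eventually (\<lambda>x. poly q x > 0) at_top" if lq: "lead_coeff q > 0" for q :: "real poly"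
  proof -
    from poly_pinfty_gt_lc[OF lq] obtain n where "\<forall>x\<ge>n. poly q x \<ge> lead_coeff q" by blast
    then have "\<forall>x\<ge>n. poly q x > 0" using lq by (meson less_le_trans)
    then show ?thesis unfolding eventually_at_top_linorder by blast
  qed
  consider "lead_coeff p > 0" | "lead_coeff p < 0" | "lead_coeff p = 0" by linarith
  then show ?thesis
  proof cases
    case 1
    show ?thesis using pos[OF 1] by eventually_elim (use 1 in simp)
  next
    case 2
    then have "lead_coeff (- p) > 0" by simp
    from pos[OF this] show ?thesis by eventually_elim (use 2 in simp)
  next
    case 3
    then show ?thesis by simp
  qed
qed

section \<open>Negative eigenvalues of a symmetric matrix of polynomials, for large
  arguments\<close>

fun mpow :: "'s set \<Rightarrow> ('s \<Rightarrow> 's \<Rightarrow> 'a::comm_ring_1) \<Rightarrow> nat \<Rightarrow> 's \<Rightarrow> 's \<Rightarrow> 'a" where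
  "mpow S H 0 s t = (if s = t then 1 else 0)"
| "mpow S H (Suc k) s t = (\<Sum>r\<in>S. H s r * mpow S H k r t)"

definition ptr :: "'s set \<Rightarrow> ('s \<Rightarrow> 's \<Rightarrow> 'a::comm_ring_1) \<Rightarrow> nat \<Rightarrow> 'a" where
  "ptr S H k = (\<Sum>s\<in>S. mpow S H k s s)"

text \<open>Elementary symmetric functions from the power sums \<open>p\<close> by Newton's
  recursion. Only integers are divided by, so the results stay polynomials.\<close>

fun newt :: "(nat \<Rightarrow> real poly) \<Rightarrow> nat \<Rightarrow> real poly" where
  "newt p 0 = 1"
| "newt p (Suc k) = smult (1 / real (Suc k)) (\<Sum>i\<le>k. (-1) ^ i * newt p (k - i) * p (Suc i))"

definition neg_index :: "'s set \<Rightarrow> ('s \<Rightarrow> 's \<Rightarrow> real poly) \<Rightarrow> nat" where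
  "neg_index S H = sign_changes (\<lambda>k. lead_coeff (newt (ptr S H) k)) (Suc (card S))"

lemma mpow_hom:
  assumes f: "\<And>x y. f (x + y) = f x + f y" "\<And>x y. f (x * y) = f x * f y" "f 1 = 1" "f 0 = 0"
  shows "f (mpow S H k s t) = mpow S (\<lambda>s t. f (H s t)) k s t"
proof -
  have fs: "f (sum h X) = (\<Sum>x\<in>X. f (h x))" for h X
    by (induction X rule: infinite_finite_induct) (auto simp: f)
  show ?thesis by (induction k arbitrary: s t) (auto simp: f fs)
qed

text \<open>Traces of powers are power sums of the eigenvalues, and Descartes' rule reads the number
  of negative ones from the elementary symmetric functions. The threshold depends on finitely many
  polynomials only, hence serves all eigenbases at once.\<close>

lemma neg_index_correct:
  fixes H :: "'s \<Rightarrow> 's \<Rightarrow> real poly"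
  shows "eventually (\<lambda>x. \<forall>U lam. hermitian_spectrum S (\<lambda>s t. of_real (poly (H s t) x)) U lam \<longrightarrow>
    card {i. i < card S \<and> lam i < 0} = neg_index S H) at_top"
proof -
  have "eventually (\<lambda>x. \<forall>k\<in>{..card S}. sgn (poly (newt (ptr S H) k) x) = sgn (lead_coeff (newt (ptr S H) k))) at_top"
    by (intro eventually_ball_finite) (auto intro: eventually_sgn_poly)
  then show ?thesis
  proof eventually_elim
    case (elim x)
    show ?case
    proof (intro allI impI)
      fix U lam assume "hermitian_spectrum S (\<lambda>s t. complex_of_real (poly (H s t) x)) U lam"
      then interpret hs: hermitian_spectrum S "\<lambda>s t. complex_of_real (poly (H s t) x)" U lam .
      have pt: "poly (ptr S H k) x = (\<Sum>j<card S. lam j ^ k)" for k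
      proof -
        have "complex_of_real (poly (ptr S H k) x) = (\<Sum>s\<in>S. mpow S (\<lambda>s t. complex_of_real (poly (H s t) x)) k s s)"
          unfolding ptr_def poly_sum of_real_sum by (intro sum.cong refl mpow_hom) auto
        also have "\<dots> = of_real (\<Sum>j<card S. lam j ^ k)"
          by (rule hs.trace_power) auto
        finally show ?thesis by (simp only: of_real_eq_iff)
      qed
      have E: "poly (newt (ptr S H) k) x = coeff (\<Prod>j<card S. [:1, lam j:]) k" for k
        by (rule newton_identities) (simp_all add: poly_sum pt)
      have "card {i. i < card S \<and> lam i < 0} = sign_changes (coeff (\<Prod>j<card S. [:1, lam j:])) (Suc (card S))"
        by (rule descartes_real_rooted[symmetric])
      also have "\<dots> = neg_index S H"
        unfolding neg_index_def
        by (rule sign_changes_cong[THEN conjunct2]) (use elim in \<open>auto simp: E[symmetric]\<close>)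
      finally show "card {i. i < card S \<and> lam i < 0} = neg_index S H" .
    qed
  qed
qed

section \<open>Deciding whether a nonnegative quartic has infimum zero\<close>

locale quartic =
  fixes N :: nat and T :: "'t set" and b :: "'t \<Rightarrow> real" and g :: "'t \<Rightarrow> nat \<Rightarrow> nat"
  assumes finT: "finite T"
    and g_mon: "\<And>t. t \<in> T \<Longrightarrow> g t \<in> mon N" and g_deg: "\<And>t. t \<in> T \<Longrightarrow> mdeg N (g t) \<le> 4"
    and nonneg: "\<And>x. (\<Sum>t\<in>T. b t * mev N x (g t)) \<ge> 0"
begin

definition Gv :: "real \<Rightarrow> (nat \<Rightarrow> real) \<Rightarrow> real" where
  "Gv \<kappa> x = \<kappa>\<^sup>2 * (\<Sum>t\<in>T. b t * mev N x (g t)) + (\<Sum>i<N. x i ^ 6) - \<kappa>"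

text \<open>Exponents of the partial derivative in direction \<open>i\<close>. If
  \<open>g t i\<close> is 0, truncated subtraction leaves them unchanged, but then the coefficient
  \<open>crc i t\<close> is 0.\<close>

definition crd :: "nat \<Rightarrow> 't \<Rightarrow> nat \<Rightarrow> nat" where "crd i t = g t - ex i 1"

definition crc :: "nat \<Rightarrow> 't \<Rightarrow> real poly" where "crc i t = monom (- b t * real (g t i) / 6) 2"

text \<open>Index set of the monomials of the perturbed function: \<open>Inl\<close> for the terms
  of the quartic, \<open>Inr i\<close> with i below \<open>N\<close> for the sixth powers, and
  \<open>Inr N\<close> for the constant - \<kappa>.\<close>

definition TG :: "('t + nat) set" where "TG = Inl ` T \<union> Inr ` {..N}"

definition cg :: "'t + nat \<Rightarrow> real poly" where
  "cg u = (case u of Inl t \<Rightarrow> monom (b t) 2 | Inr i \<Rightarrow> if i < N then 1 else monom (-1) 1)"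

definition dg :: "'t + nat \<Rightarrow> nat \<Rightarrow> nat" where
  "dg u = (case u of Inl t \<Rightarrow> g t | Inr i \<Rightarrow> if i < N then ex i 6 else 0)"

lemma finTG: "finite TG" by (simp add: TG_def finT)

lemma dg_mon: "u \<in> TG \<Longrightarrow> dg u \<in> mon N"
  by (auto simp: TG_def dg_def g_mon)

lemma quot: "quot N T crd"
proof
  fix i t assume "i < N" "t \<in> T"
  then show "crd i t \<in> mon N" by (simp add: crd_def g_mon)
  have "mdeg N (crd i t) \<le> mdeg N (g t)"
    unfolding mdeg_def crd_def by (rule sum_mono) simp
  then show "mdeg N (crd i t) < 5" using g_deg[OF \<open>t \<in> T\<close>] by simp
qed (rule finT)

sublocale pq: quot N T crd crc by (rule quot)

text \<open>The Hermite matrix of the perturbed function, with \<open>H2\<close> that of its square.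
  The square is nonzero at the same nonreal points and is never negative at real ones, so the
  difference of the negative indices counts the real critical points with negative value.\<close>

definition H1 :: "(nat \<Rightarrow> nat) \<Rightarrow> (nat \<Rightarrow> nat) \<Rightarrow> real poly" where
  "H1 s t = (\<Sum>u\<in>TG. cg u * pq.tau (dg u + (s + t)))"

definition H2 :: "(nat \<Rightarrow> nat) \<Rightarrow> (nat \<Rightarrow> nat) \<Rightarrow> real poly" where
  "H2 s t = (\<Sum>u\<in>TG. \<Sum>v\<in>TG. cg u * cg v * pq.tau (dg u + dg v + (s + t)))"

lemma Gv_terms: "(\<Sum>u\<in>TG. poly (cg u) \<kappa> * mev N x (dg u)) = Gv \<kappa> x"
proof -
  have "(\<Sum>u\<in>TG. poly (cg u) \<kappa> * mev N x (dg u)) = (\<Sum>u\<in>Inl ` T. poly (cg u) \<kappa> * mev N x (dg u))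
     + (\<Sum>u\<in>Inr ` {..N}. poly (cg u) \<kappa> * mev N x (dg u))"
    unfolding TG_def by (rule sum.union_disjoint) (use finT in auto)
  also have "(\<Sum>u\<in>Inl ` T. poly (cg u) \<kappa> * mev N x (dg u)) = \<kappa>\<^sup>2 * (\<Sum>t\<in>T. b t * mev N x (g t))"
    by (subst sum.reindex) (auto simp: cg_def dg_def poly_monom sum_distrib_left mult_ac)
  also have "(\<Sum>u\<in>Inr ` {..N}. poly (cg u) \<kappa> * mev N x (dg u)) = (\<Sum>i\<le>N. if i < N then x i ^ 6 else - \<kappa>)"
    by (subst sum.reindex) (auto simp: cg_def dg_def poly_monom intro!: sum.cong)
  also have "\<dots> = (\<Sum>i<N. x i ^ 6) - \<kappa>"
    by (simp add: lessThan_Suc_atMost[symmetric])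
  finally show ?thesis by (simp add: Gv_def)
qed

text \<open>Along the line in direction \<open>i\<close> the derivative at the minimum vanishes; it
  contains the term 6 x_i^5, for which the equation is solved.\<close>

lemma Gv_critical:
  assumes i: "i < N" and min: "\<And>y. (\<forall>j\<ge>N. y j = 0) \<Longrightarrow> Gv \<kappa> x \<le> Gv \<kappa> y" and x: "\<forall>j\<ge>N. x j = 0"
  shows "x i ^ 5 = (\<Sum>t\<in>T. poly (crc i t) \<kappa> * mev N x (crd i t))"
proof -
  have dm: "((\<lambda>s. mev N (x(i := s)) h) has_real_derivative real (h i) * mev N (x(i := s)) (h - ex i 1)) (at s)" for h s
  proof -
    have split: "mev N (x(i := s)) h = s ^ h i * (\<Prod>j\<in>{..<N} - {i}. x j ^ h j)" for s h
      unfolding mev_def using i by (subst prod.remove[of _ i]) (auto intro!: prod.cong)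
    have "((\<lambda>s. s ^ h i * (\<Prod>j\<in>{..<N} - {i}. x j ^ h j)) has_real_derivative
       (real (h i) * s ^ (h i - 1)) * (\<Prod>j\<in>{..<N} - {i}. x j ^ h j)) (at s)"
      by (auto intro!: derivative_eq_intros)
    moreover have "(\<Prod>j\<in>{..<N} - {i}. x j ^ (h - ex i 1) j) = (\<Prod>j\<in>{..<N} - {i}. x j ^ h j)"
      by (rule prod.cong) (auto simp: ex_def)
    ultimately show ?thesis unfolding split by (simp add: ex_def mult.assoc)
  qed
  have ds: "((\<lambda>s. \<Sum>j<N. (x(i := s)) j ^ 6) has_real_derivative 6 * s ^ 5) (at s)" for s
  proof -
    have split: "(\<Sum>j<N. (x(i := s)) j ^ 6) = s ^ 6 + (\<Sum>j\<in>{..<N} - {i}. x j ^ 6)" for s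
      using i by (subst sum.remove[of _ i]) (auto intro!: sum.cong)
    show ?thesis unfolding split by (auto intro!: derivative_eq_intros)
  qed
  define D where "D = \<kappa>\<^sup>2 * (\<Sum>t\<in>T. b t * (real (g t i) * mev N x (g t - ex i 1))) + 6 * x i ^ 5"
  have "((\<lambda>s. Gv \<kappa> (x(i := s))) has_real_derivative
     \<kappa>\<^sup>2 * (\<Sum>t\<in>T. b t * (real (g t i) * mev N (x(i := x i)) (g t - ex i 1))) + 6 * x i ^ 5 - 0) (at (x i))"
    unfolding Gv_def by (intro DERIV_diff DERIV_add DERIV_cmult DERIV_sum dm ds DERIV_const)
  then have D: "((\<lambda>s. Gv \<kappa> (x(i := s))) has_real_derivative D) (at (x i))"
    by (simp add: D_def)
  have "D = 0"
    by (rule DERIV_local_min[OF D, of 1]) (use min x i in auto)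
  then have "x i ^ 5 = - (\<kappa>\<^sup>2 / 6) * (\<Sum>t\<in>T. b t * (real (g t i) * mev N x (g t - ex i 1)))"
    by (simp add: D_def field_simps)
  also have "\<dots> = (\<Sum>t\<in>T. poly (crc i t) \<kappa> * mev N x (crd i t))"
    unfolding sum_distrib_left by (intro sum.cong refl) (simp add: crc_def crd_def poly_monom mult_ac)
  finally show ?thesis .
qed

text \<open>Since the quartic is nonnegative, the sixth powers bound the function from below; a
  minimizing sequence is therefore bounded in every coordinate.\<close>

lemma Gv_attains_min:
  shows "\<exists>x. (\<forall>j\<ge>N. x j = 0) \<and> (\<forall>y. (\<forall>j\<ge>N. y j = 0) \<longrightarrow> Gv \<kappa> x \<le> Gv \<kappa> y)"
proof -
  let ?V = "{Gv \<kappa> x | x. \<forall>j\<ge>N. x j = 0}"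
  have low: "(\<Sum>i<N. x i ^ 6) - \<kappa> \<le> Gv \<kappa> x" for x
    using mult_nonneg_nonneg[OF zero_le_power2[of \<kappa>] nonneg[of x]] by (simp add: Gv_def)
  have low': "- \<kappa> \<le> Gv \<kappa> x" for x
    using low[of x] sum_nonneg[of "{..<N}" "\<lambda>i. x i ^ 6"] by (simp add: zero_le_even_power)
  have bdd: "bdd_below ?V" using low' by (auto intro!: bdd_belowI[of _ "- \<kappa>"])
  have ne: "?V \<noteq> {}" by (auto intro!: exI[of _ "\<lambda>_. 0"])
  define I where "I = Inf ?V"
  have "\<exists>x. (\<forall>j\<ge>N. x j = 0) \<and> Gv \<kappa> x < I + 1 / real (Suc m)" for m
  proof -
    have "I < I + 1 / real (Suc m)" by simp
    then show ?thesis using cInf_less_iff[OF ne bdd, of "I + 1 / real (Suc m)"] unfolding I_def by blast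
  qed
  then obtain X where X: "\<And>m. \<forall>j\<ge>N. X m j = 0" "\<And>m. Gv \<kappa> (X m) < I + 1 / real (Suc m)" by metis
  have "\<bar>X m i\<bar> \<le> \<bar>I + 1 + \<kappa>\<bar> + 1" if "i < N" for m i
  proof -
    have "1 / real (Suc m) \<le> 1" by simp
    then have "(\<Sum>i<N. X m i ^ 6) \<le> I + 1 + \<kappa>" using low[of "X m"] X(2)[of m] by linarith
    moreover have "X m i ^ 6 \<le> (\<Sum>i<N. X m i ^ 6)"
      by (rule member_le_sum) (use that in \<open>auto simp: zero_le_even_power\<close>)
    ultimately have le: "\<bar>X m i\<bar> ^ 6 \<le> \<bar>I + 1 + \<kappa>\<bar>" by (simp add: power_even_abs)
    show ?thesis
    proof (cases "\<bar>X m i\<bar> \<le> 1")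
      case False
      then have "\<bar>X m i\<bar> ^ 1 \<le> \<bar>X m i\<bar> ^ 6" by (intro power_increasing) auto
      then show ?thesis using le by simp
    qed simp
  qed
  then obtain r where r: "strict_mono (r :: nat \<Rightarrow> nat)" "\<And>i. i < N \<Longrightarrow> convergent (\<lambda>m. X (r m) i)"
    using convergent_subseq_coordinates[of N X] by blast
  define x where "x i = (if i < N then lim (\<lambda>m. X (r m) i) else 0)" for i
  have lim: "(\<lambda>m. X (r m) i) \<longlonglongrightarrow> x i" if "i < N" for i
    using r(2)[OF that] that by (simp add: x_def convergent_LIMSEQ_iff)
  have "(\<lambda>m. Gv \<kappa> (X (r m))) \<longlonglongrightarrow> Gv \<kappa> x"
    unfolding Gv_def mev_def by (intro tendsto_intros lim) auto
  moreover have "(\<lambda>m. I + 1 / real (Suc (r m))) \<longlonglongrightarrow> I + 0"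
    by (intro tendsto_intros LIMSEQ_subseq_LIMSEQ[OF LIMSEQ_inverse_real_of_nat r(1), unfolded o_def inverse_eq_divide])
  ultimately have "Gv \<kappa> x \<le> I + 0"
    by (rule LIMSEQ_le) (use X(2) in \<open>auto intro: less_imp_le\<close>)
  moreover have "I \<le> Gv \<kappa> y" if "\<forall>j\<ge>N. y j = 0" for y
    unfolding I_def by (rule cInf_lower[OF _ bdd]) (use that in auto)
  ultimately show ?thesis by (intro exI[of _ x]) (auto simp: x_def intro: order_trans)
qed

lemma negative_iff_critical:
  "(\<exists>x. (\<forall>j\<ge>N. x j = 0) \<and> Gv \<kappa> x < 0) \<longleftrightarrow>
   (\<exists>x. (\<forall>j\<ge>N. x j = 0) \<and> (\<forall>i<N. x i ^ 5 = (\<Sum>t\<in>T. poly (crc i t) \<kappa> * mev N x (crd i t))) \<and> Gv \<kappa> x < 0)"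
proof
  assume "\<exists>x. (\<forall>j\<ge>N. x j = 0) \<and> Gv \<kappa> x < 0"
  then obtain y where y: "\<forall>j\<ge>N. y j = 0" "Gv \<kappa> y < 0" by blast
  obtain x where x: "\<forall>j\<ge>N. x j = 0" "\<And>y. (\<forall>j\<ge>N. y j = 0) \<Longrightarrow> Gv \<kappa> x \<le> Gv \<kappa> y"
    using Gv_attains_min by blast
  have "Gv \<kappa> x < 0" using x(2)[OF y(1)] y(2) by simp
  then show "\<exists>x. (\<forall>j\<ge>N. x j = 0) \<and> (\<forall>i<N. x i ^ 5 = (\<Sum>t\<in>T. poly (crc i t) \<kappa> * mev N x (crd i t))) \<and> Gv \<kappa> x < 0"
    using x Gv_critical by blast
qed blast

lemma mev_of_real: "mev N (\<lambda>i. complex_of_real (x i)) h = of_real (mev N x h)"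
  by (simp add: mev_def)

theorem negative_decision:
  "eventually (\<lambda>\<kappa>. (\<exists>x. (\<forall>j\<ge>N. x j = 0) \<and> Gv \<kappa> x < 0) \<longleftrightarrow> neg_index (Bs N) H2 < neg_index (Bs N) H1) at_top"
  using neg_index_correct[of "Bs N" H1] neg_index_correct[of "Bs N" H2]
proof eventually_elim
  case (elim \<kappa>)
  define rcC where "rcC i t = complex_of_real (poly (crc i t) \<kappa>)" for i t
  interpret rq: rquot N T crd rcC
  proof -
    interpret quot N T crd rcC by (rule quot)
    show "rquot N T crd rcC" by unfold_locales (simp add: rcC_def)
  qed
  \<comment> \<open>Specialization at the fixed large \<kappa>: the symbolic normal forms become
    those of a system with real coefficients.\<close>
  have nfC: "complex_of_real (poly (pq.nf h s) \<kappa>) = rq.nf h s" for h s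
    unfolding rcC_def by (rule nf_hom[OF quot, of "\<lambda>p. complex_of_real (poly p \<kappa>)"]) auto
  have tauC: "complex_of_real (poly (pq.tau h) \<kappa>) = rq.tau h" for h
    by (simp add: pq.tau_def rq.tau_def poly_sum nfC)
  define cc where "cc u = complex_of_real (poly (cg u) \<kappa>)" for u
  define A1 where "A1 b' b = (\<Sum>u\<in>TG. cc u * rq.M (dg u) b' b)" for b' b
  define f1 where "f1 z = (\<Sum>u\<in>TG. cc u * mev N z (dg u))" for z
  define A2 where "A2 b' b = (\<Sum>a\<in>Bs N. A1 b' a * A1 a b)" for b' b
  define f2 where "f2 z = f1 z * f1 z" for z
  have p1: "rq.pr A1 f1" unfolding A1_def[abs_def] f1_def[abs_def]
    by (intro rq.pr_sum rq.pr_scale rq.pr_mon dg_mon)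
  have p2: "rq.pr A2 f2" unfolding A2_def[abs_def] f2_def[abs_def] by (rule rq.pr_mult[OF p1 p1])
  have r1: "cnj (A1 b' b) = A1 b' b" for b' b by (simp add: A1_def cc_def rq.M_real)
  have r2: "cnj (A2 b' b) = A2 b' b" for b' b by (simp add: A2_def r1)
  have c1: "f1 (conjS z) = cnj (f1 z)" for z by (simp add: f1_def cc_def mev_conjS)
  have c2: "f2 (conjS z) = cnj (f2 z)" for z by (simp add: f2_def c1)
  have AM: "(\<Sum>a\<in>Bs N. A1 b' a * rq.M h a b) = (\<Sum>u\<in>TG. cc u * rq.M (dg u + h) b' b)"
    if "h \<in> mon N" "b \<in> Bs N" for h b' b
  proof -
    have "(\<Sum>a\<in>Bs N. A1 b' a * rq.M h a b) = (\<Sum>u\<in>TG. cc u * (\<Sum>a\<in>Bs N. rq.M (dg u) b' a * rq.M h a b))"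
      unfolding A1_def sum_distrib_left sum_distrib_right by (subst sum.swap) (simp add: mult.assoc)
    then show ?thesis using that by (simp add: rq.M_mult dg_mon)
  qed
  have h1: "complex_of_real (poly (H1 s t) \<kappa>) = (\<Sum>b\<in>Bs N. \<Sum>a\<in>Bs N. A1 b a * rq.M (s + t) a b)"
    if st: "s \<in> Bs N" "t \<in> Bs N" for s t
  proof -
    have m: "s + t \<in> mon N" using st Bs_mon by auto
    have "(\<Sum>b\<in>Bs N. \<Sum>a\<in>Bs N. A1 b a * rq.M (s + t) a b) = (\<Sum>b\<in>Bs N. \<Sum>u\<in>TG. cc u * rq.M (dg u + (s + t)) b b)"
      by (intro sum.cong refl AM m)
    also have "\<dots> = (\<Sum>u\<in>TG. cc u * rq.tau (dg u + (s + t)))"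
      unfolding rq.tau_def rq.M_def sum_distrib_left by (rule sum.swap)
    finally show ?thesis by (simp add: H1_def poly_sum tauC cc_def)
  qed
  have h2: "complex_of_real (poly (H2 s t) \<kappa>) = (\<Sum>b\<in>Bs N. \<Sum>a\<in>Bs N. A2 b a * rq.M (s + t) a b)"
    if st: "s \<in> Bs N" "t \<in> Bs N" for s t
  proof -
    have m: "s + t \<in> mon N" using st Bs_mon by auto
    have "(\<Sum>a\<in>Bs N. A2 b a * rq.M (s + t) a b) = (\<Sum>u\<in>TG. \<Sum>v\<in>TG. cc u * cc v * rq.M (dg u + dg v + (s + t)) b b)"
      if b: "b \<in> Bs N" for b
    proof -
      have "(\<Sum>a\<in>Bs N. A2 b a * rq.M (s + t) a b) = (\<Sum>c\<in>Bs N. A1 b c * (\<Sum>a\<in>Bs N. A1 c a * rq.M (s + t) a b))"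
        unfolding A2_def sum_distrib_left sum_distrib_right by (subst sum.swap) (simp add: mult.assoc)
      also have "\<dots> = (\<Sum>c\<in>Bs N. A1 b c * (\<Sum>v\<in>TG. cc v * rq.M (dg v + (s + t)) c b))"
        by (simp add: AM m b)
      also have "\<dots> = (\<Sum>v\<in>TG. cc v * (\<Sum>c\<in>Bs N. A1 b c * rq.M (dg v + (s + t)) c b))"
        unfolding sum_distrib_left by (subst sum.swap) (simp add: mult.left_commute)
      also have "\<dots> = (\<Sum>v\<in>TG. cc v * (\<Sum>u\<in>TG. cc u * rq.M (dg u + (dg v + (s + t))) b b))"
        by (intro sum.cong refl arg_cong2[where f = "(*)"] AM) (use m b dg_mon in auto)
      also have "\<dots> = (\<Sum>u\<in>TG. \<Sum>v\<in>TG. cc u * cc v * rq.M (dg u + dg v + (s + t)) b b)"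
        unfolding sum_distrib_left by (subst sum.swap) (simp add: mult_ac add.assoc)
      finally show ?thesis .
    qed
    then have "(\<Sum>b\<in>Bs N. \<Sum>a\<in>Bs N. A2 b a * rq.M (s + t) a b)
       = (\<Sum>b\<in>Bs N. \<Sum>u\<in>TG. \<Sum>v\<in>TG. cc u * cc v * rq.M (dg u + dg v + (s + t)) b b)" by simp
    also have "\<dots> = (\<Sum>u\<in>TG. \<Sum>b\<in>Bs N. \<Sum>v\<in>TG. cc u * cc v * rq.M (dg u + dg v + (s + t)) b b)"
      by (rule sum.swap)
    also have "\<dots> = (\<Sum>u\<in>TG. \<Sum>v\<in>TG. \<Sum>b\<in>Bs N. cc u * cc v * rq.M (dg u + dg v + (s + t)) b b)"
      by (intro sum.cong refl sum.swap)
    also have "\<dots> = (\<Sum>u\<in>TG. \<Sum>v\<in>TG. cc u * cc v * rq.tau (dg u + dg v + (s + t)))"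
      by (simp add: rq.tau_def rq.M_def sum_distrib_left)
    finally show ?thesis by (simp add: H2_def poly_sum tauC cc_def)
  qed
  have count: "neg_index (Bs N) H = card {z\<in>rq.Sol. conjS z = z \<and> Re (f z) < 0} + card {z\<in>rq.Sol. upper z \<and> f z \<noteq> 0}"
    if A: "rq.pr A f" "\<And>b' b. cnj (A b' b) = A b' b" "\<And>z. f (conjS z) = cnj (f z)"
      and H: "\<And>s t. s \<in> Bs N \<Longrightarrow> t \<in> Bs N \<Longrightarrow> complex_of_real (poly (H s t) \<kappa>) = (\<Sum>b\<in>Bs N. \<Sum>a\<in>Bs N. A b a * rq.M (s + t) a b)"
      and el: "\<forall>U lam. hermitian_spectrum (Bs N) (\<lambda>s t. complex_of_real (poly (H s t) \<kappa>)) U lam \<longrightarrow>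
         card {i. i < card (Bs N) \<and> lam i < 0} = neg_index (Bs N) H" for A f H
  proof -
    have "\<exists>(U :: nat \<Rightarrow> (nat \<Rightarrow> nat) \<Rightarrow> complex) (lam :: nat \<Rightarrow> real).
      (\<forall>i<card (Bs N). \<forall>j<card (Bs N). (\<Sum>s\<in>Bs N. cnj (U i s) * U j s) = (if i = j then 1 else 0)) \<and>
      (\<forall>i<card (Bs N). \<forall>s\<in>Bs N. (\<Sum>t\<in>Bs N. complex_of_real (poly (H s t) \<kappa>) * U i t) = of_real (lam i) * U i s)"
    proof (rule hermitian_eigenbasis)
      fix s t assume "s \<in> Bs N" "t \<in> Bs N"
      then have "complex_of_real (poly (H s t) \<kappa>) = complex_of_real (poly (H t s) \<kappa>)"
        by (simp add: H add.commute)
      then show "complex_of_real (poly (H s t) \<kappa>) = cnj (complex_of_real (poly (H t s) \<kappa>))" by simp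
    qed simp
    then obtain U lam where
      "\<forall>i<card (Bs N). \<forall>j<card (Bs N). (\<Sum>s\<in>Bs N. cnj (U i s) * U j s) = (if i = j then 1 else (0::complex))"
      "\<forall>i<card (Bs N). \<forall>s\<in>Bs N. (\<Sum>t\<in>Bs N. complex_of_real (poly (H s t) \<kappa>) * U i t) = of_real (lam i) * U i s"
      by (elim exE conjE)
    then have sp: "hermitian_spectrum (Bs N) (\<lambda>s t. complex_of_real (poly (H s t) \<kappa>)) U lam"
      unfolding hermitian_spectrum_def using finite_Bs by blast
    have "neg_index (Bs N) H = card {i. i < card (Bs N) \<and> lam i < 0}" by (rule el[rule_format, OF sp, symmetric])
    also have "\<dots> = card {z\<in>rq.Sol. conjS z = z \<and> Re (f z) < 0} + card {z\<in>rq.Sol. upper z \<and> f z \<noteq> 0}"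
      by (rule rq.hermite_negative_index[OF A(1) _ A(3) H sp]) (use A(2) in auto)
    finally show ?thesis .
  qed
  have real1: "Im (f1 z) = 0" if "conjS z = z" for z
    using c1[of z] that by (metis Reals_cnj_iff complex_is_Real_iff)
  \<comment> \<open>A real value has nonnegative square, so \<open>H2\<close> counts conjugate pairs
    alone.\<close>
  have e2: "{z\<in>rq.Sol. conjS z = z \<and> Re (f2 z) < 0} = {}"
    using real1 by (auto simp: f2_def not_less)
  have n2: "neg_index (Bs N) H2 = card {z\<in>rq.Sol. upper z \<and> f1 z \<noteq> 0}"
    using count[OF p2 r2 c2 h2 elim(2)] unfolding e2 card.empty by (simp add: f2_def)
  have n1: "neg_index (Bs N) H1 = card {z\<in>rq.Sol. conjS z = z \<and> Re (f1 z) < 0} + card {z\<in>rq.Sol. upper z \<and> f1 z \<noteq> 0}"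
    by (rule count[OF p1 r1 c1 h1 elim(1)])
  have "neg_index (Bs N) H2 < neg_index (Bs N) H1 \<longleftrightarrow> {z\<in>rq.Sol. conjS z = z \<and> Re (f1 z) < 0} \<noteq> {}"
    unfolding n1 n2 using rq.finite_Sol by (simp add: card_gt_0_iff)
  also have "\<dots> \<longleftrightarrow> (\<exists>x. (\<forall>j\<ge>N. x j = 0) \<and> (\<forall>i<N. x i ^ 5 = (\<Sum>t\<in>T. poly (crc i t) \<kappa> * mev N x (crd i t))) \<and> Gv \<kappa> x < 0)"
  proof -
    have f1r: "f1 (\<lambda>i. complex_of_real (x i)) = of_real (Gv \<kappa> x)" for x
      unfolding Gv_terms[symmetric] by (simp add: f1_def cc_def mev_of_real)
    have Sr: "(\<lambda>i. complex_of_real (x i)) \<in> rq.Sol \<longleftrightarrow>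
       (\<forall>j\<ge>N. x j = 0) \<and> (\<forall>i<N. x i ^ 5 = (\<Sum>t\<in>T. poly (crc i t) \<kappa> * mev N x (crd i t)))" for x
    proof -
      have "complex_of_real (x i) ^ 5 = (\<Sum>t\<in>T. rcC i t * mev N (\<lambda>i. complex_of_real (x i)) (crd i t))
        \<longleftrightarrow> x i ^ 5 = (\<Sum>t\<in>T. poly (crc i t) \<kappa> * mev N x (crd i t))" for i
      proof -
        have "(\<Sum>t\<in>T. rcC i t * mev N (\<lambda>i. complex_of_real (x i)) (crd i t))
          = of_real (\<Sum>t\<in>T. poly (crc i t) \<kappa> * mev N x (crd i t))" by (simp add: rcC_def mev_of_real)
        then show ?thesis by (simp only: of_real_power[symmetric] of_real_eq_iff)
      qed
      then show ?thesis by (simp add: rq.Sol_def)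
    qed
    have re: "\<exists>x. z = (\<lambda>i. complex_of_real (x i))" if "conjS z = z" for z
    proof -
      have "Im (z i) = 0" for i
      proof -
        have "cnj (z i) = z i" using fun_cong[OF that, of i] by (simp add: conjS_def)
        then show ?thesis by (simp add: complex_eq_iff)
      qed
      then have "z = (\<lambda>i. complex_of_real (Re (z i)))" by (auto simp: complex_eq_iff)
      then show ?thesis by (rule exI[of _ "\<lambda>i. Re (z i)"])
    qed
    have cr: "conjS (\<lambda>i. complex_of_real (x i)) = (\<lambda>i. complex_of_real (x i))" for x by (simp add: conjS_def)
    show ?thesis
    proof
      assume "{z\<in>rq.Sol. conjS z = z \<and> Re (f1 z) < 0} \<noteq> {}"
      then obtain z where z: "z \<in> rq.Sol" "conjS z = z" "Re (f1 z) < 0" by blast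
      from re[OF z(2)] obtain x where "z = (\<lambda>i. complex_of_real (x i))" by blast
      with z Sr[of x] f1r[of x]
      show "\<exists>x. (\<forall>j\<ge>N. x j = 0) \<and> (\<forall>i<N. x i ^ 5 = (\<Sum>t\<in>T. poly (crc i t) \<kappa> * mev N x (crd i t))) \<and> Gv \<kappa> x < 0"
        by auto
    next
      assume "\<exists>x. (\<forall>j\<ge>N. x j = 0) \<and> (\<forall>i<N. x i ^ 5 = (\<Sum>t\<in>T. poly (crc i t) \<kappa> * mev N x (crd i t))) \<and> Gv \<kappa> x < 0"
      then obtain x where "(\<lambda>i. complex_of_real (x i)) \<in> rq.Sol" "Gv \<kappa> x < 0" using Sr by blast
      then show "{z\<in>rq.Sol. conjS z = z \<and> Re (f1 z) < 0} \<noteq> {}" using f1r[of x] cr[of x] by force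
    qed
  qed
  finally show ?case unfolding negative_iff_critical by blast
qed

end

section \<open>Straight-line computations\<close>

text \<open>The state is the set of functions of the input computed so far. Intermediate results are
  thus shared at no cost, and positions appear only at compilation.\<close>

inductive reach :: "('f set \<Rightarrow> 'f \<Rightarrow> bool) \<Rightarrow> nat \<Rightarrow> 'f set \<Rightarrow> 'f set \<Rightarrow> bool" for G where
  reach_0: "reach G 0 S S"
| reach_Suc: "reach G c S S' \<Longrightarrow> G S' h \<Longrightarrow> reach G (Suc c) S (insert h S')"

definition cmp :: "('f set \<Rightarrow> 'f \<Rightarrow> bool) \<Rightarrow> nat \<Rightarrow> 'f set \<Rightarrow> 'f set \<Rightarrow> bool" where
  "cmp G c S F \<longleftrightarrow> (\<exists>c'\<le>c. \<exists>S'. reach G c' S S' \<and> F \<subseteq> S')"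

lemma reach_subset: "reach G c S S' \<Longrightarrow> S \<subseteq> S'"
  by (induction rule: reach.induct) auto

lemma reach_trans: "reach G c' S' S'' \<Longrightarrow> reach G c S S' \<Longrightarrow> reach G (c + c') S S''"
  by (induction rule: reach.induct) (auto intro: reach_Suc)

locale gates =
  fixes G :: "'f set \<Rightarrow> 'f \<Rightarrow> bool"
  assumes mono: "G S h \<Longrightarrow> S \<subseteq> S' \<Longrightarrow> G S' h"
begin

lemma reach_Un: "reach G c S S' \<Longrightarrow> reach G c (S \<union> T) (S' \<union> T)"
proof (induction rule: reach.induct)
  case (reach_Suc c S S' h)
  have "G (S' \<union> T) h" by (rule mono[OF reach_Suc.hyps(2)]) auto
  from reach.reach_Suc[OF reach_Suc.IH this] show ?case by simp
qed (rule reach_0)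

lemma cmp_subset: "F \<subseteq> S \<Longrightarrow> cmp G c S F"
  unfolding cmp_def by (intro exI[of _ 0] exI[of _ S]) (auto intro: reach_0)

lemma cmp_mono:
  assumes "cmp G c S F" "c \<le> c'" "S \<subseteq> S'" "F' \<subseteq> F"
  shows "cmp G c' S' F'"
proof -
  from assms(1) obtain k R where "k \<le> c" "reach G k S R" "F \<subseteq> R" by (auto simp: cmp_def)
  then have "reach G k (S \<union> S') (R \<union> S')" "k \<le> c'" "F' \<subseteq> R \<union> S'"
    using reach_Un assms by auto
  moreover have "S \<union> S' = S'" using assms(3) by auto
  ultimately show ?thesis unfolding cmp_def by metis
qed

lemma cmp_trans:
  assumes "cmp G c S F" "cmp G c' (S \<union> F) F'"
  shows "cmp G (c + c') S (F \<union> F')"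
proof -
  from assms(1) obtain k R where k: "k \<le> c" "reach G k S R" "F \<subseteq> R" by (auto simp: cmp_def)
  from assms(2) obtain k' R' where k': "k' \<le> c'" "reach G k' (S \<union> F) R'" "F' \<subseteq> R'" by (auto simp: cmp_def)
  have "S \<union> F \<union> R = R" using k(3) reach_subset[OF k(2)] by auto
  then have "reach G k' R (R' \<union> R)" using reach_Un[OF k'(2), of R] by simp
  then have "reach G (k + k') S (R' \<union> R)" using reach_trans k(2) by metis
  then show ?thesis unfolding cmp_def using k k' by (intro exI[of _ "k + k'"]) auto
qed

lemma cmp_trans': "cmp G c S F \<Longrightarrow> cmp G c' (S \<union> F) F' \<Longrightarrow> c + c' \<le> k \<Longrightarrow> cmp G k S F'"
  by (rule cmp_mono[OF cmp_trans]) auto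

lemma cmp_Un:
  assumes "cmp G c S F" "cmp G c' S F'"
  shows "cmp G (c + c') S (F \<union> F')"
  by (rule cmp_trans[OF assms(1) cmp_mono[OF assms(2)]]) auto

lemma cmp_UN:
  assumes "finite I" "\<And>i. i \<in> I \<Longrightarrow> cmp G c S (F i)"
  shows "cmp G (card I * c) S (\<Union>i\<in>I. F i)"
  using assms
proof (induction I rule: finite_induct)
  case empty then show ?case by (simp add: cmp_subset)
next
  case (insert i I)
  have "cmp G (c + card I * c) S (F i \<union> (\<Union>i\<in>I. F i))"
    by (rule cmp_Un) (use insert in auto)
  then show ?case using insert.hyps by simp
qed

text \<open>The form in which tables are filled stage by stage: a stage may use all earlier ones,
  and the costs add.\<close>

lemma cmp_chain:
  assumes "\<And>i. i < n \<Longrightarrow> cmp G c (S \<union> (\<Union>j<i. F j)) (F i)"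
  shows "cmp G (n * c) S (\<Union>i<n. F i)"
  using assms
proof (induction n)
  case 0 show ?case by (simp add: cmp_subset)
next
  case (Suc n)
  have "cmp G (n * c + c) S ((\<Union>i<n. F i) \<union> F n)"
    by (rule cmp_trans) (use Suc in auto)
  then show ?case by (simp add: lessThan_Suc Un_commute add.commute)
qed

lemma cmp_insert: "cmp G c S F \<Longrightarrow> G (S \<union> F) h \<Longrightarrow> cmp G (Suc c) S (insert h F)"
proof -
  assume a: "cmp G c S F" "G (S \<union> F) h"
  have "reach G (Suc 0) (S \<union> F) (insert h (S \<union> F))" by (intro reach_Suc reach_0 a)
  then have "cmp G 1 (S \<union> F) {h}" unfolding cmp_def by (intro exI[of _ "Suc 0"]) auto
  from cmp_trans[OF a(1) this] show ?thesis by simp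
qed

end

text \<open>The four operations that the interpreter decodes. Addition is obtained from two
  subtractions; code 3 is a comparison of the first argument with 0, returned as a number, which is
  how straight-line programs branch.\<close>

definition gop :: "nat \<Rightarrow> real \<Rightarrow> real \<Rightarrow> real" where
  "gop k a b = (if k = 0 then a - b else if k = 1 then a * b else if k = 2 then a / b
     else if a > 0 then 1 else 0)"

definition rgate :: "('x \<Rightarrow> real) set \<Rightarrow> ('x \<Rightarrow> real) \<Rightarrow> bool" where
  "rgate S h \<longleftrightarrow> (\<exists>k\<le>3. \<exists>f\<in>S. \<exists>g\<in>S. h = (\<lambda>x. gop k (f x) (g x)))"

interpretation rg: gates rgate
  by unfold_locales (unfold rgate_def, blast)

abbreviation rcmp where "rcmp \<equiv> cmp rgate"

abbreviation one where "one \<equiv> (\<lambda>_. 1 :: real)"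

lemma rcmp_gate2:
  assumes "rcmp c S {f}" "rcmp c' S {g}" "k \<le> 3"
  shows "rcmp (c + c' + 1) S {\<lambda>x. gop k (f x) (g x)}"
proof -
  have "rcmp (Suc (c + c')) S (insert (\<lambda>x. gop k (f x) (g x)) ({f} \<union> {g}))"
    by (rule rg.cmp_insert[OF rg.cmp_Un[OF assms(1,2)]]) (use assms(3) in \<open>auto simp: rgate_def\<close>)
  then show ?thesis by (rule rg.cmp_mono) auto
qed

lemma rcmp_sub: "rcmp c S {f} \<Longrightarrow> rcmp c' S {g} \<Longrightarrow> rcmp (c + c' + 1) S {\<lambda>x. f x - g x}"
  using rcmp_gate2[of c S f c' g 0] by (simp add: gop_def)

lemma rcmp_mult: "rcmp c S {f} \<Longrightarrow> rcmp c' S {g} \<Longrightarrow> rcmp (c + c' + 1) S {\<lambda>x. f x * g x}"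
  using rcmp_gate2[of c S f c' g 1] by (simp add: gop_def)

lemma rcmp_div: "rcmp c S {f} \<Longrightarrow> rcmp c' S {g} \<Longrightarrow> rcmp (c + c' + 1) S {\<lambda>x. f x / g x}"
  using rcmp_gate2[of c S f c' g 2] by (simp add: gop_def)

lemma rcmp_in: "f \<in> S \<Longrightarrow> rcmp c S {f}"
  by (rule rg.cmp_subset) simp

lemma rcmp_pos: "rcmp c S {f} \<Longrightarrow> rcmp (c + 1) S {\<lambda>x. if f x > 0 then 1 else 0}"
proof -
  assume a: "rcmp c S {f}"
  have "rcmp (Suc c) S (insert (\<lambda>x. gop 3 (f x) (f x)) {f})"
    by (rule rg.cmp_insert[OF a]) (auto simp: rgate_def)
  then have "rcmp (c + 1) S {\<lambda>x. gop 3 (f x) (f x)}" by (rule rg.cmp_mono) auto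
  then show ?thesis by (simp add: gop_def)
qed

lemma rcmp_zero: "one \<in> S \<Longrightarrow> rcmp 1 S {\<lambda>_. 0}"
  using rcmp_sub[OF rcmp_in[of one S 0] rcmp_in[of one S 0]] by simp

lemma rcmp_add:
  assumes "one \<in> S" "rcmp c S {f}" "rcmp c' S {g}"
  shows "rcmp (c + c' + 3) S {\<lambda>x. f x + g x}"
proof -
  have "rcmp (c + (1 + c' + 1) + 1) S {\<lambda>x. f x - (0 - g x)}"
    by (intro rcmp_sub rcmp_zero assms)
  then show ?thesis by (rule rg.cmp_mono) auto
qed

lemma rcmp_nat: "one \<in> S \<Longrightarrow> rcmp (3 * n + 1) S {\<lambda>_. real n}"
proof (induction n)
  case 0 then show ?case using rcmp_zero by simp
next
  case (Suc n)
  from rcmp_add[OF Suc.prems Suc.IH[OF Suc.prems] rcmp_in[OF Suc.prems, of 0]]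
  show ?case by (simp add: add.commute)
qed

lemma rcmp_sum:
  assumes "one \<in> S" "finite I" "\<And>i. i \<in> I \<Longrightarrow> rcmp c S {f i}"
  shows "rcmp (card I * (c + 3) + 1) S {\<lambda>x. \<Sum>i\<in>I. f i x}"
  using assms(2,3)
proof (induction I rule: finite_induct)
  case empty then show ?case using rcmp_zero[OF assms(1)] by simp
next
  case (insert i I)
  from rcmp_add[OF assms(1) insert.prems[of i] insert.IH] insert.prems
  have "rcmp (c + (card I * (c + 3) + 1) + 3) S {\<lambda>x. f i x + (\<Sum>i\<in>I. f i x)}" by auto
  then show ?case using insert.hyps by (simp add: algebra_simps)
qed

text \<open>Without jumps, both branches are evaluated and then blended by the indicator.\<close>

lemma rcmp_if:
  assumes "one \<in> S" "rcmp c S {\<lambda>x. if P x then 1 else 0}" "rcmp c1 S {f}" "rcmp c2 S {g}"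
  shows "rcmp (2 * c + c1 + c2 + 6) S {\<lambda>x. if P x then f x else g x}"
proof -
  have "rcmp (c + c1 + 1 + (0 + c + 1 + c2 + 1) + 3) S
    {\<lambda>x. (if P x then 1 else 0) * f x + (1 - (if P x then 1 else 0)) * g x}"
    by (intro rcmp_add rcmp_mult rcmp_sub rcmp_in assms)
  moreover have "(\<lambda>x. (if P x then 1 else 0) * f x + (1 - (if P x then 1 else 0)) * g x) = (\<lambda>x. if P x then f x else g x)"
    by auto
  ultimately show ?thesis by (auto elim: rg.cmp_mono)
qed

lemma rcmp_nonzero:
  assumes "rcmp c S {f}"
  shows "rcmp (2 * c + 2) S {\<lambda>x. if f x \<noteq> 0 then 1 else 0}"
proof -
  have "rcmp (c + c + 1 + 1) S {\<lambda>x. if f x * f x > 0 then 1 else 0}"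
    by (intro rcmp_pos rcmp_mult assms)
  moreover have "f x * f x > 0 \<longleftrightarrow> f x \<noteq> 0" for x by (auto simp: zero_less_mult_iff)
  ultimately show ?thesis by (simp add: mult_2)
qed

section \<open>Straight-line computations with polynomials of bounded degree\<close>

text \<open>The degree bound is imposed on every gate, so that each value can be represented by
  \<open>J + 1\<close> real coefficients.\<close>

definition pgate :: "nat \<Rightarrow> ('x \<Rightarrow> real poly) set \<Rightarrow> ('x \<Rightarrow> real poly) \<Rightarrow> bool" where
  "pgate J S h \<longleftrightarrow> (\<forall>x. degree (h x) \<le> J) \<and> (\<exists>f\<in>S. \<exists>g\<in>S. h = (\<lambda>x. f x + g x) \<or> h = (\<lambda>x. f x * g x))"

interpretation pg: gates "pgate J" for J
  by unfold_locales (unfold pgate_def, blast)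

abbreviation pcmp where "pcmp J \<equiv> cmp (pgate J)"

definition coeffs_upto :: "nat \<Rightarrow> ('x \<Rightarrow> real poly) set \<Rightarrow> ('x \<Rightarrow> real) set" where
  "coeffs_upto J F = {\<lambda>x. coeff (f x) j | f j. f \<in> F \<and> j \<le> J}"

lemma coeffs_upto_mono: "F \<subseteq> F' \<Longrightarrow> coeffs_upto J F \<subseteq> coeffs_upto J F'"
  by (auto simp: coeffs_upto_def)

lemma coeffs_upto_I: "f \<in> F \<Longrightarrow> j \<le> J \<Longrightarrow> (\<lambda>x. coeff (f x) j) \<in> coeffs_upto J F"
  by (auto simp: coeffs_upto_def)

lemma coeffs_upto_UN: "coeffs_upto J {h} = (\<Union>j\<in>{..J}. {\<lambda>x. coeff (h x) j})"
  by (auto simp: coeffs_upto_def)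

text \<open>The costly case is a product, whose coefficients are convolutions of at most
  \<open>J + 1\<close> terms; this gives \<open>4 * J + 5\<close> real gates for each of the
  \<open>Suc J\<close> coefficients.\<close>

lemma pgate_coeffs:
  assumes "pgate J S h"
  shows "rcmp (Suc J * (4 * J + 5)) (insert one (coeffs_upto J S)) (coeffs_upto J {h})"
proof -
  let ?S = "insert one (coeffs_upto J S)"
  from assms obtain f g where fg: "f \<in> S" "g \<in> S" "h = (\<lambda>x. f x + g x) \<or> h = (\<lambda>x. f x * g x)"
    by (auto simp: pgate_def)
  have "rcmp (4 * J + 5) ?S {\<lambda>x. coeff (h x) j}" if j: "j \<in> {..J}" for j
    using fg(3)
  proof
    assume h: "h = (\<lambda>x. f x + g x)"
    have "rcmp (0 + 0 + 3) ?S {\<lambda>x. coeff (f x) j + coeff (g x) j}"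
      by (intro rcmp_add rcmp_in) (use fg j in \<open>auto intro: coeffs_upto_I\<close>)
    then show ?thesis by (rule rg.cmp_mono) (auto simp: h)
  next
    assume h: "h = (\<lambda>x. f x * g x)"
    have "rcmp (card {..j} * (0 + 0 + 1 + 3) + 1) ?S {\<lambda>x. \<Sum>i\<in>{..j}. coeff (f x) i * coeff (g x) (j - i)}"
      by (intro rcmp_sum rcmp_mult rcmp_in) (use fg j in \<open>auto intro!: coeffs_upto_I\<close>)
    then show ?thesis by (rule rg.cmp_mono) (use j in \<open>auto simp: h coeff_mult\<close>)
  qed
  from rg.cmp_UN[where F = "\<lambda>j. {\<lambda>x. coeff (h x) j}", OF finite_atMost this]
  show ?thesis unfolding coeffs_upto_UN by (simp only: card_atMost)
qed

lemma pcmp_coeffs: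
  assumes "pcmp J c S F"
  shows "rcmp (c * (Suc J * (4 * J + 5))) (insert one (coeffs_upto J S)) (coeffs_upto J F)"
proof -
  from assms obtain k S' where k: "k \<le> c" "reach (pgate J) k S S'" "F \<subseteq> S'" by (auto simp: cmp_def)
  from k(2) have "rcmp (k * (Suc J * (4 * J + 5))) (insert one (coeffs_upto J S)) (coeffs_upto J S')"
  proof (induction rule: reach.induct)
    case (reach_0 S)
    show ?case by (rule rg.cmp_subset) auto
  next
    case (reach_Suc k S S' h)
    have "rcmp (k * (Suc J * (4 * J + 5)) + Suc J * (4 * J + 5)) (insert one (coeffs_upto J S)) (coeffs_upto J S' \<union> coeffs_upto J {h})"
      by (rule rg.cmp_trans[OF reach_Suc.IH rg.cmp_mono[OF pgate_coeffs[OF reach_Suc.hyps(2)]]]) auto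
    then show ?case by (rule rg.cmp_mono) (auto simp: coeffs_upto_def add.commute)
  qed
  then show ?thesis by (rule rg.cmp_mono) (use k coeffs_upto_mono[OF k(3)] in auto)
qed

lemma pcmp_in: "f \<in> S \<Longrightarrow> pcmp J c S {f}"
  by (rule pg.cmp_subset) simp

lemma pcmp_add:
  assumes "pcmp J c S {f}" "pcmp J c' S {g}" "\<And>x. degree (f x) \<le> J" "\<And>x. degree (g x) \<le> J"
  shows "pcmp J (c + c' + 1) S {\<lambda>x. f x + g x}"
proof -
  have "pcmp J (Suc (c + c')) S (insert (\<lambda>x. f x + g x) ({f} \<union> {g}))"
    by (rule pg.cmp_insert[OF pg.cmp_Un[OF assms(1,2)]])
      (use assms(3,4) in \<open>auto simp: pgate_def intro: degree_add_le\<close>)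
  then show ?thesis by (rule pg.cmp_mono) auto
qed

lemma pcmp_mult:
  assumes "pcmp J c S {f}" "pcmp J c' S {g}" "\<And>x. degree (f x * g x) \<le> J"
  shows "pcmp J (c + c' + 1) S {\<lambda>x. f x * g x}"
proof -
  have "pcmp J (Suc (c + c')) S (insert (\<lambda>x. f x * g x) ({f} \<union> {g}))"
    by (rule pg.cmp_insert[OF pg.cmp_Un[OF assms(1,2)]]) (use assms(3) in \<open>auto simp: pgate_def\<close>)
  then show ?thesis by (rule pg.cmp_mono) auto
qed

lemma pcmp_sum:
  assumes "(\<lambda>_. 0) \<in> S" "finite I" "\<And>i. i \<in> I \<Longrightarrow> pcmp J c S {f i}" "\<And>i x. i \<in> I \<Longrightarrow> degree (f i x) \<le> J"
  shows "pcmp J (card I * (c + 1)) S {\<lambda>x. \<Sum>i\<in>I. f i x}"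
  using assms(2,3,4)
proof (induction I rule: finite_induct)
  case empty then show ?case using pcmp_in[OF assms(1)] by simp
next
  case (insert i I)
  have "pcmp J (c + card I * (c + 1) + 1) S {\<lambda>x. f i x + (\<Sum>i\<in>I. f i x)}"
    by (rule pcmp_add) (use insert in \<open>auto intro: degree_sum_le\<close>)
  then show ?case using insert.hyps by (simp add: algebra_simps)
qed

section \<open>Compilation to lists of gates\<close>

fun run_gates :: "(nat \<times> nat \<times> nat) list \<Rightarrow> real list \<Rightarrow> real list" where
  "run_gates [] v = v"
| "run_gates ((k, a, b) # gs) v = run_gates gs (v @ [gop k (v ! a) (v ! b)])"

fun wf_gates :: "(nat \<times> nat \<times> nat) list \<Rightarrow> nat \<Rightarrow> bool" where
  "wf_gates [] n \<longleftrightarrow> True"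
| "wf_gates ((k, a, b) # gs) n \<longleftrightarrow> k \<le> 3 \<and> a < n \<and> b < n \<and> wf_gates gs (Suc n)"

lemma run_gates_append: "run_gates (gs @ hs) v = run_gates hs (run_gates gs v)"
  by (induction gs v rule: run_gates.induct) auto

lemma length_run_gates: "length (run_gates gs v) = length v + length gs"
  by (induction gs v rule: run_gates.induct) auto

lemma wf_gates_append: "wf_gates (gs @ hs) n \<longleftrightarrow> wf_gates gs n \<and> wf_gates hs (n + length gs)"
  by (induction gs n rule: wf_gates.induct) auto

lemma reach_run_gates:
  assumes "reach rgate c (set fs) S'"
  shows "\<exists>gs hs. length gs = c \<and> wf_gates gs (length fs) \<and> set hs = S' \<and> length hs = length fs + c
     \<and> (\<forall>x. run_gates gs (map (\<lambda>f. f x) fs) = map (\<lambda>f. f x) hs)"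
  using assms
proof (induction c "set fs" S' rule: reach.induct)
  case reach_0
  show ?case by (intro exI[of _ "[]"] exI[of _ fs]) auto
next
  case (reach_Suc c S' h)
  then obtain gs hs where gs: "length gs = c" "wf_gates gs (length fs)" "set hs = S'" "length hs = length fs + c"
    "\<And>x. run_gates gs (map (\<lambda>f. f x) fs) = map (\<lambda>f. f x) hs" by auto
  from reach_Suc.hyps(3) gs(3) obtain k f g where k: "k \<le> 3" "f \<in> set hs" "g \<in> set hs" "h = (\<lambda>x. gop k (f x) (g x))"
    by (auto simp: rgate_def)
  then obtain a b where ab: "a < length hs" "hs ! a = f" "b < length hs" "hs ! b = g"
    by (metis in_set_conv_nth)
  show ?case
    by (intro exI[of _ "gs @ [(k, a, b)]"] exI[of _ "hs @ [h]"])
      (use gs k ab in \<open>auto simp: run_gates_append wf_gates_append\<close>)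
qed

text \<open>The computed function is made the last entry by a final gate \<open>[f > 0]\<close>.\<close>

lemma rcmp_run_gates:
  assumes "rcmp c (set fs) {f}"
  shows "\<exists>gs. length gs \<le> Suc c \<and> gs \<noteq> [] \<and> wf_gates gs (length fs)
    \<and> (\<forall>x. last (run_gates gs (map (\<lambda>f. f x) fs)) = (if f x > 0 then 1 else 0))"
proof -
  from assms obtain k S' where k: "k \<le> c" "reach rgate k (set fs) S'" "f \<in> S'" by (auto simp: cmp_def)
  from reach_run_gates[OF k(2)] obtain gs hs where gs: "length gs = k" "wf_gates gs (length fs)" "set hs = S'"
    "length hs = length fs + k" "\<And>x. run_gates gs (map (\<lambda>f. f x) fs) = map (\<lambda>f. f x) hs" by blast
  then obtain a where a: "a < length hs" "hs ! a = f" using k(3) by (metis in_set_conv_nth)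
  show ?thesis
    by (intro exI[of _ "gs @ [(3, a, a)]"]) (use gs k a in \<open>auto simp: run_gates_append wf_gates_append gop_def\<close>)
qed

section \<open>The cost of the decision procedure for quartics\<close>

text \<open>Induction over the exponent of the last variable; the powers of 2 that arise form a
  geometric sum below the next power.\<close>

lemma card_mon_le: "finite {g \<in> mon N. mdeg N g \<le> D} \<and> card {g \<in> mon N. mdeg N g \<le> D} \<le> 2 ^ (N + D)"
proof (induction N arbitrary: D)
  case 0
  have "{g \<in> mon 0. mdeg 0 g \<le> D} = {0}" by (auto simp: mon_def mdeg_def fun_eq_iff)
  then show ?case by simp
next
  case (Suc N)
  let ?A = "\<lambda>D. {g \<in> mon N. mdeg N g \<le> D}"
  let ?U = "\<Union>j\<in>{..D}. (\<lambda>g. g(N := j)) ` ?A (D - j)"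
  have sub: "{g \<in> mon (Suc N). mdeg (Suc N) g \<le> D} \<subseteq> ?U"
  proof
    fix g assume g: "g \<in> {g \<in> mon (Suc N). mdeg (Suc N) g \<le> D}"
    have "mdeg N (g(N := 0)) = (\<Sum>i<N. g i)" unfolding mdeg_def by (rule sum.cong) auto
    then have "g(N := 0) \<in> ?A (D - g N)" "g N \<le> D"
      using g by (auto simp: mon_def mdeg_def not_less_eq_eq dest: Suc_leI le_neq_implies_less)
    moreover have "g = (g(N := 0))(N := g N)" by simp
    ultimately show "g \<in> ?U" by blast
  qed
  have fin: "finite ?U" using Suc by auto
  have "card ?U \<le> (\<Sum>j\<le>D. card ((\<lambda>g. g(N := j)) ` ?A (D - j)))" by (rule card_UN_le) simp
  also have "\<dots> \<le> (\<Sum>j\<le>D. 2 ^ (N + (D - j)))"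
    by (intro sum_mono order_trans[OF card_image_le]) (use Suc in blast)+
  also have "\<dots> = (\<Sum>j\<le>D. 2 ^ (N + j))"
    by (rule sum.reindex_bij_witness[of _ "\<lambda>j. D - j" "\<lambda>j. D - j"]) auto
  also have "\<dots> \<le> 2 ^ (Suc N + D)"
  proof -
    have "(\<Sum>j\<le>D. (2::nat) ^ (N + j)) + 2 ^ N = 2 ^ (Suc N + D)" by (induction D) auto
    then show ?thesis by linarith
  qed
  finally have "card ?U \<le> 2 ^ (Suc N + D)" .
  then show ?case using fin sub card_mono[OF fin sub] finite_subset[OF sub fin] by linarith
qed

lemma card_Bs: "card (Bs N) = 5 ^ N"
proof -
  have "bij_betw (\<lambda>f i. if i < N then f i else 0) (PiE {..<N} (\<lambda>_. {..<5::nat})) (Bs N)"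
    by (rule bij_betw_byWitness[of _ "\<lambda>g. restrict g {..<N}"])
      (auto simp: Bs_def mon_def PiE_def extensional_def fun_eq_iff Pi_def restrict_def)
  then have "card (Bs N) = card (PiE {..<N} (\<lambda>_. {..<5::nat}))" by (rule bij_betw_same_card[symmetric])
  then show ?thesis by (simp add: card_PiE)
qed

lemma mdeg_Bs: "s \<in> Bs N \<Longrightarrow> mdeg N s \<le> 4 * N"
  using sum_bounded_above[of "{..<N}" s 4] by (force simp: Bs_def mdeg_def)

lemma neg1_poly: "(-1 :: real poly) ^ i = [:(-1) ^ i:]"
  by (induction i) (auto simp: one_pCons)

lemma degree_power_neg1: "degree ((-1 :: real poly) ^ i) = 0"
  by (simp add: neg1_poly)

lemma degree_mpow:
  assumes "finite S" "\<And>s t. s \<in> S \<Longrightarrow> t \<in> S \<Longrightarrow> degree (H s t) \<le> D" "s \<in> S" "t \<in> S"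
  shows "degree (mpow S H k s t :: real poly) \<le> k * D"
  using assms(3)
proof (induction k arbitrary: s)
  case (Suc k)
  have "degree (H s r * mpow S H k r t) \<le> D + k * D" if "r \<in> S" for r
    by (rule order_trans[OF degree_mult_le add_mono]) (use assms Suc that in auto)
  then show ?case by (auto intro!: degree_sum_le assms(1))
qed simp

lemma degree_newt:
  assumes "\<And>i. degree (p i) \<le> i * D"
  shows "degree (newt p k) \<le> k * D"
proof (induction k rule: less_induct)
  case (less k)
  show ?case
  proof (cases k)
    case 0 then show ?thesis by simp
  next
    case (Suc m)
    have "degree ((-1) ^ i * newt p (m - i) * p (Suc i)) \<le> Suc m * D" if "i \<le> m" for i
    proof -
      have "degree ((-1) ^ i * newt p (m - i) * p (Suc i)) \<le> 0 + (m - i) * D + Suc i * D"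
        using less[of "m - i"] assms[of "Suc i"] Suc
        by (intro order_trans[OF degree_mult_le add_mono]) (auto simp: degree_power_neg1)
      also have "\<dots> = Suc m * D" using that by (simp add: distrib_right[symmetric])
      finally show ?thesis .
    qed
    then show ?thesis unfolding Suc newt.simps
      by (intro order_trans[OF degree_smult_le]) (auto intro!: degree_sum_le)
  qed
qed

text \<open>The reciprocals are the factors in Newton's recursion, and 1 and -1 supply its
  alternating signs.\<close>

definition base_consts :: "nat \<Rightarrow> real set" where
  "base_consts m = {0, 1, -1} \<union> (\<lambda>k. 1 / real (Suc k)) ` {..<m}"

text \<open>The three summands of the cost are the matrix powers, their traces and Newton's
  recursion. With entries of degree at most \<open>D\<close>, the objects of index k have degree at
  most k D, whence the requirement on \<open>J\<close>.\<close>

lemma pcmp_newt: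
  fixes H :: "'x \<Rightarrow> 's \<Rightarrow> 's \<Rightarrow> real poly"
  assumes B: "finite B" "card B = m" and S: "(\<lambda>c _. [:c:]) ` base_consts m \<subseteq> S"
    and HS: "\<And>s t. s \<in> B \<Longrightarrow> t \<in> B \<Longrightarrow> (\<lambda>x. H x s t) \<in> S"
    and deg: "\<And>x s t. s \<in> B \<Longrightarrow> t \<in> B \<Longrightarrow> degree (H x s t) \<le> D" and J: "m * D \<le> J"
  shows "pcmp J (Suc m * (m * m * (2 * m)) + Suc m * m + Suc m * (3 * m + 4)) S (\<Union>k\<in>{..m}. {\<lambda>x. newt (ptr B (H x)) k})"
proof -
  have dm: "degree (mpow B (H x) k s t) \<le> k * D" if "s \<in> B" "t \<in> B" for x k s t
    by (rule degree_mpow) (use B deg that in auto)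
  have dt: "degree (ptr B (H x) k) \<le> k * D" for x k
    unfolding ptr_def by (intro degree_sum_le) (use dm B in auto)
  have dn: "degree (newt (ptr B (H x)) k) \<le> k * D" for x k
    by (rule degree_newt) (rule dt)
  have le: "k * D \<le> J" if "k \<le> m" for k using that J by (meson mult_le_mono1 order_trans)
  have z: "(\<lambda>_. 0) \<in> S" and o: "(\<lambda>_. 1) \<in> S" and n: "(\<lambda>_. [:(-1) ^ i:]) \<in> S" for i
  proof -
    show "(\<lambda>_. 0) \<in> S" using S by (auto simp: base_consts_def)
    show "(\<lambda>_. 1) \<in> S" using S by (auto simp: base_consts_def one_pCons)
    have "(-1 :: real) ^ i = 1 \<or> (-1 :: real) ^ i = -1" by (metis neg_one_even_power neg_one_odd_power)
    then show "(\<lambda>_. [:(-1) ^ i:]) \<in> S" using S by (auto simp: base_consts_def)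
  qed
  define F where "F k = (\<Union>st\<in>B \<times> B. {\<lambda>x. mpow B (H x) k (fst st) (snd st)})" for k
  have c1: "pcmp J (Suc m * (m * m * (2 * m))) S (\<Union>k<Suc m. F k)"
  proof (rule pg.cmp_chain)
    fix k assume k: "k < Suc m"
    have "pcmp J (card (B \<times> B) * (2 * m)) (S \<union> (\<Union>j<k. F j)) (F k)"
      unfolding F_def[of k]
    proof (rule pg.cmp_UN)
      fix st assume "st \<in> B \<times> B"
      then obtain s t where st: "st = (s, t)" "s \<in> B" "t \<in> B" by auto
      show "pcmp J (2 * m) (S \<union> (\<Union>j<k. F j)) {\<lambda>x. mpow B (H x) k (fst st) (snd st)}"
      proof (cases k)
        case 0
        then show ?thesis using z o by (cases "s = t") (auto simp: st intro!: pcmp_in)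
      next
        case (Suc j)
        have "pcmp J (card B * (0 + 0 + 1 + 1)) (S \<union> (\<Union>j<k. F j)) {\<lambda>x. \<Sum>r\<in>B. H x s r * mpow B (H x) j r t}"
        proof (intro pcmp_sum pcmp_mult pcmp_in)
          fix r assume r: "r \<in> B"
          show "(\<lambda>x. mpow B (H x) j r t) \<in> S \<union> (\<Union>j<k. F j)"
            using r st Suc by (auto simp: F_def intro!: bexI[of _ j] bexI[of _ "(r, t)"])
          have "degree (H x s r * mpow B (H x) j r t) \<le> D + j * D" for x
            by (rule order_trans[OF degree_mult_le add_mono[OF deg dm]]) (use r st in auto)
          moreover have "D + j * D \<le> J" using le[of k] k Suc by simp
          ultimately show "\<And>x. degree (H x s r * mpow B (H x) j r t) \<le> J" "\<And>x. degree (H x s r * mpow B (H x) j r t) \<le> J"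
            by (meson order_trans)+
        qed (use z HS st B in auto)
        then show ?thesis by (rule pg.cmp_mono) (auto simp: B st Suc)
      qed
    qed (use B in auto)
    then show "pcmp J (m * m * (2 * m)) (S \<union> (\<Union>j<k. F j)) (F k)" by (simp add: B card_cartesian_product)
  qed
  define P where "P = (\<Union>k\<in>{..m}. {\<lambda>x. ptr B (H x) k})"
  define S1 where "S1 = S \<union> (\<Union>k<Suc m. F k)"
  have "pcmp J (card {..m} * m) S1 P"
    unfolding P_def
  proof (rule pg.cmp_UN)
    fix k assume k: "k \<in> {..m}"
    have "pcmp J (card B * (0 + 1)) S1 {\<lambda>x. \<Sum>s\<in>B. mpow B (H x) k s s}"
    proof (intro pcmp_sum pcmp_in)
      fix s assume s: "s \<in> B"
      show "(\<lambda>x. mpow B (H x) k s s) \<in> S1"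
        using s k by (auto simp: F_def S1_def intro!: bexI[of _ k] bexI[of _ "(s, s)"])
      show "degree (mpow B (H x) k s s) \<le> J" for x using dm[OF s s, of x k] le[of k] k by simp
    qed (use z B in \<open>auto simp: S1_def\<close>)
    then show "pcmp J m S1 {\<lambda>x. ptr B (H x) k}" by (simp add: B ptr_def)
  qed simp
  then have c2: "pcmp J (Suc m * m) S1 P" by simp
  define S2 where "S2 = S1 \<union> P"
  define R where "R k = {\<lambda>x. newt (ptr B (H x)) k}" for k
  have "pcmp J (Suc m * (3 * m + 4)) S2 (\<Union>k<Suc m. R k)"
  proof (rule pg.cmp_chain)
    fix k assume k: "k < Suc m"
    show "pcmp J (3 * m + 4) (S2 \<union> (\<Union>j<k. R j)) (R k)"
    proof (cases k)
      case 0
      then show ?thesis using o by (auto simp: R_def S2_def S1_def intro!: pcmp_in)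
    next
      case (Suc j)
      let ?S = "S2 \<union> (\<Union>j<k. R j)"
      have d: "degree ((-1) ^ i * newt (ptr B (H x)) (j - i) * ptr B (H x) (Suc i)) \<le> J"
        "degree ([:(-1) ^ i:] * newt (ptr B (H x)) (j - i)) \<le> J"
        "degree ([:(-1) ^ i:] * newt (ptr B (H x)) (j - i) * ptr B (H x) (Suc i)) \<le> J" if "i \<in> {..j}" for x i
      proof -
        have "degree ((-1) ^ i * newt (ptr B (H x)) (j - i) * ptr B (H x) (Suc i)) \<le> 0 + (j - i) * D + Suc i * D"
          by (intro order_trans[OF degree_mult_le add_mono] dn dt) (simp add: degree_power_neg1)
        also have "\<dots> = Suc j * D" using that by (simp add: distrib_right[symmetric])
        also have "\<dots> \<le> J" using le[of k] k Suc by simp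
        finally show 1: "degree ((-1) ^ i * newt (ptr B (H x)) (j - i) * ptr B (H x) (Suc i)) \<le> J" .
        then show "degree ([:(-1) ^ i:] * newt (ptr B (H x)) (j - i) * ptr B (H x) (Suc i)) \<le> J"
          by (simp only: neg1_poly)
        have "degree ([:(-1) ^ i:] * newt (ptr B (H x)) (j - i)) \<le> 0 + (j - i) * D"
          by (intro order_trans[OF degree_mult_le add_mono] dn) simp
        also have "\<dots> \<le> J" using le[of "j - i"] k Suc by simp
        finally show "degree ([:(-1) ^ i:] * newt (ptr B (H x)) (j - i)) \<le> J" .
      qed
      have s: "pcmp J (card {..j} * (0 + 0 + 1 + 0 + 1 + 1)) ?S {\<lambda>x. \<Sum>i\<in>{..j}. [:(-1) ^ i:] * newt (ptr B (H x)) (j - i) * ptr B (H x) (Suc i)}"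
      proof (intro pcmp_sum pcmp_mult pcmp_in)
        fix i assume i: "i \<in> {..j}"
        show "(\<lambda>x. newt (ptr B (H x)) (j - i)) \<in> ?S" using Suc by (auto simp: R_def)
        show "(\<lambda>x. ptr B (H x) (Suc i)) \<in> ?S" using i Suc k by (auto simp: S2_def P_def)
      qed (use z n d in \<open>auto simp: S2_def S1_def\<close>)
      have "(\<lambda>_. [:1 / real (Suc j):]) \<in> ?S"
        using S k Suc by (auto simp: S2_def S1_def base_consts_def)
      then have "pcmp J (0 + card {..j} * (0 + 0 + 1 + 0 + 1 + 1) + 1) ?S
        {\<lambda>x. [:1 / real (Suc j):] * (\<Sum>i\<in>{..j}. [:(-1) ^ i:] * newt (ptr B (H x)) (j - i) * ptr B (H x) (Suc i))}"
      proof (intro pcmp_mult s pcmp_in)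
        fix x
        show "degree ([:1 / real (Suc j):] * (\<Sum>i\<in>{..j}. [:(-1) ^ i:] * newt (ptr B (H x)) (j - i) * ptr B (H x) (Suc i))) \<le> J"
          using d(3) by (intro order_trans[OF degree_mult_le]) (auto intro!: degree_sum_le)
      qed
      moreover have "(\<lambda>x. [:1 / real (Suc j):] * (\<Sum>i\<in>{..j}. [:(-1) ^ i:] * newt (ptr B (H x)) (j - i) * ptr B (H x) (Suc i)))
        = (\<lambda>x. newt (ptr B (H x)) k)"
        unfolding Suc newt.simps neg1_poly by simp
      ultimately show ?thesis unfolding R_def by (auto elim!: pg.cmp_mono) (use k Suc in auto)
    qed
  qed
  then have c3: "pcmp J (Suc m * (3 * m + 4)) (S1 \<union> P) (\<Union>k\<in>{..m}. {\<lambda>x. newt (ptr B (H x)) k})"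
    by (simp add: S2_def R_def lessThan_Suc_atMost)
  show ?thesis
    by (rule pg.cmp_trans'[OF c1[folded] pg.cmp_trans'[OF c2[unfolded S1_def] c3[unfolded S1_def]]]) auto
qed

text \<open>\<open>L j\<close> is the topmost nonzero coefficient among those up to index
  \<open>j\<close>; from the degree on it no longer changes.\<close>

lemma rcmp_lead_coeff:
  assumes "one \<in> S" "\<And>j. j \<le> J \<Longrightarrow> (\<lambda>x. coeff (f x) j) \<in> S" "\<And>x. degree (f x) \<le> J"
  shows "rcmp (10 * J) S {\<lambda>x. lead_coeff (f x)}"
proof -
  define L where "L j x = rec_nat (coeff (f x) 0) (\<lambda>j l. if coeff (f x) (Suc j) \<noteq> 0 then coeff (f x) (Suc j) else l) j" for j x
  have L0: "L 0 = (\<lambda>x. coeff (f x) 0)" and LS: "L (Suc j) = (\<lambda>x. if coeff (f x) (Suc j) \<noteq> 0 then coeff (f x) (Suc j) else L j x)" for j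
    by (simp_all add: L_def fun_eq_iff)
  have lead: "L j x = lead_coeff (f x)" if "degree (f x) \<le> j" for j x
    using that
  proof (induction j)
    case (Suc j)
    show ?case
    proof (cases "degree (f x) = Suc j")
      case True
      then have "coeff (f x) (Suc j) \<noteq> 0" by (metis degree_0 leading_coeff_0_iff nat.distinct(1))
      then show ?thesis using True by (simp add: LS)
    next
      case False
      then have "degree (f x) \<le> j" using Suc.prems by simp
      then show ?thesis using Suc.IH by (simp add: LS coeff_eq_0)
    qed
  qed (simp add: L0)
  have "j \<le> J \<Longrightarrow> rcmp (10 * j) S {L j}" for j
  proof (induction j)
    case 0 then show ?case using assms by (auto simp: L0 intro!: rcmp_in)
  next
    case (Suc j)
    have c: "rcmp 0 S {\<lambda>x. coeff (f x) (Suc j)}" by (intro rcmp_in assms Suc.prems)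
    have "rcmp (2 * (2 * 0 + 2) + 0 + 10 * j + 6) S {\<lambda>x. if coeff (f x) (Suc j) \<noteq> 0 then coeff (f x) (Suc j) else L j x}"
      by (rule rcmp_if[OF assms(1) rcmp_nonzero[OF c] c]) (use Suc in auto)
    then show ?case unfolding LS by (rule rg.cmp_mono) auto
  qed
  moreover have "L J = (\<lambda>x. lead_coeff (f x))" by (rule ext) (rule lead[OF assms(3)])
  ultimately show ?thesis by (metis order_refl)
qed

lemma rcmp_sign_changes:
  assumes o: "one \<in> S" and e: "\<And>k. k < K \<Longrightarrow> (\<lambda>x. e x k) \<in> S"
  shows "rcmp (30 * K + 1) S {\<lambda>x. last_sign (e x) K, \<lambda>x. real (sign_changes (e x) K)}"
  using e
proof (induction K)
  case 0 then show ?case using rcmp_zero[OF o] by simp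
next
  case (Suc K)
  let ?F = "{\<lambda>x. last_sign (e x) K, \<lambda>x. real (sign_changes (e x) K)}"
  let ?S = "S \<union> ?F"
  have o': "one \<in> ?S" using o by simp
  have eK: "(\<lambda>x. e x K) \<in> ?S" using Suc.prems by simp
  have "rcmp (2 * (2 * 0 + 2) + (0 + 1 + (1 + 0 + 1 + 1) + 1) + 0 + 6) ?S
     {\<lambda>x. if e x K \<noteq> 0 then (if e x K > 0 then 1 else 0) - (if 0 - e x K > 0 then 1 else 0) else last_sign (e x) K}"
    by (intro rcmp_if rcmp_nonzero rcmp_sub rcmp_pos rcmp_in rcmp_zero o' eK) auto
  moreover have "(\<lambda>x. if e x K \<noteq> 0 then (if e x K > 0 then 1 else 0) - (if 0 - e x K > 0 then 1 else 0) else last_sign (e x) K)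
     = (\<lambda>x. last_sign (e x) (Suc K))" by (auto simp: sgn_if)
  ultimately have 1: "rcmp 15 ?S {\<lambda>x. last_sign (e x) (Suc K)}" by simp
  have "rcmp (0 + (1 + (0 + 0 + 1) + 1 + 1) + 3) ?S
    {\<lambda>x. real (sign_changes (e x) K) + (if 0 - e x K * last_sign (e x) K > 0 then 1 else 0)}"
    by (intro rcmp_add rcmp_pos rcmp_sub rcmp_mult rcmp_in rcmp_zero o' eK) auto
  moreover have "(\<lambda>x. real (sign_changes (e x) K) + (if 0 - e x K * last_sign (e x) K > 0 then 1 else 0))
     = (\<lambda>x. real (sign_changes (e x) (Suc K)))" by auto
  ultimately have 2: "rcmp 15 ?S {\<lambda>x. real (sign_changes (e x) (Suc K))}"
    by (auto elim!: rg.cmp_mono)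
  have "rcmp (30 * K + 1) S ?F" using Suc by auto
  from rg.cmp_trans'[OF this rg.cmp_Un[OF 1 2], of "30 * Suc K + 1"]
  show ?case by (simp add: insert_commute)
qed

section \<open>One straight-line program for a family of quartics\<close>

text \<open>The exponents \<open>g\<close> do not depend on the input \<open>x\<close>, only the
  coefficients do; hence the order of operations is the same for all inputs.\<close>

locale quartic_family =
  fixes N :: nat and T :: "'t set" and b :: "'x \<Rightarrow> 't \<Rightarrow> real" and g :: "'t \<Rightarrow> nat \<Rightarrow> nat"
  assumes Q: "\<And>x. quartic N T (b x) g" and N: "1 \<le> N" and cT: "card T \<le> (N + 1) ^ 4"
begin

abbreviation "crdx \<equiv> quartic.crd g"
abbreviation "crcx x \<equiv> quartic.crc (b x) g"
abbreviation "nfx x \<equiv> quot.nf N T crdx (crcx x)"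
abbreviation "taux x \<equiv> quot.tau N T crdx (crcx x)"
abbreviation "TGx \<equiv> quartic.TG N T"
abbreviation "cgx x \<equiv> quartic.cg N (b x)"
abbreviation "dgx \<equiv> quartic.dg N g"
abbreviation "H1x x \<equiv> quartic.H1 N T (b x) g"
abbreviation "H2x x \<equiv> quartic.H2 N T (b x) g"

lemma quot: "quot N T crdx"
  by (rule quartic.quot[OF Q])

lemma finT: "finite T"
  using Q quartic.finT by metis

lemma finTG: "finite TGx"
  by (rule quartic.finTG[OF Q])

lemma card_TG: "card TGx \<le> card T + N + 1"
  unfolding quartic.TG_def[OF Q]
  by (rule order_trans[OF card_Un_le]) (simp add: card_image)

text \<open>A reduction multiplies by a coefficient of degree at most 2 in \<kappa>, while the
  monomial degree drops by at least 2, because x_i^5 is replaced by monomials of degree at most 3.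
  Where the exponent of x_i was not lowered, the coefficient is 0.\<close>

lemma degree_nf: "degree (nfx x h s) \<le> mdeg N h"
proof (induction "mdeg N h" arbitrary: h rule: less_induct)
  case less
  interpret q: quartic N T "b x" g by (rule Q)
  show ?case
  proof (cases "\<exists>i<N. 5 \<le> h i")
    case True
    then obtain i where i: "i < N" "5 \<le> h i" by blast
    have "degree (crcx x i t * nfx x (h - ex i 5 + crdx i t) s) \<le> mdeg N h" if t: "t \<in> T" for t
    proof (cases "g t i = 0")
      case True
      then show ?thesis by (simp add: q.crc_def)
    next
      case False
      have "mdeg N (crdx i t) + 1 = mdeg N (g t)"
        unfolding q.crd_def by (rule mdeg_diff_ex) (use i False in auto)
      moreover have "mdeg N (h - ex i 5) + 5 = mdeg N h" by (rule mdeg_diff_ex) (use i in auto)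
      ultimately have 1: "mdeg N (h - ex i 5 + crdx i t) + 2 \<le> mdeg N h"
        using q.g_deg[OF t] by (simp add: mdeg_add)
      have "degree (crcx x i t) \<le> 2" by (simp add: q.crc_def degree_monom_le)
      moreover have "degree (nfx x (h - ex i 5 + crdx i t) s) \<le> mdeg N (h - ex i 5 + crdx i t)"
        by (rule less) (use 1 in simp)
      ultimately show ?thesis using 1 degree_mult_le[of "crcx x i t" "nfx x (h - ex i 5 + crdx i t) s"] by linarith
    qed
    then show ?thesis unfolding q.pq.nf_reduce[where g = h, OF i] by (intro degree_sum_le finT)
  next
    case False
    then show ?thesis by (subst q.pq.nf.simps) auto
  qed
qed

lemma degree_tau: "degree (taux x h) \<le> mdeg N h + 4 * N"
proof -
  interpret q: quartic N T "b x" g by (rule Q)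
  have "degree (nfx x (s + h) s) \<le> mdeg N h + 4 * N" if "s \<in> Bs N" for s
    using degree_nf[of x "s + h" s] mdeg_Bs[OF that] by (simp add: mdeg_add)
  then show ?thesis unfolding q.pq.tau_def by (intro degree_sum_le) auto
qed

lemma degree_cg: "degree (cgx x u) \<le> 2"
  unfolding quartic.cg_def[OF Q] by (auto split: sum.split simp: degree_monom_le intro: order_trans[OF degree_monom_le])

lemma mdeg_dg: "u \<in> TGx \<Longrightarrow> mdeg N (dgx u) \<le> 6"
proof -
  assume u: "u \<in> TGx"
  have "mdeg N (g t) \<le> 6" if "t \<in> T" for t
    using quartic.g_deg[OF Q that] by simp
  then show ?thesis using u by (auto simp: quartic.dg_def[OF Q] quartic.TG_def[OF Q] mdeg_def[of N 0])
qed

lemma dg_mon: "u \<in> TGx \<Longrightarrow> dgx u \<in> mon N"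
  by (rule quartic.dg_mon[OF Q])

text \<open>Two coefficients of degree 2, a monomial of degree at most 6 + 6 + 8 N, and 4 N more for
  taking the trace: this is the origin of \<open>12 * N + 16\<close>.\<close>

lemma degree_H_terms:
  assumes "u \<in> TGx" "v \<in> TGx" "s \<in> Bs N" "t \<in> Bs N"
  shows "degree (cgx x u * taux x (dgx u + (s + t))) \<le> 12 * N + 16"
    "degree (cgx x u * cgx x v) \<le> 12 * N + 16"
    "degree (cgx x u * cgx x v * taux x (dgx u + dgx v + (s + t))) \<le> 12 * N + 16"
proof -
  note d = degree_cg[of x u] degree_cg[of x v] mdeg_dg[OF assms(1)] mdeg_dg[OF assms(2)]
    mdeg_Bs[OF assms(3)] mdeg_Bs[OF assms(4)]
  show "degree (cgx x u * taux x (dgx u + (s + t))) \<le> 12 * N + 16"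
    using d degree_tau[of x "dgx u + (s + t)"] degree_mult_le[of "cgx x u" "taux x (dgx u + (s + t))"]
    by (simp add: mdeg_add)
  show 1: "degree (cgx x u * cgx x v) \<le> 12 * N + 16"
    using d degree_mult_le[of "cgx x u" "cgx x v"] by simp
  show "degree (cgx x u * cgx x v * taux x (dgx u + dgx v + (s + t))) \<le> 12 * N + 16"
    using d degree_mult_le[of "cgx x u" "cgx x v"] degree_tau[of x "dgx u + dgx v + (s + t)"]
      degree_mult_le[of "cgx x u * cgx x v" "taux x (dgx u + dgx v + (s + t))"]
    by (simp add: mdeg_add)
qed

lemma degree_H:
  assumes "s \<in> Bs N" "t \<in> Bs N"
  shows "degree (H1x x s t) \<le> 12 * N + 16" "degree (H2x x s t) \<le> 12 * N + 16"
  unfolding quartic.H1_def[OF Q] quartic.H2_def[OF Q]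
  by (intro degree_sum_le finTG degree_H_terms(1) degree_H_terms(3) assms; assumption)+

definition nf_set :: "nat \<Rightarrow> ('x \<Rightarrow> real poly) set" where
  "nf_set d = (\<Union>hs\<in>{h \<in> mon N. mdeg N h = d} \<times> Bs N. {\<lambda>x. nfx x (fst hs) (snd hs)})"

text \<open>The bound \<open>8 * N + 12\<close> covers two terms of degree 6 together with two basis
  monomials of degree at most 4 N each.\<close>

definition tau_set :: "('x \<Rightarrow> real poly) set" where
  "tau_set = (\<Union>h\<in>{h \<in> mon N. mdeg N h \<le> 8 * N + 12}. {\<lambda>x. taux x h})"

definition H_set :: "('x \<Rightarrow> real poly) set" where
  "H_set = (\<Union>st\<in>Bs N \<times> Bs N. {\<lambda>x. H1x x (fst st) (snd st), \<lambda>x. H2x x (fst st) (snd st)})"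

text \<open>Tabulation by degree: a reduction refers only to monomials of smaller degree, whose
  coordinates are already in the table, so each entry costs one product and one addition per term of
  \<open>T\<close>.\<close>

lemma pcmp_nf:
  assumes S: "(\<lambda>_. 0) \<in> S" "(\<lambda>_. 1) \<in> S" "\<And>i t. i < N \<Longrightarrow> t \<in> T \<Longrightarrow> (\<lambda>x. crcx x i t) \<in> S" and J: "D \<le> J"
  shows "pcmp J (Suc D * (2 ^ (N + D) * 5 ^ N * (2 * card T))) S (\<Union>d<Suc D. nf_set d)"
proof (rule pg.cmp_chain)
  fix d assume d: "d < Suc D"
  let ?S = "S \<union> (\<Union>j<d. nf_set j)" and ?I = "{h \<in> mon N. mdeg N h = d} \<times> Bs N"
  have sub: "{h \<in> mon N. mdeg N h = d} \<subseteq> {h \<in> mon N. mdeg N h \<le> D}" using d by auto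
  have fin: "finite {h \<in> mon N. mdeg N h = d}" using finite_subset[OF sub] card_mon_le[of N D] by blast
  have "card {h \<in> mon N. mdeg N h = d} \<le> 2 ^ (N + D)"
    using card_mono[OF _ sub] card_mon_le[of N D] by linarith
  then have cI: "card ?I \<le> 2 ^ (N + D) * 5 ^ N" by (simp add: card_cartesian_product card_Bs)
  have "pcmp J (card ?I * (2 * card T)) ?S (nf_set d)"
    unfolding nf_set_def[of d]
  proof (rule pg.cmp_UN)
    fix hs assume "hs \<in> ?I"
    then obtain h s where hs: "hs = (h, s)" "h \<in> mon N" "mdeg N h = d" "s \<in> Bs N" by auto
    show "pcmp J (2 * card T) ?S {\<lambda>x. nfx x (fst hs) (snd hs)}"
      using hs(2)
    proof (cases rule: quot.mon_cases[OF quot, consumes 1])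
      case 1
      then have "(\<lambda>x. nfx x h s) = (\<lambda>_. if s = h then 1 else 0)"
        by (auto simp: quot.nf_basis[OF quot])
      then show ?thesis using S(1,2) by (auto simp: hs(1) intro!: pcmp_in)
    next
      case (2 i)
      have eq: "(\<lambda>x. nfx x h s) = (\<lambda>x. \<Sum>t\<in>T. crcx x i t * nfx x (h - ex i 5 + crdx i t) s)"
        by (rule ext) (rule quot.nf_reduce[where g = h, OF quot 2])
      have lt: "mdeg N (h - ex i 5 + crdx i t) < d" if "t \<in> T" for t
        using quot.reduce_deg[where g = h, OF quot 2 that] hs by simp
      have "pcmp J (card T * (0 + 0 + 1 + 1)) ?S {\<lambda>x. \<Sum>t\<in>T. crcx x i t * nfx x (h - ex i 5 + crdx i t) s}"
      proof (intro pcmp_sum pcmp_mult pcmp_in finT)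
        fix t assume t: "t \<in> T"
        show "(\<lambda>x. crcx x i t) \<in> ?S" using S(3) 2 t by simp
        have "h - ex i 5 + crdx i t \<in> mon N" using hs quot.rd_mon[OF quot 2(1) t] by simp
        then show "(\<lambda>x. nfx x (h - ex i 5 + crdx i t) s) \<in> ?S"
          using lt[OF t] hs unfolding nf_set_def
          by (intro UnI2 UN_I[of "mdeg N (h - ex i 5 + crdx i t)"] UN_I[of "(h - ex i 5 + crdx i t, s)"]) auto
        have "degree (crcx x i t * nfx x (h - ex i 5 + crdx i t) s) \<le> J" for x
        proof -
          interpret q: quartic N T "b x" g by (rule Q)
          show ?thesis
          proof (cases "g t i = 0")
            case True then show ?thesis by (simp add: q.crc_def)
          next
            case False
            have "mdeg N (crdx i t) + 1 = mdeg N (g t)"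
              unfolding q.crd_def by (rule mdeg_diff_ex) (use 2 False in auto)
            moreover have "mdeg N (h - ex i 5) + 5 = mdeg N h" by (rule mdeg_diff_ex) (use 2 in auto)
            ultimately have 1: "mdeg N (h - ex i 5 + crdx i t) + 2 \<le> mdeg N h"
              using q.g_deg[OF t] by (simp add: mdeg_add)
            have "degree (crcx x i t) \<le> 2" by (simp add: q.crc_def degree_monom_le)
            then show ?thesis using 1 hs(3) d J degree_nf[of x "h - ex i 5 + crdx i t" s]
                degree_mult_le[of "crcx x i t" "nfx x (h - ex i 5 + crdx i t) s"] by linarith
          qed
        qed
        then show "\<And>x. degree (crcx x i t * nfx x (h - ex i 5 + crdx i t) s) \<le> J"
          "\<And>x. degree (crcx x i t * nfx x (h - ex i 5 + crdx i t) s) \<le> J" by auto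
      qed (use S in auto)
      then show ?thesis unfolding hs(1) fst_conv snd_conv eq by (rule pg.cmp_mono) auto
    qed
  qed (use fin in auto)
  then show "pcmp J (2 ^ (N + D) * 5 ^ N * (2 * card T)) ?S (nf_set d)"
    by (rule pg.cmp_mono) (use cI mult_le_mono1 in auto)
qed

lemma pcmp_tau:
  assumes S: "(\<lambda>_. 0) \<in> S" "(\<Union>d<Suc (12 * N + 12). nf_set d) \<subseteq> S" and J: "12 * N + 12 \<le> J"
  shows "pcmp J (2 ^ (9 * N + 12) * 5 ^ N) S tau_set"
proof -
  let ?I = "{h \<in> mon N. mdeg N h \<le> 8 * N + 12}"
  have I: "finite ?I" "card ?I \<le> 2 ^ (9 * N + 12)" using card_mon_le[of N "8 * N + 12"] by (simp_all add: add.assoc[symmetric])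
  have "pcmp J (card ?I * 5 ^ N) S tau_set"
    unfolding tau_set_def
  proof (rule pg.cmp_UN[OF I(1)])
    fix h assume h: "h \<in> ?I"
    have le: "mdeg N (s + h) \<le> 12 * N + 12" if "s \<in> Bs N" for s
      using mdeg_Bs[OF that] h by (simp add: mdeg_add)
    have "pcmp J (card (Bs N) * (0 + 1)) S {\<lambda>x. \<Sum>s\<in>Bs N. nfx x (s + h) s}"
    proof (intro pcmp_sum pcmp_in)
      fix s assume s: "s \<in> Bs N"
      have "(\<lambda>x. nfx x (s + h) s) \<in> nf_set (mdeg N (s + h))"
        unfolding nf_set_def by (rule UN_I[of "(s + h, s)"]) (use s h Bs_mon in auto)
      moreover have "nf_set (mdeg N (s + h)) \<subseteq> S"
        using le[OF s] by (intro subset_trans[OF UN_upper S(2)]) auto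
      ultimately show "(\<lambda>x. nfx x (s + h) s) \<in> S" by blast
      show "degree (nfx x (s + h) s) \<le> J" for x
        using degree_nf[of x "s + h" s] le[OF s] J by linarith
    qed (use S in auto)
    then show "pcmp J (5 ^ N) S {\<lambda>x. taux x h}"
      by (simp add: quot.tau_def[OF quot] card_Bs)
  qed
  then show ?thesis by (rule pg.cmp_mono) (use I mult_le_mono1 in auto)
qed

lemma pcmp_H:
  assumes S: "(\<lambda>_. 0) \<in> S" "tau_set \<subseteq> S" "\<And>u. u \<in> TGx \<Longrightarrow> (\<lambda>x. cgx x u) \<in> S" and J: "12 * N + 16 \<le> J"
  shows "pcmp J (5 ^ N * 5 ^ N * (card TGx * 2 + card TGx * (card TGx * 3 + 1))) S H_set"
proof -
  have "pcmp J (card (Bs N \<times> Bs N) * (card TGx * 2 + card TGx * (card TGx * 3 + 1))) S H_set"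
    unfolding H_set_def
  proof (rule pg.cmp_UN)
    fix st assume "st \<in> Bs N \<times> Bs N"
    then obtain s t where st: "st = (s, t)" "s \<in> Bs N" "t \<in> Bs N" by auto
    have m: "s + t \<in> mon N" "mdeg N (s + t) \<le> 8 * N"
      using st Bs_mon mdeg_Bs[of s N] mdeg_Bs[of t N] by (auto simp: mdeg_add)
    have tau: "(\<lambda>x. taux x h) \<in> S" if "h \<in> mon N" "mdeg N h \<le> 8 * N + 12" for h
      using that S(2) by (auto simp: tau_set_def)
    have t1: "(\<lambda>x. taux x (dgx u + (s + t))) \<in> S" if "u \<in> TGx" for u
      by (rule tau) (use that dg_mon m mdeg_dg[OF that] in \<open>auto simp: mdeg_add[of _ "dgx u"]\<close>)
    have t2: "(\<lambda>x. taux x (dgx u + dgx v + (s + t))) \<in> S" if "u \<in> TGx" "v \<in> TGx" for u v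
      by (rule tau) (use that dg_mon m mdeg_dg[OF that(1)] mdeg_dg[OF that(2)] in \<open>auto simp: mdeg_add[of _ "dgx u + dgx v"] mdeg_add[of _ "dgx u"]\<close>)
    note dH = order_trans[OF degree_H_terms(1)[OF _ _ st(2,3)] J] order_trans[OF degree_H_terms(2)[OF _ _ st(2,3)] J]
      order_trans[OF degree_H_terms(3)[OF _ _ st(2,3)] J]
    have 1: "pcmp J (card TGx * (0 + 0 + 1 + 1)) S {\<lambda>x. \<Sum>u\<in>TGx. cgx x u * taux x (dgx u + (s + t))}"
      by (intro pcmp_sum pcmp_mult pcmp_in S t1 finTG dH)
    have 2: "pcmp J (card TGx * (card TGx * (0 + 0 + 1 + 0 + 1 + 1) + 1)) S
      {\<lambda>x. \<Sum>u\<in>TGx. \<Sum>v\<in>TGx. cgx x u * cgx x v * taux x (dgx u + dgx v + (s + t))}"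
      by (intro pcmp_sum pcmp_mult pcmp_in S t2 finTG dH degree_sum_le)
    show "pcmp J (card TGx * 2 + card TGx * (card TGx * 3 + 1)) S {\<lambda>x. H1x x (fst st) (snd st), \<lambda>x. H2x x (fst st) (snd st)}"
      using pg.cmp_Un[OF 1 2] by (simp add: st(1) quartic.H1_def[OF Q] quartic.H2_def[OF Q] insert_commute numeral_eq_Suc)
  qed simp
  then show ?thesis by (simp add: card_cartesian_product card_Bs)
qed

definition coeff_fns :: "('x \<Rightarrow> real) set" where
  "coeff_fns = (\<Union>it\<in>{..<N} \<times> T. {\<lambda>x. - b x (snd it) * real (g (snd it) (fst it)) / 6})"

definition start_polys :: "('x \<Rightarrow> real poly) set" where
  "start_polys = (\<lambda>c _. [:c:]) ` base_consts (5 ^ N) \<union> (\<Union>it\<in>{..<N} \<times> T. {\<lambda>x. crcx x (fst it) (snd it)})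
     \<union> (\<Union>u\<in>TGx. {\<lambda>x. cgx x u})"

lemma coeffs_start_polys:
  "coeffs_upto J start_polys \<subseteq> (\<lambda>c _. c) ` base_consts (5 ^ N) \<union> coeff_fns \<union> (\<Union>t\<in>T. {\<lambda>x. b x t})"
proof
  let ?R = "(\<lambda>c (_::'x). c) ` base_consts (5 ^ N) \<union> coeff_fns \<union> (\<Union>t\<in>T. {\<lambda>x. b x t})"
  fix h assume "h \<in> coeffs_upto J start_polys"
  then obtain f j where h: "h = (\<lambda>x. coeff (f x) j)" "f \<in> start_polys" by (auto simp: coeffs_upto_def)
  have c: "(\<lambda>_. c) \<in> ?R" if "c \<in> base_consts (5 ^ N)" for c using that by auto
  have k: "(\<lambda>_. 0) \<in> ?R" "(\<lambda>_. 1) \<in> ?R" "(\<lambda>_. -1) \<in> ?R" by (rule c, simp add: base_consts_def)+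
  from h(2) consider (1) c where "c \<in> base_consts (5 ^ N)" "f = (\<lambda>_. [:c:])"
    | (2) i t where "i < N" "t \<in> T" "f = (\<lambda>x. crcx x i t)" | (3) u where "u \<in> TGx" "f = (\<lambda>x. cgx x u)"
    by (auto simp: start_polys_def)
  then show "h \<in> ?R"
  proof cases
    case 1
    have "h = (if j = 0 then (\<lambda>_. c) else (\<lambda>_. 0))" unfolding h 1 by (cases j) auto
    then show ?thesis using c[OF 1(1)] k(1) by presburger
  next
    case 2
    have "h = (if j = 2 then (\<lambda>x. - b x t * real (g t i) / 6) else (\<lambda>_. 0))"
      unfolding h 2 by (auto simp: quartic.crc_def[OF Q])
    moreover have "(\<lambda>x. - b x t * real (g t i) / 6) \<in> ?R" using 2 by (auto simp: coeff_fns_def intro!: bexI[of _ "(i, t)"])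
    ultimately show ?thesis using k(1) by presburger
  next
    case 3
    show ?thesis
    proof (cases u)
      case (Inl t)
      have "h = (if j = 2 then (\<lambda>x. b x t) else (\<lambda>_. 0))"
        unfolding h 3 Inl by (auto simp: quartic.cg_def[OF Q])
      moreover have "t \<in> T" using 3 Inl by (auto simp: quartic.TG_def[OF Q])
      then have "(\<lambda>x. b x t) \<in> ?R" by auto
      ultimately show ?thesis using k(1) by presburger
    next
      case (Inr i)
      have "h = (if i < N then (if j = 0 then (\<lambda>_. 1) else (\<lambda>_. 0)) else if j = 1 then (\<lambda>_. -1) else (\<lambda>_. 0))"
        unfolding h 3 Inr by (auto simp: quartic.cg_def[OF Q] coeff_1)
      then show ?thesis using k by presburger
    qed
  qed
qed

lemma rcmp_start:
  assumes S: "one \<in> S" "\<And>t. t \<in> T \<Longrightarrow> (\<lambda>x. b x t) \<in> S"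
  shows "rcmp ((5 ^ N + 3) * (3 * 5 ^ N + 2) + N * card T * 40) S
    (insert one (coeffs_upto J start_polys))"
proof -
  have fin: "finite (base_consts (5 ^ N))" by (simp add: base_consts_def)
  have "card (base_consts (5 ^ N)) \<le> card {0, 1, -1 :: real} + card ((\<lambda>k. 1 / real (Suc k)) ` {..<5 ^ N})"
    unfolding base_consts_def by (rule card_Un_le)
  also have "\<dots> \<le> 3 + 5 ^ N"
    by (intro add_mono order_trans[OF card_image_le]) (auto simp: card_insert_if)
  finally have cb: "card (base_consts (5 ^ N)) \<le> 5 ^ N + 3" by simp
  have c1: "rcmp (card (base_consts (5 ^ N)) * (3 * 5 ^ N + 2)) S (\<Union>c\<in>base_consts (5 ^ N). {\<lambda>_. c})"
  proof (rule rg.cmp_UN[OF fin])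
    fix c assume "c \<in> base_consts (5 ^ N)"
    then consider "c = 0" | "c = 1" | "c = -1" | k where "k < 5 ^ N" "c = 1 / real (Suc k)"
      by (auto simp: base_consts_def)
    then show "rcmp (3 * 5 ^ N + 2) S {\<lambda>_. c}"
    proof cases
      case 1 then show ?thesis using rcmp_zero[OF S(1)] by (auto elim!: rg.cmp_mono)
    next
      case 2 then show ?thesis using S(1) by (auto intro: rcmp_in)
    next
      case 3
      have "rcmp (1 + 0 + 1) S {\<lambda>x. 0 - 1}" by (intro rcmp_sub rcmp_zero rcmp_in S(1))
      then show ?thesis using 3 by (auto elim!: rg.cmp_mono)
    next
      case (4 k)
      have "rcmp (0 + (3 * Suc k + 1) + 1) S {\<lambda>x. 1 / real (Suc k)}" by (intro rcmp_div rcmp_nat rcmp_in S(1))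
      then show ?thesis by (rule rg.cmp_mono) (use 4 in auto)
    qed
  qed
  have c2: "rcmp (card ({..<N} \<times> T) * 40) S coeff_fns"
    unfolding coeff_fns_def
  proof (rule rg.cmp_UN)
    fix it assume "it \<in> {..<N} \<times> T"
    then obtain i t where it: "it = (i, t)" "i < N" "t \<in> T" by auto
    have "g t i \<le> mdeg N (g t)" unfolding mdeg_def by (rule member_le_sum) (use it in auto)
    then have g4: "g t i \<le> 4" using quartic.g_deg[OF Q it(3)] by simp
    have "rcmp ((1 + 0 + 1) + (3 * g t i + 1) + 1 + (3 * 6 + 1) + 1) S {\<lambda>x. (0 - b x t) * real (g t i) / real 6}"
      by (intro rcmp_div rcmp_mult rcmp_sub rcmp_zero rcmp_nat rcmp_in S it)
    then show "rcmp 40 S {\<lambda>x. - b x (snd it) * real (g (snd it) (fst it)) / 6}"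
      by (rule rg.cmp_mono) (use g4 in \<open>auto simp: it\<close>)
  qed (use finT in auto)
  show ?thesis
  proof (rule rg.cmp_mono[OF rg.cmp_Un[OF rg.cmp_Un[OF c1 c2] rg.cmp_subset[of "insert one (\<Union>t\<in>T. {\<lambda>x. b x t})" S 0]]])
    show "insert one (\<Union>t\<in>T. {\<lambda>x. b x t}) \<subseteq> S" using S by auto
    show "insert one (coeffs_upto J start_polys)
      \<subseteq> (\<Union>c\<in>base_consts (5 ^ N). {\<lambda>_. c}) \<union> coeff_fns \<union> insert one (\<Union>t\<in>T. {\<lambda>x. b x t})"
      using coeffs_start_polys[of J] by auto
    have "card (base_consts (5 ^ N)) * (3 * 5 ^ N + 2) \<le> (5 ^ N + 3) * (3 * 5 ^ N + 2)"
      using cb by (rule mult_le_mono1)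
    then show "card (base_consts (5 ^ N)) * (3 * 5 ^ N + 2) + card ({..<N} \<times> T) * 40 + 0
      \<le> (5 ^ N + 3) * (3 * 5 ^ N + 2) + N * card T * 40"
      by (simp add: card_cartesian_product)
  qed simp
qed

definition newt_set :: "('x \<Rightarrow> real poly) set" where
  "newt_set = (\<Union>k\<in>{..5 ^ N}. {\<lambda>x. newt (ptr (Bs N) (H1x x)) k}) \<union> (\<Union>k\<in>{..5 ^ N}. {\<lambda>x. newt (ptr (Bs N) (H2x x)) k})"

lemma pcmp_newt_set:
  assumes J: "J = 5 ^ N * (12 * N + 16)"
  shows "pcmp J (Suc (12 * N + 12) * (2 ^ (N + (12 * N + 12)) * 5 ^ N * (2 * card T)) + 2 ^ (9 * N + 12) * 5 ^ N
     + 5 ^ N * 5 ^ N * (card TGx * 2 + card TGx * (card TGx * 3 + 1))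
     + 2 * (Suc (5 ^ N) * (5 ^ N * 5 ^ N * (2 * 5 ^ N)) + Suc (5 ^ N) * 5 ^ N + Suc (5 ^ N) * (3 * 5 ^ N + 4)))
     start_polys newt_set"
proof -
  have "1 * (12 * N + 16) \<le> J" unfolding J by (rule mult_le_mono1) simp
  then have J': "12 * N + 12 \<le> J" "12 * N + 16 \<le> J" by auto
  have zero: "(\<lambda>_. 0) \<in> start_polys" and one': "(\<lambda>_. 1) \<in> start_polys"
    and bc: "(\<lambda>c _. [:c:]) ` base_consts (5 ^ N) \<subseteq> start_polys"
    and crc: "\<And>i t. i < N \<Longrightarrow> t \<in> T \<Longrightarrow> (\<lambda>x. crcx x i t) \<in> start_polys"
    and cg: "\<And>u. u \<in> TGx \<Longrightarrow> (\<lambda>x. cgx x u) \<in> start_polys"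
    unfolding start_polys_def base_consts_def by (auto simp: one_pCons image_iff)
  define S1 where "S1 = start_polys \<union> (\<Union>d<Suc (12 * N + 12). nf_set d)"
  define S2 where "S2 = S1 \<union> tau_set"
  define S3 where "S3 = S2 \<union> H_set"
  note a1 = pcmp_nf[OF zero one' crc J'(1)]
  have a2: "pcmp J (2 ^ (9 * N + 12) * 5 ^ N) S1 tau_set"
    by (rule pcmp_tau) (use zero J' in \<open>auto simp: S1_def\<close>)
  have a3: "pcmp J (5 ^ N * 5 ^ N * (card TGx * 2 + card TGx * (card TGx * 3 + 1))) S2 H_set"
    by (rule pcmp_H) (use zero cg J' in \<open>auto simp: S1_def S2_def\<close>)
  have H: "(\<lambda>x. H1x x s t) \<in> S3" "(\<lambda>x. H2x x s t) \<in> S3" if "s \<in> Bs N" "t \<in> Bs N" for s t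
    using that by (auto simp: S3_def H_set_def)
  have bc3: "(\<lambda>c _. [:c:]) ` base_consts (5 ^ N) \<subseteq> S3" using bc by (auto simp: S1_def S2_def S3_def)
  let ?c = "Suc (5 ^ N) * (5 ^ N * 5 ^ N * (2 * 5 ^ N)) + Suc (5 ^ N) * 5 ^ N + Suc (5 ^ N) * (3 * 5 ^ N + 4)"
  have n1: "pcmp J ?c S3 (\<Union>k\<in>{..5 ^ N}. {\<lambda>x. newt (ptr (Bs N) (H1x x)) k})"
    by (rule pcmp_newt[where D = "12 * N + 16", OF finite_Bs card_Bs bc3 H(1) degree_H(1)]) (auto simp: J)
  have n2: "pcmp J ?c S3 (\<Union>k\<in>{..5 ^ N}. {\<lambda>x. newt (ptr (Bs N) (H2x x)) k})"
    by (rule pcmp_newt[where D = "12 * N + 16", OF finite_Bs card_Bs bc3 H(2) degree_H(2)]) (auto simp: J)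
  have a4: "pcmp J (2 * ?c) S3 newt_set"
    using pg.cmp_Un[OF n1 n2] unfolding newt_set_def by (simp only: mult_2)
  from pg.cmp_trans'[OF a3 a4[unfolded S3_def] order_refl] have b3: "pcmp J (5 ^ N * 5 ^ N * (card TGx * 2 + card TGx * (card TGx * 3 + 1)) + 2 * ?c) S2 newt_set" .
  from pg.cmp_trans'[OF a2 b3[unfolded S2_def] order_refl] have b2: "pcmp J (2 ^ (9 * N + 12) * 5 ^ N + (5 ^ N * 5 ^ N * (card TGx * 2 + card TGx * (card TGx * 3 + 1)) + 2 * ?c)) S1 newt_set" .
  from pg.cmp_trans'[OF a1 b2[unfolded S1_def] order_refl] show ?thesis by (simp only: add.assoc)
qed

lemma rcmp_neg_index:
  assumes S: "one \<in> S" and co: "coeffs_upto J (\<Union>k\<in>{..m}. {\<lambda>x. newt (ptr B (H x)) k}) \<subseteq> S"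
    and m: "card B = m" and deg: "\<And>x k. k \<le> m \<Longrightarrow> degree (newt (ptr B (H x)) k) \<le> J"
  shows "rcmp (Suc m * (10 * J) + (30 * Suc m + 1)) S {\<lambda>x. real (neg_index B (H x))}"
proof -
  let ?L = "\<Union>k\<in>{..m}. {\<lambda>x. lead_coeff (newt (ptr B (H x)) k)}"
  have "rcmp (card {..m} * (10 * J)) S ?L"
  proof (rule rg.cmp_UN)
    fix k assume k: "k \<in> {..m}"
    show "rcmp (10 * J) S {\<lambda>x. lead_coeff (newt (ptr B (H x)) k)}"
    proof (rule rcmp_lead_coeff[OF S])
      fix j assume "j \<le> J"
      then have "(\<lambda>x. coeff (newt (ptr B (H x)) k) j) \<in> coeffs_upto J (\<Union>k\<in>{..m}. {\<lambda>x. newt (ptr B (H x)) k})"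
        using k by (intro coeffs_upto_I) auto
      then show "(\<lambda>x. coeff (newt (ptr B (H x)) k) j) \<in> S" using co by blast
    qed (use deg k in auto)
  qed simp
  then have 1: "rcmp (Suc m * (10 * J)) S ?L" by simp
  have "rcmp (30 * Suc m + 1) (S \<union> ?L) {\<lambda>x. last_sign (\<lambda>k. lead_coeff (newt (ptr B (H x)) k)) (Suc m),
     \<lambda>x. real (sign_changes (\<lambda>k. lead_coeff (newt (ptr B (H x)) k)) (Suc m))}"
    by (rule rcmp_sign_changes) (use S in auto)
  then have 2: "rcmp (30 * Suc m + 1) (S \<union> ?L) {\<lambda>x. real (neg_index B (H x))}"
    by (rule rg.cmp_mono) (auto simp: neg_index_def m)
  show ?thesis by (rule rg.cmp_trans'[OF 1 2 order_refl])
qed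

lemma degree_newt_H:
  assumes "k \<le> 5 ^ N"
  shows "degree (newt (ptr (Bs N) (H1x x)) k) \<le> 5 ^ N * (12 * N + 16)"
    "degree (newt (ptr (Bs N) (H2x x)) k) \<le> 5 ^ N * (12 * N + 16)"
proof -
  have "k * (12 * N + 16) \<le> 5 ^ N * (12 * N + 16)" using assms by (rule mult_le_mono1)
  moreover have "degree (newt (ptr (Bs N) H) k) \<le> k * (12 * N + 16)"
    if "\<And>s t. s \<in> Bs N \<Longrightarrow> t \<in> Bs N \<Longrightarrow> degree (H s t) \<le> 12 * N + 16" for H
    by (rule degree_newt) (auto simp: ptr_def intro!: degree_sum_le degree_mpow that)
  ultimately show "degree (newt (ptr (Bs N) (H1x x)) k) \<le> 5 ^ N * (12 * N + 16)"
    "degree (newt (ptr (Bs N) (H2x x)) k) \<le> 5 ^ N * (12 * N + 16)"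
    using degree_H by (meson order_trans)+
qed

text \<open>All counts are compared with powers of \<open>W\<close> = 2^N: 5^N is at most W^3,
  \<open>N + 1\<close> at most \<open>W\<close>, and a number up to 2^i at most W^i because
  \<open>N\<close> is positive. Each sum of two costs one exponent; the generous total stays below
  80.\<close>

theorem rcmp_quartic_decision:
  assumes S: "one \<in> S" "\<And>t. t \<in> T \<Longrightarrow> (\<lambda>x. b x t) \<in> S"
  shows "rcmp (2 ^ (80 * N)) S {\<lambda>x. if neg_index (Bs N) (H2x x) < neg_index (Bs N) (H1x x) then 1 else 0}"
proof -
  define J where "J = 5 ^ N * (12 * N + 16)"
  define m :: nat where "m = 5 ^ N"
  define W :: nat where "W = 2 ^ N"
  define c0 where "c0 = (5 ^ N + 3) * (3 * 5 ^ N + 2) + N * card T * 40"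
  define c1 where "c1 = Suc (12 * N + 12) * (2 ^ (N + (12 * N + 12)) * 5 ^ N * (2 * card T)) + 2 ^ (9 * N + 12) * 5 ^ N
     + 5 ^ N * 5 ^ N * (card TGx * 2 + card TGx * (card TGx * 3 + 1))
     + 2 * (Suc (5 ^ N) * (5 ^ N * 5 ^ N * (2 * 5 ^ N)) + Suc (5 ^ N) * 5 ^ N + Suc (5 ^ N) * (3 * 5 ^ N + 4))"
  define c2 where "c2 = Suc m * (10 * J) + (30 * Suc m + 1)"
  define C where "C = coeffs_upto J newt_set"
  have 1: "rcmp c0 S (insert one (coeffs_upto J start_polys))"
    unfolding c0_def by (rule rcmp_start[OF S])
  have "rcmp (c1 * (Suc J * (4 * J + 5))) (insert one (coeffs_upto J start_polys)) C"
    unfolding C_def c1_def by (rule pcmp_coeffs[OF pcmp_newt_set[OF J_def]])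
  then have 2: "rcmp (c1 * (Suc J * (4 * J + 5))) (S \<union> insert one (coeffs_upto J start_polys)) C"
    by (rule rg.cmp_mono) auto
  from rg.cmp_trans'[OF 1 2 order_refl] have 3: "rcmp (c0 + c1 * (Suc J * (4 * J + 5))) S C" .
  have sub: "coeffs_upto J (\<Union>k\<in>{..m}. {\<lambda>x. newt (ptr (Bs N) (H1x x)) k}) \<subseteq> S \<union> C"
    "coeffs_upto J (\<Union>k\<in>{..m}. {\<lambda>x. newt (ptr (Bs N) (H2x x)) k}) \<subseteq> S \<union> C"
    unfolding C_def m_def newt_set_def
    by (rule subset_trans[OF coeffs_upto_mono Un_upper2], blast)+
  have 4: "rcmp c2 (S \<union> C) {\<lambda>x. real (neg_index (Bs N) (H1x x))}" "rcmp c2 (S \<union> C) {\<lambda>x. real (neg_index (Bs N) (H2x x))}"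
    unfolding c2_def
    by (rule rcmp_neg_index[OF _ sub(1)] rcmp_neg_index[OF _ sub(2)]; use S degree_newt_H in \<open>simp add: m_def card_Bs J_def\<close>)+
  have "rcmp (c2 + c2 + 1 + 1) (S \<union> C) {\<lambda>x. if real (neg_index (Bs N) (H1x x)) - real (neg_index (Bs N) (H2x x)) > 0 then 1 else 0}"
    by (intro rcmp_pos rcmp_sub 4)
  from rg.cmp_trans'[OF 3 this order_refl]
  have fin: "rcmp (c0 + c1 * (Suc J * (4 * J + 5)) + (c2 + c2 + 1 + 1)) S
    {\<lambda>x. if neg_index (Bs N) (H2x x) < neg_index (Bs N) (H1x x) then 1 else 0}" by simp
  have W2: "2 \<le> W" using N power_increasing[of 1 N "2::nat"] by (simp add: W_def)
  then have W1: "1 \<le> W" by simp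
  have N1: "N + 1 \<le> W" unfolding W_def using less_exp[of N] by (simp add: Suc_le_eq)
  have m3: "m \<le> W ^ 3" unfolding m_def W_def by (simp flip: power_mult add: power_mono mult.commute[of N] power_mult[of 2 3])
  have up: "a \<le> W ^ j" if "a \<le> W ^ i" "i \<le> j" for a i j
    using that W1 power_increasing[of i j W] by linarith
  have mul: "a * c \<le> W ^ (i + j)" if "a \<le> W ^ i" "c \<le> W ^ j" for a c i j
    using mult_mono[OF that] by (simp add: power_add)
  have add: "a + c \<le> W ^ (i + 1)" if "a \<le> W ^ i" "c \<le> W ^ i" for a c i
  proof -
    have "a + c \<le> 2 * W ^ i" using that by simp
    also have "\<dots> \<le> W * W ^ i" using W2 by (rule mult_le_mono1)
    finally show ?thesis by simp
  qed
  have num: "a \<le> W ^ i" if "a \<le> 2 ^ i" for a i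
    using that power_mono[OF W2, of i] by simp
  have pw: "2 ^ (i * N) \<le> W ^ i" for i unfolding W_def by (simp add: power_mult[symmetric] mult.commute)
  have cT4: "card T \<le> W ^ 4" by (rule order_trans[OF cT power_mono[OF N1]]) simp
  have cTG5: "card TGx \<le> W ^ 5"
  proof -
    have "card TGx \<le> card T + (N + 1)" using card_TG by simp
    also have "\<dots> \<le> W ^ (4 + 1)" by (rule add[OF cT4]) (rule up[of _ 1], use N1 in auto)
    finally show ?thesis by simp
  qed
  have lin: "12 * N + 16 \<le> W ^ 5"
  proof -
    have "12 * N + 16 \<le> 16 * (N + 1)" by simp
    also have "\<dots> \<le> W ^ (4 + 1)" by (rule mul[OF num]) (use N1 in auto)
    finally show ?thesis by simp
  qed
  have Sm: "Suc m \<le> W ^ 4" using add[OF m3, of 1] W1 by (simp add: one_le_power)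
  have J8: "J \<le> W ^ 8" unfolding J_def using mul[OF m3[unfolded m_def] lin] by simp
  have p13: "(2::nat) ^ (N + (12 * N + 12)) \<le> W ^ 25"
    by (rule order_trans[OF _ pw]) (use N in \<open>auto intro!: power_increasing\<close>)
  have p9: "(2::nat) ^ (9 * N + 12) \<le> W ^ 21"
    by (rule order_trans[OF _ pw]) (use N in \<open>auto intro!: power_increasing\<close>)
  have num1: "2 \<le> W ^ 1" "3 \<le> W ^ 2" "4 \<le> W ^ 2" "5 \<le> W ^ 3" "10 \<le> W ^ 4" "30 \<le> W ^ 5" "40 \<le> W ^ 6" "1 \<le> W ^ 0" "2 \<le> W ^ 1"
    by (rule num; simp)+
  have b1: "Suc (12 * N + 12) * (2 ^ (N + (12 * N + 12)) * 5 ^ N * (2 * card T)) \<le> W ^ 38"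
  proof -
    have "Suc (12 * N + 12) \<le> W ^ 5" using lin by simp
    from mul[OF this mul[OF mul[OF p13 m3[unfolded m_def]] mul[OF num1(1) cT4]]] show ?thesis by simp
  qed
  have b2: "2 ^ (9 * N + 12) * 5 ^ N \<le> W ^ 38"
    using up[OF mul[OF p9 m3[unfolded m_def]], of 38] by simp
  have b3: "5 ^ N * 5 ^ N * (card TGx * 2 + card TGx * (card TGx * 3 + 1)) \<le> W ^ 38"
  proof -
    have "card TGx * 3 + 1 \<le> W ^ (7 + 1)"
      by (rule add) (use mul[OF cTG5 num1(2)] up[OF num1(8), of 7] in auto)
    from mul[OF cTG5 this] have "card TGx * (card TGx * 3 + 1) \<le> W ^ 13" by simp
    moreover have "card TGx * 2 \<le> W ^ 13" using up[OF mul[OF cTG5 num1(1)], of 13] by simp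
    ultimately have "card TGx * 2 + card TGx * (card TGx * 3 + 1) \<le> W ^ (13 + 1)" using add by blast
    from up[OF mul[OF mul[OF m3[unfolded m_def] m3[unfolded m_def]] this], of 38] show ?thesis by simp
  qed
  have b4: "2 * (Suc (5 ^ N) * (5 ^ N * 5 ^ N * (2 * 5 ^ N)) + Suc (5 ^ N) * 5 ^ N + Suc (5 ^ N) * (3 * 5 ^ N + 4)) \<le> W ^ 38"
  proof -
    note M = m3[unfolded m_def] note SM = Sm[unfolded m_def]
    have "Suc (5 ^ N) * (5 ^ N * 5 ^ N * (2 * 5 ^ N)) \<le> W ^ 14"
      using mul[OF SM mul[OF mul[OF M M] mul[OF num1(1) M]]] by simp
    moreover have "Suc (5 ^ N) * 5 ^ N \<le> W ^ 14" using up[OF mul[OF SM M], of 14] by simp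
    ultimately have x: "Suc (5 ^ N) * (5 ^ N * 5 ^ N * (2 * 5 ^ N)) + Suc (5 ^ N) * 5 ^ N \<le> W ^ 15"
      by (rule add[where i = 14, simplified])
    have "3 * 5 ^ N + 4 \<le> W ^ (5 + 1)"
      by (rule add) (use mul[OF num1(2) M] up[OF num1(3), of 5] in auto)
    then have "Suc (5 ^ N) * (3 * 5 ^ N + 4) \<le> W ^ 15" using up[OF mul[OF SM], of _ 6 15] by simp
    from add[where i = 15, simplified, OF x this] have "2 * (Suc (5 ^ N) * (5 ^ N * 5 ^ N * (2 * 5 ^ N)) + Suc (5 ^ N) * 5 ^ N + Suc (5 ^ N) * (3 * 5 ^ N + 4)) \<le> W ^ (1 + 16)"
      by (rule mul[OF num1(1)])
    then show ?thesis by (rule up) simp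
  qed
  have "c1 \<le> W ^ 41"
  proof -
    have "c1 \<le> 4 * W ^ 38" unfolding c1_def using b1 b2 b3 b4 by linarith
    also have "\<dots> \<le> W ^ (2 + 38)" by (rule mul[OF num1(3)]) simp
    finally show ?thesis using up[of _ 40 41] by simp
  qed
  moreover have SJ: "Suc J \<le> W ^ 9" using add[OF J8, of 1] W1 by (simp add: one_le_power)
  moreover have "4 * J + 5 \<le> W ^ 11"
    using add[of "4 * J" 10 5] mul[OF num1(3) J8] up[OF num1(4), of 10] by simp
  ultimately have d1: "c1 * (Suc J * (4 * J + 5)) \<le> W ^ 61"
    using mul[of c1 41 _ 20] mul[of "Suc J" 9 "4 * J + 5" 11] by simp
  have d0: "c0 \<le> W ^ 61"
  proof -
    note M = m3[unfolded m_def]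
    have "5 ^ N + 3 \<le> W ^ (3 + 1)" by (rule add) (use M up[OF num1(2), of 3] in auto)
    moreover have "3 * 5 ^ N + 2 \<le> W ^ (5 + 1)" by (rule add) (use mul[OF num1(2) M] up[OF num1(1), of 5] in auto)
    ultimately have "(5 ^ N + 3) * (3 * 5 ^ N + 2) \<le> W ^ (3 + 1 + (5 + 1))" by (rule mul)
    then have "(5 ^ N + 3) * (3 * 5 ^ N + 2) \<le> W ^ 60" by (rule up) simp
    moreover have "N \<le> W ^ 1" using N1 by simp
    then have "N * card T * 40 \<le> W ^ 60" using up[OF mul[OF mul[OF _ cT4] num1(7)], of N 1 60] by simp
    ultimately show ?thesis unfolding c0_def by (rule add[where i = 60, simplified])
  qed
  have d2: "c2 + 1 \<le> W ^ 61"
  proof -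
    have "Suc m * (10 * J) \<le> W ^ 59" using up[OF mul[OF Sm mul[OF num1(5) J8]], of 59] by simp
    moreover have "30 * Suc m + 1 \<le> W ^ 59"
    proof -
      have "30 * Suc m + 1 \<le> W ^ (9 + 1)" by (rule add) (use mul[OF num1(6) Sm] up[OF num1(8), of 9] in auto)
      then show ?thesis using up by simp
    qed
    ultimately have "c2 \<le> W ^ 60" unfolding c2_def using add[of _ 59] by simp
    then show ?thesis using add[of c2 60 1] up[OF num1(8), of 60] by simp
  qed
  have "c0 + c1 * (Suc J * (4 * J + 5)) + (c2 + c2 + 1 + 1) \<le> 4 * W ^ 61" using d0 d1 d2 by linarith
  also have "\<dots> \<le> W ^ (2 + 61)" by (rule mul[OF num1(3)]) simp
  also have "\<dots> \<le> W ^ 80" by (rule up[OF order_refl]) simp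
  also have "\<dots> = 2 ^ (80 * N)" unfolding W_def by (simp add: power_mult[symmetric] mult.commute)
  finally show ?thesis using rg.cmp_mono[OF fin] by simp
qed

end

section \<open>Reading a bit stream from a real constant\<close>

text \<open>With ternary digits 0 and 2 only, the number avoids the open middle third. After
  tripling it is at most 1 or at least 2, so one exact comparison reads the leading digit.\<close>

definition cantor :: "(nat \<Rightarrow> bool) \<Rightarrow> real" where
  "cantor s = (\<Sum>i. (if s i then 2 else 0) * (1 / 3) ^ Suc i)"

lemma cantor_summable: "summable (\<lambda>i. (if s i then 2 else 0) * (1 / 3 :: real) ^ Suc i)"
proof (rule summable_comparison_test')
  show "summable (\<lambda>i. 2 * (1 / 3 :: real) ^ Suc i)"
    by (intro summable_mult summable_Suc_iff[THEN iffD2] summable_geometric) simp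
qed auto

lemma cantor_shift: "3 * cantor s = (if s 0 then 2 else 0) + cantor (\<lambda>i. s (Suc i))"
proof -
  have "cantor s = (\<Sum>i. (if s (Suc i) then 2 else 0) * (1 / 3) ^ Suc (Suc i)) + (if s 0 then 2 else 0) * (1 / 3)"
    unfolding cantor_def using suminf_split_head[OF cantor_summable[of s]] by simp
  also have "(\<Sum>i. (if s (Suc i) then 2 else 0) * (1 / 3 :: real) ^ Suc (Suc i))
    = (\<Sum>i. (1 / 3) * ((if s (Suc i) then 2 else 0) * (1 / 3) ^ Suc i))" by (rule suminf_cong) simp
  also have "\<dots> = (1 / 3) * cantor (\<lambda>i. s (Suc i))"
    unfolding cantor_def by (rule suminf_mult[OF cantor_summable])
  finally show ?thesis by simp
qed

lemma cantor_nonneg: "0 \<le> cantor s"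
  unfolding cantor_def by (rule suminf_nonneg[OF cantor_summable]) simp

lemma cantor_le_1: "cantor s \<le> 1"
proof -
  have g: "summable (\<lambda>i. 2 * (1 / 3 :: real) ^ Suc i)"
    by (intro summable_mult summable_Suc_iff[THEN iffD2] summable_geometric) simp
  have "cantor s \<le> (\<Sum>i. 2 * (1 / 3) ^ Suc i)"
    unfolding cantor_def by (rule suminf_le[OF _ cantor_summable g]) simp
  also have "\<dots> = 2 * (1 / 3) * (\<Sum>i. (1 / 3 :: real) ^ i)"
    by (subst suminf_mult[symmetric]) (auto simp: mult.assoc intro: summable_geometric)
  also have "\<dots> = 1" by (subst suminf_geometric) auto
  finally show ?thesis .
qed

text \<open>Unary code with a closing zero bit: it can be read bit by bit without knowing any
  length, in time proportional to its size.\<close>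

fun unary :: "nat list \<Rightarrow> bool list" where
  "unary [] = []"
| "unary (k # ks) = replicate k True @ False # unary ks"

lemma unary_append: "unary (ks @ ls) = unary ks @ unary ls"
  by (induction ks) auto

text \<open>Only a prefix is prescribed. What remains after reading a number satisfies a statement
  of the same form.\<close>

definition holds_stream :: "nat list \<Rightarrow> real \<Rightarrow> bool" where
  "holds_stream ks r \<longleftrightarrow> (\<exists>s. r = cantor s \<and> (\<forall>i<length (unary ks). s i = unary ks ! i))"

lemma holds_stream_Suc:
  assumes "holds_stream (Suc k # ks) r"
  shows "3 * r - 1 > 0" "holds_stream (k # ks) (3 * r - 2)"
proof -
  from assms obtain s where s: "r = cantor s" "\<forall>i<length (unary (Suc k # ks)). s i = unary (Suc k # ks) ! i"
    by (auto simp: holds_stream_def)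
  then have s0: "s 0" by auto
  have r: "3 * r - 2 = cantor (\<lambda>i. s (Suc i))" using cantor_shift[of s] s0 s(1) by simp
  then show "3 * r - 1 > 0" using cantor_nonneg[of "\<lambda>i. s (Suc i)"] by linarith
  show "holds_stream (k # ks) (3 * r - 2)"
    unfolding holds_stream_def using r s(2) by (intro exI[of _ "\<lambda>i. s (Suc i)"]) auto
qed

lemma holds_stream_0:
  assumes "holds_stream (0 # ks) r"
  shows "\<not> 3 * r - 1 > 0" "holds_stream ks (3 * r)"
proof -
  from assms obtain s where s: "r = cantor s" "\<forall>i<length (unary (0 # ks)). s i = unary (0 # ks) ! i"
    by (auto simp: holds_stream_def)
  then have s0: "\<not> s 0" by auto
  have r: "3 * r = cantor (\<lambda>i. s (Suc i))" using cantor_shift[of s] s0 s(1) by simp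
  then show "\<not> 3 * r - 1 > 0" using cantor_le_1[of "\<lambda>i. s (Suc i)"] by linarith
  show "holds_stream ks (3 * r)"
    unfolding holds_stream_def using r s(2) by (intro exI[of _ "\<lambda>i. s (Suc i)"]) auto
qed

section \<open>The interpreter\<close>

lemma run_0 [simp]: "run P 0 c = c"
  by (simp add: run_def)

lemma run_Suc: "run P (Suc t) c = run P t (step P c)"
  by (simp add: run_def funpow_swap1)

lemma run_add: "run P (s + t) c = run P t (run P s c)"
  by (induction s arbitrary: c) (simp_all add: run_Suc)

lemma run_step:
  assumes "pc < length P" "P ! pc \<noteq> Halt"
  shows "run P (Suc t) (pc, I, R) = run P t (exec (P ! pc) (pc, I, R))"
  using assms by (simp add: run_Suc step_def halted_def)

text \<open>Integer register \<open>r\<close> counts the one bits. Tripling shifts the expansion,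
  real register 1 receives the comparison with 1, and for a one bit the digit 2 is
  subtracted.\<close>

definition read_code :: "nat \<Rightarrow> nat \<Rightarrow> instr list" where
  "read_code p r = [IConst r 0, RMul 0 0 2, RSub 1 0 3, IfRPos 1 (p + 5), Jmp (p + 8), RSub 0 0 4, IAdd r r 2, Jmp (p + 1)]"

text \<open>Positions 0 to 29 compute the address 9 + n + n d, move the real registers 0 to 7 there
  and load the constants. Positions 30 to 57 read a block header and set the flag register 9 iff it
  matches the input sizes. Positions 58 to 107 read a gate and execute it if the flag is set; 108 to
  114 report the last value. Integer register 10 stays 0 and serves for copying and negating, 11
  holds the address of the first result, 8 that of the next one.\<close>

definition interpreter :: "real \<Rightarrow> instr list" where
  "interpreter c =
    [IConst 2 1, IConst 3 9, IAdd 3 3 0, IAdd 4 1 10,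
     IfIPos 4 6, Jmp 9, IAdd 3 3 0, ISub 4 4 2, Jmp 4, IAdd 11 3 10,
     RStore 0 11, IAdd 11 11 2, RStore 1 11, IAdd 11 11 2, RStore 2 11, IAdd 11 11 2, RStore 3 11, IAdd 11 11 2,
     RStore 4 11, IAdd 11 11 2, RStore 5 11, IAdd 11 11 2, RStore 6 11, IAdd 11 11 2, RStore 7 11, IAdd 11 11 2,
     RConst 0 c, RConst 2 3, RConst 3 1, RConst 4 2]
    @ read_code 30 5 @ read_code 38 6 @
    [IConst 9 1, ISub 5 5 0, IfIPos 5 56, ISub 5 10 5, IfIPos 5 56, ISub 6 6 1, IfIPos 6 56, ISub 6 10 6, IfIPos 6 56,
     Jmp 57, IConst 9 0, IAdd 8 11 10]
    @ read_code 58 5 @ read_code 66 6 @ read_code 74 7 @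
    [IfIPos 5 85, IfIPos 9 108, Jmp 30, IfIPos 9 87, Jmp 58,
     RLoad 5 6, RLoad 6 7, ISub 5 5 2, IfIPos 5 93, RSub 5 5 6, Jmp 105,
     ISub 5 5 2, IfIPos 5 97, RMul 5 5 6, Jmp 105,
     ISub 5 5 2, IfIPos 5 101, RDiv 5 5 6, Jmp 105,
     IfRPos 5 104, RSub 5 5 5, Jmp 105, RDiv 5 5 5,
     RStore 5 8, IAdd 8 8 2, Jmp 58,
     ISub 8 8 2, RLoad 5 8, IfRPos 5 113, IConst 0 0, Halt, IConst 0 1, Halt]"

lemma length_interpreter: "length (interpreter c) = 115"
  by (simp add: interpreter_def read_code_def)

lemma interpreter_read:
  "take 8 (drop 30 (interpreter c)) = read_code 30 5" "take 8 (drop 38 (interpreter c)) = read_code 38 6"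
  "take 8 (drop 58 (interpreter c)) = read_code 58 5" "take 8 (drop 66 (interpreter c)) = read_code 66 6"
  "take 8 (drop 74 (interpreter c)) = read_code 74 7"
  by (simp_all add: interpreter_def read_code_def)

lemma interpreter_nth:
  "interpreter c ! 0 = IConst 2 1" "interpreter c ! 1 = IConst 3 9" "interpreter c ! Suc 0 = IConst 3 9"
  "interpreter c ! 2 = IAdd 3 3 0" "interpreter c ! 3 = IAdd 4 1 10"
  "interpreter c ! 4 = IfIPos 4 6" "interpreter c ! 5 = Jmp 9" "interpreter c ! 6 = IAdd 3 3 0"
  "interpreter c ! 7 = ISub 4 4 2" "interpreter c ! 8 = Jmp 4" "interpreter c ! 9 = IAdd 11 3 10"
  "interpreter c ! 10 = RStore 0 11" "interpreter c ! 11 = IAdd 11 11 2" "interpreter c ! 12 = RStore 1 11"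
  "interpreter c ! 13 = IAdd 11 11 2" "interpreter c ! 14 = RStore 2 11" "interpreter c ! 15 = IAdd 11 11 2"
  "interpreter c ! 16 = RStore 3 11" "interpreter c ! 17 = IAdd 11 11 2" "interpreter c ! 18 = RStore 4 11"
  "interpreter c ! 19 = IAdd 11 11 2" "interpreter c ! 20 = RStore 5 11" "interpreter c ! 21 = IAdd 11 11 2"
  "interpreter c ! 22 = RStore 6 11" "interpreter c ! 23 = IAdd 11 11 2" "interpreter c ! 24 = RStore 7 11"
  "interpreter c ! 25 = IAdd 11 11 2" "interpreter c ! 26 = RConst 0 c" "interpreter c ! 27 = RConst 2 3"
  "interpreter c ! 28 = RConst 3 1" "interpreter c ! 29 = RConst 4 2"
  "interpreter c ! 46 = IConst 9 1" "interpreter c ! 47 = ISub 5 5 0" "interpreter c ! 48 = IfIPos 5 56"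
  "interpreter c ! 49 = ISub 5 10 5" "interpreter c ! 50 = IfIPos 5 56" "interpreter c ! 51 = ISub 6 6 1"
  "interpreter c ! 52 = IfIPos 6 56" "interpreter c ! 53 = ISub 6 10 6" "interpreter c ! 54 = IfIPos 6 56"
  "interpreter c ! 55 = Jmp 57" "interpreter c ! 56 = IConst 9 0" "interpreter c ! 57 = IAdd 8 11 10"
  "interpreter c ! 82 = IfIPos 5 85" "interpreter c ! 83 = IfIPos 9 108" "interpreter c ! 84 = Jmp 30"
  "interpreter c ! 85 = IfIPos 9 87" "interpreter c ! 86 = Jmp 58" "interpreter c ! 87 = RLoad 5 6"
  "interpreter c ! 88 = RLoad 6 7" "interpreter c ! 89 = ISub 5 5 2" "interpreter c ! 90 = IfIPos 5 93"
  "interpreter c ! 91 = RSub 5 5 6" "interpreter c ! 92 = Jmp 105" "interpreter c ! 93 = ISub 5 5 2"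
  "interpreter c ! 94 = IfIPos 5 97" "interpreter c ! 95 = RMul 5 5 6" "interpreter c ! 96 = Jmp 105"
  "interpreter c ! 97 = ISub 5 5 2" "interpreter c ! 98 = IfIPos 5 101" "interpreter c ! 99 = RDiv 5 5 6"
  "interpreter c ! 100 = Jmp 105" "interpreter c ! 101 = IfRPos 5 104" "interpreter c ! 102 = RSub 5 5 5"
  "interpreter c ! 103 = Jmp 105" "interpreter c ! 104 = RDiv 5 5 5" "interpreter c ! 105 = RStore 5 8"
  "interpreter c ! 106 = IAdd 8 8 2" "interpreter c ! 107 = Jmp 58" "interpreter c ! 108 = ISub 8 8 2"
  "interpreter c ! 109 = RLoad 5 8" "interpreter c ! 110 = IfRPos 5 113" "interpreter c ! 111 = IConst 0 0"
  "interpreter c ! 112 = Halt" "interpreter c ! 113 = IConst 0 1" "interpreter c ! 114 = Halt"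
  by (simp_all add: interpreter_def read_code_def)

text \<open>An upper bound in place of an exact step count lets code paths of different length share
  one statement.\<close>

definition goes :: "instr list \<Rightarrow> nat \<Rightarrow> config \<Rightarrow> config \<Rightarrow> bool" where
  "goes P t c c' \<longleftrightarrow> (\<exists>t'\<le>t. run P t' c = c')"

lemma goes_refl: "goes P t c c"
  unfolding goes_def by (intro exI[of _ 0]) simp

lemma goes_trans: "goes P s c c' \<Longrightarrow> goes P t c' c'' \<Longrightarrow> s + t \<le> u \<Longrightarrow> goes P u c c''"
  unfolding goes_def by (metis run_add add_mono order_trans)

lemma goes_run: "run P t c = c' \<Longrightarrow> t \<le> u \<Longrightarrow> goes P u c c'"
  unfolding goes_def by blast

definition consts_ok :: "(nat \<Rightarrow> int) \<Rightarrow> (nat \<Rightarrow> real) \<Rightarrow> bool" where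
  "consts_ok I R \<longleftrightarrow> I 2 = 1 \<and> R 2 = 3 \<and> R 3 = 1 \<and> R 4 = 2"

text \<open>Six instructions per one bit, four for the closing zero bit, one to clear the counter.
  Among the integer registers only \<open>r\<close> changes, among the real ones only 0 and
  1.\<close>

lemma read_number:
  assumes code: "take 8 (drop p P) = read_code p r" and len: "p + 8 \<le> length P" and r: "r \<noteq> 2"
    and ok: "consts_ok I R" and h: "holds_stream (k # ks) (R 0)"
  shows "\<exists>I' R'. goes P (6 * k + 5) (p, I, R) (p + 8, I', R') \<and> I' r = int k \<and> (\<forall>j. j \<noteq> r \<longrightarrow> I' j = I j)
    \<and> (\<forall>j\<ge>2. R' j = R j) \<and> holds_stream ks (R' 0)"
proof -
  have nth: "P ! (p + i) = read_code p r ! i" if "i < 8" for i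
    using arg_cong[OF code, of "\<lambda>l. l ! i"] that len by simp
  note nths = nth[of 0, simplified] nth[of 1, simplified] nth[of 2, simplified] nth[of 3, simplified]
    nth[of 4, simplified] nth[of 5, simplified] nth[of 6, simplified] nth[of 7, simplified]
  have c: "P ! p = IConst r 0" "P ! Suc p = RMul 0 0 2" "P ! Suc (Suc p) = RSub 1 0 3"
    "P ! Suc (Suc (Suc p)) = IfRPos 1 (p + 5)" "P ! Suc (Suc (Suc (Suc p))) = Jmp (p + 8)"
    "P ! (p + 5) = RSub 0 0 4" "P ! Suc (p + 5) = IAdd r r 2" "P ! Suc (Suc (p + 5)) = Jmp (p + 1)"
    "P ! (6 + p) = IAdd r r 2" "P ! (7 + p) = Jmp (p + 1)"
    using nths by (simp_all add: read_code_def eval_nat_numeral)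
  have loop: "\<exists>I' R'. goes P (6 * k + 4) (Suc p, I, R) (p + 8, I', R') \<and> I' r = m + int k \<and> (\<forall>j. j \<noteq> r \<longrightarrow> I' j = I j)
    \<and> (\<forall>j\<ge>2. R' j = R j) \<and> holds_stream ks (R' 0)"
    if "consts_ok I R" "holds_stream (k # ks) (R 0)" "I r = m" for k m I R
    using that
  proof (induction k arbitrary: m I R)
    case 0
    let ?R = "R(0 := R 0 * 3, 1 := R 0 * 3 - 1)"
    note s = holds_stream_0[OF 0(2)]
    have "run P (Suc (Suc (Suc (Suc 0)))) (Suc p, I, R) = (p + 8, I, ?R)"
      using 0(1) s(1) len by (simp add: run_step c consts_ok_def mult.commute)
    then have g: "goes P (6 * 0 + 4) (Suc p, I, R) (p + 8, I, ?R)" by (rule goes_run) simp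
    show ?case
    proof (intro exI[of _ I] exI[of _ ?R] conjI)
      show "goes P (6 * 0 + 4) (Suc p, I, R) (p + 8, I, ?R)" by (rule g)
      show "holds_stream ks (?R 0)" using s by (simp add: mult.commute)
    qed (use 0 in auto)
  next
    case (Suc k)
    let ?R = "R(0 := R 0 * 3 - 2, 1 := R 0 * 3 - 1)" and ?I = "I(r := I r + 1)"
    note s = holds_stream_Suc[OF Suc.prems(2)]
    have "run P (Suc (Suc (Suc (Suc (Suc (Suc 0)))))) (Suc p, I, R) = (Suc p, ?I, ?R)"
      using Suc.prems(1) s(1) len r by (simp add: run_step c consts_ok_def mult.commute fun_upd_twist)
    then have 1: "goes P 6 (Suc p, I, R) (Suc p, ?I, ?R)" by (rule goes_run) simp
    have ok: "consts_ok ?I ?R" using Suc.prems(1) r by (simp add: consts_ok_def)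
    have h: "holds_stream (k # ks) (?R 0)" using s(2) by (simp add: mult.commute)
    have Ir: "?I r = m + 1" using Suc.prems(3) by simp
    from Suc.IH[OF ok h Ir] obtain I' R' where
      2: "goes P (6 * k + 4) (Suc p, ?I, ?R) (p + 8, I', R')" "I' r = m + 1 + int k" "\<forall>j. j \<noteq> r \<longrightarrow> I' j = ?I j"
        "\<forall>j\<ge>2. R' j = ?R j" "holds_stream ks (R' 0)" by blast
    from goes_trans[OF 1 2(1), of "6 * Suc k + 4"]
    show ?case using 2(2-5) by (intro exI[of _ I'] exI[of _ R'] conjI) simp_all
  qed
  have 1: "goes P 1 (p, I, R) (Suc p, I(r := 0), R)"
    by (rule goes_run[of _ "Suc 0"]) (use len in \<open>simp_all add: run_step c\<close>)
  have "consts_ok (I(r := 0)) R" using ok r by (simp add: consts_ok_def)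
  from loop[OF this h fun_upd_same] obtain I' R' where
    2: "goes P (6 * k + 4) (Suc p, I(r := 0), R) (p + 8, I', R')" "I' r = 0 + int k" "\<forall>j. j \<noteq> r \<longrightarrow> I' j = (I(r := 0)) j"
        "\<forall>j\<ge>2. R' j = R j" "holds_stream ks (R' 0)" by blast
  from goes_trans[OF 1 2(1), of "6 * k + 5"]
  show ?thesis using 2 by (intro exI[of _ I'] exI[of _ R']) auto
qed

text \<open>The operation code is shifted by one so that 0 can mark the end of a block.\<close>

definition gate_code :: "(nat \<Rightarrow> nat) \<Rightarrow> nat \<times> nat \<times> nat \<Rightarrow> nat list" where
  "gate_code adr = (\<lambda>(k, a, b). [Suc k, adr a, adr b])"

definition base_adr :: "nat \<Rightarrow> nat \<Rightarrow> nat" where "base_adr n d = 9 + n + n * d"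

text \<open>Inputs stay in place, except for the first eight, which make room for scratch registers.
  The constant 1 is the one that the interpreter keeps in register 3; results are stored from
  \<open>base_adr n d + 8\<close> on.\<close>

definition adr :: "nat \<Rightarrow> nat \<Rightarrow> nat \<Rightarrow> nat" where
  "adr n d j = (if j < 1 + n + n * d then (if j < 8 then base_adr n d + j else j)
     else if j = 1 + n + n * d then 3 else base_adr n d + 8 + (j - (2 + n + n * d)))"

text \<open>Three closing zeros, because triples are read as a whole before the end mark is
  tested.\<close>

definition block :: "nat \<Rightarrow> nat \<Rightarrow> (nat \<times> nat \<times> nat) list \<Rightarrow> nat list" where
  "block n d gs = [n, d] @ concat (map (gate_code (adr n d)) gs) @ [0, 0, 0]"

definition loop_inv :: "nat \<Rightarrow> nat \<Rightarrow> (nat \<Rightarrow> int) \<Rightarrow> (nat \<Rightarrow> real) \<Rightarrow> bool" where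
  "loop_inv n d I R \<longleftrightarrow> consts_ok I R \<and> I 0 = int n \<and> I 1 = int d \<and> I 10 = 0 \<and> I 11 = int (base_adr n d + 8)"

lemma loop_inv_cong:
  "loop_inv n d I R \<Longrightarrow> (\<forall>j\<in>{0,1,2,10,11}. I' j = I j) \<Longrightarrow> (\<forall>j\<in>{2,3,4}. R' j = R j) \<Longrightarrow> loop_inv n d I' R'"
  by (simp add: loop_inv_def consts_ok_def)

lemma read_triple:
  assumes i: "loop_inv n d I R" and h: "holds_stream (k # a # b # ks) (R 0)"
  shows "\<exists>I' R'. goes (interpreter c) (6 * (k + a + b) + 15) (58, I, R) (82, I', R') \<and> loop_inv n d I' R'
    \<and> I' 5 = int k \<and> I' 6 = int a \<and> I' 7 = int b \<and> I' 8 = I 8 \<and> I' 9 = I 9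
    \<and> (\<forall>j\<ge>2. R' j = R j) \<and> holds_stream ks (R' 0)"
proof -
  have ok: "consts_ok I R" using i by (simp add: loop_inv_def)
  from read_number[OF interpreter_read(3)[of c] _ _ ok h, unfolded length_interpreter, simplified] obtain I1 R1 where
    1: "goes (interpreter c) (6 * k + 5) (58, I, R) (66, I1, R1)" "I1 5 = int k" "\<forall>j. j \<noteq> 5 \<longrightarrow> I1 j = I j"
      "\<forall>j\<ge>2. R1 j = R j" "holds_stream (a # b # ks) (R1 0)" by auto
  have ok1: "consts_ok I1 R1" using ok 1 by (simp add: consts_ok_def)
  from read_number[OF interpreter_read(4)[of c] _ _ ok1 1(5), unfolded length_interpreter, simplified] obtain I2 R2 where
    2: "goes (interpreter c) (6 * a + 5) (66, I1, R1) (74, I2, R2)" "I2 6 = int a" "\<forall>j. j \<noteq> 6 \<longrightarrow> I2 j = I1 j"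
      "\<forall>j\<ge>2. R2 j = R1 j" "holds_stream (b # ks) (R2 0)" by auto
  have ok2: "consts_ok I2 R2" using ok1 2 by (simp add: consts_ok_def)
  from read_number[OF interpreter_read(5)[of c] _ _ ok2 2(5), unfolded length_interpreter, simplified] obtain I3 R3 where
    3: "goes (interpreter c) (6 * b + 5) (74, I2, R2) (82, I3, R3)" "I3 7 = int b" "\<forall>j. j \<noteq> 7 \<longrightarrow> I3 j = I2 j"
      "\<forall>j\<ge>2. R3 j = R2 j" "holds_stream ks (R3 0)" by auto
  have "goes (interpreter c) (6 * (k + a + b) + 15) (58, I, R) (82, I3, R3)"
    by (rule goes_trans[OF goes_trans[OF 1(1) 2(1) order_refl] 3(1)]) simp
  moreover have "loop_inv n d I3 R3"
    by (rule loop_inv_cong[OF i]) (use 1(3,4) 2(3,4) 3(3,4) in auto)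
  ultimately show ?thesis using 1 2 3 by (intro exI[of _ I3] exI[of _ R3]) auto
qed

lemma read_header:
  assumes i: "loop_inv n d I R" and h: "holds_stream (n' # d' # ks) (R 0)"
  shows "\<exists>I' R'. goes (interpreter c) (6 * (n' + d') + 22) (30, I, R) (58, I', R') \<and> loop_inv n d I' R'
    \<and> I' 8 = int (base_adr n d + 8) \<and> I' 9 = (if n' = n \<and> d' = d then 1 else 0)
    \<and> (\<forall>j\<ge>2. R' j = R j) \<and> holds_stream ks (R' 0)"
proof -
  have ok: "consts_ok I R" using i by (simp add: loop_inv_def)
  from read_number[OF interpreter_read(1)[of c] _ _ ok h, unfolded length_interpreter, simplified] obtain I1 R1 where
    1: "goes (interpreter c) (6 * n' + 5) (30, I, R) (38, I1, R1)" "I1 5 = int n'" "\<forall>j. j \<noteq> 5 \<longrightarrow> I1 j = I j"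
      "\<forall>j\<ge>2. R1 j = R j" "holds_stream (d' # ks) (R1 0)" by auto
  have ok1: "consts_ok I1 R1" using ok 1 by (simp add: consts_ok_def)
  from read_number[OF interpreter_read(2)[of c] _ _ ok1 1(5), unfolded length_interpreter, simplified] obtain I2 R2 where
    2: "goes (interpreter c) (6 * d' + 5) (38, I1, R1) (46, I2, R2)" "I2 6 = int d'" "\<forall>j. j \<noteq> 6 \<longrightarrow> I2 j = I1 j"
      "\<forall>j\<ge>2. R2 j = R1 j" "holds_stream ks (R2 0)" by auto
  have i2: "loop_inv n d I2 R2" by (rule loop_inv_cong[OF i]) (use 1(3,4) 2(3,4) in auto)
  have v: "I2 5 = int n'" "I2 6 = int d'" "I2 0 = int n" "I2 1 = int d" "I2 10 = 0" "I2 11 = int (base_adr n d + 8)"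
    using 1 2 i2 by (auto simp: loop_inv_def)
  note sim = run_step interpreter_nth length_interpreter v v(4)[unfolded One_nat_def]
  have "\<exists>I3. goes (interpreter c) 12 (46, I2, R2) (58, I3, R2) \<and> (\<forall>j\<in>{0,1,2,10,11}. I3 j = I2 j)
     \<and> I3 8 = int (base_adr n d + 8) \<and> I3 9 = (if n' = n \<and> d' = d then 1 else 0)"
  proof -
    consider "n' > n" | "n' < n" | "n' = n" "d' > d" | "n' = n" "d' < d" | "n' = n" "d' = d" by linarith
    then show ?thesis
    proof cases
      case 1
      have "run (interpreter c) (Suc (Suc (Suc (Suc (Suc 0))))) (46, I2, R2)
        = (58, I2(9 := 1, 5 := int n' - int n, 9 := 0, 8 := int (base_adr n d + 8)), R2)"
        using 1 by (simp add: sim)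
      then have "goes (interpreter c) 12 (46, I2, R2) (58, I2(9 := 1, 5 := int n' - int n, 9 := 0, 8 := int (base_adr n d + 8)), R2)" by (rule goes_run) simp
      then show ?thesis using 1 by (intro exI[of _ "I2(9 := 1, 5 := int n' - int n, 9 := 0, 8 := int (base_adr n d + 8))"] conjI) auto
    next
      case 2
      have "run (interpreter c) (Suc (Suc (Suc (Suc (Suc (Suc (Suc 0))))))) (46, I2, R2)
        = (58, I2(9 := 1, 5 := int n' - int n, 5 := - (int n' - int n), 9 := 0, 8 := int (base_adr n d + 8)), R2)"
        using 2 by (simp add: sim)
      then have "goes (interpreter c) 12 (46, I2, R2) (58, I2(9 := 1, 5 := int n' - int n, 5 := - (int n' - int n), 9 := 0, 8 := int (base_adr n d + 8)), R2)" by (rule goes_run) simp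
      then show ?thesis using 2 by (intro exI[of _ "I2(9 := 1, 5 := int n' - int n, 5 := - (int n' - int n), 9 := 0, 8 := int (base_adr n d + 8))"] conjI) auto
    next
      case 3
      have "run (interpreter c) (Suc (Suc (Suc (Suc (Suc (Suc (Suc (Suc (Suc 0))))))))) (46, I2, R2)
        = (58, I2(9 := 1, 5 := 0, 6 := int d' - int d, 9 := 0, 8 := int (base_adr n d + 8)), R2)"
        using 3 by (simp add: sim fun_upd_twist)
      then have "goes (interpreter c) 12 (46, I2, R2) (58, I2(9 := 1, 5 := 0, 6 := int d' - int d, 9 := 0, 8 := int (base_adr n d + 8)), R2)" by (rule goes_run) simp
      then show ?thesis using 3 by (intro exI[of _ "I2(9 := 1, 5 := 0, 6 := int d' - int d, 9 := 0, 8 := int (base_adr n d + 8))"] conjI) auto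
    next
      case 4
      have "run (interpreter c) (Suc (Suc (Suc (Suc (Suc (Suc (Suc (Suc (Suc (Suc (Suc 0))))))))))) (46, I2, R2)
        = (58, I2(9 := 1, 5 := 0, 6 := - (int d' - int d), 9 := 0, 8 := int (base_adr n d + 8)), R2)"
        using 4 by (simp add: sim fun_upd_twist)
      then have "goes (interpreter c) 12 (46, I2, R2) (58, I2(9 := 1, 5 := 0, 6 := - (int d' - int d), 9 := 0, 8 := int (base_adr n d + 8)), R2)" by (rule goes_run) simp
      then show ?thesis using 4 by (intro exI[of _ "I2(9 := 1, 5 := 0, 6 := - (int d' - int d), 9 := 0, 8 := int (base_adr n d + 8))"] conjI) auto
    next
      case 5
      have "run (interpreter c) (Suc (Suc (Suc (Suc (Suc (Suc (Suc (Suc (Suc (Suc (Suc 0))))))))))) (46, I2, R2)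
        = (58, I2(9 := 1, 5 := 0, 6 := 0, 8 := int (base_adr n d + 8)), R2)"
        using 5 by (simp add: sim fun_upd_twist)
      then have "goes (interpreter c) 12 (46, I2, R2) (58, I2(9 := 1, 5 := 0, 6 := 0, 8 := int (base_adr n d + 8)), R2)" by (rule goes_run) simp
      then show ?thesis using 5 by (intro exI[of _ "I2(9 := 1, 5 := 0, 6 := 0, 8 := int (base_adr n d + 8))"] conjI) auto
    qed
  qed
  then obtain I3 where 3: "goes (interpreter c) 12 (46, I2, R2) (58, I3, R2)" "\<forall>j\<in>{0,1,2,10,11}. I3 j = I2 j"
    "I3 8 = int (base_adr n d + 8)" "I3 9 = (if n' = n \<and> d' = d then 1 else 0)" by blast
  have "goes (interpreter c) (6 * (n' + d') + 22) (30, I, R) (58, I3, R2)"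
    by (rule goes_trans[OF goes_trans[OF 1(1) 2(1) order_refl] 3(1)]) simp
  moreover have "loop_inv n d I3 R2" by (rule loop_inv_cong[OF i2]) (use 3 in auto)
  ultimately show ?thesis using 1 2 3 by (intro exI[of _ I3] exI[of _ R2]) auto
qed

text \<open>Time is charged to the code length: a triple costs six steps per one bit plus a bounded
  overhead, for which its three zero bits pay. The rate of 20 per bit also covers execution of gates
  and block headers.\<close>

lemma skip_gates:
  assumes "loop_inv n d I R" "holds_stream (concat (map (gate_code f) gs) @ [0, 0, 0] @ ks) (R 0)" "I 9 = 0"
  shows "\<exists>I' R'. goes (interpreter c) (20 * length (unary (concat (map (gate_code f) gs) @ [0, 0, 0]))) (58, I, R) (30, I', R')
    \<and> loop_inv n d I' R' \<and> (\<forall>j\<ge>2. R' j = R j) \<and> holds_stream ks (R' 0)"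
  using assms
proof (induction gs arbitrary: I R)
  case Nil
  then have "holds_stream (0 # 0 # 0 # ks) (R 0)" by simp
  from read_triple[OF Nil.prems(1) this, of c] obtain I1 R1 where
    1: "goes (interpreter c) 15 (58, I, R) (82, I1, R1)" "loop_inv n d I1 R1" "I1 5 = 0" "I1 9 = I 9"
      "\<forall>j\<ge>2. R1 j = R j" "holds_stream ks (R1 0)" by auto
  have "run (interpreter c) (Suc (Suc (Suc 0))) (82, I1, R1) = (30, I1, R1)"
    using 1 Nil.prems(3) by (simp add: run_step interpreter_nth length_interpreter)
  then have 2: "goes (interpreter c) 3 (82, I1, R1) (30, I1, R1)" by (rule goes_run) simp
  have "goes (interpreter c) (20 * length (unary (concat (map (gate_code f) []) @ [0, 0, 0]))) (58, I, R) (30, I1, R1)"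
    by (rule goes_trans[OF 1(1) 2]) simp
  then show ?case using 1 by blast
next
  case (Cons g gs)
  obtain k a b where g: "g = (k, a, b)" by (cases g)
  from Cons.prems(2) have "holds_stream (Suc k # f a # f b # (concat (map (gate_code f) gs) @ [0, 0, 0] @ ks)) (R 0)"
    by (simp add: g gate_code_def)
  from read_triple[OF Cons.prems(1) this, of c] obtain I1 R1 where
    1: "goes (interpreter c) (6 * (Suc k + f a + f b) + 15) (58, I, R) (82, I1, R1)" "loop_inv n d I1 R1" "I1 5 = int (Suc k)" "I1 9 = I 9"
      "\<forall>j\<ge>2. R1 j = R j" "holds_stream (concat (map (gate_code f) gs) @ [0, 0, 0] @ ks) (R1 0)" by blast
  have "run (interpreter c) (Suc (Suc (Suc 0))) (82, I1, R1) = (58, I1, R1)"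
    using 1 Cons.prems(3) by (simp add: run_step interpreter_nth length_interpreter)
  then have 2: "goes (interpreter c) 3 (82, I1, R1) (58, I1, R1)" by (rule goes_run) simp
  from Cons.IH[OF 1(2,6)] 1(4) Cons.prems(3) obtain I2 R2 where
    3: "goes (interpreter c) (20 * length (unary (concat (map (gate_code f) gs) @ [0, 0, 0]))) (58, I1, R1) (30, I2, R2)"
    "loop_inv n d I2 R2" "\<forall>j\<ge>2. R2 j = R1 j" "holds_stream ks (R2 0)" by auto
  have "goes (interpreter c) (20 * length (unary (concat (map (gate_code f) (g # gs)) @ [0, 0, 0]))) (58, I, R) (30, I2, R2)"
    by (rule goes_trans[OF goes_trans[OF 1(1) 2 order_refl] 3(1)]) (simp add: g gate_code_def unary_append)
  then show ?case using 3 1(5) by (intro exI[of _ I2] exI[of _ R2]) auto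
qed

text \<open>Operands are kept apart from the next result and from the registers that the interpreter
  overwrites: apart from register 3, all addresses are at least 8.\<close>

lemma adr_inj:
  assumes "j < 2 + n + n * d + m" shows "adr n d j \<noteq> base_adr n d + 8 + m" "adr n d j \<ge> 2" "j \<noteq> 1 + n + n * d \<Longrightarrow> adr n d j \<ge> 8"
  using assms by (auto simp: adr_def base_adr_def)

lemma exec_gates:
  assumes "loop_inv n d I R" "holds_stream (concat (map (gate_code (adr n d)) gs) @ [0, 0, 0] @ ks) (R 0)" "I 9 = 1"
    and "wf_gates gs (length v)" "length v = 2 + n + n * d + m" "I 8 = int (base_adr n d + 8 + m)"
    and "\<forall>j<length v. R (adr n d j) = v ! j"
  shows "\<exists>I' R'. goes (interpreter c) (20 * length (unary (concat (map (gate_code (adr n d)) gs) @ [0, 0, 0]))) (58, I, R) (108, I', R')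
    \<and> loop_inv n d I' R' \<and> I' 8 = int (base_adr n d + 8 + m + length gs)
    \<and> (\<forall>j<length v + length gs. R' (adr n d j) = run_gates gs v ! j)"
  using assms
proof (induction gs arbitrary: I R v m)
  case Nil
  then have "holds_stream (0 # 0 # 0 # ks) (R 0)" by simp
  from read_triple[OF Nil.prems(1) this, of c] obtain I1 R1 where
    1: "goes (interpreter c) 15 (58, I, R) (82, I1, R1)" "loop_inv n d I1 R1" "I1 5 = 0" "I1 8 = I 8" "I1 9 = I 9"
      "\<forall>j\<ge>2. R1 j = R j" "holds_stream ks (R1 0)" by auto
  have "run (interpreter c) (Suc (Suc 0)) (82, I1, R1) = (108, I1, R1)"
    using 1 Nil.prems(3) by (simp add: run_step interpreter_nth length_interpreter)
  then have 2: "goes (interpreter c) 2 (82, I1, R1) (108, I1, R1)" by (rule goes_run) simp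
  have "goes (interpreter c) (20 * length (unary (concat (map (gate_code (adr n d)) []) @ [0, 0, 0]))) (58, I, R) (108, I1, R1)"
    by (rule goes_trans[OF 1(1) 2]) simp
  moreover have "R1 (adr n d j) = v ! j" if "j < length v" for j
    using 1(6) Nil.prems(7) that adr_inj(2)[of j n d m] Nil.prems(5) by simp
  ultimately show ?case using 1 Nil.prems by (intro exI[of _ I1] exI[of _ R1]) auto
next
  case (Cons g gs)
  obtain k a b where g: "g = (k, a, b)" by (cases g)
  from Cons.prems(4) have wf: "k \<le> 3" "a < length v" "b < length v" "wf_gates gs (Suc (length v))" by (auto simp: g)
  from Cons.prems(2) have "holds_stream (Suc k # adr n d a # adr n d b # (concat (map (gate_code (adr n d)) gs) @ [0, 0, 0] @ ks)) (R 0)"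
    by (simp add: g gate_code_def)
  from read_triple[OF Cons.prems(1) this, of c] obtain I1 R1 where
    1: "goes (interpreter c) (6 * (Suc k + adr n d a + adr n d b) + 15) (58, I, R) (82, I1, R1)" "loop_inv n d I1 R1" "I1 5 = int (Suc k)"
      "I1 6 = int (adr n d a)" "I1 7 = int (adr n d b)" "I1 8 = I 8" "I1 9 = I 9"
      "\<forall>j\<ge>2. R1 j = R j" "holds_stream (concat (map (gate_code (adr n d)) gs) @ [0, 0, 0] @ ks) (R1 0)" by blast
  have va: "R1 (adr n d a) = v ! a" "R1 (adr n d b) = v ! b"
    using 1(8) Cons.prems(5,7) wf adr_inj(2)[of a n d m] adr_inj(2)[of b n d m] by auto
  \<comment> \<open>Register 5 receives the first operand before the second is fetched, so the
    second must not live there.\<close>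
  have b5: "adr n d b \<noteq> 5"
    using adr_inj(3)[of b n d m] wf Cons.prems(5) by (cases "b = 1 + n + n * d") (auto simp: adr_def)
  let ?w = "gop k (v ! a) (v ! b)" and ?D = "base_adr n d + 8 + m"
  let ?I = "\<lambda>x. I1(5 := x, 8 := int (Suc ?D))"
  let ?R = "R1(5 := ?w, 6 := v ! b, ?D := ?w)"
  have nD: "nat (int (base_adr n d) + 8 + int m) = ?D" by simp
  have c2: "I1 2 = 1" "R1 3 = 1" using 1(2) by (auto simp: loop_inv_def consts_ok_def)
  note sim = run_step interpreter_nth length_interpreter c2 1(3-7) Cons.prems(3,6) va b5 gop_def nD
  have "\<exists>x. goes (interpreter c) 18 (82, I1, R1) (58, ?I x, ?R)"
  proof -
    \<comment> \<open>For the comparison gate, 1 is produced as x / x for positive x and 0 as x - x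
      otherwise.\<close>
    consider "k = 0" | "k = 1" | "k = 2" | "k = 3" "v ! a > 0" | "k = 3" "\<not> v ! a > 0" using wf(1) by linarith
    then show ?thesis
    proof cases
      case 1
      have "run (interpreter c) (Suc (Suc (Suc (Suc (Suc (Suc (Suc (Suc (Suc (Suc (Suc 0))))))))))) (82, I1, R1) = (58, ?I 0, ?R)"
        using 1 by (simp add: sim fun_upd_twist)
      then show ?thesis by (intro exI[of _ 0], elim goes_run) simp
    next
      case 2
      have "run (interpreter c) (Suc (Suc (Suc (Suc (Suc (Suc (Suc (Suc (Suc (Suc (Suc (Suc (Suc 0))))))))))))) (82, I1, R1) = (58, ?I 0, ?R)"
        using 2 by (simp add: sim fun_upd_twist)
      then show ?thesis by (intro exI[of _ 0], elim goes_run) simp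
    next
      case 3
      have "run (interpreter c) (Suc (Suc (Suc (Suc (Suc (Suc (Suc (Suc (Suc (Suc (Suc (Suc (Suc (Suc (Suc 0))))))))))))))) (82, I1, R1) = (58, ?I 0, ?R)"
        using 3 by (simp add: sim fun_upd_twist)
      then show ?thesis by (intro exI[of _ 0], elim goes_run) simp
    next
      case 4
      have "run (interpreter c) (Suc (Suc (Suc (Suc (Suc (Suc (Suc (Suc (Suc (Suc (Suc (Suc (Suc (Suc (Suc 0))))))))))))))) (82, I1, R1) = (58, ?I 1, ?R)"
        using 4 by (simp add: sim fun_upd_twist)
      then show ?thesis by (intro exI[of _ 1], elim goes_run) simp
    next
      case 5
      have "run (interpreter c) (Suc (Suc (Suc (Suc (Suc (Suc (Suc (Suc (Suc (Suc (Suc (Suc (Suc (Suc (Suc (Suc 0)))))))))))))))) (82, I1, R1) = (58, ?I 1, ?R)"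
        using 5 by (simp add: sim fun_upd_twist)
      then show ?thesis by (intro exI[of _ 1], elim goes_run) simp
    qed
  qed
  then obtain x where 2: "goes (interpreter c) 18 (82, I1, R1) (58, ?I x, ?R)" by blast
  have D: "?D > 8" by (simp add: base_adr_def)
  have i2: "loop_inv n d (?I x) ?R" by (rule loop_inv_cong[OF 1(2)]) (use D in auto)
  have h2: "holds_stream (concat (map (gate_code (adr n d)) gs) @ [0, 0, 0] @ ks) (?R 0)" using 1(9) D by simp
  have mem: "\<forall>j<length (v @ [?w]). ?R (adr n d j) = (v @ [?w]) ! j"
  proof (intro allI impI)
    fix j assume j: "j < length (v @ [?w])"
    show "?R (adr n d j) = (v @ [?w]) ! j"
    proof (cases "j < length v")
      case True
      have "adr n d j \<noteq> 5" "adr n d j \<noteq> 6"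
        using adr_inj(3)[of j n d m] True Cons.prems(5) by (cases "j = 1 + n + n * d"; auto simp: adr_def)+
      moreover have "adr n d j \<noteq> ?D" "adr n d j \<ge> 2" using adr_inj[of j n d m] True Cons.prems(5) by auto
      ultimately show ?thesis using True 1(8) Cons.prems(7) by (simp add: nth_append)
    next
      case False
      then have "j = length v" using j by simp
      then have "adr n d j = ?D" using Cons.prems(5) by (simp add: adr_def)
      then show ?thesis using \<open>j = length v\<close> by (simp add: nth_append)
    qed
  qed
  have "wf_gates gs (length (v @ [?w]))" "length (v @ [?w]) = 2 + n + n * d + Suc m"
    "?I x 8 = int (base_adr n d + 8 + Suc m)" "?I x 9 = 1"
    using wf Cons.prems(3,5) 1(7) by auto
  from Cons.IH[OF i2 h2 this(4,1,2,3) mem] obtain I2 R2 where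
    3: "goes (interpreter c) (20 * length (unary (concat (map (gate_code (adr n d)) gs) @ [0, 0, 0]))) (58, ?I x, ?R) (108, I2, R2)"
    "loop_inv n d I2 R2" "I2 8 = int (base_adr n d + 8 + Suc m + length gs)"
    "\<forall>j<length (v @ [?w]) + length gs. R2 (adr n d j) = run_gates gs (v @ [?w]) ! j" by blast
  have "goes (interpreter c) (20 * length (unary (concat (map (gate_code (adr n d)) (g # gs)) @ [0, 0, 0]))) (58, I, R) (108, I2, R2)"
    by (rule goes_trans[OF goes_trans[OF 1(1) 2 order_refl] 3(1)]) (simp add: g gate_code_def unary_append)
  then show ?case using 3 by (intro exI[of _ I2] exI[of _ R2]) (auto simp: g)
qed

lemma skip_blocks:
  assumes "loop_inv n d I R" "holds_stream (concat (map (\<lambda>(n, d). block n d (prog n d)) xs) @ ks) (R 0)" "(n, d) \<notin> set xs"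
  shows "\<exists>I' R'. goes (interpreter c) (20 * length (unary (concat (map (\<lambda>(n, d). block n d (prog n d)) xs)))) (30, I, R) (30, I', R')
    \<and> loop_inv n d I' R' \<and> (\<forall>j\<ge>2. R' j = R j) \<and> holds_stream ks (R' 0)"
  using assms
proof (induction xs arbitrary: I R)
  case Nil
  then show ?case by (intro exI[of _ I] exI[of _ R]) (auto intro: goes_refl)
next
  case (Cons x xs)
  obtain n' d' where x: "x = (n', d')" by (cases x)
  let ?G = "concat (map (gate_code (adr n' d')) (prog n' d')) @ [0, 0, 0]"
  let ?ks = "concat (map (\<lambda>(n, d). block n d (prog n d)) xs) @ ks"
  have "holds_stream (n' # d' # (?G @ ?ks)) (R 0)" using Cons.prems(2) by (simp add: x block_def)
  from read_header[OF Cons.prems(1) this, of c] obtain I1 R1 where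
    1: "goes (interpreter c) (6 * (n' + d') + 22) (30, I, R) (58, I1, R1)" "loop_inv n d I1 R1"
    "I1 9 = (if n' = n \<and> d' = d then 1 else 0)" "\<forall>j\<ge>2. R1 j = R j" "holds_stream (?G @ ?ks) (R1 0)" by blast
  have "I1 9 = 0" using 1(3) Cons.prems(3) x by auto
  from skip_gates[OF 1(2) 1(5)[unfolded append_assoc] this, of c] obtain I2 R2 where
    2: "goes (interpreter c) (20 * length (unary ?G)) (58, I1, R1) (30, I2, R2)" "loop_inv n d I2 R2"
    "\<forall>j\<ge>2. R2 j = R1 j" "holds_stream ?ks (R2 0)" by blast
  have "(n, d) \<notin> set xs" using Cons.prems(3) by simp
  from Cons.IH[OF 2(2,4) this] obtain I3 R3 where
    3: "goes (interpreter c) (20 * length (unary (concat (map (\<lambda>(n, d). block n d (prog n d)) xs)))) (30, I2, R2) (30, I3, R3)"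
    "loop_inv n d I3 R3" "\<forall>j\<ge>2. R3 j = R2 j" "holds_stream ks (R3 0)" by blast
  have "goes (interpreter c) (20 * length (unary (concat (map (\<lambda>(n, d). block n d (prog n d)) (x # xs))))) (30, I, R) (30, I3, R3)"
    by (rule goes_trans[OF goes_trans[OF 1(1) 2(1) order_refl] 3(1)]) (simp add: x block_def unary_append)
  then show ?case using 1 2 3 by (intro exI[of _ I3] exI[of _ R3]) auto
qed

text \<open>Integer registers can only add and subtract, so n d is accumulated by d additions of
  n.\<close>

lemma init_loop:
  "I 4 = int j \<Longrightarrow> I 2 = 1 \<Longrightarrow>
    \<exists>I'. goes (interpreter c) (4 * j + 2) (4, I, R) (9, I', R) \<and> I' 3 = I 3 + int j * I 0 \<and> (\<forall>i. i \<noteq> 3 \<and> i \<noteq> 4 \<longrightarrow> I' i = I i)"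
proof (induction j arbitrary: I)
  case 0
  have "run (interpreter c) (Suc (Suc 0)) (4, I, R) = (9, I, R)"
    using 0 by (simp add: run_step interpreter_nth length_interpreter)
  then have "goes (interpreter c) (4 * 0 + 2) (4, I, R) (9, I, R)" by (rule goes_run) simp
  then show ?case by (intro exI[of _ I]) simp
next
  case (Suc j)
  let ?I = "I(3 := I 3 + I 0, 4 := int j)"
  have "run (interpreter c) (Suc (Suc (Suc (Suc 0)))) (4, I, R) = (4, ?I, R)"
    using Suc.prems by (simp add: run_step interpreter_nth length_interpreter)
  then have 1: "goes (interpreter c) 4 (4, I, R) (4, ?I, R)" by (rule goes_run) simp
  have "?I 4 = int j" "?I 2 = 1" using Suc.prems by auto
  from Suc.IH[OF this] obtain I' where
    2: "goes (interpreter c) (4 * j + 2) (4, ?I, R) (9, I', R)" "I' 3 = ?I 3 + int j * ?I 0" "\<forall>i. i \<noteq> 3 \<and> i \<noteq> 4 \<longrightarrow> I' i = ?I i"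
    by blast
  have "goes (interpreter c) (4 * Suc j + 2) (4, I, R) (9, I', R)"
    by (rule goes_trans[OF 1 2(1)]) simp
  then show ?case using 2(2,3) by (intro exI[of _ I']) (auto simp: algebra_simps)
qed

lemma nat_int_add_numeral: "nat (int B + numeral w) = B + numeral w" "nat (numeral w + int B) = B + numeral w" "nat (int B + 1) = Suc B" "nat (1 + int B) = Suc B"
  by (simp_all add: nat_add_distrib)

lemma init_phase:
  fixes n d :: nat and X :: "nat \<Rightarrow> nat \<Rightarrow> real" and y :: "nat \<Rightarrow> real" and k c :: real
  defines "R0 \<equiv> snd (snd (init_config n d X y k))"
  shows "\<exists>I R. goes (interpreter c) (4 * d + 40) (init_config n d X y k) (30, I, R) \<and> loop_inv n d I R \<and> R 0 = c
    \<and> (\<forall>j<2 + n + n * d. R (adr n d j) = (map R0 [0..<1 + n + n * d] @ [1]) ! j)"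
proof -
  define I0 :: "nat \<Rightarrow> int" where "I0 = (\<lambda>r. if r = 0 then int n else if r = 1 then int d else 0)"
  have ic: "init_config n d X y k = (0, I0, R0)" by (simp add: init_config_def R0_def I0_def)
  let ?I1 = "I0(2 := 1, 3 := 9 + int n, 4 := int d)"
  have c23: "interpreter c ! Suc (Suc 0) = IAdd 3 3 0" "interpreter c ! Suc (Suc (Suc 0)) = IAdd 4 1 10"
    using interpreter_nth(4,5)[of c] by (simp_all only: numeral_2_eq_2 numeral_3_eq_3)
  have "run (interpreter c) (Suc (Suc (Suc (Suc 0)))) (0, I0, R0) = (Suc (Suc (Suc (Suc 0))), ?I1, R0)"
    by (simp add: run_step interpreter_nth c23 length_interpreter I0_def)
  moreover have "Suc (Suc (Suc (Suc 0))) = 4" by simp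
  ultimately have "run (interpreter c) (Suc (Suc (Suc (Suc 0)))) (0, I0, R0) = (4, ?I1, R0)" by metis
  then have 1: "goes (interpreter c) 4 (0, I0, R0) (4, ?I1, R0)" by (rule goes_run) simp
  have "?I1 4 = int d" "?I1 2 = 1" by auto
  from init_loop[OF this, of c R0] obtain I2 where
    2: "goes (interpreter c) (4 * d + 2) (4, ?I1, R0) (9, I2, R0)" "I2 3 = ?I1 3 + int d * ?I1 0" "\<forall>i. i \<noteq> 3 \<and> i \<noteq> 4 \<longrightarrow> I2 i = ?I1 i" by blast
  define B where "B = base_adr n d"
  have B: "I2 3 = int B" "B > 8" using 2(2) by (simp_all add: I0_def B_def base_adr_def mult.commute)
  have v: "I2 2 = 1" "I2 10 = 0" "I2 0 = int n" "I2 1 = int d" using 2(3) by (auto simp: I0_def)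
  note sim = run_step interpreter_nth length_interpreter nat_int_add_numeral v B(1)
  let ?R1 = "R0(B := R0 0, B + 1 := R0 1, B + 2 := R0 2, B + 3 := R0 3)"
  have "run (interpreter c) (Suc (Suc (Suc (Suc (Suc (Suc (Suc (Suc (Suc 0))))))))) (9, I2, R0)
    = (18, I2(11 := 4 + int B), ?R1)"
    using B(2) by (simp add: sim)
  then have 3: "goes (interpreter c) 9 (9, I2, R0) (18, I2(11 := 4 + int B), ?R1)" by (rule goes_run) simp
  let ?R2 = "?R1(B + 4 := R0 4, B + 5 := R0 5, B + 6 := R0 6, B + 7 := R0 7)"
  have "run (interpreter c) (Suc (Suc (Suc (Suc (Suc (Suc (Suc (Suc 0)))))))) (18, I2(11 := 4 + int B), ?R1)
    = (26, I2(11 := 8 + int B), ?R2)"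
    using B(2) by (simp add: sim)
  then have 4: "goes (interpreter c) 8 (18, I2(11 := 4 + int B), ?R1) (26, I2(11 := 8 + int B), ?R2)" by (rule goes_run) simp
  let ?I3 = "I2(11 := 8 + int B)"
  let ?R3 = "?R2(0 := c, 2 := 3, 3 := 1, 4 := 2)"
  have "run (interpreter c) (Suc (Suc (Suc (Suc 0)))) (26, ?I3, ?R2) = (30, ?I3, ?R3)"
    by (simp add: sim)
  then have 5: "goes (interpreter c) 4 (26, ?I3, ?R2) (30, ?I3, ?R3)" by (rule goes_run) simp
  have g: "goes (interpreter c) (4 * d + 40) (init_config n d X y k) (30, ?I3, ?R3)"
    unfolding ic
    by (rule goes_trans[OF goes_trans[OF 1 2(1) order_refl] goes_trans[OF goes_trans[OF 3 4 order_refl] 5 order_refl]]) simp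
  have i: "loop_inv n d ?I3 ?R3" using v B by (simp add: loop_inv_def consts_ok_def B_def)
  have mem: "?R3 (adr n d j) = (map R0 [0..<1 + n + n * d] @ [1]) ! j" if j: "j < 2 + n + n * d" for j
  proof -
    consider "j < 8" "j < 1 + n + n * d" | "j \<ge> 8" "j < 1 + n + n * d" | "j = 1 + n + n * d" using j by linarith
    then show ?thesis
    proof cases
      case 1
      have "(map R0 [0..<1 + n + n * d] @ [1]) ! j = R0 j" using 1 by (simp add: nth_append del: upt_Suc)
      moreover have "adr n d j = B + j" using 1 by (simp add: adr_def B_def)
      moreover have "j = 0 \<or> j = 1 \<or> j = 2 \<or> j = 3 \<or> j = 4 \<or> j = 5 \<or> j = 6 \<or> j = 7" using 1 by linarith
      ultimately show ?thesis using B(2) by (elim disjE) simp_all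
    next
      case 2
      have "(map R0 [0..<1 + n + n * d] @ [1]) ! j = R0 j" using 2 by (simp add: nth_append del: upt_Suc)
      moreover have "adr n d j = j" "j < B" using 2 by (auto simp: adr_def B_def base_adr_def)
      ultimately show ?thesis using 2 by simp
    next
      case 3
      then show ?thesis using B(2) by (simp add: adr_def nth_append del: upt_Suc)
    qed
  qed
  have "?R3 0 = c" using B(2) by simp
  with g i mem show ?thesis by blast
qed

theorem interpreter_correct:
  fixes X :: "nat \<Rightarrow> nat \<Rightarrow> real" and y :: "nat \<Rightarrow> real" and k c :: real
  assumes h: "holds_stream (concat (map (\<lambda>(n, d). block n d (prog n d)) xs) @ block n d (prog n d) @ ks) c"
    and xs: "(n, d) \<notin> set xs" and wf: "wf_gates (prog n d) (2 + n + n * d)" "prog n d \<noteq> []"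
  shows "\<exists>t\<le>4 * d + 80 + 20 * length (unary (concat (map (\<lambda>(n, d). block n d (prog n d)) xs) @ block n d (prog n d))).
    halted (interpreter c) (run (interpreter c) t (init_config n d X y k)) \<and>
    (accepts (run (interpreter c) t (init_config n d X y k)) \<longleftrightarrow>
     last (run_gates (prog n d) (map (snd (snd (init_config n d X y k))) [0..<1 + n + n * d] @ [1])) > 0)"
proof -
  let ?v = "map (snd (snd (init_config n d X y k))) [0..<1 + n + n * d] @ [1]"
  let ?G = "concat (map (gate_code (adr n d)) (prog n d)) @ [0, 0, 0]"
  let ?Xs = "concat (map (\<lambda>(n, d). block n d (prog n d)) xs)"
  have lv: "length ?v = 2 + n + n * d + 0" by simp
  from init_phase[where n = n and d = d and X = X and y = y and k = k and c = c] obtain I R where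
    1: "goes (interpreter c) (4 * d + 40) (init_config n d X y k) (30, I, R)" "loop_inv n d I R" "R 0 = c"
    "\<forall>j<2 + n + n * d. R (adr n d j) = ?v ! j" by blast
  have "holds_stream (?Xs @ (block n d (prog n d) @ ks)) (R 0)" using h 1(3) by simp
  from skip_blocks[OF 1(2) this xs, of c] obtain I1 R1 where
    2: "goes (interpreter c) (20 * length (unary ?Xs)) (30, I, R) (30, I1, R1)" "loop_inv n d I1 R1"
    "\<forall>j\<ge>2. R1 j = R j" "holds_stream (block n d (prog n d) @ ks) (R1 0)" by blast
  have "holds_stream (n # d # (?G @ ks)) (R1 0)" using 2(4) by (simp add: block_def)
  from read_header[OF 2(2) this, of c] obtain I2 R2 where
    3: "goes (interpreter c) (6 * (n + d) + 22) (30, I1, R1) (58, I2, R2)" "loop_inv n d I2 R2" "I2 8 = int (base_adr n d + 8)"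
    "I2 9 = (if n = n \<and> d = d then 1 else 0)" "\<forall>j\<ge>2. R2 j = R1 j" "holds_stream (?G @ ks) (R2 0)" by blast
  have mem: "\<forall>j<length ?v. R2 (adr n d j) = ?v ! j"
  proof (intro allI impI)
    fix j assume "j < length ?v"
    then have j: "j < 2 + n + n * d" by simp
    then have "adr n d j \<ge> 2" using adr_inj(2)[of j n d 0] by simp
    then show "R2 (adr n d j) = ?v ! j" using 1(4) j 2(3) 3(5) by simp
  qed
  have "wf_gates (prog n d) (length ?v)" "I2 8 = int (base_adr n d + 8 + 0)" "I2 9 = 1" using wf 3 by auto
  from exec_gates[OF 3(2) 3(6)[unfolded append_assoc] this(3,1) lv this(2) mem, of c] obtain I3 R3 where
    4: "goes (interpreter c) (20 * length (unary ?G)) (58, I2, R2) (108, I3, R3)" "loop_inv n d I3 R3"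
    "I3 8 = int (base_adr n d + 8 + 0 + length (prog n d))"
    "\<forall>j<length ?v + length (prog n d). R3 (adr n d j) = run_gates (prog n d) ?v ! j" by blast
  define w where "w = last (run_gates (prog n d) ?v)"
  have L: "length (prog n d) > 0" using wf by simp
  define j where "j = length ?v + length (prog n d) - 1"
  have j: "j < length ?v + length (prog n d)" "adr n d j = base_adr n d + 7 + length (prog n d)"
    using L by (auto simp: j_def adr_def)
  have "run_gates (prog n d) ?v \<noteq> []" using length_run_gates[of "prog n d" ?v] by force
  then have "w = run_gates (prog n d) ?v ! j"
    unfolding w_def j_def using length_run_gates[of "prog n d" ?v] by (simp add: last_conv_nth)
  then have w: "R3 (base_adr n d + 7 + length (prog n d)) = w" using 4(4) j by metis
  have nt: "nat (int (base_adr n d) + 8 + int (length (prog n d)) - 1) = base_adr n d + 7 + length (prog n d)"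
    "nat (7 + (int (base_adr n d) + int (length (prog n d)))) = base_adr n d + 7 + length (prog n d)" by simp_all
  note sim = run_step interpreter_nth length_interpreter 4(3) nt w
  have i2: "I3 2 = 1" using 4(2) by (simp add: loop_inv_def consts_ok_def)
  obtain I4 R4 p where 5: "goes (interpreter c) 4 (108, I3, R3) (p, I4, R4)" "p = 112 \<or> p = 114" "I4 0 = 1 \<longleftrightarrow> w > 0"
  proof (cases "w > 0")
    case True
    have "run (interpreter c) (Suc (Suc (Suc (Suc 0)))) (108, I3, R3)
      = (114, I3(8 := 7 + (int (base_adr n d) + int (length (prog n d))), 0 := 1), R3(5 := w))"
      using True by (simp add: sim i2)
    from goes_run[OF this, of 4] show ?thesis by (rule that) (use True in auto)
  next
    case False
    have "run (interpreter c) (Suc (Suc (Suc (Suc 0)))) (108, I3, R3)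
      = (112, I3(8 := 7 + (int (base_adr n d) + int (length (prog n d))), 0 := 0), R3(5 := w))"
      using False by (simp add: sim i2)
    from goes_run[OF this, of 4] show ?thesis by (rule that) (use False in auto)
  qed
  have "goes (interpreter c) (4 * d + 80 + 20 * length (unary (?Xs @ block n d (prog n d)))) (init_config n d X y k) (p, I4, R4)"
    by (rule goes_trans[OF goes_trans[OF goes_trans[OF 1(1) 2(1) order_refl] goes_trans[OF 3(1) 4(1) order_refl] order_refl] 5(1)])
      (simp add: block_def unary_append)
  then obtain t where t: "t \<le> 4 * d + 80 + 20 * length (unary (?Xs @ block n d (prog n d)))"
    "run (interpreter c) t (init_config n d X y k) = (p, I4, R4)" unfolding goes_def by blast
  have "halted (interpreter c) (p, I4, R4)" using 5(2) by (auto simp: halted_def interpreter_nth)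
  moreover have "accepts (p, I4, R4) \<longleftrightarrow> w > 0" using 5(3) by (simp add: accepts_def)
  ultimately show ?thesis using t unfolding w_def by (intro exI[of _ t]) simp
qed

section \<open>One real constant encodes all straight-line programs\<close>

text \<open>Blocks are ordered by the size v = (n + 1)^(d^3) that governs the permitted time. Both
  components are below v, so each list is finite and complete, and what precedes a block of size v
  can have length polynomial in v.\<close>

definition pairs_at :: "nat \<Rightarrow> (nat \<times> nat) list" where
  "pairs_at v = filter (\<lambda>(n, d). (n + 1) ^ (d ^ 3) = v) (List.product [1..<v + 1] [1..<v + 1])"

definition pairs_upto :: "nat \<Rightarrow> (nat \<times> nat) list" where
  "pairs_upto v = concat (map pairs_at [0..<Suc v])"

lemma less_size:
  assumes "1 \<le> n" "1 \<le> d"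
  shows "n < (n + 1) ^ (d ^ 3)" "d < (n + 1) ^ (d ^ 3)"
proof -
  have d3: "d \<le> d ^ 3" "1 \<le> d ^ 3" using assms self_le_power[of d 3] by auto
  have "(n + 1) ^ 1 \<le> (n + 1) ^ (d ^ 3)" by (rule power_increasing) (use d3 in auto)
  then show "n < (n + 1) ^ (d ^ 3)" by simp
  have "d < 2 ^ d" by (rule less_exp)
  also have "(2::nat) ^ d \<le> (n + 1) ^ d" by (rule power_mono) (use assms in auto)
  also have "\<dots> \<le> (n + 1) ^ (d ^ 3)" by (rule power_increasing) (use d3 in auto)
  finally show "d < (n + 1) ^ (d ^ 3)" .
qed

lemma pairs_upto_member: "1 \<le> n \<Longrightarrow> 1 \<le> d \<Longrightarrow> (n, d) \<in> set (pairs_upto ((n + 1) ^ (d ^ 3)))"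
  using less_size[of n d]
  by (auto simp: pairs_upto_def pairs_at_def simp del: upt_Suc intro!: bexI[of _ "(n + 1) ^ (d ^ 3)"])

lemma pairs_upto_set: "(n, d) \<in> set (pairs_upto v) \<Longrightarrow> 1 \<le> n \<and> 1 \<le> d \<and> (n + 1) ^ (d ^ 3) \<le> v"
  by (auto simp: pairs_upto_def pairs_at_def simp del: upt_Suc)

lemma length_pairs_upto: "length (pairs_upto v) \<le> Suc v * v\<^sup>2"
proof -
  have "length (pairs_at u) \<le> v\<^sup>2" if "u \<le> v" for u
  proof -
    have "length (pairs_at u) \<le> length (List.product [1..<u + 1] [1..<u + 1])"
      unfolding pairs_at_def by (rule length_filter_le)
    also have "\<dots> = u\<^sup>2" by (simp add: power2_eq_square)
    also have "\<dots> \<le> v\<^sup>2" using that by (rule power_mono) simp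
    finally show ?thesis .
  qed
  then have "sum_list (map (\<lambda>u. length (pairs_at u)) [0..<Suc v]) \<le> sum_list (map (\<lambda>u. v\<^sup>2) [0..<Suc v])"
    by (intro sum_list_mono) (auto simp del: upt_Suc)
  then show ?thesis by (simp add: pairs_upto_def length_concat comp_def sum_list_triv del: upt_Suc)
qed

lemma pairs_upto_prefix: "u \<le> v \<Longrightarrow> \<exists>ys. pairs_upto v = pairs_upto u @ ys"
proof (induction v rule: dec_induct)
  case (step v)
  then obtain ys where "pairs_upto v = pairs_upto u @ ys" by blast
  moreover have "pairs_upto (Suc v) = pairs_upto v @ pairs_at (Suc v)" by (simp add: pairs_upto_def)
  ultimately show ?case by simp
qed simp

text \<open>The lists for increasing v extend each other, so their codes are prefixes of a single
  infinite bit sequence.\<close>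

lemma stream_exists:
  fixes f :: "nat \<times> nat \<Rightarrow> nat list"
  shows "\<exists>c. \<forall>v. holds_stream (concat (map f (pairs_upto v))) c"
proof -
  define B where "B v = unary (concat (map f (pairs_upto v)))" for v
  define s where "s i = (if \<exists>v. i < length (B v) then B (LEAST v. i < length (B v)) ! i else False)" for i
  have "s i = B v ! i" if i: "i < length (B v)" for i v
  proof -
    define u where "u = (LEAST v. i < length (B v))"
    have u: "i < length (B u)" "u \<le> v" unfolding u_def using i by (auto intro: LeastI Least_le)
    from pairs_upto_prefix[OF u(2)] obtain ys where "B v = B u @ unary (concat (map f ys))"
      by (auto simp: B_def unary_append)
    then have "B v ! i = B u ! i" using u(1) by (simp add: nth_append)
    then show ?thesis using i by (auto simp: s_def u_def)
  qed
  then show ?thesis unfolding holds_stream_def B_def by (intro exI[of _ "cantor s"] allI exI[of _ s]) auto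
qed

lemma length_unary_concat: "(\<And>x. x \<in> set xs \<Longrightarrow> length (unary (f x)) \<le> M) \<Longrightarrow> length (unary (concat (map f xs))) \<le> length xs * M"
  by (induction xs) (auto simp: unary_append add_mono)

lemma length_unary_block:
  assumes "wf_gates gs (2 + n + n * d)"
  shows "length (unary (block n d gs)) \<le> n + d + 5 + length gs * (49 + 4 * (n + n * d) + 2 * length gs)"
proof -
  have wf: "k \<le> 3 \<and> a < m + length gs \<and> b < m + length gs" if "wf_gates gs m" "(k, a, b) \<in> set gs" for k a b m
    using that by (induction gs m rule: wf_gates.induct) force+
  have adr: "adr n d j \<le> 19 + n + n * d + j" for j by (auto simp: adr_def base_adr_def)
  have "length (unary (concat (map (gate_code (adr n d)) gs))) \<le> length gs * (49 + 4 * (n + n * d) + 2 * length gs)"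
  proof (rule length_unary_concat)
    fix x assume x: "x \<in> set gs"
    obtain k a b where k: "x = (k, a, b)" by (cases x)
    from wf[OF assms x[unfolded k]] adr[of a] adr[of b]
    show "length (unary (gate_code (adr n d) x)) \<le> 49 + 4 * (n + n * d) + 2 * length gs"
      by (simp add: k gate_code_def)
  qed
  then show ?thesis by (simp add: block_def unary_append)
qed

text \<open>With v = (n + 1)^(d^3), at most 2 v^3 blocks are read. Each has code length of order
  v^(2 K + 2), because it has at most K v^K gates whose addresses are bounded linearly by the
  program length and the number of inputs. The family \<open>prog\<close> is arbitrary; only lengths
  enter.\<close>

theorem straight_line_programs_on_ram:
  fixes prog :: "nat \<Rightarrow> nat \<Rightarrow> (nat \<times> nat \<times> nat) list"
  assumes prog: "\<And>n d. 1 \<le> n \<Longrightarrow> 1 \<le> d \<Longrightarrow> wf_gates (prog n d) (2 + n + n * d) \<and> prog n d \<noteq> []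
      \<and> length (prog n d) \<le> K * (n + 1) ^ (K * d ^ 3)"
  shows "\<exists>(P :: instr list) (C :: nat). \<forall>n d (X :: nat \<Rightarrow> nat \<Rightarrow> real) (y :: nat \<Rightarrow> real) (k :: real).
      1 \<le> n \<longrightarrow> 1 \<le> d \<longrightarrow>
      (\<exists>t\<le>C * (n + 1) ^ (C * d ^ 3). halted P (run P t (init_config n d X y k)) \<and>
         (accepts (run P t (init_config n d X y k)) \<longleftrightarrow>
           last (run_gates (prog n d) (map (snd (snd (init_config n d X y k))) [0..<1 + n + n * d] @ [1])) > 0))"
proof -
  define f where "f = (\<lambda>(n, d). block n d (prog n d))"
  obtain c where c: "\<And>v. holds_stream (concat (map f (pairs_upto v))) c" using stream_exists by blast
  define A where "A = 7 + K * (53 + 2 * K)"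
  define C where "C = 84 + 40 * A + (2 * K + 5)"
  have "\<exists>t\<le>C * (n + 1) ^ (C * d ^ 3). halted (interpreter c) (run (interpreter c) t (init_config n d X y k)) \<and>
         (accepts (run (interpreter c) t (init_config n d X y k)) \<longleftrightarrow>
           last (run_gates (prog n d) (map (snd (snd (init_config n d X y k))) [0..<1 + n + n * d] @ [1])) > 0)"
    if nd: "1 \<le> n" "1 \<le> d" for n d X y k
  proof -
    define v where "v = (n + 1) ^ (d ^ 3)"
    have v1: "1 \<le> v" by (simp add: v_def)
    have bound: "length (unary (f x)) \<le> A * v ^ (2 * K + 2)" if x: "x \<in> set (pairs_upto v)" for x
    proof -
      obtain n' d' where x': "x = (n', d')" by (cases x)
      define u where "u = (n' + 1) ^ (d' ^ 3)"
      have n': "1 \<le> n'" "1 \<le> d'" "u \<le> v" using pairs_upto_set[OF x[unfolded x']] by (auto simp: u_def)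
      have lu: "n' < u" "d' < u" using less_size[OF n'(1,2)] by (auto simp: u_def)
      note p = prog[OF n'(1,2)]
      define L where "L = length (prog n' d')"
      have "L \<le> K * u ^ K" using p by (simp add: L_def u_def power_mult[symmetric] mult.commute)
      also have "\<dots> \<le> K * v ^ K" using n'(3) by (intro mult_le_mono2 power_mono) auto
      finally have L: "L \<le> K * v ^ K" .
      have "n' + n' * d' = n' * (1 + d')" by simp
      also have "\<dots> \<le> v * v" using lu n' by (intro mult_mono) auto
      finally have nn: "n' + n' * d' \<le> v\<^sup>2" by (simp add: power2_eq_square)
      have vp: "v ^ i \<le> v ^ j" if "i \<le> j" for i j using that v1 by (rule power_increasing)
      have "length (unary (f x)) \<le> n' + d' + 5 + L * (49 + 4 * (n' + n' * d') + 2 * L)"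
        unfolding x' f_def prod.case L_def by (rule length_unary_block) (use p in simp)
      also have "\<dots> \<le> 7 * v ^ (2 * K + 2) + (K * v ^ K) * ((53 + 2 * K) * v ^ (K + 2))"
      proof (rule add_mono)
        have "n' + d' + 5 \<le> 7 * v ^ 1" using lu n' v1 by simp
        also have "\<dots> \<le> 7 * v ^ (2 * K + 2)" by (intro mult_le_mono2 vp) simp
        finally show "n' + d' + 5 \<le> 7 * v ^ (2 * K + 2)" .
        have "49 + 4 * (n' + n' * d') + 2 * L \<le> 49 * v ^ (K + 2) + 4 * v ^ (K + 2) + 2 * (K * v ^ (K + 2))"
        proof (intro add_mono mult_le_mono2)
          show "49 \<le> 49 * v ^ (K + 2)" using v1 by simp
          show "n' + n' * d' \<le> v ^ (K + 2)" using nn vp[of 2 "K + 2"] by simp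
          have "K * v ^ K \<le> K * v ^ (K + 2)" by (intro mult_le_mono2 vp) simp
          then show "L \<le> K * v ^ (K + 2)" using L by linarith
        qed
        also have "\<dots> = (53 + 2 * K) * v ^ (K + 2)" by (simp add: algebra_simps)
        finally show "L * (49 + 4 * (n' + n' * d') + 2 * L) \<le> (K * v ^ K) * ((53 + 2 * K) * v ^ (K + 2))"
          using L by (intro mult_mono) auto
      qed
      also have "\<dots> = A * v ^ (2 * K + 2)"
      proof -
        have "v ^ K * v ^ (K + 2) = v ^ (2 * K + 2)" by (simp add: power_add[symmetric] mult_2)
        then have "(K * v ^ K) * ((53 + 2 * K) * v ^ (K + 2)) = K * (53 + 2 * K) * v ^ (2 * K + 2)" by (metis mult.assoc mult.left_commute)
        then show ?thesis by (simp add: A_def distrib_right)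
      qed
      finally show ?thesis .
    qed
    have "(n, d) \<in> set (pairs_upto v)" unfolding v_def by (rule pairs_upto_member[OF nd])
    then obtain xs ys where split: "pairs_upto v = xs @ (n, d) # ys" "(n, d) \<notin> set xs" by (meson split_list_first)
    have "concat (map f (pairs_upto v)) = concat (map f xs) @ block n d (prog n d) @ concat (map f ys)"
      by (simp add: split(1) f_def)
    then have h: "holds_stream (concat (map f xs) @ block n d (prog n d) @ concat (map f ys)) c" using c[of v] by simp
    note p = prog[OF nd]
    from interpreter_correct[OF h[unfolded f_def] split(2), of X y k] p obtain t where
      t: "t \<le> 4 * d + 80 + 20 * length (unary (concat (map f xs) @ block n d (prog n d)))"
      "halted (interpreter c) (run (interpreter c) t (init_config n d X y k)) \<and>
         (accepts (run (interpreter c) t (init_config n d X y k)) \<longleftrightarrow>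
           last (run_gates (prog n d) (map (snd (snd (init_config n d X y k))) [0..<1 + n + n * d] @ [1])) > 0)"
      unfolding f_def by blast
    have "length (unary (concat (map f xs) @ block n d (prog n d))) \<le> length (unary (concat (map f (pairs_upto v))))"
      by (simp add: split(1) f_def unary_append)
    also have "\<dots> \<le> length (pairs_upto v) * (A * v ^ (2 * K + 2))"
      by (rule length_unary_concat) (rule bound)
    also have "\<dots> \<le> (2 * v ^ 3) * (A * v ^ (2 * K + 2))"
    proof (rule mult_le_mono1)
      have "Suc v * v\<^sup>2 \<le> (2 * v) * v\<^sup>2" using v1 by (intro mult_le_mono1) simp
      also have "\<dots> = 2 * v ^ 3" by (simp add: power2_eq_square power3_eq_cube)
      finally show "length (pairs_upto v) \<le> 2 * v ^ 3" using length_pairs_upto[of v] by linarith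
    qed
    also have "\<dots> = 2 * A * v ^ (2 * K + 5)"
    proof -
      have "v ^ (2 * K + 5) = v ^ (3 + (2 * K + 2))" by (rule arg_cong[where f = "(^) v"]) simp
      then have "v ^ 3 * v ^ (2 * K + 2) = v ^ (2 * K + 5)" by (simp only: power_add[symmetric])
      then show ?thesis by (metis mult.assoc mult.left_commute)
    qed
    finally have len: "length (unary (concat (map f xs) @ block n d (prog n d))) \<le> 2 * A * v ^ (2 * K + 5)" .
    have "d \<le> v" using less_size(2)[OF nd] by (simp add: v_def)
    also have "v = v ^ 1" by simp
    also have "\<dots> \<le> v ^ (2 * K + 5)" by (rule power_increasing) (use v1 in auto)
    finally have dv: "d \<le> v ^ (2 * K + 5)" .
    have "1 \<le> v ^ (2 * K + 5)" using v1 by simp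
    then have "4 * d + 80 + 20 * length (unary (concat (map f xs) @ block n d (prog n d))) \<le> (84 + 40 * A) * v ^ (2 * K + 5)"
      using len dv by (simp add: distrib_right)
    also have "\<dots> \<le> C * v ^ C"
      using v1 by (intro mult_mono power_increasing) (auto simp: C_def)
    also have "\<dots> = C * (n + 1) ^ (C * d ^ 3)" unfolding v_def by (simp add: power_mult[symmetric] mult.commute)
    finally show ?thesis using t by (meson order_trans)
  qed
  then show ?thesis by blast
qed

section \<open>Normal equations and closedness of the feasible set\<close>

definition resid :: "nat \<Rightarrow> (nat \<Rightarrow> nat \<Rightarrow> real) \<Rightarrow> (nat \<Rightarrow> real) \<Rightarrow> (nat \<Rightarrow> real) \<Rightarrow> nat \<Rightarrow> real" where
  "resid d X y \<beta> i = (\<Sum>j<d. X i j * \<beta> j) - y i"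

text \<open>Along coordinate l the loss changes by a quadratic 2 u t + c t^2, nonnegative for all t
  only if u = 0. Conversely, the normal equations remove the cross term between the residuals and
  any change of the coefficients.\<close>

lemma OLS_iff_normal_equations:
  assumes n: "1 \<le> n" and w: "\<And>i. i < n \<Longrightarrow> 0 \<le> w i"
  shows "\<beta> \<in> OLS n d X y w \<longleftrightarrow> is_vec d \<beta> \<and> (\<forall>l<d. (\<Sum>i<n. w i * resid d X y \<beta> i * X i l) = 0)"
proof -
  have loss: "wloss n d X y w \<beta> \<le> wloss n d X y w \<beta>' \<longleftrightarrow> (\<Sum>i<n. w i * (resid d X y \<beta> i)\<^sup>2) \<le> (\<Sum>i<n. w i * (resid d X y \<beta>' i)\<^sup>2)" for \<beta> \<beta>'
    using n by (simp add: wloss_def resid_def divide_le_cancel)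
  show ?thesis
  proof (intro iffI conjI allI impI)
    assume b: "\<beta> \<in> OLS n d X y w"
    then show "is_vec d \<beta>" by (simp add: OLS_def)
    fix l assume l: "l < d"
    define u where "u = (\<Sum>i<n. w i * resid d X y \<beta> i * X i l)"
    define c where "c = (\<Sum>i<n. w i * (X i l)\<^sup>2)"
    have c: "c \<ge> 0" unfolding c_def by (intro sum_nonneg mult_nonneg_nonneg) (use w in auto)
    have key: "2 * u * t + c * t\<^sup>2 \<ge> 0" for t
    proof -
      let ?b = "\<beta>(l := \<beta> l + t)"
      have "is_vec d ?b" using b l by (simp add: OLS_def is_vec_def)
      then have le: "(\<Sum>i<n. w i * (resid d X y \<beta> i)\<^sup>2) \<le> (\<Sum>i<n. w i * (resid d X y ?b i)\<^sup>2)"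
        using b loss by (simp add: OLS_def)
      have r: "resid d X y ?b i = resid d X y \<beta> i + t * X i l" for i
      proof -
        have "(\<Sum>j<d. X i j * ?b j) = (\<Sum>j<d. X i j * \<beta> j + (if j = l then t * X i l else 0))"
          by (rule sum.cong) (auto simp: algebra_simps)
        then show ?thesis using l by (simp add: resid_def sum.distrib)
      qed
      have "(\<Sum>i<n. w i * (resid d X y ?b i)\<^sup>2) = (\<Sum>i<n. w i * (resid d X y \<beta> i)\<^sup>2) + 2 * u * t + c * t\<^sup>2"
        unfolding r u_def c_def sum_distrib_left sum_distrib_right sum.distrib[symmetric]
        by (intro sum.cong refl) (simp add: power2_eq_square algebra_simps)
      then show ?thesis using le by simp
    qed
    show "(\<Sum>i<n. w i * resid d X y \<beta> i * X i l) = 0"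
    proof (rule ccontr)
      assume "\<not> ?thesis"
      then have u: "u\<^sup>2 > 0" by (simp add: u_def)
      \<comment> \<open>The step - u / (c + 1) lowers the loss even if c = 0.\<close>
      have "2 * u * (- u / (c + 1)) + c * (- u / (c + 1))\<^sup>2 = - (u\<^sup>2 * (c + 2)) / (c + 1)\<^sup>2"
        using c by (simp add: divide_simps power2_eq_square) (simp add: algebra_simps)
      also have "\<dots> < 0" using u c by (simp add: divide_neg_pos)
      finally show False using key[of "- u / (c + 1)"] by simp
    qed
  next
    assume b: "is_vec d \<beta> \<and> (\<forall>l<d. (\<Sum>i<n. w i * resid d X y \<beta> i * X i l) = 0)"
    have "(\<Sum>i<n. w i * (resid d X y \<beta> i)\<^sup>2) \<le> (\<Sum>i<n. w i * (resid d X y \<beta>' i)\<^sup>2)" for \<beta>'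
    proof -
      define D where "D i = (\<Sum>j<d. X i j * (\<beta>' j - \<beta> j))" for i
      have r: "resid d X y \<beta>' i = resid d X y \<beta> i + D i" for i
        by (simp add: resid_def D_def right_diff_distrib sum_subtractf)
      have "(\<Sum>i<n. w i * resid d X y \<beta> i * D i) = (\<Sum>j<d. (\<beta>' j - \<beta> j) * (\<Sum>i<n. w i * resid d X y \<beta> i * X i j))"
        unfolding D_def sum_distrib_left by (subst sum.swap) (simp add: mult_ac)
      also have "\<dots> = 0" using b by simp
      finally have z: "(\<Sum>i<n. w i * resid d X y \<beta> i * D i) = 0" .
      have "(\<Sum>i<n. w i * (resid d X y \<beta>' i)\<^sup>2)
         = (\<Sum>i<n. w i * (resid d X y \<beta> i)\<^sup>2) + 2 * (\<Sum>i<n. w i * resid d X y \<beta> i * D i) + (\<Sum>i<n. w i * (D i)\<^sup>2)"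
        unfolding r sum_distrib_left sum.distrib[symmetric]
        by (intro sum.cong refl) (simp add: power2_eq_square algebra_simps)
      moreover have "(\<Sum>i<n. w i * (D i)\<^sup>2) \<ge> 0" by (intro sum_nonneg mult_nonneg_nonneg) (use w in auto)
      ultimately show ?thesis using z by simp
    qed
    then show "\<beta> \<in> OLS n d X y w" using b loss by (simp add: OLS_def)
  qed
qed

text \<open>Closedness of a column space, by induction on the columns. If the coefficients of column
  \<open>j\<close> are bounded, they converge along a subsequence and the column moves to the
  right-hand side. Otherwise, dividing by them shows this column to be a limit of combinations of
  the others, hence such a combination, and it can be eliminated.\<close>

lemma linear_image_closed:
  fixes X :: "'i \<Rightarrow> 'j \<Rightarrow> real" and b :: "nat \<Rightarrow> 'j \<Rightarrow> real"
  assumes "finite J" "\<And>i. i \<in> A \<Longrightarrow> (\<lambda>m. \<Sum>j\<in>J. X i j * b m j) \<longlonglongrightarrow> \<rho> i"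
  shows "\<exists>\<beta>. \<forall>i\<in>A. (\<Sum>j\<in>J. X i j * \<beta> j) = \<rho> i"
  using assms
proof (induction J arbitrary: b \<rho> rule: finite_induct)
  case empty
  have "0 = \<rho> i" if "i \<in> A" for i
    using empty[OF that] by (simp add: LIMSEQ_const_iff)
  then show ?case by (intro exI[of _ "\<lambda>_. 0"]) simp
next
  case (insert j J)
  show ?case
  proof (cases "\<exists>B. \<forall>m. \<bar>b m j\<bar> \<le> B")
    case True
    then obtain B where B: "\<And>m. \<bar>b m j\<bar> \<le> B" by blast
    obtain r :: "nat \<Rightarrow> nat" where r: "strict_mono r" "monoseq (\<lambda>m. b (r m) j)"
      using seq_monosub[of "\<lambda>m. b m j"] by blast
    have "convergent (\<lambda>m. b (r m) j)"
      by (rule Bseq_monoseq_convergent[OF _ r(2)]) (rule BseqI'[of _ B], simp add: B)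
    then obtain c where c: "(\<lambda>m. b (r m) j) \<longlonglongrightarrow> c" by (auto simp: convergent_def)
    have "(\<lambda>m. \<Sum>k\<in>J. X i k * b (r m) k) \<longlonglongrightarrow> \<rho> i - X i j * c" if i: "i \<in> A" for i
    proof -
      have "(\<lambda>m. (\<Sum>k\<in>insert j J. X i k * b (r m) k) - X i j * b (r m) j) \<longlonglongrightarrow> \<rho> i - X i j * c"
        by (intro tendsto_intros c LIMSEQ_subseq_LIMSEQ[OF insert.prems[OF i] r(1), unfolded o_def])
      then show ?thesis using insert.hyps by simp
    qed
    from insert.IH[of "\<lambda>m. b (r m)" "\<lambda>i. \<rho> i - X i j * c", OF this] obtain \<beta> where
      \<beta>: "\<forall>i\<in>A. (\<Sum>k\<in>J. X i k * \<beta> k) = \<rho> i - X i j * c" by blast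
    have "(\<Sum>k\<in>J. X i k * (\<beta>(j := c)) k) = (\<Sum>k\<in>J. X i k * \<beta> k)" for i
      by (rule sum.cong) (use insert.hyps in auto)
    then show ?thesis using \<beta> insert.hyps by (intro exI[of _ "\<beta>(j := c)"]) auto
  next
    case False
    then have "\<exists>m'. \<bar>b m' j\<bar> > real (Suc m)" for m by (metis not_le)
    then obtain q where q: "\<And>m. \<bar>b (q m) j\<bar> > real (Suc m)" by metis
    have qn: "b (q m) j \<noteq> 0" for m using q[of m] by auto
    have "(\<lambda>m. \<Sum>k\<in>J. X i k * (b (q m) k / b (q m) j)) \<longlonglongrightarrow> - X i j" if i: "i \<in> A" for i
    proof -
      obtain K where K: "\<And>m. \<bar>\<Sum>k\<in>insert j J. X i k * b m k\<bar> \<le> K"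
        using convergent_imp_Bseq[OF convergentI[OF insert.prems[OF i]]] by (auto simp: Bseq_def)
      have "(\<lambda>m. (\<Sum>k\<in>insert j J. X i k * b (q m) k) / b (q m) j) \<longlonglongrightarrow> 0"
      proof (rule tendsto_0_le[OF LIMSEQ_inverse_real_of_nat, of _ K])
        have K0: "0 \<le> K" using K[of 0] by linarith
        have "norm ((\<Sum>k\<in>insert j J. X i k * b (q m) k) / b (q m) j) \<le> norm (inverse (real (Suc m))) * K" for m
        proof -
          have "\<bar>\<Sum>k\<in>insert j J. X i k * b (q m) k\<bar> / \<bar>b (q m) j\<bar> \<le> K / real (Suc m)"
            using K[of "q m"] q[of m] K0 by (intro frac_le) auto
          then show ?thesis by (simp add: abs_mult divide_inverse mult.commute)
        qed
        then show "\<forall>\<^sub>F m in sequentially. norm ((\<Sum>k\<in>insert j J. X i k * b (q m) k) / b (q m) j) \<le> norm (inverse (real (Suc m))) * K"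
          by (intro always_eventually allI)
      qed
      then have "(\<lambda>m. (\<Sum>k\<in>insert j J. X i k * b (q m) k) / b (q m) j - X i j) \<longlonglongrightarrow> 0 - X i j"
        by (intro tendsto_diff) auto
      moreover have "(\<Sum>k\<in>insert j J. X i k * b (q m) k) / b (q m) j - X i j = (\<Sum>k\<in>J. X i k * (b (q m) k / b (q m) j))" for m
        using insert.hyps qn[of m] by (simp add: add_divide_distrib sum_divide_distrib)
      ultimately show ?thesis by simp
    qed
    from insert.IH[OF this] obtain \<gamma> where g: "\<forall>i\<in>A. (\<Sum>k\<in>J. X i k * \<gamma> k) = - X i j" by blast
    have "(\<lambda>m. \<Sum>k\<in>J. X i k * (b m k - \<gamma> k * b m j)) \<longlonglongrightarrow> \<rho> i" if i: "i \<in> A" for i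
    proof -
      have "(\<Sum>k\<in>J. X i k * (b m k - \<gamma> k * b m j)) = (\<Sum>k\<in>J. X i k * b m k) - (\<Sum>k\<in>J. X i k * \<gamma> k) * b m j" for m
        by (simp add: right_diff_distrib sum_subtractf sum_distrib_right mult.assoc)
      then have "(\<Sum>k\<in>J. X i k * (b m k - \<gamma> k * b m j)) = (\<Sum>k\<in>insert j J. X i k * b m k)" for m
        using g i insert.hyps by simp
      then show ?thesis using insert.prems[OF i] by simp
    qed
    from insert.IH[OF this] obtain \<beta> where \<beta>: "\<forall>i\<in>A. (\<Sum>k\<in>J. X i k * \<beta> k) = \<rho> i" by blast
    have "(\<Sum>k\<in>J. X i k * (\<beta>(j := 0)) k) = (\<Sum>k\<in>J. X i k * \<beta> k)" for i
      by (rule sum.cong) (use insert.hyps in auto)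
    then show ?thesis using \<beta> insert.hyps by (intro exI[of _ "\<beta>(j := 0)"]) auto
  qed
qed

definition feasible :: "nat \<Rightarrow> nat \<Rightarrow> (nat \<Rightarrow> nat \<Rightarrow> real) \<Rightarrow> (nat \<Rightarrow> real) \<Rightarrow> (nat \<Rightarrow> real) \<Rightarrow> (nat \<Rightarrow> real) \<Rightarrow> bool" where
  "feasible n d X y w \<beta> \<longleftrightarrow> is_vec d \<beta> \<and> \<beta> 0 = 0 \<and> (\<forall>l<d. (\<Sum>i<n. w i * resid d X y \<beta> i * X i l) = 0)"

text \<open>The vectors \<open>b m\<close> may be unbounded. What stays bounded is the energy
  \<open>\<Sum> w\<^sub>i r\<^sub>i\<^sup>2\<close>, because it equals \<open>- \<Sum> w\<^sub>i r\<^sub>i y\<^sub>i\<close> up to the error in the normal equations; hence the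
  products \<open>w\<^sub>i r\<^sub>i\<close> converge along a subsequence, and the limit of the residuals on the support of
  the limit weights is again a residual.\<close>

lemma feasible_closed:
  fixes w b :: "nat \<Rightarrow> nat \<Rightarrow> real"
  assumes w: "\<And>m i. i < n \<Longrightarrow> 0 \<le> w m i \<and> w m i \<le> 1"
    and b: "\<And>m. is_vec d (b m) \<and> b m 0 = 0"
    and e: "\<And>l. l < d \<Longrightarrow> (\<lambda>m. \<Sum>i<n. w m i * resid d X y (b m) i * X i l) \<longlonglongrightarrow> 0"
    and C: "\<And>m. (\<Sum>l<d. b m l * (\<Sum>i<n. w m i * resid d X y (b m) i * X i l)) \<le> C"
  shows "\<exists>r w' \<beta>. strict_mono (r :: nat \<Rightarrow> nat) \<and> (\<forall>i<n. (\<lambda>m. w (r m) i) \<longlonglongrightarrow> w' i) \<and> feasible n d X y w' \<beta>"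
proof -
  define rr where "rr m i = resid d X y (b m) i" for m i
  define K where "K = \<bar>2 * C\<bar> + (\<Sum>i<n. (y i)\<^sup>2)"
  \<comment> \<open>\<open>C\<close> bounds the defect of the normal equations paired with the
    coefficients; the term with \<open>y\<close> is split by the inequality between product and
    squares, which moves half of the energy to the left.\<close>
  have energy: "(\<Sum>i<n. w m i * (rr m i)\<^sup>2) \<le> K" for m
  proof -
    have e1: "(\<Sum>i<n. w m i * (rr m i)\<^sup>2) = (\<Sum>i<n. w m i * rr m i * (\<Sum>j<d. X i j * b m j)) - (\<Sum>i<n. w m i * rr m i * y i)"
      unfolding sum_subtractf[symmetric]
      by (intro sum.cong refl) (simp add: rr_def resid_def power2_eq_square algebra_simps)
    have e2: "(\<Sum>i<n. w m i * rr m i * (\<Sum>j<d. X i j * b m j)) = (\<Sum>l<d. b m l * (\<Sum>i<n. w m i * rr m i * X i l))"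
      unfolding sum_distrib_left by (subst sum.swap) (simp add: mult_ac)
    have e3: "(\<Sum>l<d. b m l * (\<Sum>i<n. w m i * rr m i * X i l)) \<le> C" using C[of m] by (simp add: rr_def)
    have e4: "- (\<Sum>i<n. w m i * rr m i * y i) \<le> (\<Sum>i<n. w m i * (rr m i)\<^sup>2 / 2 + (y i)\<^sup>2 / 2)"
      unfolding sum_negf[symmetric]
    proof (rule sum_mono)
      fix i assume "i \<in> {..<n}"
      then have wi: "0 \<le> w m i" "w m i \<le> 1" using w by auto
      have "0 \<le> w m i * (rr m i + y i)\<^sup>2" using wi by simp
      then have "- (w m i * rr m i * y i) \<le> w m i * (rr m i)\<^sup>2 / 2 + w m i * (y i)\<^sup>2 / 2"
        by (simp add: power2_eq_square algebra_simps)
      moreover have "w m i * (y i)\<^sup>2 \<le> 1 * (y i)\<^sup>2" using wi by (intro mult_right_mono) auto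
      ultimately show "- (w m i * rr m i * y i) \<le> w m i * (rr m i)\<^sup>2 / 2 + (y i)\<^sup>2 / 2" by linarith
    qed
    have "(\<Sum>i<n. w m i * (rr m i)\<^sup>2 / 2 + (y i)\<^sup>2 / 2) = (\<Sum>i<n. w m i * (rr m i)\<^sup>2) / 2 + (\<Sum>i<n. (y i)\<^sup>2) / 2"
      by (simp add: sum.distrib sum_divide_distrib)
    then show ?thesis using e1 e2 e3 e4 unfolding K_def by linarith
  qed
  have K0: "K \<ge> 0" unfolding K_def by (intro add_nonneg_nonneg sum_nonneg) auto
  define s where "s m i = w m i * rr m i" for m i
  \<comment> \<open>The products of weight and residual are bounded, and they vanish in the limit
    wherever the weight does.\<close>
  have s2: "(s m i)\<^sup>2 \<le> w m i * K" if i: "i < n" for m i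
  proof -
    have "w m i * (rr m i)\<^sup>2 \<le> (\<Sum>i<n. w m i * (rr m i)\<^sup>2)"
      by (rule member_le_sum) (use i w in auto)
    then have "w m i * (rr m i)\<^sup>2 \<le> K" using energy[of m] by linarith
    then have "w m i * (w m i * (rr m i)\<^sup>2) \<le> w m i * K" using w[OF i] by (intro mult_left_mono) auto
    then show ?thesis by (simp add: s_def power2_eq_square mult_ac)
  qed
  \<comment> \<open>Weights and products form one sequence with 2 n coordinates, so that a single
    subsequence serves both.\<close>
  define F where "F m i = (if i < n then w m i else s m (i - n))" for m i
  have "\<exists>B. \<forall>m. \<bar>F m i\<bar> \<le> B" if "i < 2 * n" for i
  proof (cases "i < n")
    case True
    then show ?thesis using w by (intro exI[of _ 1]) (auto simp: F_def)
  next
    case False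
    then have j: "i - n < n" using that by simp
    have "\<bar>s m (i - n)\<bar> \<le> K + 1" for m
    proof (rule ccontr)
      assume "\<not> ?thesis"
      then have "K + 1 < \<bar>s m (i - n)\<bar>" by simp
      then have "(K + 1)\<^sup>2 < (s m (i - n))\<^sup>2" using K0 by (simp add: abs_le_square_iff[symmetric] not_le[symmetric])
      moreover have "(s m (i - n))\<^sup>2 \<le> K"
      proof -
        have "w m (i - n) * K \<le> 1 * K" using w[OF j] K0 by (intro mult_right_mono) auto
        then show ?thesis using s2[OF j, of m] by simp
      qed
      moreover have "(K + 1)\<^sup>2 \<ge> K" using K0 by (simp add: power2_eq_square algebra_simps)
      ultimately show False by linarith
    qed
    then show ?thesis using False by (intro exI[of _ "K + 1"]) (auto simp: F_def)
  qed
  then obtain r where r: "strict_mono (r :: nat \<Rightarrow> nat)" "\<And>i. i < 2 * n \<Longrightarrow> convergent (\<lambda>m. F (r m) i)"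
    using convergent_subseq_coordinates[of "2 * n" F] by blast
  define w' where "w' i = lim (\<lambda>m. w (r m) i)" for i
  define s' where "s' i = lim (\<lambda>m. s (r m) i)" for i
  have wl: "(\<lambda>m. w (r m) i) \<longlonglongrightarrow> w' i" if "i < n" for i
    using r(2)[of i] that by (simp add: F_def w'_def convergent_LIMSEQ_iff)
  have sl: "(\<lambda>m. s (r m) i) \<longlonglongrightarrow> s' i" if "i < n" for i
    using r(2)[of "n + i"] that by (simp add: F_def s'_def convergent_LIMSEQ_iff)
  have w'0: "w' i \<ge> 0" if "i < n" for i
    by (rule LIMSEQ_le_const[OF wl[OF that]]) (use w[OF that] in auto)
  have s'0: "s' i = 0" if i: "i < n" "w' i = 0" for i
  proof -
    have "(s' i)\<^sup>2 \<le> w' i * K"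
      by (rule LIMSEQ_le[OF tendsto_power[OF sl[OF i(1)]] tendsto_mult_right[OF wl[OF i(1)]]]) (use s2[OF i(1)] in auto)
    then show ?thesis using i by simp
  qed
  define A where "A = {i. i < n \<and> w' i > 0}"
  \<comment> \<open>On the support of the limit weights the residuals themselves converge. The
    columns start at 1 because the coefficient with index 0 is held at 0.\<close>
  have "\<exists>\<beta>. \<forall>i\<in>A. (\<Sum>j\<in>{1..<d}. X i j * \<beta> j) = s' i / w' i + y i"
  proof (rule linear_image_closed)
    fix i assume "i \<in> A"
    then have i: "i < n" "w' i > 0" by (auto simp: A_def)
    have ev: "\<forall>\<^sub>F m in sequentially. w (r m) i > 0"
      using order_tendstoD(1)[OF wl[OF i(1)] i(2)] .
    have "(\<lambda>m. s (r m) i / w (r m) i + y i) \<longlonglongrightarrow> s' i / w' i + y i"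
      by (intro tendsto_intros sl wl) (use i in auto)
    moreover have "\<forall>\<^sub>F m in sequentially. s (r m) i / w (r m) i + y i = (\<Sum>j\<in>{1..<d}. X i j * b (r m) j)"
      using ev
    proof eventually_elim
      case (elim m)
      have "(\<Sum>j<d. X i j * b (r m) j) = (\<Sum>j\<in>{1..<d}. X i j * b (r m) j)"
        by (rule sum.mono_neutral_right) (use b in \<open>auto simp: Suc_le_eq\<close>)
      then show ?case using elim by (simp add: s_def rr_def resid_def)
    qed
    ultimately show "(\<lambda>m. \<Sum>j\<in>{1..<d}. X i j * b (r m) j) \<longlonglongrightarrow> s' i / w' i + y i"
      by (rule Lim_transform_eventually)
  qed simp
  then obtain \<gamma> where g: "\<And>i. i \<in> A \<Longrightarrow> (\<Sum>j\<in>{1..<d}. X i j * \<gamma> j) = s' i / w' i + y i" by blast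
  define \<beta> where "\<beta> j = (if j \<in> {1..<d} then \<gamma> j else 0)" for j
  have \<beta>: "is_vec d \<beta>" "\<beta> 0 = 0" by (auto simp: \<beta>_def is_vec_def)
  have ws: "w' i * resid d X y \<beta> i = s' i" if i: "i < n" for i
  proof (cases "w' i = 0")
    case True then show ?thesis using s'0[OF i] by simp
  next
    case False
    then have "i \<in> A" using w'0[OF i] i by (simp add: A_def)
    have "(\<Sum>j<d. X i j * \<beta> j) = (\<Sum>j\<in>{1..<d}. X i j * \<beta> j)"
      by (rule sum.mono_neutral_right) (auto simp: \<beta>_def)
    also have "\<dots> = (\<Sum>j\<in>{1..<d}. X i j * \<gamma> j)" by (rule sum.cong) (auto simp: \<beta>_def)
    finally show ?thesis using g[OF \<open>i \<in> A\<close>] False by (simp add: resid_def)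
  qed
  have "(\<Sum>i<n. w' i * resid d X y \<beta> i * X i l) = 0" if l: "l < d" for l
  proof -
    have "(\<lambda>m. \<Sum>i<n. s (r m) i * X i l) \<longlonglongrightarrow> (\<Sum>i<n. s' i * X i l)"
      by (intro tendsto_intros sl) auto
    moreover have "(\<lambda>m. \<Sum>i<n. s (r m) i * X i l) \<longlonglongrightarrow> 0"
      using LIMSEQ_subseq_LIMSEQ[OF e[OF l] r(1)] by (simp add: o_def s_def rr_def)
    ultimately have "(\<Sum>i<n. s' i * X i l) = 0" by (rule LIMSEQ_unique)
    then show ?thesis by (simp add: ws)
  qed
  then have "feasible n d X y w' \<beta>" using \<beta> by (simp add: feasible_def)
  with r(1) wl show ?thesis by blast
qed

text \<open>The infimum is attained: nearly optimal certificates satisfy the normal equations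
  exactly, so \<open>feasible_closed\<close> applies with \<open>C = 0\<close> and yields a limiting
  certificate.\<close>

lemma Stability_le_iff:
  assumes n: "1 \<le> n"
  shows "Stability n d X y \<le> k \<longleftrightarrow>
    (\<exists>w \<beta>. (\<forall>i<n. 0 \<le> w i \<and> w i \<le> 1) \<and> feasible n d X y w \<beta> \<and> real n - (\<Sum>i<n. w i) \<le> k)"
proof -
  let ?S = "{real n - (\<Sum>i<n. w i) | w \<beta>. (\<forall>i<n. 0 \<le> w i \<and> w i \<le> 1) \<and> \<beta> 0 = 0 \<and> \<beta> \<in> OLS n d X y w}"
  have key: "(\<forall>i<n. 0 \<le> w i \<and> w i \<le> 1) \<and> \<beta> 0 = 0 \<and> \<beta> \<in> OLS n d X y w
     \<longleftrightarrow> (\<forall>i<n. 0 \<le> w i \<and> w i \<le> 1) \<and> feasible n d X y w \<beta>" for w \<beta>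
    using OLS_iff_normal_equations[OF n, of w] by (fastforce simp: feasible_def)
  have S: "?S = {real n - (\<Sum>i<n. w i) | w \<beta>. (\<forall>i<n. 0 \<le> w i \<and> w i \<le> 1) \<and> feasible n d X y w \<beta>}"
    by (simp only: key)
  \<comment> \<open>Zero weights with zero coefficients are always feasible.\<close>
  have ne: "?S \<noteq> {}" unfolding S
    by (auto simp: feasible_def is_vec_def intro!: exI[of _ "\<lambda>_. 0"])
  have bdd: "bdd_below ?S"
  proof (rule bdd_belowI[of _ 0])
    fix z assume "z \<in> ?S"
    then obtain w where w: "z = real n - (\<Sum>i<n. w i)" "\<forall>i<n. 0 \<le> w i \<and> w i \<le> 1" by blast
    have "(\<Sum>i<n. w i) \<le> (\<Sum>i<n. 1)" by (rule sum_mono) (use w in auto)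
    then show "0 \<le> z" using w by simp
  qed
  show ?thesis
  proof
    assume le: "Stability n d X y \<le> k"
    have "\<exists>w \<beta>. (\<forall>i<n. 0 \<le> w i \<and> w i \<le> 1) \<and> feasible n d X y w \<beta> \<and> real n - (\<Sum>i<n. w i) < k + inverse (real (Suc m))" for m
    proof -
      have "Inf ?S < k + inverse (real (Suc m))" using le unfolding Stability_def by (rule le_less_trans) simp
      then show ?thesis using cInf_less_iff[OF ne bdd] unfolding S by blast
    qed
    then obtain w b where wb: "\<And>m i. i < n \<Longrightarrow> 0 \<le> w m i \<and> w m i \<le> 1" "\<And>m. feasible n d X y (w m) (b m)"
      "\<And>m. real n - (\<Sum>i<n. w m i) < k + inverse (real (Suc m))" by metis
    have "\<exists>r w' \<beta>. strict_mono (r :: nat \<Rightarrow> nat) \<and> (\<forall>i<n. (\<lambda>m. w (r m) i) \<longlonglongrightarrow> w' i) \<and> feasible n d X y w' \<beta>"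
      by (rule feasible_closed[where b = b and C = 0]) (use wb in \<open>auto simp: feasible_def\<close>)
    then obtain r w' \<beta> where r: "strict_mono (r :: nat \<Rightarrow> nat)" "\<And>i. i < n \<Longrightarrow> (\<lambda>m. w (r m) i) \<longlonglongrightarrow> w' i" "feasible n d X y w' \<beta>"
      by blast
    have "(\<lambda>m. real n - (\<Sum>i<n. w (r m) i)) \<longlonglongrightarrow> real n - (\<Sum>i<n. w' i)"
      by (intro tendsto_intros r) auto
    moreover have "(\<lambda>m. k + inverse (real (Suc (r m)))) \<longlonglongrightarrow> k + 0"
      by (intro tendsto_intros LIMSEQ_subseq_LIMSEQ[OF LIMSEQ_inverse_real_of_nat r(1), unfolded o_def])
    ultimately have "real n - (\<Sum>i<n. w' i) \<le> k + 0"
      by (rule LIMSEQ_le) (use wb(3) in \<open>auto intro: less_imp_le\<close>)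
    moreover have "0 \<le> w' i \<and> w' i \<le> 1" if "i < n" for i
      using LIMSEQ_le_const[OF r(2)[OF that], of 0] LIMSEQ_le_const2[OF r(2)[OF that], of 1] wb(1)[OF that] by auto
    ultimately show "\<exists>w \<beta>. (\<forall>i<n. 0 \<le> w i \<and> w i \<le> 1) \<and> feasible n d X y w \<beta> \<and> real n - (\<Sum>i<n. w i) \<le> k"
      using r(3) by (intro exI[of _ w'] exI[of _ \<beta>]) auto
  next
    assume "\<exists>w \<beta>. (\<forall>i<n. 0 \<le> w i \<and> w i \<le> 1) \<and> feasible n d X y w \<beta> \<and> real n - (\<Sum>i<n. w i) \<le> k"
    then obtain z where z: "z \<in> ?S" "z \<le> k" unfolding S by blast
    have "Inf ?S \<le> z" by (rule cInf_lower[OF z(1) bdd])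
    then show "Stability n d X y \<le> k" unfolding Stability_def using z(2) by (rule order_trans)
  qed
qed

section \<open>Basic optimal solutions of a linear program over the unit box\<close>

text \<open>The vectors \<open>phi 0, \<dots>, phi (n - 1)\<close> of length \<open>p\<close> are followed by the \<open>p\<close> unit vectors, which have
  capacity 0 and only serve to complete bases.\<close>

locale box_lp =
  fixes n p :: nat and phi :: "nat \<Rightarrow> nat \<Rightarrow> real"
begin

definition vec :: "nat \<Rightarrow> nat \<Rightarrow> real" where
  "vec i a = (if i < n then phi i a else if a = i - n then 1 else 0)"

text \<open>The inverse matrix \<open>E\<close> is carried along, stored so that row
  \<open>E a\<close> is dual to the vector of \<open>Z a\<close>; both inverse identities are
  recorded.\<close>

definition basis :: "(nat \<Rightarrow> nat) \<Rightarrow> (nat \<Rightarrow> nat \<Rightarrow> real) \<Rightarrow> bool" where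
  "basis Z E \<longleftrightarrow> (\<forall>a<p. Z a < n + p) \<and>
    (\<forall>a<p. \<forall>a'<p. (\<Sum>b<p. vec (Z a) b * E a' b) = (if a = a' then 1 else 0)) \<and>
    (\<forall>b<p. \<forall>b'<p. (\<Sum>a<p. E a b * vec (Z a) b') = (if b = b' then 1 else 0))"

definition coord :: "(nat \<Rightarrow> nat \<Rightarrow> real) \<Rightarrow> nat \<Rightarrow> nat \<Rightarrow> real" where
  "coord E j a = (\<Sum>b<p. vec j b * E a b)"

text \<open>The reduced cost of linear programming.\<close>

definition red :: "(nat \<Rightarrow> real) \<Rightarrow> (nat \<Rightarrow> nat) \<Rightarrow> (nat \<Rightarrow> nat \<Rightarrow> real) \<Rightarrow> nat \<Rightarrow> real" where
  "red c Z E j = c j - (\<Sum>a<p. coord E j a * c (Z a))"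

text \<open>The dual prices, at which every basis vector has reduced cost 0.\<close>

definition dual :: "(nat \<Rightarrow> real) \<Rightarrow> (nat \<Rightarrow> nat) \<Rightarrow> (nat \<Rightarrow> nat \<Rightarrow> real) \<Rightarrow> nat \<Rightarrow> real" where
  "dual c Z E b = (\<Sum>a<p. c (Z a) * E a b)"

lemma basisD:
  assumes "basis Z E"
  shows "a < p \<Longrightarrow> Z a < n + p"
    "a < p \<Longrightarrow> a' < p \<Longrightarrow> (\<Sum>b<p. vec (Z a) b * E a' b) = (if a = a' then 1 else 0)"
    "b < p \<Longrightarrow> b' < p \<Longrightarrow> (\<Sum>a<p. E a b * vec (Z a) b') = (if b = b' then 1 else 0)"
  using assms by (auto simp: basis_def)

lemma coord_basis: "basis Z E \<Longrightarrow> a < p \<Longrightarrow> a' < p \<Longrightarrow> coord E (Z a) a' = (if a = a' then 1 else 0)"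
  by (simp add: coord_def basisD)

lemma expand_in_basis:
  assumes "basis Z E" "b < p"
  shows "(\<Sum>a<p. (\<Sum>b'<p. v b' * E a b') * vec (Z a) b) = v b"
proof -
  have "(\<Sum>a<p. (\<Sum>b'<p. v b' * E a b') * vec (Z a) b) = (\<Sum>b'<p. v b' * (\<Sum>a<p. E a b' * vec (Z a) b))"
    unfolding sum_distrib_left sum_distrib_right by (subst sum.swap) (simp add: mult_ac)
  also have "\<dots> = (\<Sum>b'<p. if b' = b then v b else 0)"
    by (rule sum.cong) (use basisD(3)[OF assms(1)] assms(2) in auto)
  finally show ?thesis using assms(2) by simp
qed

lemma vec_expansion: "basis Z E \<Longrightarrow> b < p \<Longrightarrow> (\<Sum>a<p. coord E j a * vec (Z a) b) = vec j b"
  unfolding coord_def by (rule expand_in_basis)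

lemma basis_inj: "basis Z E \<Longrightarrow> inj_on Z {..<p}"
  unfolding inj_on_def by (metis basisD(2) lessThan_iff zero_neq_one)

lemma red_dual: "red c Z E j = c j - (\<Sum>b<p. vec j b * dual c Z E b)"
proof -
  have "(\<Sum>a<p. coord E j a * c (Z a)) = (\<Sum>b<p. vec j b * dual c Z E b)"
    unfolding coord_def dual_def sum_distrib_left sum_distrib_right by (subst sum.swap) (simp add: mult_ac)
  then show ?thesis by (simp add: red_def)
qed

lemma dual_basis: "basis Z E \<Longrightarrow> a < p \<Longrightarrow> (\<Sum>b<p. vec (Z a) b * dual c Z E b) = c (Z a)"
proof -
  assume b: "basis Z E" "a < p"
  have "red c Z E (Z a) = 0"
    unfolding red_def using b by (simp add: coord_basis if_distrib[of "\<lambda>x. x * _"] cong: if_cong)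
  then show ?thesis by (simp add: red_dual)
qed

lemma dual_unique:
  assumes "basis Z E" "\<And>a. a < p \<Longrightarrow> (\<Sum>b<p. vec (Z a) b * N b) = c (Z a)" "b < p"
  shows "N b = dual c Z E b"
proof -
  have "dual c Z E b = (\<Sum>a<p. (\<Sum>b'<p. vec (Z a) b' * N b') * E a b)"
    unfolding dual_def by (rule sum.cong) (simp_all add: assms(2))
  also have "\<dots> = (\<Sum>b'<p. (\<Sum>a<p. E a b * vec (Z a) b') * N b')"
    unfolding sum_distrib_left sum_distrib_right by (subst sum.swap) (simp add: mult_ac)
  also have "\<dots> = (\<Sum>b'<p. if b' = b then N b else 0)"
    by (rule sum.cong) (use basisD(3)[OF assms(1,3)] in auto)
  finally show ?thesis using assms(3) by simp
qed

lemma unit_basis: "basis (\<lambda>a. n + a) (\<lambda>a b. if a = b then 1 else 0)"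
  unfolding basis_def vec_def by (auto simp: if_distrib[of "\<lambda>x. x * _"] if_distrib[of "\<lambda>x. _ * x"] cong: if_cong)

text \<open>The simplex exchange of position \<open>a\<close> for \<open>j\<close>: the inverse
  changes by the row operation with pivot element \<open>coord E j a\<close>.\<close>

lemma pivot:
  assumes B: "basis Z E" and a: "a < p" and j: "j < n + p" and nz: "coord E j a \<noteq> 0"
  shows "basis (Z(a := j)) (\<lambda>a' b. if a' = a then E a b / coord E j a else E a' b - coord E j a' * E a b / coord E j a)"
    (is "basis ?Z ?E")
  unfolding basis_def
proof (intro conjI allI impI)
  fix a' assume "a' < p" then show "?Z a' < n + p" using basisD(1)[OF B] j by simp
next
  fix a1 a2 assume a12: "a1 < p" "a2 < p"
  have E2: "(\<Sum>b<p. vec i b * ?E a2 b) = (if a2 = a then coord E i a / coord E j a else coord E i a2 - coord E j a2 * coord E i a / coord E j a)" for i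
  proof (cases "a2 = a")
    case True then show ?thesis by (simp add: coord_def[of _ i] sum_divide_distrib)
  next
    case False
    have "(\<Sum>b<p. vec i b * (E a2 b - coord E j a2 * E a b / coord E j a))
        = (\<Sum>b<p. vec i b * E a2 b - (coord E j a2 / coord E j a) * (vec i b * E a b))"
      by (rule sum.cong) (auto simp: right_diff_distrib)
    also have "\<dots> = coord E i a2 - (coord E j a2 / coord E j a) * coord E i a"
      unfolding coord_def[of E i] by (simp add: sum_subtractf sum_distrib_left)
    finally show ?thesis using False by simp
  qed
  show "(\<Sum>b<p. vec (?Z a1) b * ?E a2 b) = (if a1 = a2 then 1 else 0)"
    unfolding E2 using nz coord_basis[OF B] a a12 by auto
next
  fix b b' assume b: "b < p" "b' < p"
  let ?q = "coord E j a"
  have sp: "(\<Sum>a'<p. f a') = f a + (\<Sum>a'\<in>{..<p} - {a}. f a')" for f :: "nat \<Rightarrow> real"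
    using a by (simp add: sum.remove)
  have "(\<Sum>a'\<in>{..<p} - {a}. ?E a' b * vec (?Z a') b')
      = (\<Sum>a'\<in>{..<p} - {a}. E a' b * vec (Z a') b' - (E a b / ?q) * (coord E j a' * vec (Z a') b'))"
    by (rule sum.cong) (auto simp: left_diff_distrib)
  also have "\<dots> = (\<Sum>a'\<in>{..<p} - {a}. E a' b * vec (Z a') b') - (E a b / ?q) * (\<Sum>a'\<in>{..<p} - {a}. coord E j a' * vec (Z a') b')"
    by (simp add: sum_subtractf sum_distrib_left)
  also have "(\<Sum>a'\<in>{..<p} - {a}. coord E j a' * vec (Z a') b') = vec j b' - ?q * vec (Z a) b'"
    using vec_expansion[OF B b(2), of j] by (simp add: sp)
  also have "(\<Sum>a'\<in>{..<p} - {a}. E a' b * vec (Z a') b') = (if b = b' then 1 else 0) - E a b * vec (Z a) b'"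
    using basisD(3)[OF B b] by (simp add: sp)
  finally have rest: "(\<Sum>a'\<in>{..<p} - {a}. ?E a' b * vec (?Z a') b') =
      (if b = b' then 1 else 0) - E a b * vec (Z a) b' - E a b / ?q * (vec j b' - ?q * vec (Z a) b')" .
  show "(\<Sum>a'<p. ?E a' b * vec (?Z a') b') = (if b = b' then 1 else 0)"
    by (subst sp, subst rest) (use nz in \<open>simp add: right_diff_distrib\<close>)
qed

text \<open>A basis minimizing the piecewise linear dual function among all bases satisfies the optimality
  conditions: each of the \<open>2 p\<close> edge directions either leads to another basis or is unbounded.\<close>

lemma optimal_basis:
  assumes w: "\<And>i. i < n \<Longrightarrow> 0 \<le> w i \<and> w i \<le> 1"
    and gen: "\<And>Z E j. basis Z E \<Longrightarrow> j < n + p \<Longrightarrow> j \<notin> Z ` {..<p} \<Longrightarrow> red c Z E j \<noteq> 0"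
  shows "\<exists>Z E w'. basis Z E \<and> (\<forall>i<n. 0 \<le> w' i \<and> w' i \<le> 1)
    \<and> (\<forall>b<p. (\<Sum>i<n. w' i * phi i b) = (\<Sum>i<n. w i * phi i b))
    \<and> (\<Sum>i<n. w i * c i) \<le> (\<Sum>i<n. w' i * c i)
    \<and> (\<forall>j<n. j \<notin> Z ` {..<p} \<longrightarrow> w' j = (if red c Z E j > 0 then 1 else 0))"
proof -
  define M where "M b = (\<Sum>i<n. w i * phi i b)" for b
  define pr where "pr i N = (\<Sum>b<p. vec i b * N b)" for i and N :: "nat \<Rightarrow> real"
  \<comment> \<open>The Lagrangian dual function: \<open>N\<close> prices the equality constraints,
    and a weight free in the unit interval contributes the positive part of what its cost leaves
    after prices.\<close>
  define g where "g N = (\<Sum>i<n. max 0 (c i - pr i N)) + (\<Sum>b<p. M b * N b)" for N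
  have g_cong: "g N = g N'" if "\<And>b. b < p \<Longrightarrow> N b = N' b" for N N'
  proof -
    have "pr i N = pr i N'" for i unfolding pr_def by (rule sum.cong) (use that in auto)
    then show ?thesis using that by (simp add: g_def)
  qed
  have MN: "(\<Sum>b<p. M b * N b) = (\<Sum>i<n. w i * pr i N)" for N
    unfolding M_def pr_def sum_distrib_left sum_distrib_right
    by (subst sum.swap) (simp add: vec_def mult.assoc)
  have weak: "(\<Sum>i<n. w i * c i) \<le> g N" for N
    unfolding g_def MN sum.distrib[symmetric]
  proof (rule sum_mono)
    fix i assume "i \<in> {..<n}"
    then have "0 \<le> w i" "w i \<le> 1" using w by auto
    then have "w i * (c i - pr i N) \<le> max 0 (c i - pr i N)"
      by (cases "0 \<le> c i - pr i N") (auto simp: mult_left_le_one_le mult_nonneg_nonpos max_def)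
    then show "w i * c i \<le> max 0 (c i - pr i N) + w i * pr i N" by (simp add: right_diff_distrib)
  qed
  \<comment> \<open>Dual prices depend on \<open>Z\<close> alone, so only finitely many values occur
    at bases and a minimum among them exists.\<close>
  define V where "V = {g (dual c Z E) | Z E. basis Z E}"
  have "V \<subseteq> (\<lambda>Z. g (dual c Z (SOME E. basis Z E))) ` PiE {..<p} (\<lambda>_. {..<n + p})"
  proof
    fix x assume "x \<in> V"
    then obtain Z E where ZE: "x = g (dual c Z E)" "basis Z E" by (auto simp: V_def)
    define Z0 where "Z0 = restrict Z {..<p}"
    have "(\<Sum>a<p. E a b * vec (Z0 a) b') = (\<Sum>a<p. E a b * vec (Z a) b')" for b b'
      by (rule sum.cong) (auto simp: Z0_def)
    then have B0: "basis Z0 E" using ZE(2) by (simp add: basis_def) (simp add: Z0_def)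
    then have B1: "basis Z0 (SOME E. basis Z0 E)" by (rule someI[where P = "basis Z0"])
    have "dual c Z E b = dual c Z0 (SOME E. basis Z0 E) b" if "b < p" for b
      by (rule dual_unique[OF B1 _ that]) (use dual_basis[OF ZE(2)] in \<open>simp add: Z0_def\<close>)
    then have "x = g (dual c Z0 (SOME E. basis Z0 E))" unfolding ZE(1) by (rule g_cong)
    moreover have "Z0 \<in> PiE {..<p} (\<lambda>_. {..<n + p})" using basisD(1)[OF ZE(2)] by (auto simp: Z0_def)
    ultimately show "x \<in> (\<lambda>Z. g (dual c Z (SOME E. basis Z E))) ` PiE {..<p} (\<lambda>_. {..<n + p})" by blast
  qed
  then have finV: "finite V" by (rule finite_subset) (intro finite_imageI finite_PiE, auto)
  have "V \<noteq> {}" using unit_basis by (auto simp: V_def)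
  then have "Min V \<in> V" using finV by simp
  then obtain Z E where B: "basis Z E" and minV: "g (dual c Z E) = Min V" by (auto simp: V_def)
  have min: "g (dual c Z E) \<le> g (dual c Z' E')" if "basis Z' E'" for Z' E'
    unfolding minV by (rule Min_le[OF finV]) (use that in \<open>auto simp: V_def\<close>)
  define N where "N = dual c Z E"
  have red: "red c Z E j = c j - pr j N" for j by (simp add: red_dual pr_def N_def)
  have redZ: "c (Z a) - pr (Z a) N = 0" if "a < p" for a using dual_basis[OF B that] by (simp add: pr_def N_def)
  define S where "S = {j. j < n \<and> j \<notin> Z ` {..<p} \<and> red c Z E j > 0}"
  have S: "finite S" "S \<subseteq> {..<n}" by (auto simp: S_def)
  \<comment> \<open>The weight that position \<open>a\<close> must carry once the nonbasic samples
    of positive reduced cost are set to 1. The slopes of \<open>g\<close> along the edges show that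
    it is admissible.\<close>
  define D where "D a = (\<Sum>b<p. M b * E a b) - (\<Sum>i\<in>S. coord E i a)" for a
  \<comment> \<open>The slope of \<open>g\<close> in direction \<open>s * E a\<close>. The vector at
    position \<open>a\<close> itself contributes only if its term becomes positive, that is for s <
    0, and only if it is a sample rather than a unit vector.\<close>
  have edge: "0 \<le> s * D a + (if s < 0 \<and> Z a < n then - s else 0)" if a: "a < p" and s: "s = 1 \<or> s = -1" for a and s :: real
  proof -
    define slope where "slope = s * D a + (if s < 0 \<and> Z a < n then - s else 0)"
    define Nt where "Nt t = (\<lambda>b. N b + t * s * E a b)" for t
    have prN: "pr i (Nt t) = pr i N + t * s * coord E i a" for i t
      by (simp add: pr_def Nt_def coord_def distrib_left sum.distrib sum_distrib_left mult_ac)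
    have gN: "g (Nt t) = g N + t * slope"
      if t: "t \<ge> 0" and blk: "\<And>j. j < n \<Longrightarrow> j \<notin> Z ` {..<p} \<Longrightarrow> red c Z E j * (red c Z E j - t * s * coord E j a) \<ge> 0" for t
    proof -
      have trm: "max 0 (c i - pr i (Nt t)) = max 0 (c i - pr i N)
         + (if i \<in> S then - t * s * coord E i a else 0) + (if i = Z a \<and> s < 0 then - t * s else 0)" if i: "i < n" for i
      proof (cases "i \<in> Z ` {..<p}")
        case True
        then obtain a' where a': "a' < p" "i = Z a'" by auto
        have "i \<notin> S" using True by (simp add: S_def)
        moreover have "c i - pr i N = 0" using redZ a' by simp
        moreover have "coord E i a = (if a' = a then 1 else 0)" using coord_basis[OF B a'(1) a] a' by simp
        moreover have "i = Z a \<longleftrightarrow> a' = a" using basis_inj[OF B] a' a by (auto simp: inj_on_def)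
        ultimately show ?thesis unfolding prN using s t by (auto simp: max_def)
      next
        case False
        then have iZ: "i \<noteq> Z a" using a by auto
        have nz: "red c Z E i \<noteq> 0" by (rule gen[OF B _ False]) (use i in simp)
        note b = blk[OF i False]
        have e: "c i - pr i (Nt t) = red c Z E i - t * s * coord E i a" unfolding prN red by simp
        show ?thesis
        proof (cases "red c Z E i > 0")
          case True
          then have "i \<in> S" using i False by (simp add: S_def)
          moreover have "red c Z E i - t * s * coord E i a \<ge> 0" using b True by (simp add: zero_le_mult_iff)
          ultimately show ?thesis using iZ True unfolding e by (simp add: red[symmetric])
        next
          case F: False
          then have "i \<notin> S" by (simp add: S_def)
          moreover have "red c Z E i - t * s * coord E i a \<le> 0" using b F nz by (auto simp: zero_le_mult_iff)
          ultimately show ?thesis using iZ F unfolding e by (simp add: red[symmetric])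
        qed
      qed
      have "(\<Sum>i<n. max 0 (c i - pr i (Nt t))) = (\<Sum>i<n. max 0 (c i - pr i N))
        + (\<Sum>i<n. if i \<in> S then - t * s * coord E i a else 0) + (\<Sum>i<n. if i = Z a \<and> s < 0 then - t * s else 0)"
        unfolding sum.distrib[symmetric] by (rule sum.cong) (simp_all add: trm)
      also have "(\<Sum>i<n. if i \<in> S then - t * s * coord E i a else 0) = - t * s * (\<Sum>i\<in>S. coord E i a)"
        using S by (subst sum.inter_restrict[symmetric]) (auto simp: sum_distrib_left Int_absorb1 intro!: sum.cong)
      also have "(\<Sum>i<n. if i = Z a \<and> s < 0 then - t * s else 0) = (if s < 0 \<and> Z a < n then - t * s else 0)"
        by (cases "s < 0") auto
      finally have 1: "(\<Sum>i<n. max 0 (c i - pr i (Nt t))) = (\<Sum>i<n. max 0 (c i - pr i N))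
         - t * s * (\<Sum>i\<in>S. coord E i a) + (if s < 0 \<and> Z a < n then - t * s else 0)" by simp
      have 2: "(\<Sum>b<p. M b * Nt t b) = (\<Sum>b<p. M b * N b) + t * s * (\<Sum>b<p. M b * E a b)"
        by (simp add: Nt_def distrib_left sum.distrib sum_distrib_left mult_ac)
      show ?thesis unfolding g_def 1 2 slope_def D_def by (simp add: algebra_simps)
    qed
    define J where "J = {j. j < n + p \<and> j \<notin> Z ` {..<p} \<and> s * coord E j a / red c Z E j > 0}"
    show ?thesis
    proof (cases "J = {}")
      \<comment> \<open>No index blocks the edge, so a negative slope would drive \<open>g\<close>
        below the bound from weak duality.\<close>
      case True
      have "slope \<ge> 0"
      proof (rule ccontr)
        assume neg: "\<not> slope \<ge> 0"
        define t where "t = (g N - (\<Sum>i<n. w i * c i) + 1) / - slope"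
        have "g N - (\<Sum>i<n. w i * c i) \<ge> 0" using weak[of N] by simp
        then have t0: "t \<ge> 0" using neg by (simp add: t_def divide_nonneg_neg)
        have "g (Nt t) = g N + t * slope"
        proof (rule gN[OF t0])
          fix j assume j: "j < n" "j \<notin> Z ` {..<p}"
          have nz: "red c Z E j \<noteq> 0" by (rule gen[OF B]) (use j in auto)
          have "j \<notin> J" using True by simp
          then have "s * coord E j a / red c Z E j \<le> 0" using j by (simp add: J_def not_less)
          then have "s * coord E j a * red c Z E j \<le> 0" using nz by (auto simp: divide_le_0_iff mult_le_0_iff)
          then have "t * (s * coord E j a * red c Z E j) \<le> 0" using t0 by (simp add: mult_nonneg_nonpos)
          also have "0 \<le> red c Z E j * red c Z E j" by simp
          finally show "red c Z E j * (red c Z E j - t * s * coord E j a) \<ge> 0" by (simp add: algebra_simps)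
        qed
        moreover have "t * slope = - (g N - (\<Sum>i<n. w i * c i) + 1)" using neg by (simp add: t_def)
        ultimately show False using weak[of "Nt t"] by simp
      qed
      then show ?thesis by (simp add: slope_def)
    next
      case False
      have finJ: "finite J" by (simp add: J_def)
      \<comment> \<open>Ratio test: the first index whose reduced cost reaches 0 enters the basis,
        and minimality of \<open>g\<close> among bases forbids a negative slope.\<close>
      define q where "q j = red c Z E j / (s * coord E j a)" for j
      have "Min (q ` J) \<in> q ` J" using finJ False by simp
      then obtain j where j: "j \<in> J" "q j = Min (q ` J)" by auto
      have qmin: "q j \<le> q i" if "i \<in> J" for i using j(2) finJ that by simp
      have jJ: "j < n + p" "j \<notin> Z ` {..<p}" "s * coord E j a / red c Z E j > 0" using j(1) by (auto simp: J_def)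
      then have nz: "coord E j a \<noteq> 0" "s \<noteq> 0" by auto
      have q0: "q j > 0" using jJ(3) unfolding q_def zero_less_divide_iff by blast
      have "g (Nt (q j)) = g N + q j * slope"
      proof (rule gN)
        fix i assume i: "i < n" "i \<notin> Z ` {..<p}"
        have nzi: "red c Z E i \<noteq> 0" by (rule gen[OF B]) (use i in auto)
        show "red c Z E i * (red c Z E i - q j * s * coord E i a) \<ge> 0"
        proof (cases "i \<in> J")
          case True
          then have pos: "s * coord E i a / red c Z E i > 0" by (simp add: J_def)
          then have "s * coord E i a * red c Z E i > 0" by (auto simp: zero_less_divide_iff zero_less_mult_iff)
          then have "q j * (s * coord E i a * red c Z E i) \<le> q i * (s * coord E i a * red c Z E i)"
            using qmin[OF True] by (intro mult_right_mono) auto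
          also have "\<dots> = red c Z E i * red c Z E i" using pos by (auto simp: q_def)
          finally show ?thesis by (simp add: algebra_simps)
        next
          case F: False
          then have "s * coord E i a / red c Z E i \<le> 0" using i by (simp add: J_def not_less)
          then have "s * coord E i a * red c Z E i \<le> 0" using nzi by (auto simp: divide_le_0_iff mult_le_0_iff)
          then have "q j * (s * coord E i a * red c Z E i) \<le> 0" using q0 by (simp add: mult_nonneg_nonpos)
          also have "0 \<le> red c Z E i * red c Z E i" by simp
          finally show ?thesis by (simp add: algebra_simps)
        qed
      qed (use q0 in simp)
      moreover have "g N \<le> g (Nt (q j))"
      proof -
        note B' = pivot[OF B a jJ(1) nz(1)]
        let ?Z = "Z(a := j)" and ?E = "\<lambda>a' b. if a' = a then E a b / coord E j a else E a' b - coord E j a' * E a b / coord E j a"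
        have "Nt (q j) b = dual c ?Z ?E b" if "b < p" for b
        proof (rule dual_unique[OF B' _ that])
          fix a' assume a': "a' < p"
          show "(\<Sum>b<p. vec (?Z a') b * Nt (q j) b) = c (?Z a')"
          proof (cases "a' = a")
            case True
            have "pr j (Nt (q j)) = c j" unfolding prN using nz red[of j] by (simp add: q_def)
            then show ?thesis using True by (simp add: pr_def)
          next
            case False
            have "pr (Z a') (Nt (q j)) = c (Z a')" unfolding prN using redZ[OF a'] coord_basis[OF B a' a] False by simp
            then show ?thesis using False by (simp add: pr_def)
          qed
        qed
        then have "g (Nt (q j)) = g (dual c ?Z ?E)" by (rule g_cong)
        then show ?thesis using min[OF B'] by (simp add: N_def)
      qed
      ultimately have "0 \<le> q j * slope" by simp
      then show ?thesis using q0 by (simp add: slope_def[symmetric] zero_le_mult_iff)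
    qed
  qed
  define t where "t a = D a" for a
  have t0: "0 \<le> t a" if "a < p" for a using edge[OF that, of 1] by (simp add: t_def)
  have t1: "t a \<le> (if Z a < n then 1 else 0)" if "a < p" for a using edge[OF that, of "-1"] by (simp add: t_def split: if_splits)
  define w' where "w' i = (if i \<in> S then 1 else if \<exists>a<p. Z a = i then t (THE a. a < p \<and> Z a = i) else 0)" for i
  have the: "(THE a'. a' < p \<and> Z a' = Z a) = a" if "a < p" for a
    by (rule the_equality) (use that basis_inj[OF B] in \<open>auto simp: inj_on_def\<close>)
  have w'Z: "w' (Z a) = t a" if "a < p" for a
    using that the[OF that] by (auto simp: w'_def S_def)
  have w'S: "w' i = 1" if "i \<in> S" for i using that by (simp add: w'_def)
  have w'0: "w' i = 0" if "i \<notin> S" "i \<notin> Z ` {..<p}" for i using that by (auto simp: w'_def)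
  have sumw: "(\<Sum>i<n. w' i * f i) = (\<Sum>i\<in>S. f i) + (\<Sum>a<p. t a * f (Z a))" for f :: "nat \<Rightarrow> real"
  proof -
    have "(\<Sum>i<n. w' i * f i) = (\<Sum>i\<in>S \<union> (Z ` {..<p} \<inter> {..<n}). w' i * f i)"
      by (rule sum.mono_neutral_right) (use S w'0 in auto)
    also have "\<dots> = (\<Sum>i\<in>S. w' i * f i) + (\<Sum>i\<in>Z ` {..<p} \<inter> {..<n}. w' i * f i)"
      by (rule sum.union_disjoint) (auto simp: S_def)
    also have "(\<Sum>i\<in>S. w' i * f i) = (\<Sum>i\<in>S. f i)" by (simp add: w'S)
    also have "(\<Sum>i\<in>Z ` {..<p} \<inter> {..<n}. w' i * f i) = (\<Sum>i\<in>Z ` {..<p}. w' i * f i)"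
    proof (rule sum.mono_neutral_left)
      show "\<forall>i\<in>Z ` {..<p} - Z ` {..<p} \<inter> {..<n}. w' i * f i = 0"
      proof
        fix i assume "i \<in> Z ` {..<p} - Z ` {..<p} \<inter> {..<n}"
        then obtain a where a: "a < p" "i = Z a" "\<not> Z a < n" by auto
        then show "w' i * f i = 0" using t0[OF a(1)] t1[OF a(1)] w'Z[OF a(1)] by simp
      qed
    qed auto
    also have "\<dots> = (\<Sum>a<p. t a * f (Z a))"
      using basis_inj[OF B] by (simp add: sum.reindex w'Z)
    finally show ?thesis .
  qed
  have bal: "(\<Sum>i\<in>S. vec i b) + (\<Sum>a<p. t a * vec (Z a) b) = M b" if b: "b < p" for b
  proof -
    define v where "v b' = M b' - (\<Sum>i\<in>S. vec i b')" for b'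
    have "t a = (\<Sum>b'<p. v b' * E a b')" for a
      unfolding t_def D_def v_def coord_def left_diff_distrib sum_subtractf sum_distrib_right
      by (subst (2) sum.swap) simp
    then have "(\<Sum>a<p. t a * vec (Z a) b) = v b" using expand_in_basis[OF B b, of v] by simp
    then show ?thesis by (simp add: v_def)
  qed
  have prS: "(\<Sum>i\<in>S. pr i N) + (\<Sum>a<p. t a * pr (Z a) N) = (\<Sum>b<p. M b * N b)"
  proof -
    have "(\<Sum>i\<in>S. pr i N) + (\<Sum>a<p. t a * pr (Z a) N)
      = (\<Sum>b<p. (\<Sum>i\<in>S. vec i b) * N b) + (\<Sum>b<p. (\<Sum>a<p. t a * vec (Z a) b) * N b)"
      unfolding pr_def sum_distrib_left sum_distrib_right
      by (subst sum.swap, subst (3) sum.swap) (simp add: mult.assoc)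
    also have "\<dots> = (\<Sum>b<p. M b * N b)"
      unfolding sum.distrib[symmetric] distrib_right[symmetric] by (rule sum.cong) (simp_all add: bal)
    finally show ?thesis .
  qed
  have "g N = (\<Sum>i<n. w' i * c i)"
  proof -
    have "(\<Sum>i<n. max 0 (c i - pr i N)) = (\<Sum>i\<in>S. c i - pr i N)"
    proof -
      have "max 0 (c i - pr i N) = (if i \<in> S then c i - pr i N else 0)" if i: "i < n" for i
        using redZ i by (auto simp: S_def red max_def)
      then have "(\<Sum>i<n. max 0 (c i - pr i N)) = (\<Sum>i<n. if i \<in> S then c i - pr i N else 0)" by simp
      also have "\<dots> = (\<Sum>i\<in>S. c i - pr i N)"
        using S by (subst sum.inter_restrict[symmetric]) (auto simp: Int_absorb1)
      finally show ?thesis .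
    qed
    then have "g N = (\<Sum>i\<in>S. c i) + (\<Sum>a<p. t a * pr (Z a) N)"
      unfolding g_def prS[symmetric] by (simp add: sum_subtractf)
    also have "(\<Sum>a<p. t a * pr (Z a) N) = (\<Sum>a<p. t a * c (Z a))"
      by (rule sum.cong) (use redZ in auto)
    finally show ?thesis by (simp add: sumw)
  qed
  then have "(\<Sum>i<n. w i * c i) \<le> (\<Sum>i<n. w' i * c i)" using weak[of N] by simp
  moreover have "0 \<le> w' i \<and> w' i \<le> 1" if "i < n" for i
  proof (cases "i \<in> Z ` {..<p} \<and> i \<notin> S")
    case True
    then obtain a where a: "a < p" "i = Z a" by auto
    then show ?thesis using t0[OF a(1)] t1[OF a(1)] w'Z[OF a(1)] that by simp
  next
    case False
    then show ?thesis using w'S w'0 by (cases "i \<in> S") auto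
  qed
  moreover have "(\<Sum>i<n. w' i * phi i b) = (\<Sum>i<n. w i * phi i b)" if b: "b < p" for b
  proof -
    have "(\<Sum>i<n. w' i * phi i b) = (\<Sum>i<n. w' i * vec i b)" by (simp add: vec_def)
    also have "\<dots> = M b" unfolding sumw by (rule bal[OF b])
    finally show ?thesis by (simp add: M_def)
  qed
  moreover have "w' j = (if red c Z E j > 0 then 1 else 0)" if "j < n" "j \<notin> Z ` {..<p}" for j
    using that w'S w'0 by (auto simp: S_def)
  ultimately show ?thesis using B by (intro exI[of _ Z] exI[of _ E] exI[of _ w']) blast
qed

end

section \<open>Tie-breaking costs and the 0/1 pattern outside the basis\<close>

context box_lp
begin

lemma basis_unique:
  assumes "basis Z E" "basis Z E'" "a < p" "b < p"
  shows "E a b = E' a b"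
proof -
  have "E a b = (\<Sum>b'<p. E a b' * (if b = b' then 1 else 0))"
    using assms(4) by (simp add: if_distrib[of "\<lambda>x. _ * x"] cong: if_cong)
  also have "\<dots> = (\<Sum>b'<p. E a b' * (\<Sum>a'<p. E' a' b * vec (Z a') b'))"
    by (rule sum.cong) (use basisD(3)[OF assms(2,4)] in auto)
  also have "\<dots> = (\<Sum>a'<p. E' a' b * (\<Sum>b'<p. vec (Z a') b' * E a b'))"
    unfolding sum_distrib_left sum_distrib_right by (subst sum.swap) (simp add: mult_ac)
  also have "\<dots> = (\<Sum>a'<p. if a' = a then E' a' b else 0)"
    by (rule sum.cong) (use basisD(2)[OF assms(1) _ assms(3)] in auto)
  finally show ?thesis using assms(3) by simp
qed

lemma basis_restrict: "basis (restrict Z {..<p}) E \<longleftrightarrow> basis Z E"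
proof -
  have "(\<Sum>a<p. E a b * vec (restrict Z {..<p} a) b') = (\<Sum>a<p. E a b * vec (Z a) b')" for b b'
    by (rule sum.cong) auto
  then show ?thesis by (simp add: basis_def)
qed

text \<open>Cramer's rule expresses the inverse by a formula in the data, as a straight-line program
  requires. For dependent vectors the division by 0 gives 0; the pattern derived from it is still a
  0/1 pattern, and soundness asks for no more.\<close>

definition inverse_entry :: "(nat \<Rightarrow> nat) \<Rightarrow> nat \<Rightarrow> nat \<Rightarrow> real" where
  "inverse_entry Z a b = cofactor (mat p p (\<lambda>(a, b). vec (Z a) b)) a b / det (mat p p (\<lambda>(a, b). vec (Z a) b))"

lemma basis_inverse_entry:
  assumes "basis Z E"
  shows "basis Z (inverse_entry Z)"
proof -
  define A where "A = mat p p (\<lambda>(a, b). vec (Z a) b)"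
  define B where "B = mat p p (\<lambda>(b, a). E a b)"
  have A: "A \<in> carrier_mat p p" and B: "B \<in> carrier_mat p p" by (auto simp: A_def B_def)
  have "A * B = 1\<^sub>m p"
    by (rule eq_matI) (use basisD(2)[OF assms] in \<open>auto simp: A_def B_def scalar_prod_def lessThan_atLeast0\<close>)
  then have "det A * det B = 1" using det_mult[OF A B] by simp
  then have nz: "det A \<noteq> 0" by auto
  have c: "inverse_entry Z a b = cofactor A a b / det A" for a b by (simp add: inverse_entry_def A_def)
  note adj = adj_mat[OF A]
  have 1: "(\<Sum>b<p. vec (Z a) b * cofactor A a' b) = (if a = a' then det A else 0)" if "a < p" "a' < p" for a a'
  proof -
    have "(A * adj_mat A) $$ (a, a') = (\<Sum>b<p. vec (Z a) b * cofactor A a' b)"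
      using that A by (simp add: A_def adj_mat_def scalar_prod_def lessThan_atLeast0)
    then show ?thesis using adj(2) that by auto
  qed
  have 2: "(\<Sum>a<p. cofactor A a b * vec (Z a) b') = (if b = b' then det A else 0)" if "b < p" "b' < p" for b b'
  proof -
    have "(adj_mat A * A) $$ (b, b') = (\<Sum>a<p. cofactor A a b * vec (Z a) b')"
      using that A by (simp add: A_def adj_mat_def scalar_prod_def lessThan_atLeast0)
    then show ?thesis using adj(3) that by auto
  qed
  show ?thesis
    unfolding basis_def c using basisD(1)[OF assms] nz
    by (auto simp: 1 2 sum_divide_distrib[symmetric])
qed

text \<open>Costs in a large parameter: the common top power of the samples makes the total weight
  dominate, and the distinct lower powers break all ties.\<close>

definition cost_poly :: "nat \<Rightarrow> real poly" where
  "cost_poly i = (if i < n then monom 1 (n + p) else 0) + monom 1 i"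

definition red_poly :: "(nat \<Rightarrow> nat) \<Rightarrow> (nat \<Rightarrow> nat \<Rightarrow> real) \<Rightarrow> nat \<Rightarrow> real poly" where
  "red_poly Z E j = cost_poly j - (\<Sum>a<p. smult (coord E j a) (cost_poly (Z a)))"

lemma poly_red_poly: "poly (red_poly Z E j) x = red (\<lambda>i. poly (cost_poly i) x) Z E j"
  by (simp add: red_poly_def red_def poly_sum)

lemma coeff_red_poly:
  "coeff (red_poly Z E j) m = coeff (cost_poly j) m - (\<Sum>a<p. coord E j a * coeff (cost_poly (Z a)) m)"
  by (simp add: red_poly_def coeff_sum)

text \<open>The power with exponent \<open>j\<close> occurs in the cost of \<open>j\<close> and of
  no basis member, so it cannot cancel.\<close>

lemma red_poly_nonzero:
  assumes "basis Z E" "j < n + p" "j \<notin> Z ` {..<p}"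
  shows "red_poly Z E j \<noteq> 0"
proof -
  have "coeff (cost_poly (Z a)) j = 0" if "a < p" for a
  proof -
    have "Z a \<noteq> j" using assms(3) that by blast
    then show ?thesis using assms(2) by (simp add: cost_poly_def)
  qed
  then have "coeff (red_poly Z E j) j = 1" using assms(2) by (simp add: coeff_red_poly cost_poly_def)
  then show ?thesis by auto
qed

lemma red_poly_cong:
  assumes "basis Z E" "basis Z' E'" "\<And>a. a < p \<Longrightarrow> Z a = Z' a"
  shows "red_poly Z E j = red_poly Z' E' j"
proof -
  have r: "restrict Z {..<p} = restrict Z' {..<p}" using assms(3) by auto
  have "basis Z' E" using assms(1) r by (metis basis_restrict)
  then have "coord E j a = coord E' j a" if "a < p" for a
    unfolding coord_def using basis_unique[OF _ assms(2) that] by (intro sum.cong) auto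
  then show ?thesis unfolding red_poly_def using assms(3) by simp
qed

definition top_set :: "(nat \<Rightarrow> nat) \<Rightarrow> nat set" where
  "top_set Z = {j. j < n \<and> j \<notin> Z ` {..<p} \<and> lead_coeff (red_poly Z (inverse_entry Z) j) > 0}"

text \<open>For every large parameter \<kappa> an optimal basis yields the required pattern, at a
  loss of at most n / \<kappa> in total weight. One \<open>Z\<close> recurs for infinitely many
  parameters; along these the weights subconverge, the loss disappears, and pattern and constraints
  persist in the limit.\<close>

lemma basic_weights:
  assumes w: "\<And>i. i < n \<Longrightarrow> 0 \<le> w i \<and> w i \<le> 1" and \<theta>: "\<theta> \<le> (\<Sum>i<n. w i)"
  shows "\<exists>Z\<in>{..<p} \<rightarrow>\<^sub>E {..<n + p}. \<exists>w'. inj_on Z {..<p} \<and> (\<forall>i<n. 0 \<le> w' i \<and> w' i \<le> 1)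
    \<and> (\<forall>b<p. (\<Sum>i<n. w' i * phi i b) = (\<Sum>i<n. w i * phi i b)) \<and> \<theta> \<le> (\<Sum>i<n. w' i)
    \<and> (\<forall>j<n. j \<notin> Z ` {..<p} \<longrightarrow> w' j = (if j \<in> top_set Z then 1 else 0))"
proof -
  let ?P = "{..<p} \<rightarrow>\<^sub>E {..<n + p}"
  let ?c = "\<lambda>x i. poly (cost_poly i) x"
  have finP: "finite ?P" by (intro finite_PiE) auto
  have "\<forall>\<^sub>F x in at_top. \<forall>Z\<in>?P. \<forall>j\<in>{..<n + p}. sgn (poly (red_poly Z (inverse_entry Z) j) x) = sgn (lead_coeff (red_poly Z (inverse_entry Z) j))"
    by (intro eventually_ball_finite ballI finP finite_lessThan eventually_sgn_poly)
  then obtain x0 where x0: "\<And>x Z j. x \<ge> x0 \<Longrightarrow> Z \<in> ?P \<Longrightarrow> j < n + p \<Longrightarrow>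
     sgn (poly (red_poly Z (inverse_entry Z) j) x) = sgn (lead_coeff (red_poly Z (inverse_entry Z) j))"
    unfolding eventually_at_top_linorder by blast
  obtain m0 :: nat where m0: "x0 \<le> real m0" using real_arch_simple by blast
  define \<kappa> where "\<kappa> m = real (m0 + Suc m)" for m
  have \<kappa>: "\<kappa> m \<ge> x0" "\<kappa> m \<ge> 1" for m using m0 by (auto simp: \<kappa>_def)
  define R where "R m Z w' \<longleftrightarrow> Z \<in> ?P \<and> inj_on Z {..<p} \<and> (\<forall>i<n. 0 \<le> w' i \<and> w' i \<le> 1)
    \<and> (\<forall>b<p. (\<Sum>i<n. w' i * phi i b) = (\<Sum>i<n. w i * phi i b)) \<and> \<theta> - real n / \<kappa> m \<le> (\<Sum>i<n. w' i)
    \<and> (\<forall>j<n. j \<notin> Z ` {..<p} \<longrightarrow> w' j = (if j \<in> top_set Z then 1 else 0))" for m Z w'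
  have ex: "\<exists>Z w'. R m Z w'" for m
  proof -
    have same: "red (?c (\<kappa> m)) Z E j = poly (red_poly (restrict Z {..<p}) (inverse_entry (restrict Z {..<p})) j) (\<kappa> m)"
      and inP: "restrict Z {..<p} \<in> ?P" and B': "basis (restrict Z {..<p}) (inverse_entry (restrict Z {..<p}))"
      if B: "basis Z E" for Z E j
    proof -
      show B': "basis (restrict Z {..<p}) (inverse_entry (restrict Z {..<p}))"
        by (rule basis_inverse_entry) (use B in \<open>simp add: basis_restrict\<close>)
      show "red (?c (\<kappa> m)) Z E j = poly (red_poly (restrict Z {..<p}) (inverse_entry (restrict Z {..<p})) j) (\<kappa> m)"
        unfolding poly_red_poly[symmetric] by (subst red_poly_cong[OF B B']) auto
      show "restrict Z {..<p} \<in> ?P" using basisD(1)[OF B] by auto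
    qed
    have "\<exists>Z E w'. basis Z E \<and> (\<forall>i<n. 0 \<le> w' i \<and> w' i \<le> 1)
      \<and> (\<forall>b<p. (\<Sum>i<n. w' i * phi i b) = (\<Sum>i<n. w i * phi i b))
      \<and> (\<Sum>i<n. w i * ?c (\<kappa> m) i) \<le> (\<Sum>i<n. w' i * ?c (\<kappa> m) i)
      \<and> (\<forall>j<n. j \<notin> Z ` {..<p} \<longrightarrow> w' j = (if red (?c (\<kappa> m)) Z E j > 0 then 1 else 0))"
    proof (rule optimal_basis[OF w])
      fix Z E j assume B: "basis Z E" and j: "j < n + p" "j \<notin> Z ` {..<p}"
      let ?r = "red_poly (restrict Z {..<p}) (inverse_entry (restrict Z {..<p})) j"
      have "?r \<noteq> 0" by (rule red_poly_nonzero[OF B'[OF B] j(1)]) (use j in auto)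
      then show "red (?c (\<kappa> m)) Z E j \<noteq> 0"
        unfolding same[OF B] using x0[OF \<kappa>(1)[of m] inP[OF B] j(1)] by (metis sgn_0_0 leading_coeff_0_iff)
    qed
    then obtain Z E w' where Z: "basis Z E" "\<forall>i<n. 0 \<le> w' i \<and> w' i \<le> 1"
      "\<forall>b<p. (\<Sum>i<n. w' i * phi i b) = (\<Sum>i<n. w i * phi i b)"
      "(\<Sum>i<n. w i * ?c (\<kappa> m) i) \<le> (\<Sum>i<n. w' i * ?c (\<kappa> m) i)"
      "\<forall>j<n. j \<notin> Z ` {..<p} \<longrightarrow> w' j = (if red (?c (\<kappa> m)) Z E j > 0 then 1 else 0)" by blast
    let ?Z = "restrict Z {..<p}"
    have im: "?Z ` {..<p} = Z ` {..<p}" by (rule image_cong) auto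
    have off: "w' j = (if j \<in> top_set ?Z then 1 else 0)" if j: "j < n" "j \<notin> ?Z ` {..<p}" for j
    proof -
      have "red (?c (\<kappa> m)) Z E j > 0 \<longleftrightarrow> lead_coeff (red_poly ?Z (inverse_entry ?Z) j) > 0"
        unfolding same[OF Z(1)] using x0[OF \<kappa>(1) inP[OF Z(1)], of j m] j(1) by (metis sgn_greater trans_less_add1)
      then show ?thesis using Z(5) j unfolding im by (auto simp: top_set_def im)
    qed
    have k0: "\<kappa> m ^ (n + p) > 0" using \<kappa>(2)[of m] by simp
    have split: "(\<Sum>i<n. v i * ?c (\<kappa> m) i) = \<kappa> m ^ (n + p) * (\<Sum>i<n. v i) + (\<Sum>i<n. v i * \<kappa> m ^ i)" for v
      by (simp add: cost_poly_def poly_monom distrib_left sum.distrib sum_distrib_left sum_distrib_right mult.commute)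
    have "0 \<le> (\<Sum>i<n. w i * \<kappa> m ^ i)" by (rule sum_nonneg) (use w \<kappa>(2)[of m] in auto)
    \<comment> \<open>The tie-breaking powers have exponent at most n + p - 1, one below the
      dominating power.\<close>
    moreover have "(\<Sum>i<n. w' i * \<kappa> m ^ i) \<le> (\<Sum>i<n. \<kappa> m ^ (n + p) / \<kappa> m)"
    proof (rule sum_mono)
      fix i assume i: "i \<in> {..<n}"
      have "w' i * \<kappa> m ^ i \<le> 1 * \<kappa> m ^ (n + p - 1)"
        using i Z(2) \<kappa>(2)[of m] by (intro mult_mono power_increasing) auto
      also have "\<dots> = \<kappa> m ^ (n + p) / \<kappa> m"
        using i \<kappa>(2)[of m] by (simp add: power_diff)
      finally show "w' i * \<kappa> m ^ i \<le> \<kappa> m ^ (n + p) / \<kappa> m" .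
    qed
    ultimately have "\<kappa> m ^ (n + p) * (\<Sum>i<n. w i) \<le> \<kappa> m ^ (n + p) * (\<Sum>i<n. w' i) + real n * (\<kappa> m ^ (n + p) / \<kappa> m)"
      using Z(4) unfolding split by simp
    then have "\<kappa> m ^ (n + p) * (\<Sum>i<n. w i) \<le> \<kappa> m ^ (n + p) * ((\<Sum>i<n. w' i) + real n / \<kappa> m)"
      by (simp add: distrib_left mult.commute)
    then have "(\<Sum>i<n. w i) \<le> (\<Sum>i<n. w' i) + real n / \<kappa> m" using k0 by simp
    then have low: "\<theta> - real n / \<kappa> m \<le> (\<Sum>i<n. w' i)" using \<theta> by simp
    have "inj_on ?Z {..<p}" using basis_inj[OF Z(1)] by (auto simp: inj_on_def)
    moreover have "\<forall>j<n. j \<notin> ?Z ` {..<p} \<longrightarrow> w' j = (if j \<in> top_set ?Z then 1 else 0)" using off by blast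
    ultimately show ?thesis
      unfolding R_def using inP[OF Z(1)] Z(2,3) low by (intro exI[of _ ?Z] exI[of _ w'] conjI) assumption+
  qed
  obtain Z W where R: "\<And>m. R m (Z m) (W m)" using ex by metis
  then have ZW: "\<And>m. Z m \<in> ?P" "\<And>m. inj_on (Z m) {..<p}" "\<And>m i. i < n \<Longrightarrow> 0 \<le> W m i \<and> W m i \<le> 1"
    "\<And>m b. b < p \<Longrightarrow> (\<Sum>i<n. W m i * phi i b) = (\<Sum>i<n. w i * phi i b)"
    "\<And>m. \<theta> - real n / \<kappa> m \<le> (\<Sum>i<n. W m i)"
    "\<And>m j. j < n \<Longrightarrow> j \<notin> Z m ` {..<p} \<Longrightarrow> W m j = (if j \<in> top_set (Z m) then 1 else 0)"
    unfolding R_def by blast+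
  \<comment> \<open>Pigeonhole over the finitely many choices of basis.\<close>
  have "\<exists>Z0. infinite {m. Z m = Z0}"
  proof (rule ccontr)
    assume "\<not> ?thesis"
    then have "finite (\<Union>Z0\<in>?P. {m. Z m = Z0})" using finP by blast
    moreover have "(\<Union>Z0\<in>?P. {m. Z m = Z0}) = UNIV" using ZW(1) by auto
    ultimately show False by simp
  qed
  then obtain Z0 where inf: "infinite {m. Z m = Z0}" by blast
  define r where "r = enumerate {m. Z m = Z0}"
  have rZ: "Z (r m) = Z0" for m using enumerate_in_set[OF inf, of m] by (simp add: r_def)
  have rm: "strict_mono r" using strict_mono_enumerate[OF inf] by (simp add: r_def)
  have "\<exists>s. strict_mono (s :: nat \<Rightarrow> nat) \<and> (\<forall>i<n. convergent (\<lambda>m. W (r (s m)) i))"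
    by (rule convergent_subseq_coordinates[where f = "\<lambda>m i. W (r m) i"]) (use ZW(3) in \<open>auto intro!: exI[of _ 1] simp: abs_le_iff intro: order_trans[of _ 0]\<close>)
  then obtain s where s: "strict_mono (s :: nat \<Rightarrow> nat)" "\<And>i. i < n \<Longrightarrow> convergent (\<lambda>m. W (r (s m)) i)" by blast
  define w' where "w' i = lim (\<lambda>m. W (r (s m)) i)" for i
  have L: "(\<lambda>m. W (r (s m)) i) \<longlonglongrightarrow> w' i" if "i < n" for i
    using s(2)[OF that] by (simp add: w'_def convergent_LIMSEQ_iff)
  have Lsum: "(\<lambda>m. \<Sum>i<n. W (r (s m)) i * f i) \<longlonglongrightarrow> (\<Sum>i<n. w' i * f i)" for f
    by (intro tendsto_intros L) auto
  have "0 \<le> w' i \<and> w' i \<le> 1" if "i < n" for i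
    using LIMSEQ_le_const[OF L[OF that], of 0] LIMSEQ_le_const2[OF L[OF that], of 1] ZW(3)[OF that] by auto
  moreover have "(\<Sum>i<n. w' i * phi i b) = (\<Sum>i<n. w i * phi i b)" if b: "b < p" for b
    using LIMSEQ_unique[OF Lsum[of "\<lambda>i. phi i b"]] ZW(4)[OF b] by simp
  moreover have "\<theta> \<le> (\<Sum>i<n. w' i)"
  proof -
    have "filterlim \<kappa> at_top sequentially" unfolding \<kappa>_def
      by (rule filterlim_at_top_mono[OF filterlim_real_sequentially]) auto
    then have "(\<lambda>m. real n / \<kappa> m) \<longlonglongrightarrow> 0" by (intro tendsto_divide_0[OF tendsto_const] filterlim_at_top_imp_at_infinity)
    then have "(\<lambda>m. real n / \<kappa> (r (s m))) \<longlonglongrightarrow> 0"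
      using LIMSEQ_subseq_LIMSEQ[OF _ strict_mono_o[OF rm s(1)]] by (auto simp: o_def)
    then have "(\<lambda>m. \<theta> - real n / \<kappa> (r (s m))) \<longlonglongrightarrow> \<theta> - 0" by (intro tendsto_intros)
    then have "\<theta> - 0 \<le> (\<Sum>i<n. w' i * 1)"
      by (rule LIMSEQ_le[OF _ Lsum]) (use ZW(5) in auto)
    then show ?thesis by simp
  qed
  moreover have "w' j = (if j \<in> top_set Z0 then 1 else 0)" if j: "j < n" "j \<notin> Z0 ` {..<p}" for j
    using LIMSEQ_unique[OF L[OF j(1)]] ZW(6)[OF j(1)] j(2) rZ by simp
  moreover have "Z0 \<in> ?P" "inj_on Z0 {..<p}" using ZW(1,2)[of "r 0"] rZ by auto
  ultimately show ?thesis by blast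
qed

end

section \<open>A system of quadratic equations for an optimal certificate\<close>

text \<open>For a fixed basis \<open>Z\<close>, the unknowns are the weights \<open>x a\<close> at the samples \<open>Z a\<close>, the
  \<open>x (p + a)\<close> with square \<open>t - t\<^sup>2\<close>, a square root \<open>x (2 * p)\<close> of the slack in the bound on the
  total weight, and the coefficients \<open>\<beta> j = x (2 * p + 1 + j)\<close>. Index \<open>N\<close> stands for the constant 1,
  which serves at the same time as the coefficient of the last column \<open>- y\<close> of the design matrix.
  The column of \<open>\<beta> 0\<close> is replaced by 0.\<close>

locale quadratic_system =
  fixes n d :: nat and X :: "nat \<Rightarrow> nat \<Rightarrow> real" and y :: "nat \<Rightarrow> real" and k :: real
    and Z :: "nat \<Rightarrow> nat" and \<sigma> :: "nat \<Rightarrow> real"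
begin

definition p :: nat where "p = d * (d + 1)"
definition N :: nat where "N = 2 * p + 1 + d"

definition col :: "nat \<Rightarrow> nat \<Rightarrow> real" where
  "col i j = (if j = d then - y i else if j = 0 then 0 else X i j)"

text \<open>The pair of equation l and column j is flattened to l (d + 1) + j. The weighted sums of
  these features are the only way in which weights enter the normal equations.\<close>

definition feat :: "nat \<Rightarrow> nat \<Rightarrow> real" where
  "feat i a = X i (a div (d + 1)) * col i (a mod (d + 1))"

text \<open>Coefficient of the product of unknowns i and j in equation q, homogenized by index
  \<open>N\<close>: the rows below \<open>d\<close> are the normal equations, the next
  \<open>p\<close> confine the weights to the unit interval, the last one bounds the total
  weight.\<close>

definition A :: "nat \<Rightarrow> nat \<Rightarrow> nat \<Rightarrow> real" where
  "A q i j = (if q < d then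
       if 2 * p + 1 \<le> j then
         if i = N then \<Sum>i'<n. \<sigma> i' * feat i' (q * (d + 1) + (j - (2 * p + 1)))
         else if i < p \<and> Z i < n then feat (Z i) (q * (d + 1) + (j - (2 * p + 1))) else 0
       else 0
     else if q < d + p then
       if j = N then if i = q - d then 1 else 0
       else if i = j \<and> (i = q - d \<or> i = p + (q - d)) then - 1 else 0
     else
       if j = N then if i = N then (\<Sum>i'<n. \<sigma> i') - real n + k else if i < p \<and> Z i < n then 1 else 0
       else if i = 2 * p \<and> j = 2 * p then - 1 else 0)"

definition hat :: "(nat \<Rightarrow> real) \<Rightarrow> nat \<Rightarrow> real" where
  "hat x i = (if i < N then x i else 1)"

definition qv :: "(nat \<Rightarrow> real) \<Rightarrow> nat \<Rightarrow> real" where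
  "qv x q = (\<Sum>i\<le>N. \<Sum>j\<le>N. A q i j * (hat x i * hat x j))"

definition T :: "(nat \<times> nat \<times> nat \<times> nat) set" where
  "T = {..N} \<times> {..N} \<times> {..N} \<times> {..N}"

text \<open>The expanded sum of squares of the equations, with one term per quadruple of indices;
  terms with equal exponents are not collected.\<close>

definition B :: "nat \<times> nat \<times> nat \<times> nat \<Rightarrow> real" where
  "B = (\<lambda>(i, j, i', j'). \<Sum>q\<le>d + p. A q i j * A q i' j')"

definition unit_exp :: "nat \<Rightarrow> nat \<Rightarrow> nat" where
  "unit_exp i = (if i < N then ex i 1 else 0)"

definition G :: "nat \<times> nat \<times> nat \<times> nat \<Rightarrow> nat \<Rightarrow> nat" where
  "G = (\<lambda>(i, j, i', j'). unit_exp i + unit_exp j + unit_exp i' + unit_exp j')"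

lemma card_T: "card T = (N + 1) ^ 4"
  by (simp add: T_def card_cartesian_product power4_eq_xxxx)

lemma unit_exp_facts: "unit_exp i \<in> mon N" "mdeg N (unit_exp i) \<le> 1" "mev N x (unit_exp i) = hat x i"
proof -
  show "unit_exp i \<in> mon N" by (auto simp: unit_exp_def mon_def ex_def)
  show "mdeg N (unit_exp i) \<le> 1" by (auto simp: unit_exp_def mdeg_def ex_def)
  show "mev N x (unit_exp i) = hat x i" by (simp add: unit_exp_def hat_def)
qed

lemma sum_B_G: "(\<Sum>t\<in>T. B t * mev N x (G t)) = (\<Sum>q\<le>d + p. (qv x q)\<^sup>2)"
proof -
  let ?I = "{..N}"
  have "(qv x q)\<^sup>2 = (\<Sum>i\<in>?I. \<Sum>j\<in>?I. \<Sum>i'\<in>?I. \<Sum>j'\<in>?I. A q i j * (hat x i * hat x j) * (A q i' j' * (hat x i' * hat x j')))" for q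
    unfolding qv_def power2_eq_square sum_distrib_left sum_distrib_right by (simp add: mult_ac)
  moreover have "(\<Sum>i\<in>?I. \<Sum>j\<in>?I. \<Sum>i'\<in>?I. \<Sum>j'\<in>?I. A q i j * (hat x i * hat x j) * (A q i' j' * (hat x i' * hat x j')))
     = (\<Sum>(i, j, i', j')\<in>T. A q i j * (hat x i * hat x j) * (A q i' j' * (hat x i' * hat x j')))" for q
    unfolding T_def by (simp add: sum.cartesian_product)
  ultimately have "(\<Sum>q\<le>d + p. (qv x q)\<^sup>2)
     = (\<Sum>q\<le>d + p. \<Sum>(i, j, i', j')\<in>T. A q i j * (hat x i * hat x j) * (A q i' j' * (hat x i' * hat x j')))" by simp
  also have "\<dots> = (\<Sum>(i, j, i', j')\<in>T. \<Sum>q\<le>d + p. A q i j * (hat x i * hat x j) * (A q i' j' * (hat x i' * hat x j')))"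
    by (subst sum.swap) (simp add: split_def)
  also have "\<dots> = (\<Sum>t\<in>T. B t * mev N x (G t))"
    by (rule sum.cong) (auto simp: B_def G_def mev_add unit_exp_facts sum_distrib_right intro!: sum.cong)
  finally show ?thesis by simp
qed

lemma quartic: "quartic N T B G"
proof
  show "finite T" by (simp add: T_def)
  fix t :: "nat \<times> nat \<times> nat \<times> nat"
  obtain i j i' j' where t: "t = (i, j, i', j')" by (cases t) auto
  show "G t \<in> mon N" unfolding t G_def by (auto intro!: mon_add unit_exp_facts)
  show "mdeg N (G t) \<le> 4" unfolding t G_def
    using unit_exp_facts(2)[of i] unit_exp_facts(2)[of j] unit_exp_facts(2)[of i'] unit_exp_facts(2)[of j']
    by (simp add: mdeg_add)
next
  show "(\<Sum>t\<in>T. B t * mev N x (G t)) \<ge> 0" for x unfolding sum_B_G by (rule sum_nonneg) simp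
qed

sublocale q: quartic N T B G by (rule quartic)

definition defect :: "(nat \<Rightarrow> real) \<Rightarrow> (nat \<Rightarrow> real) \<Rightarrow> nat \<Rightarrow> real" where
  "defect t h l = (\<Sum>j\<le>d. h j * ((\<Sum>i<n. \<sigma> i * feat i (l * (d + 1) + j))
     + (\<Sum>a<p. if Z a < n then t a * feat (Z a) (l * (d + 1) + j) else 0)))"

lemma hat_simps: "a < p \<Longrightarrow> hat x a = x a" "a < p \<Longrightarrow> hat x (p + a) = x (p + a)" "hat x (2 * p) = x (2 * p)" "hat x N = 1"
  by (auto simp: hat_def N_def)

lemma sum_rows:
  assumes "\<And>i. i < N \<Longrightarrow> \<not> i < p \<Longrightarrow> f i = 0"
  shows "(\<Sum>i\<le>N. f i) = f N + (\<Sum>a<p. f a :: real)"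
proof -
  have "(\<Sum>i\<le>N. f i) = (\<Sum>i\<in>insert N {..<p}. f i)"
    by (rule sum.mono_neutral_right) (use assms in \<open>auto simp: N_def\<close>)
  then show ?thesis by (simp add: N_def)
qed

lemma qv_normal:
  assumes "l < d"
  shows "qv x l = defect x (\<lambda>j. hat x (2 * p + 1 + j)) l"
proof -
  let ?c = "\<lambda>i j. if i = N then \<Sum>i'<n. \<sigma> i' * feat i' (l * (d + 1) + j) else if i < p \<and> Z i < n then feat (Z i) (l * (d + 1) + j) else 0"
  have "(\<Sum>j\<le>N. A l i j * (hat x i * hat x j)) = (\<Sum>j\<le>d. ?c i j * (hat x i * hat x (2 * p + 1 + j)))" for i
  proof -
    have "(\<Sum>j\<le>N. A l i j * (hat x i * hat x j)) = (\<Sum>j\<in>(\<lambda>j. 2 * p + 1 + j) ` {..d}. A l i j * (hat x i * hat x j))"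
    proof (rule sum.mono_neutral_right)
      show "\<forall>j\<in>{..N} - (\<lambda>j. 2 * p + 1 + j) ` {..d}. A l i j * (hat x i * hat x j) = 0"
      proof
        fix j assume j: "j \<in> {..N} - (\<lambda>j. 2 * p + 1 + j) ` {..d}"
        have "\<not> 2 * p + 1 \<le> j"
        proof
          assume "2 * p + 1 \<le> j"
          then have "j = 2 * p + 1 + (j - (2 * p + 1))" "j - (2 * p + 1) \<le> d" using j by (auto simp: N_def)
          then show False using j by blast
        qed
        then show "A l i j * (hat x i * hat x j) = 0" using assms by (simp add: A_def)
      qed
    qed (auto simp: N_def)
    also have "\<dots> = (\<Sum>j\<le>d. A l i (2 * p + 1 + j) * (hat x i * hat x (2 * p + 1 + j)))"
      by (subst sum.reindex) (auto simp: inj_on_def)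
    also have "\<dots> = (\<Sum>j\<le>d. ?c i j * (hat x i * hat x (2 * p + 1 + j)))"
    proof (rule sum.cong)
      fix j
      have e: "2 * p + 1 + j - (2 * p + 1) = j" by simp
      show "A l i (2 * p + 1 + j) * (hat x i * hat x (2 * p + 1 + j)) = ?c i j * (hat x i * hat x (2 * p + 1 + j))"
        unfolding A_def e using assms by simp
    qed simp
    finally show ?thesis .
  qed
  then have "qv x l = (\<Sum>j\<le>d. \<Sum>i\<le>N. ?c i j * (hat x i * hat x (2 * p + 1 + j)))"
    unfolding qv_def by (subst sum.swap) simp
  also have "\<dots> = defect x (\<lambda>j. hat x (2 * p + 1 + j)) l"
    unfolding defect_def
  proof (rule sum.cong)
    fix j
    have "(\<Sum>i\<le>N. ?c i j * (hat x i * hat x (2 * p + 1 + j))) = ?c N j * (hat x N * hat x (2 * p + 1 + j)) + (\<Sum>i<p. ?c i j * (hat x i * hat x (2 * p + 1 + j)))"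
      by (rule sum_rows) simp
    also have "(\<Sum>i<p. ?c i j * (hat x i * hat x (2 * p + 1 + j)))
       = (\<Sum>a<p. hat x (2 * p + 1 + j) * (if Z a < n then x a * feat (Z a) (l * (d + 1) + j) else 0))"
      by (rule sum.cong) (auto simp: hat_simps N_def)
    finally show "(\<Sum>i\<le>N. ?c i j * (hat x i * hat x (2 * p + 1 + j))) = hat x (2 * p + 1 + j) * ((\<Sum>i<n. \<sigma> i * feat i (l * (d + 1) + j))
       + (\<Sum>a<p. if Z a < n then x a * feat (Z a) (l * (d + 1) + j) else 0))"
      by (simp add: hat_simps distrib_left sum_distrib_left mult.commute)
  qed simp
  finally show ?thesis .
qed

lemma qv_box:
  assumes a: "a < p"
  shows "qv x (d + a) = x a - (x a)\<^sup>2 - (x (p + a))\<^sup>2"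
proof -
  have "A (d + a) i j = (if i = a then (if j = N then 1 else if j = a then - 1 else 0) else 0)
     + (if i = p + a then if j = p + a then - 1 else 0 else 0)" if "i \<le> N" "j \<le> N" for i j
    using a that by (auto simp: A_def N_def)
  then have "qv x (d + a) = (\<Sum>i\<le>N. \<Sum>j\<le>N. (if i = a then (if j = N then hat x i * hat x j else 0) else 0)
     + (if i = a then (if j = a then - (hat x i * hat x j) else 0) else 0)
     + (if i = p + a then if j = p + a then - (hat x i * hat x j) else 0 else 0))"
    unfolding qv_def using a by (intro sum.cong refl) (auto simp: N_def)
  also have "\<dots> = x a - (x a)\<^sup>2 - (x (p + a))\<^sup>2"
  proof -
    have c: "(\<Sum>j\<le>N. if P then f j else 0) = (if P then \<Sum>j\<le>N. f j else 0)" for P and f :: "nat \<Rightarrow> real" by simp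
    show ?thesis
      using a by (simp add: sum.distrib c hat_simps power2_eq_square) (simp add: N_def)
  qed
  finally show ?thesis .
qed

lemma qv_total: "qv x (d + p) = (\<Sum>i<n. \<sigma> i) + (\<Sum>a<p. if Z a < n then x a else 0) - real n + k - (x (2 * p))\<^sup>2"
proof -
  let ?c = "\<lambda>i. if i = N then (\<Sum>i'<n. \<sigma> i') - real n + k else if i < p \<and> Z i < n then 1 else 0"
  have "qv x (d + p) = (\<Sum>i\<le>N. \<Sum>j\<le>N. (if j = N then ?c i * hat x i else 0) + (if j = 2 * p then if i = 2 * p then - (hat x i * hat x j) else 0 else 0))"
    unfolding qv_def by (intro sum.cong refl) (auto simp: A_def N_def hat_def)
  also have "\<dots> = (\<Sum>i\<le>N. ?c i * hat x i) + (\<Sum>i\<le>N. if i = 2 * p then - (hat x i * hat x (2 * p)) else 0)"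
    by (simp add: sum.distrib)
  also have "(\<Sum>i\<le>N. ?c i * hat x i) = ?c N * hat x N + (\<Sum>a<p. ?c a * hat x a)"
    by (rule sum_rows) simp
  also have "(\<Sum>a<p. ?c a * hat x a) = (\<Sum>a<p. if Z a < n then x a else 0)"
    by (rule sum.cong) (auto simp: hat_simps N_def)
  also have "(\<Sum>i\<le>N. if i = 2 * p then - (hat x i * hat x (2 * p)) else 0) = - (x (2 * p))\<^sup>2"
    by (simp add: hat_simps power2_eq_square) (simp add: N_def)
  finally show ?thesis by (simp add: hat_simps)
qed

definition weight :: "(nat \<Rightarrow> real) \<Rightarrow> nat \<Rightarrow> real" where
  "weight t i = \<sigma> i + (\<Sum>a<p. if Z a = i then t a else 0)"

lemma sum_weight: "(\<Sum>i<n. weight t i * f i) = (\<Sum>i<n. \<sigma> i * f i) + (\<Sum>a<p. if Z a < n then t a * f (Z a) else 0)"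
proof -
  have "(\<Sum>i<n. (\<Sum>a<p. if Z a = i then t a else 0) * f i) = (\<Sum>a<p. \<Sum>i<n. if i = Z a then t a * f i else 0)"
    unfolding sum_distrib_right by (subst sum.swap) (auto intro!: sum.cong)
  also have "\<dots> = (\<Sum>a<p. if Z a < n then t a * f (Z a) else 0)" by (rule sum.cong) auto
  finally show ?thesis by (simp add: weight_def distrib_right sum.distrib)
qed

text \<open>The entry \<open>h 0\<close> is left free, as its column is 0, and \<open>h d\<close> is
  1 because the last column is - y.\<close>

lemma resid_feat:
  assumes b: "\<beta> 0 = 0" "\<And>j. 1 \<le> j \<Longrightarrow> j < d \<Longrightarrow> h j = \<beta> j" "h d = 1" and l: "l < d"
  shows "resid d X y \<beta> i * X i l = (\<Sum>j\<le>d. h j * feat i (l * (d + 1) + j))"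
proof -
  have "(\<Sum>j\<le>d. h j * feat i (l * (d + 1) + j)) = (\<Sum>j\<le>d. X i l * (h j * col i j))"
  proof (rule sum.cong)
    fix j assume "j \<in> {..d}"
    then have "j < d + 1" by simp
    then have "(l * (d + 1) + j) div (d + 1) = l" "(l * (d + 1) + j) mod (d + 1) = j"
      using div_mult_self3[of "d + 1" l j] mod_mult_self3[of l "d + 1" j] by auto
    then show "h j * feat i (l * (d + 1) + j) = X i l * (h j * col i j)" unfolding feat_def by (simp only: mult_ac)
  qed simp
  also have "\<dots> = X i l * ((\<Sum>j<d. h j * col i j) + h d * col i d)"
    by (simp add: sum_distrib_left[symmetric] lessThan_Suc_atMost[symmetric])
  also have "(\<Sum>j<d. h j * col i j) = (\<Sum>j<d. X i j * \<beta> j)"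
  proof (rule sum.cong)
    fix j assume j: "j \<in> {..<d}"
    show "h j * col i j = X i j * \<beta> j" using b(1) b(2)[of j] j by (cases "j = 0") (auto simp: col_def)
  qed simp
  finally show ?thesis using b(3) by (simp add: col_def resid_def)
qed

lemma normal_defect:
  assumes b: "\<beta> 0 = 0" "\<And>j. 1 \<le> j \<Longrightarrow> j < d \<Longrightarrow> h j = \<beta> j" "h d = 1" and l: "l < d"
  shows "(\<Sum>i<n. weight t i * resid d X y \<beta> i * X i l) = defect t h l"
proof -
  note r = resid_feat[where \<beta> = \<beta> and h = h, OF b l]
  have "(\<Sum>i<n. weight t i * resid d X y \<beta> i * X i l) = (\<Sum>i<n. weight t i * (\<Sum>j\<le>d. h j * feat i (l * (d + 1) + j)))"
    by (simp add: r mult.assoc)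
  also have "\<dots> = (\<Sum>j\<le>d. h j * (\<Sum>i<n. weight t i * feat i (l * (d + 1) + j)))"
    unfolding sum_distrib_left by (subst sum.swap) (simp add: mult_ac)
  finally show ?thesis unfolding sum_weight defect_def .
qed

lemma weight_box:
  assumes "inj_on Z {..<p}" "\<And>i. i < n \<Longrightarrow> \<sigma> i = 0 \<or> \<sigma> i = 1" "\<And>a. a < p \<Longrightarrow> \<sigma> (Z a) = 0"
    and t: "\<And>a. a < p \<Longrightarrow> 0 \<le> t a \<and> t a \<le> 1" and i: "i < n"
  shows "0 \<le> weight t i \<and> weight t i \<le> 1"
proof (cases "\<exists>a<p. Z a = i")
  case True
  then obtain a where a: "a < p" "Z a = i" by blast
  have "(\<Sum>b<p. if Z b = i then t b else 0) = (\<Sum>b<p. if b = a then t b else 0)"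
    by (rule sum.cong) (use assms(1) a in \<open>auto simp: inj_on_def\<close>)
  then show ?thesis using a assms(3)[OF a(1)] t[OF a(1)] by (simp add: weight_def)
next
  case False
  then have "weight t i = \<sigma> i" by (auto simp: weight_def intro!: sum.neutral)
  then show ?thesis using assms(2)[OF i] by auto
qed


section \<open>Correctness of the test for one basis\<close>

definition decision :: bool where
  "decision \<longleftrightarrow> neg_index (Bs N) q.H2 < neg_index (Bs N) q.H1"

text \<open>The test itself does not involve \<kappa>, so an equivalence valid for all large
  \<kappa> carries over in both directions.\<close>

lemma decision_iff: "decision \<longleftrightarrow> (\<forall>\<^sub>F \<kappa> in at_top. \<exists>x. (\<forall>j\<ge>N. x j = 0) \<and> q.Gv \<kappa> x < 0)"
proof
  assume decision
  with q.negative_decision show "\<forall>\<^sub>F \<kappa> in at_top. \<exists>x. (\<forall>j\<ge>N. x j = 0) \<and> q.Gv \<kappa> x < 0"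
    by (simp add: decision_def)
next
  assume "\<forall>\<^sub>F \<kappa> in at_top. \<exists>x. (\<forall>j\<ge>N. x j = 0) \<and> q.Gv \<kappa> x < 0"
  with q.negative_decision have "\<forall>\<^sub>F \<kappa> in (at_top :: real filter). decision"
    by eventually_elim (simp add: decision_def)
  then show decision by (simp add: trivial_limit_at_top_linorder)
qed

text \<open>At an exact solution the quartic vanishes, and what remains is a constant minus
  \<kappa>.\<close>

lemma decision_complete:
  assumes t: "\<And>a. a < p \<Longrightarrow> 0 \<le> t a \<and> t a \<le> 1" and b: "\<beta> 0 = 0"
    and e: "\<And>l. l < d \<Longrightarrow> (\<Sum>i<n. weight t i * resid d X y \<beta> i * X i l) = 0"
    and tot: "real n - k \<le> (\<Sum>i<n. weight t i)"
  shows decision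
proof -
  define u where "u = (\<Sum>i<n. weight t i) - real n + k"
  \<comment> \<open>The square roots realize the slacks: t - t^2 of the unit interval and
    \<open>u\<close> of the total weight.\<close>
  define x where "x i = (if i < p then t i else if i < 2 * p then sqrt (t (i - p) - (t (i - p))\<^sup>2)
     else if i = 2 * p then sqrt u else if i < N then \<beta> (i - (2 * p + 1)) else 0)" for i
  have x1: "x a = t a" if "a < p" for a using that by (simp add: x_def)
  have x2: "(x (p + a))\<^sup>2 = t a - (t a)\<^sup>2" if "a < p" for a
    using that t[OF that] by (simp add: x_def power2_eq_square mult_left_le)
  have x3: "(x (2 * p))\<^sup>2 = u" using tot by (simp add: x_def u_def)
  have x4: "hat x (2 * p + 1 + j) = \<beta> j" if "j < d" for j using that by (simp add: x_def hat_def N_def)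
  have "(\<Sum>i<n. weight t i) = (\<Sum>i<n. \<sigma> i) + (\<Sum>a<p. if Z a < n then t a else 0)"
    using sum_weight[of t "\<lambda>_. 1", unfolded mult_1_right] .
  moreover have "(\<Sum>a<p. if Z a < n then x a else 0) = (\<Sum>a<p. if Z a < n then t a else 0)"
    by (rule sum.cong) (simp_all add: x1)
  ultimately have "qv x (d + p) = 0" by (simp add: qv_total x3 u_def)
  moreover have "qv x (d + a) = 0" if "a < p" for a using that by (simp add: qv_box x1 x2)
  moreover have "qv x l = 0" if l: "l < d" for l
  proof -
    have "qv x l = defect t (\<lambda>j. hat x (2 * p + 1 + j)) l"
      unfolding qv_normal[OF l] defect_def by (intro sum.cong refl arg_cong2[where f = "(*)"] arg_cong2[where f = "(+)"]) (simp_all add: x1)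
    also have "\<dots> = (\<Sum>i<n. weight t i * resid d X y \<beta> i * X i l)"
      by (rule normal_defect[symmetric, where \<beta> = \<beta>, OF b _ _ l]) (use x4 in \<open>auto simp: hat_def N_def\<close>)
    finally show ?thesis using e[OF l] by simp
  qed
  moreover have "q < d \<or> (q - d < p \<and> q = d + (q - d)) \<or> q = d + p" if "q \<le> d + p" for q
    using that by linarith
  ultimately have "qv x q = 0" if "q \<le> d + p" for q
    using that by metis
  then have z: "(\<Sum>t\<in>T. B t * mev N x (G t)) = 0" unfolding sum_B_G by simp
  have "\<forall>\<^sub>F \<kappa> in at_top. q.Gv \<kappa> x < 0"
    using eventually_gt_at_top[of "\<Sum>i<N. x i ^ 6"] by eventually_elim (simp add: q.Gv_def z)
  moreover have "\<forall>j\<ge>N. x j = 0" by (auto simp: x_def N_def)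
  ultimately show ?thesis unfolding decision_iff by (auto elim!: eventually_mono)
qed

text \<open>Below 0 the square only lowers t - t^2 further, and above 1 the excess t - 1 is at most
  t (t - 1).\<close>

lemma clip_error:
  fixes t \<delta> :: real
  assumes "- \<delta> \<le> t - t\<^sup>2" "0 \<le> \<delta>"
  shows "\<bar>max 0 (min 1 t) - t\<bar> \<le> \<delta>"
proof -
  consider "t < 0" | "0 \<le> t" "t \<le> 1" | "t > 1" by linarith
  then show ?thesis
  proof cases
    case 1
    then show ?thesis using assms by (auto simp: max_def min_def intro: order_trans[of _ 0] dest: order_trans[OF _ zero_le_power2])
      (smt (verit) zero_le_power2)
  next
    case 2 then show ?thesis using assms by (auto simp: max_def min_def)
  next
    case 3
    have "t - 1 \<le> t * (t - 1)" using 3 by simp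
    then show ?thesis using 3 assms by (auto simp: max_def min_def power2_eq_square algebra_simps)
  qed
qed

text \<open>With \<open>\<kappa> = \<nu>\<^sup>6\<close>, a point where the perturbed function is negative has coordinates below \<open>\<nu>\<close> and
  satisfies all equations up to \<open>\<nu>\<^sup>-\<^sup>3\<close>, so the defect in the normal equations, multiplied by the
  coefficients, still tends to 0.\<close>

lemma decision_sound:
  assumes n: "1 \<le> n" and d: "1 \<le> d" and inj: "inj_on Z {..<p}"
    and s: "\<And>i. i < n \<Longrightarrow> \<sigma> i = 0 \<or> \<sigma> i = 1" "\<And>a. a < p \<Longrightarrow> \<sigma> (Z a) = 0"
    and dec: decision
  shows "Stability n d X y \<le> k"
proof -
  from dec obtain \<kappa>0 where \<kappa>0: "\<And>\<kappa>. \<kappa> \<ge> \<kappa>0 \<Longrightarrow> \<exists>x. (\<forall>j\<ge>N. x j = 0) \<and> q.Gv \<kappa> x < 0"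
    unfolding decision_iff eventually_at_top_linorder by blast
  obtain m0 :: nat where m0: "\<kappa>0 \<le> real m0" using real_arch_simple by blast
  define \<nu> where "\<nu> m = real (m0 + Suc m)" for m
  have \<nu>1: "\<nu> m \<ge> 1" for m by (simp add: \<nu>_def)
  have \<nu>p: "\<nu> m > 0" for m by (simp add: \<nu>_def)
  have "filterlim \<nu> at_top sequentially" unfolding \<nu>_def
    by (rule filterlim_at_top_mono[OF filterlim_real_sequentially]) simp
  then have \<nu>lim: "(\<lambda>m. inverse (\<nu> m)) \<longlonglongrightarrow> 0" by (rule tendsto_inverse_0_at_top)
  \<comment> \<open>The sum of squares is below 1 / \<kappa>, so each equation fails by at most
    \<kappa>^(-1/2), which is \<nu>^(-3).\<close>
  define \<delta> where "\<delta> m = inverse (\<nu> m) ^ 3" for m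
  have \<delta>p: "\<delta> m > 0" for m using \<nu>p[of m] by (simp add: \<delta>_def)
  have \<delta>\<nu>: "\<delta> m * \<nu> m \<le> inverse (\<nu> m)" for m
  proof -
    have "\<delta> m * \<nu> m = inverse (\<nu> m) * inverse (\<nu> m)" using \<nu>p[of m] by (simp add: \<delta>_def power3_eq_cube)
    also have "\<dots> \<le> 1 * inverse (\<nu> m)" using \<nu>1[of m] \<nu>p[of m] by (intro mult_right_mono) (auto simp: inverse_le_1_iff)
    finally show ?thesis by simp
  qed
  have \<delta>le: "\<delta> m \<le> \<delta> m * \<nu> m" for m using mult_left_mono[OF \<nu>1[of m], of "\<delta> m"] \<delta>p[of m] by simp
  have \<delta>lim: "\<delta> \<longlonglongrightarrow> 0"
  proof -
    have "(\<lambda>m. inverse (\<nu> m) ^ 3) \<longlonglongrightarrow> 0 ^ 3" by (intro tendsto_intros \<nu>lim)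
    then show ?thesis by (simp add: \<delta>_def[abs_def])
  qed
  have "\<exists>x. (\<forall>i<N. \<bar>x i\<bar> \<le> \<nu> m) \<and> (\<forall>q\<le>d + p. \<bar>qv x q\<bar> \<le> \<delta> m)" for m
  proof -
    have "\<nu> m \<le> \<nu> m ^ 6" using \<nu>1[of m] by (simp add: self_le_power)
    moreover have "real m0 \<le> \<nu> m" by (simp add: \<nu>_def)
    ultimately have "\<nu> m ^ 6 \<ge> \<kappa>0" using m0 by linarith
    then obtain x where x: "q.Gv (\<nu> m ^ 6) x < 0" using \<kappa>0 by blast
    let ?K = "\<nu> m ^ 6"
    have K: "?K > 0" using \<nu>p[of m] by simp
    have x': "?K\<^sup>2 * (\<Sum>q\<le>d + p. (qv x q)\<^sup>2) + (\<Sum>i<N. x i ^ 6) < ?K"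
      using x by (simp add: q.Gv_def sum_B_G)
    have s6: "0 \<le> (\<Sum>i<N. x i ^ 6)" by (intro sum_nonneg) (simp add: zero_le_even_power)
    have sq: "0 \<le> (\<Sum>q\<le>d + p. (qv x q)\<^sup>2)" by (intro sum_nonneg) simp
    have "\<bar>x i\<bar> \<le> \<nu> m" if i: "i < N" for i
    proof -
      have "x i ^ 6 \<le> (\<Sum>i<N. x i ^ 6)"
        by (rule member_le_sum) (use i in \<open>auto simp: zero_le_even_power\<close>)
      also have "\<dots> \<le> ?K" using x' mult_nonneg_nonneg[OF zero_le_power2[of ?K] sq] by linarith
      finally have "\<bar>x i\<bar> ^ 6 \<le> \<nu> m ^ 6" by (simp add: power_even_abs)
      then show ?thesis using power_mono_iff[of "\<bar>x i\<bar>" "\<nu> m" 6] \<nu>p[of m] by simp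
    qed
    moreover have "\<bar>qv x q\<bar> \<le> \<delta> m" if q: "q \<le> d + p" for q
    proof -
      have "(qv x q)\<^sup>2 \<le> (\<Sum>q\<le>d + p. (qv x q)\<^sup>2)"
        by (rule member_le_sum) (use q in auto)
      then have "?K\<^sup>2 * (qv x q)\<^sup>2 \<le> ?K\<^sup>2 * (\<Sum>q\<le>d + p. (qv x q)\<^sup>2)" by (rule mult_left_mono) simp
      then have "?K * (?K * (qv x q)\<^sup>2) \<le> ?K * 1" using x' s6 by (simp add: power2_eq_square mult.assoc)
      then have "?K * (qv x q)\<^sup>2 \<le> 1" using K by (simp only: mult_le_cancel_left_pos)
      moreover have "?K * (qv x q)\<^sup>2 = (\<nu> m ^ 3 * \<bar>qv x q\<bar>)\<^sup>2" by (simp add: power_mult_distrib flip: power_mult)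
      ultimately have "(\<nu> m ^ 3 * \<bar>qv x q\<bar>)\<^sup>2 \<le> 1\<^sup>2" by simp
      then have "\<nu> m ^ 3 * \<bar>qv x q\<bar> \<le> 1" by (rule power2_le_imp_le) simp
      then show ?thesis using \<nu>p[of m] by (simp add: \<delta>_def field_simps)
    qed
    ultimately show ?thesis by blast
  qed
  then obtain x where x: "\<And>m i. i < N \<Longrightarrow> \<bar>x m i\<bar> \<le> \<nu> m" "\<And>m q. q \<le> d + p \<Longrightarrow> \<bar>qv (x m) q\<bar> \<le> \<delta> m" by metis
  \<comment> \<open>Clipping makes the weights admissible; by the equation for the unit interval it
    moves them by at most \<delta>.\<close>
  define \<tau> where "\<tau> m a = max 0 (min 1 (x m a))" for m a
  have clip: "\<bar>\<tau> m a - x m a\<bar> \<le> \<delta> m" if a: "a < p" for m a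
    unfolding \<tau>_def
  proof (rule clip_error)
    have "\<bar>x m a - (x m a)\<^sup>2 - (x m (p + a))\<^sup>2\<bar> \<le> \<delta> m" using x(2)[of "d + a" m] a by (simp add: qv_box)
    moreover have "0 \<le> (x m (p + a))\<^sup>2" by simp
    ultimately show "- \<delta> m \<le> x m a - (x m a)\<^sup>2" by linarith
  qed (use \<delta>p[of m] in simp)
  \<comment> \<open>The coefficient with index 0 is reset to 0 here but not in \<open>h\<close>; it
    belongs to a zero column, so the defect is the same.\<close>
  define b where "b m j = (if 1 \<le> j \<and> j < d then x m (2 * p + 1 + j) else 0)" for m j
  define h where "h m j = hat (x m) (2 * p + 1 + j)" for m j
  have h: "\<bar>h m j\<bar> \<le> \<nu> m" for m j
    using x(1)[of "2 * p + 1 + j" m] \<nu>1[of m] by (auto simp: h_def hat_def)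
  have bb: "\<bar>b m j\<bar> \<le> \<nu> m" for m j
    using x(1)[of "2 * p + 1 + j" m] \<nu>p[of m] by (auto simp: b_def N_def)
  define w where "w m = weight (\<tau> m)" for m
  define e where "e m l = (\<Sum>i<n. w m i * resid d X y (b m) i * X i l)" for m l
  define F where "F l = (\<Sum>j\<le>d. \<Sum>a<p. \<bar>if Z a < n then feat (Z a) (l * (d + 1) + j) else 0\<bar>)" for l
  have F0: "F l \<ge> 0" for l by (simp add: F_def sum_nonneg)
  have eb: "\<bar>e m l\<bar> \<le> \<delta> m * \<nu> m * (1 + F l)" if l: "l < d" for m l
  proof -
    have el: "e m l = defect (\<tau> m) (h m) l"
      unfolding e_def w_def by (rule normal_defect[where \<beta> = "b m", OF _ _ _ l]) (auto simp: b_def h_def hat_def N_def)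
    have ql: "qv (x m) l = defect (x m) (h m) l" unfolding qv_normal[OF l] h_def ..
    have de: "e m l - qv (x m) l = (\<Sum>j\<le>d. h m j * (\<Sum>a<p. (\<tau> m a - x m a) * (if Z a < n then feat (Z a) (l * (d + 1) + j) else 0)))"
      unfolding el ql defect_def sum_subtractf[symmetric]
    proof (rule sum.cong)
      fix j
      have "(\<Sum>a<p. if Z a < n then \<tau> m a * feat (Z a) (l * (d + 1) + j) else 0) - (\<Sum>a<p. if Z a < n then x m a * feat (Z a) (l * (d + 1) + j) else 0)
        = (\<Sum>a<p. (\<tau> m a - x m a) * (if Z a < n then feat (Z a) (l * (d + 1) + j) else 0))"
        unfolding sum_subtractf[symmetric] by (rule sum.cong) (auto simp: left_diff_distrib)
      then show "h m j * ((\<Sum>i<n. \<sigma> i * feat i (l * (d + 1) + j)) + (\<Sum>a<p. if Z a < n then \<tau> m a * feat (Z a) (l * (d + 1) + j) else 0)) -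
          h m j * ((\<Sum>i<n. \<sigma> i * feat i (l * (d + 1) + j)) + (\<Sum>a<p. if Z a < n then x m a * feat (Z a) (l * (d + 1) + j) else 0)) =
          h m j * (\<Sum>a<p. (\<tau> m a - x m a) * (if Z a < n then feat (Z a) (l * (d + 1) + j) else 0))"
        by (simp only: right_diff_distrib[symmetric] add_diff_cancel_left)
    qed simp
    have "\<bar>e m l - qv (x m) l\<bar> \<le> (\<Sum>j\<le>d. \<nu> m * (\<Sum>a<p. \<delta> m * \<bar>if Z a < n then feat (Z a) (l * (d + 1) + j) else 0\<bar>))"
      unfolding de
    proof (rule order_trans[OF sum_abs sum_mono])
      fix j
      have "\<bar>\<Sum>a<p. (\<tau> m a - x m a) * (if Z a < n then feat (Z a) (l * (d + 1) + j) else 0)\<bar>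
        \<le> (\<Sum>a<p. \<delta> m * \<bar>if Z a < n then feat (Z a) (l * (d + 1) + j) else 0\<bar>)"
        by (rule order_trans[OF sum_abs sum_mono]) (simp only: abs_mult, rule mult_right_mono, use clip in auto)
      then show "\<bar>h m j * (\<Sum>a<p. (\<tau> m a - x m a) * (if Z a < n then feat (Z a) (l * (d + 1) + j) else 0))\<bar>
        \<le> \<nu> m * (\<Sum>a<p. \<delta> m * \<bar>if Z a < n then feat (Z a) (l * (d + 1) + j) else 0\<bar>)"
        unfolding abs_mult using h \<nu>p[of m] by (intro mult_mono) auto
    qed
    also have "\<dots> = \<delta> m * \<nu> m * F l" by (simp add: F_def sum_distrib_left mult_ac)
    finally have "\<bar>e m l - qv (x m) l\<bar> \<le> \<delta> m * \<nu> m * F l" .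
    moreover have "\<bar>qv (x m) l\<bar> \<le> \<delta> m" using x(2)[of l m] l by simp
    ultimately have "\<bar>e m l\<bar> \<le> \<delta> m * \<nu> m * F l + \<delta> m * \<nu> m" using \<delta>le[of m] by linarith
    then show ?thesis by (simp add: distrib_left)
  qed
  have eb': "\<bar>e m l\<bar> \<le> inverse (\<nu> m) * (1 + F l)" if "l < d" for m l
    using eb[OF that, of m] mult_right_mono[OF \<delta>\<nu>[of m], of "1 + F l"] F0[of l] by linarith
  have "\<exists>r w' \<beta>. strict_mono (r :: nat \<Rightarrow> nat) \<and> (\<forall>i<n. (\<lambda>m. w (r m) i) \<longlonglongrightarrow> w' i) \<and> feasible n d X y w' \<beta>"
  proof (rule feasible_closed)
    show "0 \<le> w m i \<and> w m i \<le> 1" if "i < n" for m i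
      unfolding w_def by (rule weight_box[OF inj s]) (use that in \<open>auto simp: \<tau>_def\<close>)
    show "is_vec d (b m) \<and> b m 0 = 0" for m by (auto simp: b_def is_vec_def)
    show "(\<lambda>m. \<Sum>i<n. w m i * resid d X y (b m) i * X i l) \<longlonglongrightarrow> 0" if l: "l < d" for l
    proof (rule tendsto_0_le[where K = 1])
      have "\<bar>e m l\<bar> \<le> \<bar>inverse (\<nu> m) * (1 + F l)\<bar>" for m using eb'[OF l, of m] by linarith
      then show "\<forall>\<^sub>F m in sequentially. norm (\<Sum>i<n. w m i * resid d X y (b m) i * X i l) \<le> norm (inverse (\<nu> m) * (1 + F l)) * 1"
        by (simp add: e_def)
      show "(\<lambda>m. inverse (\<nu> m) * (1 + F l)) \<longlonglongrightarrow> 0" using tendsto_mult_left_zero[OF \<nu>lim] .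
    qed
    \<comment> \<open>Coefficients grow at most like \<nu> and defects fall like 1 / \<nu>, so their
      pairing stays bounded, as \<open>feasible_closed\<close> demands.\<close>
    show "(\<Sum>l<d. b m l * (\<Sum>i<n. w m i * resid d X y (b m) i * X i l)) \<le> (\<Sum>l<d. 1 + F l)" for m
    proof (rule sum_mono)
      fix l assume "l \<in> {..<d}"
      then have l: "l < d" by simp
      have "b m l * e m l \<le> \<bar>b m l\<bar> * \<bar>e m l\<bar>" by (metis abs_ge_self abs_mult)
      also have "\<dots> \<le> \<nu> m * (inverse (\<nu> m) * (1 + F l))" using bb eb'[OF l] \<nu>p[of m] by (intro mult_mono) auto
      also have "\<dots> = 1 + F l" using \<nu>p[of m] by simp
      finally show "b m l * (\<Sum>i<n. w m i * resid d X y (b m) i * X i l) \<le> 1 + F l" by (simp add: e_def)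
    qed
  qed
  then obtain r w' \<beta> where r: "strict_mono (r :: nat \<Rightarrow> nat)" "\<And>i. i < n \<Longrightarrow> (\<lambda>m. w (r m) i) \<longlonglongrightarrow> w' i" "feasible n d X y w' \<beta>"
    by blast
  have tot: "real n - k - \<delta> m * (1 + real p) \<le> (\<Sum>i<n. w m i)" for m
  proof -
    have "(\<Sum>i<n. w m i) = (\<Sum>i<n. \<sigma> i) + (\<Sum>a<p. if Z a < n then \<tau> m a else 0)"
      using sum_weight[of "\<tau> m" "\<lambda>_. 1", unfolded mult_1_right] by (simp add: w_def)
    moreover have "(\<Sum>a<p. if Z a < n then x m a else 0) \<le> (\<Sum>a<p. if Z a < n then \<tau> m a else 0) + real p * \<delta> m"
    proof -
    have "(\<Sum>a<p. if Z a < n then x m a else 0) \<le> (\<Sum>a<p. (if Z a < n then \<tau> m a else 0) + \<delta> m)"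
      proof (rule sum_mono)
        fix a assume "a \<in> {..<p}"
        then show "(if Z a < n then x m a else 0) \<le> (if Z a < n then \<tau> m a else 0) + \<delta> m"
          using clip[of a m] \<delta>p[of m] by auto
      qed
      then show ?thesis by (simp add: sum.distrib)
    qed
    moreover have "\<bar>qv (x m) (d + p)\<bar> \<le> \<delta> m" using x(2) by simp
    moreover have "0 \<le> (x m (2 * p))\<^sup>2" by simp
    ultimately have "real n - k - (\<delta> m + real p * \<delta> m) \<le> (\<Sum>i<n. w m i)" unfolding qv_total by linarith
    then show ?thesis by (simp add: distrib_left mult.commute)
  qed
  have "real n - k - 0 * (1 + real p) \<le> (\<Sum>i<n. w' i)"
  proof (rule LIMSEQ_le)
    show "(\<lambda>m. real n - k - \<delta> (r m) * (1 + real p)) \<longlonglongrightarrow> real n - k - 0 * (1 + real p)"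
      by (intro tendsto_intros LIMSEQ_subseq_LIMSEQ[OF \<delta>lim r(1), unfolded o_def])
    show "(\<lambda>m. \<Sum>i<n. w (r m) i) \<longlonglongrightarrow> (\<Sum>i<n. w' i)" by (intro tendsto_intros r) auto
  qed (use tot in auto)
  moreover have "0 \<le> w' i \<and> w' i \<le> 1" if i: "i < n" for i
  proof -
    have "0 \<le> w m i \<and> w m i \<le> 1" for m
      unfolding w_def by (rule weight_box[OF inj s]) (use i in \<open>auto simp: \<tau>_def\<close>)
    then show ?thesis using LIMSEQ_le_const[OF r(2)[OF i], of 0] LIMSEQ_le_const2[OF r(2)[OF i], of 1] by auto
  qed
  ultimately show ?thesis unfolding Stability_le_iff[OF n] using r(3) by (intro exI[of _ w'] exI[of _ \<beta>]) auto
qed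

end

section \<open>Stability as a disjunction over bases\<close>

text \<open>Injectivity keeps a sample from collecting several weights. Dependent choices are
  included and harmless, since acceptance is sound for every 0/1 pattern that vanishes on
  \<open>Z\<close>.\<close>

definition candidates :: "nat \<Rightarrow> nat \<Rightarrow> (nat \<Rightarrow> nat) set" where
  "candidates n d = {Z \<in> {..<quadratic_system.p d} \<rightarrow>\<^sub>E {..<n + quadratic_system.p d}. inj_on Z {..<quadratic_system.p d}}"

definition top_weight :: "nat \<Rightarrow> nat \<Rightarrow> (nat \<Rightarrow> nat \<Rightarrow> real) \<Rightarrow> (nat \<Rightarrow> real) \<Rightarrow> (nat \<Rightarrow> nat) \<Rightarrow> nat \<Rightarrow> real" where
  "top_weight n d X y Z i =
     (if i \<in> box_lp.top_set n (quadratic_system.p d) (quadratic_system.feat d X y) Z then 1 else 0)"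

text \<open>For completeness, \<beta> is kept and linear programming changes the weights without
  changing the functionals through which they enter the normal equations. Soundness holds for each
  candidate separately.\<close>

theorem Stability_le_iff_decision:
  assumes n: "1 \<le> n" and d: "1 \<le> d"
  shows "Stability n d X y \<le> k \<longleftrightarrow>
    (\<exists>Z\<in>candidates n d. quadratic_system.decision n d X y k Z (top_weight n d X y Z))"
proof
  assume "Stability n d X y \<le> k"
  then obtain w \<beta> where w: "\<And>i. i < n \<Longrightarrow> 0 \<le> w i \<and> w i \<le> 1" and f: "feasible n d X y w \<beta>"
    and "real n - (\<Sum>i<n. w i) \<le> k"
    unfolding Stability_le_iff[OF n] by blast
  then have tot: "real n - k \<le> (\<Sum>i<n. w i)" by simp
  define P where "P = quadratic_system.p d"
  define phi where "phi = quadratic_system.feat d X y"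
  obtain Z w' where Z: "Z \<in> {..<P} \<rightarrow>\<^sub>E {..<n + P}" "inj_on Z {..<P}" and w': "\<And>i. i < n \<Longrightarrow> 0 \<le> w' i \<and> w' i \<le> 1"
    "\<And>b. b < P \<Longrightarrow> (\<Sum>i<n. w' i * phi i b) = (\<Sum>i<n. w i * phi i b)" "real n - k \<le> (\<Sum>i<n. w' i)"
    "\<And>j. j < n \<Longrightarrow> j \<notin> Z ` {..<P} \<Longrightarrow> w' j = (if j \<in> box_lp.top_set n P phi Z then 1 else 0)"
    using box_lp.basic_weights[where n = n and p = P and phi = phi, OF w tot] by blast
  interpret quadratic_system n d X y k Z "top_weight n d X y Z" .
  have p: "quadratic_system.p d = P" and phi: "quadratic_system.feat d X y = phi" by (simp_all add: P_def phi_def)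
  define t where "t a = (if Z a < n then w' (Z a) else 0)" for a
  have wt: "weight t i = w' i" if i: "i < n" for i
  proof (cases "\<exists>a<P. Z a = i")
    case True
    then obtain a where a: "a < P" "Z a = i" by blast
    have "(\<Sum>b<P. if Z b = i then t b else 0) = (\<Sum>b<P. if b = a then t b else 0)"
      by (rule sum.cong) (use Z(2) a in \<open>auto simp: inj_on_def\<close>)
    moreover have "i \<notin> box_lp.top_set n P phi Z" using a by (auto simp: box_lp.top_set_def)
    ultimately show ?thesis using a i by (simp add: weight_def top_weight_def p phi t_def)
  next
    case False
    then have "(\<Sum>b<P. if Z b = i then t b else 0) = 0" by (intro sum.neutral) auto
    moreover have "i \<notin> Z ` {..<P}" using False by auto
    ultimately show ?thesis using w'(4)[OF i] by (simp add: weight_def top_weight_def p phi)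
  qed
  have \<beta>0: "\<beta> 0 = 0" using f by (simp add: feasible_def)
  define h where "h j = (if j < d then \<beta> j else 1)" for j
  have h: "\<And>j. 1 \<le> j \<Longrightarrow> j < d \<Longrightarrow> h j = \<beta> j" "h d = 1" by (simp_all add: h_def)
  have expand: "(\<Sum>i<n. v i * resid d X y \<beta> i * X i l) = (\<Sum>j\<le>d. h j * (\<Sum>i<n. v i * phi i (l * (d + 1) + j)))"
    if l: "l < d" for v l
  proof -
    have "(\<Sum>i<n. v i * resid d X y \<beta> i * X i l) = (\<Sum>i<n. v i * (\<Sum>j\<le>d. h j * phi i (l * (d + 1) + j)))"
      by (simp only: mult.assoc resid_feat[where \<beta> = \<beta> and h = h, OF \<beta>0 h l] phi)
    also have "\<dots> = (\<Sum>j\<le>d. h j * (\<Sum>i<n. v i * phi i (l * (d + 1) + j)))"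
      unfolding sum_distrib_left by (subst sum.swap) (simp add: mult_ac)
    finally show ?thesis .
  qed
  have "decision"
  proof (rule decision_complete[where t = t and \<beta> = \<beta>])
    show "0 \<le> t a \<and> t a \<le> 1" for a using w'(1) by (simp add: t_def)
    show "real n - k \<le> (\<Sum>i<n. weight t i)" using w'(3) by (simp add: wt)
    show "(\<Sum>i<n. weight t i * resid d X y \<beta> i * X i l) = 0" if l: "l < d" for l
    proof -
      have "l * (d + 1) + j < P" if "j \<le> d" for j
      proof -
        have "(l + 1) * (d + 1) \<le> d * (d + 1)" using l by (intro mult_le_mono1) simp
        then show ?thesis using that by (simp add: P_def quadratic_system.p_def)
      qed
      then have "(\<Sum>i<n. w' i * resid d X y \<beta> i * X i l) = (\<Sum>i<n. w i * resid d X y \<beta> i * X i l)"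
        unfolding expand[OF l] by (intro sum.cong refl arg_cong2[where f = "(*)"] w'(2)) auto
      also have "\<dots> = 0" using f l by (simp add: feasible_def)
      finally show ?thesis by (simp add: wt)
    qed
  qed (use \<beta>0 in simp)
  then show "\<exists>Z\<in>candidates n d. quadratic_system.decision n d X y k Z (top_weight n d X y Z)"
    using Z by (auto simp: candidates_def p)
next
  assume "\<exists>Z\<in>candidates n d. quadratic_system.decision n d X y k Z (top_weight n d X y Z)"
  then obtain Z where Z: "Z \<in> candidates n d" "quadratic_system.decision n d X y k Z (top_weight n d X y Z)" by blast
  show "Stability n d X y \<le> k"
  proof (rule quadratic_system.decision_sound[OF n d _ _ _ Z(2)])
    show "inj_on Z {..<quadratic_system.p d}" using Z(1) by (simp add: candidates_def)
    show "top_weight n d X y Z (Z a) = 0" if "a < quadratic_system.p d" for a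
      using that by (auto simp: top_weight_def box_lp.top_set_def)
  qed (simp add: top_weight_def)
qed

section \<open>The size of a straight-line program for stability\<close>

lemma rcmp_prod:
  assumes "one \<in> S" "finite I" "\<And>i. i \<in> I \<Longrightarrow> rcmp c S {f i}"
  shows "rcmp (card I * (c + 1)) S {\<lambda>x. \<Prod>i\<in>I. f i x}"
  using assms(2,3)
proof (induction I)
  case empty then show ?case using assms(1) by (simp add: rcmp_in)
next
  case (insert i I)
  have "rcmp (c + card I * (c + 1) + 1) S {\<lambda>x. f i x * (\<Prod>i\<in>I. f i x)}"
    by (rule rcmp_mult) (use insert in auto)
  then show ?case using insert.hyps by (simp add: algebra_simps)
qed

lemma rcmp_weaken: "rcmp c S {f} \<Longrightarrow> c \<le> c' \<Longrightarrow> rcmp c' S {f}"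
  by (rule rg.cmp_mono) auto

lemma rcmp_minus_one: "one \<in> S \<Longrightarrow> rcmp 2 S {\<lambda>_. - 1}"
  using rcmp_weaken[OF rcmp_sub[OF rcmp_zero[of S] rcmp_in[of one S 0]], of 2] by simp

lemma rcmp_sign: "one \<in> S \<Longrightarrow> rcmp 2 S {\<lambda>_. real_of_int (sign q)}"
  by (cases q rule: sign_cases) (auto intro: rcmp_in rcmp_minus_one)

text \<open>Leibniz expansion over all permutations. At size p the factorial is at most 2^(4 d^3),
  which the running time allows.\<close>

lemma rcmp_det:
  assumes S: "one \<in> S" and M: "\<And>x. M x \<in> carrier_mat m m"
    and e: "\<And>i j. i < m \<Longrightarrow> j < m \<Longrightarrow> rcmp c S {\<lambda>x. M x $$ (i, j)}"
  shows "rcmp (fact m * (m * (c + 1) + 6) + 1) S {\<lambda>x. det (M x)}"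
proof -
  let ?P = "{q. q permutes {0..<m}}"
  have "rcmp (card ?P * ((2 + card {0..<m} * (c + 1) + 1) + 3) + 1) S {\<lambda>x. \<Sum>q\<in>?P. real_of_int (sign q) * (\<Prod>i\<in>{0..<m}. M x $$ (i, q i))}"
  proof (rule rcmp_sum[OF S])
    fix q assume "q \<in> ?P"
    then have q: "q i < m" if "i < m" for i using that permutes_in_image[of q "{0..<m}" i] by auto
    show "rcmp (2 + card {0..<m} * (c + 1) + 1) S {\<lambda>x. real_of_int (sign q) * (\<Prod>i\<in>{0..<m}. M x $$ (i, q i))}"
      by (rule rcmp_mult[OF rcmp_sign[OF S] rcmp_prod[OF S]]) (use q e in auto)
  qed (simp add: finite_permutations)
  moreover have "card ?P = fact m" by (simp add: card_permutations)
  ultimately show ?thesis using M by (simp add: det_def'[of _ m] algebra_simps)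
qed

section \<open>Straight-line programs for the ingredients of the test\<close>

definition reg_X :: "nat \<Rightarrow> nat \<Rightarrow> (nat \<Rightarrow> real) \<Rightarrow> nat \<Rightarrow> nat \<Rightarrow> real" where
  "reg_X n d R i j = R (1 + n + i * d + j)"

definition reg_y :: "(nat \<Rightarrow> real) \<Rightarrow> nat \<Rightarrow> real" where
  "reg_y R i = R (1 + i)"

definition regs :: "nat \<Rightarrow> nat \<Rightarrow> ((nat \<Rightarrow> real) \<Rightarrow> real) list" where
  "regs n d = map (\<lambda>j R. R j) [0..<1 + n + n * d] @ [one]"

text \<open>The costs are plain functions of \<open>n\<close> and \<open>d\<close> without
  assumptions, so that their growth can be estimated as functions.\<close>

locale circuit_costs =
  fixes n d :: nat
begin

definition p :: nat where "p = d * (d + 1)"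
definition N :: nat where "N = 2 * p + 1 + d"

definition det_cost :: nat where "det_cost = fact p * (p * 4 + 6) + 1"
definition coord_cost :: nat where "coord_cost = p * (2 * det_cost + 14) + 1"
definition coeff_cost :: nat where "coeff_cost = p * (coord_cost + 11) + 9"
definition top_cost :: nat where "top_cost = (n + p + 1) * coeff_cost + 10 * (n + p) + 1"
definition A_cost :: nat where "A_cost = n * (top_cost + 7) + 3 * n + 10"
definition B_cost :: nat where "B_cost = (d + p + 1) * (2 * A_cost + 4) + 1"
definition decision_cost :: nat where "decision_cost = (N + 1) ^ 4 * B_cost + 2 ^ (80 * N)"
definition total_cost :: nat where "total_cost = (n + p) ^ p * (decision_cost + 3) + 1"

end

locale stability_circuit = circuit_costs +
  assumes n: "1 \<le> n" and d: "1 \<le> d"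
begin

definition S where "S = set (regs n d)"

abbreviation "phi R \<equiv> quadratic_system.feat d (reg_X n d R) (reg_y R)"
abbreviation "\<sigma> R Z \<equiv> top_weight n d (reg_X n d R) (reg_y R) Z"

lemma qp [simp]: "quadratic_system.p d = p" and qN [simp]: "quadratic_system.N d = N"
  by (simp_all add: quadratic_system.p_def quadratic_system.N_def p_def N_def)

lemma one [simp]: "one \<in> S"
  by (simp add: S_def regs_def)

lemma reg_in: "j < 1 + n + n * d \<Longrightarrow> (\<lambda>R. R j) \<in> S"
  unfolding S_def regs_def set_append set_map by (intro UnI1 imageI) (auto simp: less_Suc_eq)

lemma reg_X_in:
  assumes "i < n" "j < d"
  shows "(\<lambda>R. reg_X n d R i j) \<in> S"
proof -
  have "(i + 1) * d \<le> n * d" using assms by (intro mult_le_mono1) simp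
  then show ?thesis unfolding reg_X_def using assms by (intro reg_in) simp
qed

lemma reg_y_in: "i < n \<Longrightarrow> (\<lambda>R. reg_y R i) \<in> S"
  unfolding reg_y_def by (intro reg_in) simp

lemma rcmp_feat:
  assumes "i < n" "a < p"
  shows "rcmp 3 S {\<lambda>R. phi R i a}"
proof -
  have q: "a div (d + 1) < d" using assms(2) by (simp add: p_def less_mult_imp_div_less)
  have "rcmp 2 S {\<lambda>R. quadratic_system.col d (reg_X n d R) (reg_y R) i j}" if j: "j \<le> d" for j
  proof -
    have "rcmp 2 S {\<lambda>R. - reg_y R i}"
      using rcmp_weaken[OF rcmp_sub[OF rcmp_zero[OF one] rcmp_in[OF reg_y_in[OF assms(1)], of 0]], of 2] by simp
    moreover have "rcmp 2 S {\<lambda>R. 0}" by (rule rcmp_weaken[OF rcmp_zero]) auto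
    ultimately show ?thesis using rcmp_in[OF reg_X_in[of i j], of 2] assms j
      by (cases "j = d"; cases "j = 0") (auto simp: quadratic_system.col_def)
  qed
  then have c: "rcmp 2 S {\<lambda>R. quadratic_system.col d (reg_X n d R) (reg_y R) i (a mod (d + 1))}"
    by (simp add: less_Suc_eq_le[symmetric])
  have "rcmp (0 + 2 + 1) S {\<lambda>R. phi R i a}"
    unfolding quadratic_system.feat_def
    by (rule rcmp_mult[OF rcmp_in[OF reg_X_in[OF assms(1) q]] c])
  then show ?thesis by (rule rcmp_weaken) simp
qed

lemma rcmp_vec:
  assumes "a < p"
  shows "rcmp 3 S {\<lambda>R. box_lp.vec n (phi R) i a}"
  using rcmp_feat[OF _ assms, of i] rcmp_weaken[OF rcmp_zero[OF one], of 3] rcmp_in[OF one, of 3]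
  by (cases "i < n") (auto simp: box_lp.vec_def)

lemma rcmp_inverse_entry:
  assumes "a < p" "b < p"
  shows "rcmp (2 * det_cost + 6) S {\<lambda>R. box_lp.inverse_entry n p (phi R) Z a b}"
proof -
  let ?M = "\<lambda>R. mat p p (\<lambda>(a, b). box_lp.vec n (phi R) (Z a) b)"
  have "rcmp (fact p * (p * (3 + 1) + 6) + 1) S {\<lambda>R. det (?M R)}"
    by (rule rcmp_det) (use rcmp_vec in auto)
  then have 1: "rcmp det_cost S {\<lambda>R. det (?M R)}" by (simp add: det_cost_def)
  have "rcmp (fact (p - 1) * ((p - 1) * (3 + 1) + 6) + 1) S {\<lambda>R. det (mat_delete (?M R) a b)}"
  proof (rule rcmp_det)
    show "mat_delete (?M R) a b \<in> carrier_mat (p - 1) (p - 1)" for R by (simp add: mat_delete_def)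
    show "rcmp 3 S {\<lambda>R. mat_delete (?M R) a b $$ (i, j)}" if "i < p - 1" "j < p - 1" for i j
      using that rcmp_vec by (simp add: mat_delete_def)
  qed simp
  moreover have "fact (p - 1) * ((p - 1) * (3 + 1) + 6) + 1 \<le> det_cost"
  proof -
    have "fact (p - 1) \<le> (fact p :: nat)" by (rule fact_mono_nat) simp
    then show ?thesis unfolding det_cost_def by (intro add_mono mult_le_mono) auto
  qed
  ultimately have 2: "rcmp det_cost S {\<lambda>R. det (mat_delete (?M R) a b)}" by (rule rcmp_weaken)
  have "rcmp 2 S {\<lambda>R. (-1 :: real) ^ (a + b)}"
    by (cases "even (a + b)") (simp_all add: rcmp_in rcmp_minus_one del: even_add)
  from rcmp_div[OF rcmp_mult[OF this 2] 1]
  show ?thesis unfolding box_lp.inverse_entry_def cofactor_def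
    by (rule rcmp_weaken) simp
qed

lemma rcmp_coord:
  assumes "a < p"
  shows "rcmp coord_cost S {\<lambda>R. box_lp.coord n p (phi R) (box_lp.inverse_entry n p (phi R) Z) j a}"
proof -
  have "rcmp (card {..<p} * ((3 + (2 * det_cost + 6) + 1) + 3) + 1) S
     {\<lambda>R. \<Sum>b<p. box_lp.vec n (phi R) j b * box_lp.inverse_entry n p (phi R) Z a b}"
    by (intro rcmp_sum rcmp_mult rcmp_vec rcmp_inverse_entry one) (use assms in auto)
  then show ?thesis unfolding box_lp.coord_def by (rule rcmp_weaken) (simp add: coord_cost_def)
qed

lemma rcmp_cost_coeff: "rcmp 7 S {\<lambda>R. coeff (box_lp.cost_poly n p j) m}"
proof -
  have "coeff (box_lp.cost_poly n p j) m = real ((if j < n \<and> m = n + p then 1 else 0) + (if m = j then 1 else 0))"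
    by (auto simp: box_lp.cost_poly_def)
  then show ?thesis by (simp only:) (rule rcmp_weaken[OF rcmp_nat], auto)
qed

lemma rcmp_coeff_red_poly:
  "rcmp coeff_cost S {\<lambda>R. coeff (box_lp.red_poly n p (phi R) Z (box_lp.inverse_entry n p (phi R) Z) j) m}"
proof -
  have "rcmp (7 + (card {..<p} * ((coord_cost + 7 + 1) + 3) + 1) + 1) S
     {\<lambda>R. coeff (box_lp.cost_poly n p j) m - (\<Sum>a<p. box_lp.coord n p (phi R) (box_lp.inverse_entry n p (phi R) Z) j a
        * coeff (box_lp.cost_poly n p (Z a)) m)}"
    by (intro rcmp_sub rcmp_sum rcmp_mult rcmp_coord rcmp_cost_coeff one) auto
  then show ?thesis unfolding box_lp.coeff_red_poly by (rule rcmp_weaken) (simp add: coeff_cost_def)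
qed

lemma degree_red_poly:
  assumes "\<And>a. a < p \<Longrightarrow> Z a < n + p" "j < n + p"
  shows "degree (box_lp.red_poly n p ph Z E j) \<le> n + p"
proof -
  have c: "degree (box_lp.cost_poly n p i) \<le> n + p" if "i < n + p" for i
    unfolding box_lp.cost_poly_def by (intro degree_add_le) (use that in \<open>auto simp: degree_monom_le intro: order_trans[OF degree_monom_le]\<close>)
  show ?thesis
    unfolding box_lp.red_poly_def
    by (intro degree_diff_le degree_sum_le order_trans[OF degree_smult_le] c) (use assms in auto)
qed

lemma rcmp_top_weight:
  assumes Z: "\<And>a. a < p \<Longrightarrow> Z a < n + p"
  shows "rcmp top_cost S {\<lambda>R. \<sigma> R Z i}"
proof (cases "i < n \<and> i \<notin> Z ` {..<p}")
  case True
  let ?r = "\<lambda>R. box_lp.red_poly n p (phi R) Z (box_lp.inverse_entry n p (phi R) Z) i"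
  have 1: "rcmp (card {..n + p} * coeff_cost) S (\<Union>m\<in>{..n + p}. {\<lambda>R. coeff (?r R) m})"
    by (intro rg.cmp_UN rcmp_coeff_red_poly) simp
  have 2: "rcmp (10 * (n + p)) (S \<union> (\<Union>m\<in>{..n + p}. {\<lambda>R. coeff (?r R) m})) {\<lambda>R. lead_coeff (?r R)}"
    by (rule rcmp_lead_coeff) (use degree_red_poly[OF Z] True in auto)
  have "rcmp ((n + p + 1) * coeff_cost + 10 * (n + p)) S {\<lambda>R. lead_coeff (?r R)}"
    by (rule rg.cmp_trans'[OF 1 2]) simp
  from rcmp_pos[OF this] show ?thesis
    using True by (simp add: top_weight_def box_lp.top_set_def top_cost_def)
next
  case False
  then have "\<sigma> R Z i = 0" for R by (auto simp: top_weight_def box_lp.top_set_def)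
  then show ?thesis by (simp add: rcmp_weaken[OF rcmp_zero] top_cost_def)
qed

abbreviation "sysA R Z \<equiv> quadratic_system.A n d (reg_X n d R) (reg_y R) (R 0) Z (\<sigma> R Z)"
abbreviation "sysB R Z \<equiv> quadratic_system.B n d (reg_X n d R) (reg_y R) (R 0) Z (\<sigma> R Z)"

lemma rcmp_A:
  assumes Z: "\<And>a. a < p \<Longrightarrow> Z a < n + p" and ij: "i \<le> N" "j \<le> N"
  shows "rcmp A_cost S {\<lambda>R. sysA R Z q i j}"
proof -
  have const: "rcmp A_cost S {\<lambda>R. 0}" "rcmp A_cost S {\<lambda>R. 1}" "rcmp A_cost S {\<lambda>R. - 1}"
    by (auto simp: A_cost_def intro: rcmp_in rcmp_weaken[OF rcmp_zero] rcmp_weaken[OF rcmp_minus_one])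
  have ind: "q * (d + 1) + (j - (2 * p + 1)) < p" if "q < d"
  proof -
    have "(q + 1) * (d + 1) \<le> d * (d + 1)" using that by (intro mult_le_mono1) simp
    then show ?thesis using ij(2) by (simp add: p_def N_def)
  qed
  have f: "rcmp A_cost S {\<lambda>R. phi R i' (q * (d + 1) + (j - (2 * p + 1)))}" if "i' < n" "q < d" for i'
    by (rule rcmp_weaken[OF rcmp_feat]) (use that ind in \<open>auto simp: A_cost_def\<close>)
  have s: "rcmp A_cost S {\<lambda>R. \<Sum>i'<n. \<sigma> R Z i' * phi R i' (q * (d + 1) + (j - (2 * p + 1)))}" if "q < d"
  proof -
    have "rcmp (card {..<n} * ((top_cost + 3 + 1) + 3) + 1) S {\<lambda>R. \<Sum>i'<n. \<sigma> R Z i' * phi R i' (q * (d + 1) + (j - (2 * p + 1)))}"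
      by (intro rcmp_sum rcmp_mult rcmp_top_weight rcmp_feat one) (use Z ind that in auto)
    then show ?thesis by (rule rcmp_weaken) (simp add: A_cost_def algebra_simps)
  qed
  have t: "rcmp A_cost S {\<lambda>R. (\<Sum>i'<n. \<sigma> R Z i') - real n + R 0}"
  proof -
    have "rcmp (((card {..<n} * (top_cost + 3) + 1) + (3 * n + 1) + 1) + 0 + 3) S {\<lambda>R. (\<Sum>i'<n. \<sigma> R Z i') - real n + R 0}"
      by (intro rcmp_add rcmp_sub rcmp_sum rcmp_nat rcmp_top_weight rcmp_in[OF reg_in] one) (use Z in auto)
    then show ?thesis by (rule rcmp_weaken) (simp add: A_cost_def algebra_simps)
  qed
  consider "q < d" | "d \<le> q" "q < d + p" | "d + p \<le> q" by linarith
  then show ?thesis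
  proof cases
    case 1
    show ?thesis
    proof (cases "2 * p + 1 \<le> j")
      case True
      show ?thesis
      proof (cases "i = N")
        case t: True
        then show ?thesis using s 1 True unfolding quadratic_system.A_def qp qN by simp
      next
        case False
        then show ?thesis using f[of "Z i"] const(1) 1 True unfolding quadratic_system.A_def qp qN
          by (cases "i < p \<and> Z i < n") auto
      qed
    next
      case False
      then show ?thesis using const(1) 1 unfolding quadratic_system.A_def qp qN by simp
    qed
  next
    case 2
    then show ?thesis using const unfolding quadratic_system.A_def qp qN
      by (cases "j = N"; cases "i = q - d"; cases "i = j \<and> (i = q - d \<or> i = p + (q - d))") auto
  next
    case 3
    then show ?thesis using const t unfolding quadratic_system.A_def qp qN
      by (cases "j = N"; cases "i = N"; cases "i < p \<and> Z i < n"; cases "i = 2 * p \<and> j = 2 * p") auto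
  qed
qed

lemma rcmp_B:
  assumes Z: "\<And>a. a < p \<Longrightarrow> Z a < n + p" and t: "t \<in> quadratic_system.T d"
  shows "rcmp B_cost S {\<lambda>R. sysB R Z t}"
proof -
  obtain i j i' j' where t': "t = (i, j, i', j')" by (cases t) auto
  have "rcmp (card {..d + p} * ((A_cost + A_cost + 1) + 3) + 1) S {\<lambda>R. \<Sum>q\<le>d + p. sysA R Z q i j * sysA R Z q i' j'}"
    by (intro rcmp_sum rcmp_mult rcmp_A one) (use Z t t' in \<open>auto simp: quadratic_system.T_def\<close>)
  then show ?thesis unfolding t' quadratic_system.B_def
    by (simp add: B_cost_def algebra_simps)
qed

text \<open>The exponents come from the index quadruples alone; data and \<open>Z\<close> enter
  through the coefficients.\<close>

lemma quartic_family: "quartic_family N (quadratic_system.T d) (\<lambda>R. sysB R Z) (quadratic_system.G d)"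
proof (rule quartic_family.intro)
  show "quartic N (quadratic_system.T d) (sysB R Z) (quadratic_system.G d)" for R
    using quadratic_system.quartic[of d n "reg_X n d R" "reg_y R" "R 0" Z "\<sigma> R Z"] by simp
  show "1 \<le> N" by (simp add: N_def)
  show "card (quadratic_system.T d) \<le> (N + 1) ^ 4" by (simp add: quadratic_system.card_T)
qed

abbreviation "dec R Z \<equiv> quadratic_system.decision n d (reg_X n d R) (reg_y R) (R 0) Z (\<sigma> R Z)"

lemma rcmp_decision:
  assumes Z: "\<And>a. a < p \<Longrightarrow> Z a < n + p"
  shows "rcmp decision_cost S {\<lambda>R. if dec R Z then 1 else 0}"
proof -
  let ?T = "quadratic_system.T d" and ?F = "\<Union>t\<in>quadratic_system.T d. {\<lambda>R. sysB R Z t}"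
  have finT: "finite ?T" by (simp add: quadratic_system.T_def)
  have 1: "rcmp (card ?T * B_cost) S ?F"
    by (intro rg.cmp_UN finT rcmp_B Z)
  have 2: "rcmp (2 ^ (80 * N)) (S \<union> ?F) {\<lambda>R. if dec R Z then 1 else 0}"
    unfolding quadratic_system.decision_def qN
    by (rule quartic_family.rcmp_quartic_decision[OF quartic_family]) auto
  show ?thesis
    by (rule rg.cmp_trans'[OF 1 2]) (simp add: quadratic_system.card_T decision_cost_def)
qed

lemma finite_candidates: "finite (candidates n d)" and card_candidates: "card (candidates n d) \<le> (n + p) ^ p"
proof -
  have s: "candidates n d \<subseteq> {..<p} \<rightarrow>\<^sub>E {..<n + p}" by (auto simp: candidates_def)
  have f: "finite ({..<p} \<rightarrow>\<^sub>E {..<n + p})" by (intro finite_PiE) auto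
  show "finite (candidates n d)" using finite_subset[OF s f] .
  show "card (candidates n d) \<le> (n + p) ^ p" using card_mono[OF f s] by (simp add: card_PiE)
qed

text \<open>A sum of indicators serves as the disjunction over all candidates.\<close>

theorem rcmp_stability:
  "rcmp total_cost S {\<lambda>R. \<Sum>Z\<in>candidates n d. if dec R Z then 1 else 0}"
proof -
  have "rcmp (card (candidates n d) * (decision_cost + 3) + 1) S {\<lambda>R. \<Sum>Z\<in>candidates n d. if dec R Z then 1 else 0}"
    by (intro rcmp_sum finite_candidates rcmp_decision one) (auto simp: candidates_def)
  then show ?thesis by (rule rcmp_weaken) (use card_candidates in \<open>simp add: total_cost_def\<close>)
qed

theorem stability_program:
  "\<exists>gs. length gs \<le> Suc total_cost \<and> gs \<noteq> [] \<and> wf_gates gs (2 + n + n * d)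
    \<and> (\<forall>R. last (run_gates gs (map R [0..<1 + n + n * d] @ [1])) > 0 \<longleftrightarrow> Stability n d (reg_X n d R) (reg_y R) \<le> R 0)"
proof -
  obtain gs where gs: "length gs \<le> Suc total_cost" "gs \<noteq> []" "wf_gates gs (length (regs n d))"
    "\<And>R. last (run_gates gs (map (\<lambda>f. f R) (regs n d))) = (if (\<Sum>Z\<in>candidates n d. if dec R Z then 1 else 0) > (0 :: real) then 1 else 0)"
    using rcmp_run_gates[OF rcmp_stability[unfolded S_def]] by blast
  have "last (run_gates gs (map R [0..<1 + n + n * d] @ [1])) > 0 \<longleftrightarrow> Stability n d (reg_X n d R) (reg_y R) \<le> R 0" for R
  proof -
    have "map (\<lambda>f. f R) (regs n d) = map R [0..<1 + n + n * d] @ [1]" by (simp add: regs_def o_def)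
    then have "last (run_gates gs (map R [0..<1 + n + n * d] @ [1])) > 0 \<longleftrightarrow> (\<Sum>Z\<in>candidates n d. if dec R Z then 1 else 0) > (0 :: real)"
      using gs(4)[of R] by simp
    also have "\<dots> \<longleftrightarrow> (\<exists>Z\<in>candidates n d. dec R Z)"
    proof
      assume "(\<Sum>Z\<in>candidates n d. if dec R Z then 1 else 0) > (0 :: real)"
      then have "(\<Sum>Z\<in>candidates n d. if dec R Z then 1 else 0) \<noteq> (0 :: real)" by simp
      then obtain Z where "Z \<in> candidates n d" "(if dec R Z then 1 else 0) \<noteq> (0 :: real)" by (rule sum.not_neutral_contains_not_neutral)
      then show "\<exists>Z\<in>candidates n d. dec R Z" by (auto split: if_splits)
    next
      assume "\<exists>Z\<in>candidates n d. dec R Z"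
      then show "(\<Sum>Z\<in>candidates n d. if dec R Z then 1 else 0) > (0 :: real)"
        using finite_candidates by (auto intro: sum_pos2)
    qed
    finally show ?thesis unfolding Stability_le_iff_decision[OF n d] .
  qed
  then show ?thesis using gs(1-3) by (intro exI[of _ gs]) (simp add: regs_def)
qed

end

section \<open>Growth of the cost in the number of samples and the dimension\<close>

text \<open>Polynomial growth in V = (n + 1)^(d^3). As V is at least 2, constants and sums are
  absorbed, and the class is closed under products and fixed powers.\<close>

definition power_bounded :: "(nat \<Rightarrow> nat \<Rightarrow> nat) \<Rightarrow> bool" where
  "power_bounded f \<longleftrightarrow> (\<exists>e. \<forall>n d. 1 \<le> n \<longrightarrow> 1 \<le> d \<longrightarrow> f n d \<le> ((n + 1) ^ d ^ 3) ^ e)"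

lemma power_boundedI: "(\<And>n d. 1 \<le> n \<Longrightarrow> 1 \<le> d \<Longrightarrow> f n d \<le> ((n + 1) ^ d ^ 3) ^ e) \<Longrightarrow> power_bounded f"
  by (auto simp: power_bounded_def)

lemma two_le_base: "1 \<le> n \<Longrightarrow> 1 \<le> d \<Longrightarrow> 2 \<le> (n + 1 :: nat) ^ d ^ 3"
  using self_le_power[of "n + 1" "d ^ 3"] by simp

lemma two_power_le_base: "1 \<le> n \<Longrightarrow> m \<le> e * d ^ 3 \<Longrightarrow> 2 ^ m \<le> ((n + 1 :: nat) ^ d ^ 3) ^ e"
proof -
  assume n: "1 \<le> n" and m: "m \<le> e * d ^ 3"
  have "2 ^ m \<le> (2 :: nat) ^ (e * d ^ 3)" using m by (intro power_increasing) auto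
  also have "\<dots> \<le> (n + 1) ^ (e * d ^ 3)" using n by (intro power_mono) auto
  finally show ?thesis by (simp add: power_mult[symmetric] mult.commute)
qed

lemma power_bounded_mult:
  assumes "power_bounded f" "power_bounded g"
  shows "power_bounded (\<lambda>n d. f n d * g n d)"
proof -
  obtain e e' where "\<And>n d. 1 \<le> n \<Longrightarrow> 1 \<le> d \<Longrightarrow> f n d \<le> ((n + 1) ^ d ^ 3) ^ e"
    "\<And>n d. 1 \<le> n \<Longrightarrow> 1 \<le> d \<Longrightarrow> g n d \<le> ((n + 1) ^ d ^ 3) ^ e'"
    using assms unfolding power_bounded_def by blast
  then show ?thesis by (intro power_boundedI[where e = "e + e'"]) (simp add: power_add mult_le_mono)
qed

lemma power_bounded_add:
  assumes "power_bounded f" "power_bounded g"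
  shows "power_bounded (\<lambda>n d. f n d + g n d)"
proof -
  obtain e e' where f: "\<And>n d. 1 \<le> n \<Longrightarrow> 1 \<le> d \<Longrightarrow> f n d \<le> ((n + 1) ^ d ^ 3) ^ e"
    and g: "\<And>n d. 1 \<le> n \<Longrightarrow> 1 \<le> d \<Longrightarrow> g n d \<le> ((n + 1) ^ d ^ 3) ^ e'"
    using assms unfolding power_bounded_def by blast
  show ?thesis
  proof (rule power_boundedI[where e = "Suc (e + e')"])
    fix n d :: nat assume nd: "1 \<le> n" "1 \<le> d"
    let ?V = "(n + 1) ^ d ^ 3"
    have V: "2 \<le> ?V" by (rule two_le_base[OF nd])
    have "?V ^ e \<le> ?V ^ (e + e')" "?V ^ e' \<le> ?V ^ (e + e')" by (rule power_increasing; simp)+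
    then have "f n d + g n d \<le> 2 * ?V ^ (e + e')" using f[OF nd] g[OF nd] by linarith
    also have "\<dots> \<le> ?V * ?V ^ (e + e')" using V by (rule mult_le_mono1)
    finally show "f n d + g n d \<le> ?V ^ Suc (e + e')" by simp
  qed
qed

lemma power_bounded_const: "power_bounded (\<lambda>n d. c)"
proof (rule power_boundedI[where e = c])
  fix n d :: nat assume nd: "1 \<le> n" "1 \<le> d"
  have "c \<le> 2 ^ c" by simp
  also have "\<dots> \<le> ((n + 1) ^ d ^ 3) ^ c" using nd by (intro two_power_le_base) auto
  finally show "c \<le> ((n + 1) ^ d ^ 3) ^ c" .
qed

lemma power_bounded_n: "power_bounded (\<lambda>n d. n)"
proof (rule power_boundedI[where e = 1])
  fix n d :: nat assume "1 \<le> n" "1 \<le> d"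
  then show "n \<le> ((n + 1) ^ d ^ 3) ^ 1" using self_le_power[of "n + 1" "d ^ 3"] by simp
qed

lemma power_bounded_d: "power_bounded (\<lambda>n d. d)"
proof (rule power_boundedI[where e = 1])
  fix n d :: nat assume nd: "1 \<le> n" "1 \<le> d"
  have "d \<le> 2 ^ d" by simp
  also have "\<dots> \<le> ((n + 1) ^ d ^ 3) ^ 1" using nd self_le_power[of d 3] by (intro two_power_le_base) auto
  finally show "d \<le> ((n + 1) ^ d ^ 3) ^ 1" .
qed

lemma power_bounded_power: "power_bounded f \<Longrightarrow> power_bounded (\<lambda>n d. f n d ^ m)"
  by (induction m) (auto intro: power_bounded_const power_bounded_mult)

text \<open>Since p is of order d^2, the power p^p is 2^O(d^2 log d). The rough estimate of p + 1 by
  4^d replaces the logarithm by a multiple of d and leads to 2^(4 d^3).\<close>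

lemma dim_facts:
  assumes "1 \<le> d"
  shows "circuit_costs.p d \<le> 2 * d ^ 2" "circuit_costs.p d + 1 \<le> 4 ^ d" "circuit_costs.N d \<le> 6 * d ^ 3"
    "(circuit_costs.p d + 1) ^ circuit_costs.p d \<le> 2 ^ (4 * d ^ 3)"
proof -
  have dd: "d \<le> d * d" "d * d \<le> d * d * d" using assms by simp_all
  show p: "circuit_costs.p d \<le> 2 * d ^ 2" using dd by (simp add: circuit_costs.p_def power2_eq_square)
  show "circuit_costs.N d \<le> 6 * d ^ 3"
    using dd assms unfolding circuit_costs.p_def circuit_costs.N_def power3_eq_cube distrib_left mult_1_right by linarith
  have s: "Suc m * (Suc m + 1) + 1 \<le> 4 ^ Suc m" for m :: nat
    by (induction m) auto
  show p4: "circuit_costs.p d + 1 \<le> 4 ^ d"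
    using s[of "d - 1"] assms by (simp add: circuit_costs.p_def)
  have "(circuit_costs.p d + 1) ^ circuit_costs.p d \<le> (4 ^ d) ^ circuit_costs.p d"
    using p4 by (rule power_mono) simp
  also have "\<dots> \<le> (4 ^ d) ^ (2 * d ^ 2)" using p by (rule power_increasing) simp
  also have "\<dots> = 2 ^ (4 * d ^ 3)"
  proof -
    have "(4 :: nat) = 2 ^ 2" by simp
    then show ?thesis by (simp only: power_mult[symmetric]) (simp add: power2_eq_square power3_eq_cube mult_ac)
  qed
  finally show "(circuit_costs.p d + 1) ^ circuit_costs.p d \<le> 2 ^ (4 * d ^ 3)" .
qed

text \<open>The exponent 480 is 80 times the factor 6 in the bound on the number of
  unknowns.\<close>

lemma power_bounded_decision: "power_bounded (\<lambda>n d. 2 ^ (80 * circuit_costs.N d))"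
proof (rule power_boundedI[where e = 480])
  fix n d :: nat assume "1 \<le> n" "1 \<le> d"
  then show "2 ^ (80 * circuit_costs.N d) \<le> ((n + 1) ^ d ^ 3) ^ 480"
    using dim_facts(3)[of d] by (intro two_power_le_base) auto
qed

lemma power_bounded_fact: "power_bounded (\<lambda>n d. fact (circuit_costs.p d))"
proof (rule power_boundedI[where e = 4])
  fix n d :: nat assume nd: "1 \<le> n" "1 \<le> d"
  let ?p = "circuit_costs.p d"
  have "fact ?p \<le> ?p ^ ?p" using fact_le_power[of ?p, where 'a = nat] by simp
  also have "\<dots> \<le> (?p + 1) ^ ?p" by (rule power_mono) auto
  also have "\<dots> \<le> 2 ^ (4 * d ^ 3)" by (rule dim_facts(4)[OF nd(2)])
  also have "\<dots> \<le> ((n + 1) ^ d ^ 3) ^ 4" by (rule two_power_le_base[OF nd(1)]) simp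
  finally show "fact ?p \<le> ((n + 1) ^ d ^ 3) ^ 4" .
qed

text \<open>The base n + p is split as at most (n + 1) (p + 1): the first factor to the power p has
  exponent of order d^2, the second is 2^O(d^3).\<close>

lemma power_bounded_choices: "power_bounded (\<lambda>n d. (n + circuit_costs.p d) ^ circuit_costs.p d)"
proof (rule power_boundedI[where e = "2 + 4"])
  fix n d :: nat assume nd: "1 \<le> n" "1 \<le> d"
  let ?p = "circuit_costs.p d" and ?V = "(n + 1) ^ d ^ 3"
  have "(n + ?p) ^ ?p \<le> ((n + 1) * (?p + 1)) ^ ?p" by (rule power_mono) (auto simp: algebra_simps)
  also have "\<dots> = (n + 1) ^ ?p * (?p + 1) ^ ?p" by (rule power_mult_distrib)
  also have "\<dots> \<le> ?V ^ 2 * ?V ^ 4"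
  proof (rule mult_le_mono)
    have "d\<^sup>2 \<le> d ^ 3" using nd by (intro power_increasing) auto
    then have "?p \<le> d ^ 3 * 2" using dim_facts(1)[OF nd(2)] by linarith
    then show "(n + 1) ^ ?p \<le> ?V ^ 2" unfolding power_mult[symmetric] by (rule power_increasing) simp
    show "(?p + 1) ^ ?p \<le> ?V ^ 4"
      by (rule order_trans[OF dim_facts(4)[OF nd(2)] two_power_le_base[OF nd(1)]]) simp
  qed
  finally show "(n + ?p) ^ ?p \<le> ?V ^ (2 + 4)" by (simp only: power_add)
qed

lemma power_bounded_total_cost: "power_bounded circuit_costs.total_cost"
proof -
  note i = power_bounded_add power_bounded_mult power_bounded_power power_bounded_n power_bounded_d power_bounded_const
    power_bounded_decision power_bounded_fact power_bounded_choices
  have p: "power_bounded (\<lambda>n d. circuit_costs.p d)"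
    unfolding circuit_costs.p_def by (intro i)
  have N: "power_bounded (\<lambda>n d. circuit_costs.N d)"
    unfolding circuit_costs.N_def by (intro i p)
  have "power_bounded (\<lambda>n d. circuit_costs.det_cost d)"
    unfolding circuit_costs.det_cost_def by (intro i p)
  then have "power_bounded (\<lambda>n d. circuit_costs.coord_cost d)"
    unfolding circuit_costs.coord_cost_def by (intro i p)
  then have c: "power_bounded (\<lambda>n d. circuit_costs.coeff_cost d)"
    unfolding circuit_costs.coeff_cost_def by (intro i p)
  have "power_bounded (\<lambda>n d. circuit_costs.top_cost n d)"
    unfolding circuit_costs.top_cost_def by (intro i p c)
  then have "power_bounded (\<lambda>n d. circuit_costs.A_cost n d)"
    unfolding circuit_costs.A_cost_def by (intro i)
  then have B: "power_bounded (\<lambda>n d. circuit_costs.B_cost n d)"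
    unfolding circuit_costs.B_cost_def by (intro i p)
  have "power_bounded (\<lambda>n d. circuit_costs.decision_cost n d)"
    unfolding circuit_costs.decision_cost_def by (intro i N B)
  then have "power_bounded (\<lambda>n d. circuit_costs.total_cost n d)"
    unfolding circuit_costs.total_cost_def by (intro i)
  then show ?thesis .
qed

section \<open>Assembly of the decision procedure\<close>

lemma Stability_cong:
  assumes "\<And>i j. i < n \<Longrightarrow> j < d \<Longrightarrow> X i j = X' i j" "\<And>i. i < n \<Longrightarrow> y i = y' i"
  shows "Stability n d X y = Stability n d X' y'"
proof -
  have "wloss n d X y w \<beta> = wloss n d X' y' w \<beta>" for w \<beta>
    unfolding wloss_def using assms by (intro arg_cong2[where f = "(*)"] sum.cong refl) simp
  then show ?thesis by (simp add: Stability_def OLS_def)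
qed

theorem theorem1:
  shows "\<exists>(P :: instr list) (C :: nat).
    \<forall>n d (X :: nat \<Rightarrow> nat \<Rightarrow> real) (y :: nat \<Rightarrow> real) (k :: real).
      1 \<le> n \<longrightarrow> 1 \<le> d \<longrightarrow> 0 \<le> k \<longrightarrow>
      (\<exists>t. t \<le> C * (n + 1) ^ (C * d ^ 3) \<and>
           halted P (run P t (init_config n d X y k)) \<and>
           (accepts (run P t (init_config n d X y k)) \<longleftrightarrow> Stability n d X y \<le> k))"
proof -
  let ?ok = "\<lambda>n d gs. length gs \<le> Suc (circuit_costs.total_cost n d) \<and> gs \<noteq> [] \<and> wf_gates gs (2 + n + n * d)
    \<and> (\<forall>R. last (run_gates gs (map R [0..<1 + n + n * d] @ [1])) > 0 \<longleftrightarrow> Stability n d (reg_X n d R) (reg_y R) \<le> R 0)"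
  \<comment> \<open>The programs are merely chosen, one for each pair of sizes. A single real
    constant holds the whole family, so one machine program serves all sizes.\<close>
  define prog where "prog n d = (SOME gs. ?ok n d gs)" for n d
  have prog: "?ok n d (prog n d)" if "1 \<le> n" "1 \<le> d" for n d
    unfolding prog_def by (rule someI_ex[OF stability_circuit.stability_program[OF stability_circuit.intro[OF that]]])
  have "power_bounded (\<lambda>n d. 1 + circuit_costs.total_cost n d)"
    by (intro power_bounded_add power_bounded_const power_bounded_total_cost)
  then obtain e where e: "\<And>n d. 1 \<le> n \<Longrightarrow> 1 \<le> d \<Longrightarrow> 1 + circuit_costs.total_cost n d \<le> ((n + 1) ^ d ^ 3) ^ e"
    unfolding power_bounded_def by blast
  have "wf_gates (prog n d) (2 + n + n * d) \<and> prog n d \<noteq> [] \<and> length (prog n d) \<le> Suc e * (n + 1) ^ (Suc e * d ^ 3)"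
    if nd: "1 \<le> n" "1 \<le> d" for n d
  proof -
    have "length (prog n d) \<le> 1 + circuit_costs.total_cost n d" using prog[OF nd] by simp
    also have "\<dots> \<le> ((n + 1) ^ d ^ 3) ^ e" by (rule e[OF nd])
    also have "\<dots> = (n + 1) ^ (e * d ^ 3)" by (simp add: power_mult[symmetric] mult.commute)
    also have "\<dots> \<le> (n + 1) ^ (Suc e * d ^ 3)" by (rule power_increasing) auto
    also have "\<dots> \<le> Suc e * (n + 1) ^ (Suc e * d ^ 3)" by simp
    finally show ?thesis using prog[OF nd] by blast
  qed
  from straight_line_programs_on_ram[OF this] obtain P C where P: "\<And>n d X y k. 1 \<le> n \<Longrightarrow> 1 \<le> d \<Longrightarrow>
      \<exists>t\<le>C * (n + 1) ^ (C * d ^ 3). halted P (run P t (init_config n d X y k)) \<and>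
         (accepts (run P t (init_config n d X y k)) \<longleftrightarrow>
           last (run_gates (prog n d) (map (snd (snd (init_config n d X y k))) [0..<1 + n + n * d] @ [1])) > 0)"
    by blast
  have dec: "last (run_gates (prog n d) (map (snd (snd (init_config n d X y k))) [0..<1 + n + n * d] @ [1])) > 0
      \<longleftrightarrow> Stability n d X y \<le> k" if nd: "1 \<le> n" "1 \<le> d" for n d X y k
  proof -
    let ?R = "snd (snd (init_config n d X y k))"
    have X: "reg_X n d ?R i j = X i j" if ij: "i < n" "j < d" for i j
    proof -
      have "(i + 1) * d \<le> n * d" using ij by (intro mult_le_mono1) simp
      then have "i * d + j < n * d" using ij by simp
      then show ?thesis using ij by (simp add: reg_X_def init_config_def)
    qed
    have y: "reg_y ?R i = y i" if "i < n" for i using that by (simp add: reg_y_def init_config_def)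
    have "Stability n d (reg_X n d ?R) (reg_y ?R) = Stability n d X y" by (rule Stability_cong) (simp_all add: X y)
    moreover have "?R 0 = k" by (simp add: init_config_def)
    ultimately show ?thesis using prog[OF nd] by metis
  qed
  show ?thesis
  proof (rule exI[of _ P], rule exI[of _ C], intro allI impI)
    fix n d :: nat and X :: "nat \<Rightarrow> nat \<Rightarrow> real" and y k assume "1 \<le> n" "1 \<le> d"
    then show "\<exists>t. t \<le> C * (n + 1) ^ (C * d ^ 3) \<and> halted P (run P t (init_config n d X y k)) \<and>
           (accepts (run P t (init_config n d X y k)) \<longleftrightarrow> Stability n d X y \<le> k)"
      using P[of n d X y k] dec[of n d X y k] by auto
  qed
qed

end
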